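(* Let $G$ be a Lie group whose finite products are smoothly paracompact, let $\mathcal{U}_1$ be an open identity neighbourhood filterbase of $G$, and let $V$ be a smoothly loop contractible abelian Lie group. Then the morphisms $A_s^*(\mathfrak{U}_U;V)\hookrightarrow A^*(\mathfrak{U}_U;V)$ and $C(\lambda^*_{\mathfrak{U}_U},V):A_s^*(\mathfrak{U}_U;V)\to S^*(\mathfrak{U}_U;V)$ for all $U\in\mathcal{U}_1$ induce isomorphisms $$\operatorname{colim}_{U\in\mathcal{U}_1}H_s(\mathfrak{U}_U;V)\cong\operatorname{colim}_{U\in\mathcal{U}_1}H(\mathfrak{U}_U;V)\cong H_{sing}(G;V)$$ in cohomology.
   Context: Manifolds and Lie groups are smooth, real and possibly infinite dimensional (smoothness in the sense of the Bertram–Glöckner–Neeb differential calculus). A Lie group $V$ is smoothly loop contractible if there is a smooth contraction $\Phi:V\times[0,1]\to V$ to the identity (a smooth homotopy between $\mathrm{id}_V$ and the constant map to the identity element) such that each $\Phi_t=\Phi(-,t)$ is a homomorphism of Lie groups. A manifold is smoothly paracompact if every open covering admits a subordinate smooth partition of unity (smooth real functions with sum $1$ and locally finite supports contained in the respective members of the covering). "Finite products of $G$" are the powers $G^{p+1}$. For an open identity neighbourhood $U$ of $G$, $\mathfrak{U}_U:=\{gU\mid g\in G\}$. For an open covering $\mathfrak{U}$ of a manifold $M$ put $\mathfrak{U}[q]:=\bigcup_{U\in\mathfrak{U}}U^{q+1}$, an open submanifold of $M^{q+1}$. $A^q(\mathfrak{U};V)$ and $A_s^q(\mathfrak{U};V)$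 are the groups of all, respectively all smooth, functions $\mathfrak{U}[q]\to V$; they form cochain complexes with $df(u_0,\dots,u_{q+1})=\sum_k(-1)^kf(u_0,\dots,\hat u_k,\dots,u_{q+1})$, with cohomologies $H(\mathfrak{U};V)$ and $H_s(\mathfrak{U};V)$. $S^*(\mathfrak{U};V)$ is the complex of $V$-valued cochains on $\mathfrak{U}$-small singular simplices (those with image in some member of $\mathfrak{U}$); its cohomology is canonically (via restriction) singular cohomology $H_{sing}(M;V)$. $C(\lambda_{\mathfrak{U}}^*,V)$ sends $f\in A^n(\mathfrak{U};V)$ to $\tau\mapsto f(\tau(\vec e_0),\dots,\tau(\vec e_n))$, where $\vec e_0,\dots,\vec e_n$ are the vertices of $\Delta^n$. The colimits are over $\mathcal{U}_1$ directed by reverse inclusion, with transition maps given by restriction of cochains. *)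

theory Defs
  imports
    "HOL-Homology.Homology"
    "HOL-Library.Function_Algebras"
begin

section \<open>Real topological vector spaces\<close>

text \<open>
  Hausdorff real topological vector spaces (local convexity is not assumed). A general model space
  is a linear subspace of such a type; this is needed to treat all powers \<open>E\<^sup>q\<close> inside one type.
\<close>

class real_tvs = real_vector + t2_space + topological_ab_group_add +
  assumes tendsto_scaleR_Pair:
    "((\<lambda>p. fst p *\<^sub>R snd p) \<longlongrightarrow> c *\<^sub>R a) (nhds c \<times>\<^sub>F nhds a)"

lemma tendsto_scaleR_tvs:
  fixes g :: "'b \<Rightarrow> 'a :: real_tvs"
  assumes "(f \<longlongrightarrow> c) F" "(g \<longlongrightarrow> a) F"
  shows "((\<lambda>x. f x *\<^sub>R g x) \<longlongrightarrow> c *\<^sub>R a) F"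
  using filterlim_compose[OF tendsto_scaleR_Pair filterlim_Pair[OF assms]] by simp

instance real_normed_vector < real_tvs
proof
  fix c :: real and a :: 'a
  show "((\<lambda>p. fst p *\<^sub>R snd p) \<longlongrightarrow> c *\<^sub>R a) (nhds c \<times>\<^sub>F nhds a)"
    by (intro tendsto_scaleR filterlim_fst filterlim_snd)
qed

instance prod :: (topological_monoid_add, topological_monoid_add) topological_monoid_add
proof
  fix a b :: "'a \<times> 'b"
  have f: "filterlim fst (nhds a) (nhds a \<times>\<^sub>F nhds b)"
    and s: "filterlim snd (nhds b) (nhds a \<times>\<^sub>F nhds b)"
    by (simp_all add: filterlim_fst filterlim_snd)
  have "((\<lambda>x. (fst (fst x) + fst (snd x), snd (fst x) + snd (snd x)))
      \<longlongrightarrow> (fst a + fst b, snd a + snd b)) (nhds a \<times>\<^sub>F nhds b)"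
    by (intro tendsto_Pair tendsto_add tendsto_fst tendsto_snd f s)
  then show "((\<lambda>x. fst x + snd x) \<longlongrightarrow> a + b) (nhds a \<times>\<^sub>F nhds b)"
    by (simp add: plus_prod_def)
qed

instance prod :: (topological_comm_monoid_add, topological_comm_monoid_add)
  topological_comm_monoid_add ..

instance prod :: (topological_group_add, topological_group_add) topological_group_add
proof
  fix a :: "'a \<times> 'b"
  have "((\<lambda>x. (- fst x, - snd x)) \<longlongrightarrow> (- fst a, - snd a)) (nhds a)"
    by (intro tendsto_Pair filterlim_compose[OF tendsto_uminus_nhds] tendsto_fst tendsto_snd
        filterlim_ident)
  moreover have "uminus = (\<lambda>x :: 'a \<times> 'b. (- fst x, - snd x))"
    by (simp add: fun_eq_iff uminus_prod_def)
  ultimately show "(uminus \<longlongrightarrow> - a) (nhds a)"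
    by (simp add: uminus_prod_def)
qed

instance prod :: (topological_ab_group_add, topological_ab_group_add) topological_ab_group_add ..

instance prod :: (real_tvs, real_tvs) real_tvs
proof
  fix c :: real and a :: "'a \<times> 'b"
  have f: "filterlim fst (nhds c) (nhds c \<times>\<^sub>F nhds a)"
    and s: "filterlim snd (nhds a) (nhds c \<times>\<^sub>F nhds a)"
    by (simp_all add: filterlim_fst filterlim_snd)
  have "((\<lambda>p. (fst p *\<^sub>R fst (snd p), fst p *\<^sub>R snd (snd p)))
      \<longlongrightarrow> (c *\<^sub>R fst a, c *\<^sub>R snd a)) (nhds c \<times>\<^sub>F nhds a)"
    by (intro tendsto_Pair tendsto_scaleR_tvs tendsto_fst tendsto_snd f s)
  then show "((\<lambda>p. fst p *\<^sub>R snd p) \<longlongrightarrow> c *\<^sub>R a) (nhds c \<times>\<^sub>F nhds a)"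
    by (simp add: scaleR_prod_def)
qed

instantiation "fun" :: (type, real_vector) real_vector
begin

definition "c *\<^sub>R f = (\<lambda>x. c *\<^sub>R f x)"

instance
proof
  fix a b :: real and x y :: "'a \<Rightarrow> 'b"
  show "a *\<^sub>R (x + y) = a *\<^sub>R x + a *\<^sub>R y"
    unfolding fun_eq_iff scaleR_fun_def plus_fun_apply by (intro allI scaleR_add_right)
  show "(a + b) *\<^sub>R x = a *\<^sub>R x + b *\<^sub>R x"
    unfolding fun_eq_iff scaleR_fun_def plus_fun_apply by (intro allI scaleR_add_left)
  show "a *\<^sub>R b *\<^sub>R x = (a * b) *\<^sub>R x"
    unfolding fun_eq_iff scaleR_fun_def by (intro allI scaleR_scaleR)
  show "1 *\<^sub>R x = x"
    unfolding fun_eq_iff scaleR_fun_def by (intro allI scaleR_one)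
qed

end

lemma scaleR_fun_apply [simp]: "(c *\<^sub>R f) x = c *\<^sub>R f x"
  by (simp add: scaleR_fun_def)

lemma open_coordinate_vimage:
  fixes U :: "'b::topological_space set"
  assumes "open U"
  shows "open {h :: 'a \<Rightarrow> 'b. h i \<in> U}"
  using open_vimage[OF assms continuous_on_product_coordinates[of i]] unfolding vimage_def .

instance "fun" :: (type, t0_space) t0_space
proof
  fix f g :: "'a \<Rightarrow> 'b"
  assume "f \<noteq> g"
  then obtain i where i: "f i \<noteq> g i" by (auto simp: fun_eq_iff)
  then obtain U where U: "open U" "\<not> (f i \<in> U \<longleftrightarrow> g i \<in> U)"
    using t0_space[OF i] by blast
  show "\<exists>U. open U \<and> \<not> (f \<in> U \<longleftrightarrow> g \<in> U)"
    using open_coordinate_vimage[OF U(1), of i] U(2)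
    by (intro exI[of _ "{h. h i \<in> U}"] conjI) simp_all
qed

instance "fun" :: (type, t1_space) t1_space
proof
  fix f g :: "'a \<Rightarrow> 'b"
  assume "f \<noteq> g"
  then obtain i where i: "f i \<noteq> g i" by (auto simp: fun_eq_iff)
  then obtain U where U: "open U" "f i \<in> U" "g i \<notin> U"
    using t1_space[OF i] by blast
  show "\<exists>U. open U \<and> f \<in> U \<and> g \<notin> U"
    using open_coordinate_vimage[OF U(1), of i] U(2,3)
    by (intro exI[of _ "{h. h i \<in> U}"] conjI) simp_all
qed

instance "fun" :: (type, t2_space) t2_space
proof
  fix f g :: "'a \<Rightarrow> 'b"
  assume "f \<noteq> g"
  then obtain i where i: "f i \<noteq> g i" by (auto simp: fun_eq_iff)
  then obtain U W where *: "open U" "open W" "f i \<in> U" "g i \<in> W" "U \<inter> W = {}"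
    using hausdorff[OF i] by blast
  have "{h :: 'a \<Rightarrow> 'b. h i \<in> U} \<inter> {h. h i \<in> W} = {}"
    using *(5) by blast
  then show "\<exists>U W. open U \<and> open W \<and> f \<in> U \<and> g \<in> W \<and> U \<inter> W = {}"
    using open_coordinate_vimage[OF *(1), of i] open_coordinate_vimage[OF *(2), of i] *(3,4)
    by (intro exI[of _ "{h. h i \<in> U}"] exI[of _ "{h. h i \<in> W}"] conjI) simp_all
qed

lemma tendsto_fun_iff:
  fixes f :: "'c \<Rightarrow> 'a \<Rightarrow> 'b :: topological_space"
  shows "(f \<longlongrightarrow> l) F \<longleftrightarrow> (\<forall>i. ((\<lambda>x. f x i) \<longlongrightarrow> l i) F)"
  using limitin_componentwise[of "\<lambda>_ :: 'a. euclidean :: 'b topology" UNIV f l F]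
  by (simp add: euclidean_product_topology)

instance "fun" :: (type, real_tvs) real_tvs
proof
  fix a b :: "'a \<Rightarrow> 'b"
  have f: "filterlim fst (nhds a) (nhds a \<times>\<^sub>F nhds b)"
    and s: "filterlim snd (nhds b) (nhds a \<times>\<^sub>F nhds b)"
    by (simp_all add: filterlim_fst filterlim_snd)
  show "((\<lambda>x. fst x + snd x) \<longlongrightarrow> a + b) (nhds a \<times>\<^sub>F nhds b)"
    unfolding tendsto_fun_iff plus_fun_apply
    by (intro allI tendsto_add f[unfolded tendsto_fun_iff, rule_format]
        s[unfolded tendsto_fun_iff, rule_format])
  have i: "((\<lambda>x. x) \<longlongrightarrow> a) (nhds a)" by (rule filterlim_ident)
  have "((\<lambda>x. - x i) \<longlongrightarrow> - a i) (nhds a)" for i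
    using i[unfolded tendsto_fun_iff] by (intro tendsto_minus) simp
  then show "(uminus \<longlongrightarrow> - a) (nhds a)"
    by (simp add: tendsto_fun_iff)
next
  fix c :: real and a :: "'a \<Rightarrow> 'b"
  have f: "filterlim fst (nhds c) (nhds c \<times>\<^sub>F nhds a)"
    and s: "filterlim snd (nhds a) (nhds c \<times>\<^sub>F nhds a)"
    by (simp_all add: filterlim_fst filterlim_snd)
  show "((\<lambda>p. fst p *\<^sub>R snd p) \<longlongrightarrow> c *\<^sub>R a) (nhds c \<times>\<^sub>F nhds a)"
    unfolding tendsto_fun_iff scaleR_fun_apply
    by (intro allI tendsto_scaleR_tvs f s[unfolded tendsto_fun_iff, rule_format])
qed


section \<open>Bertram--Gloeckner--Neeb differential calculus\<close>

text \<open>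
  A map \<open>f : W \<rightarrow> F\<close> on \<open>W \<subseteq> E\<close> is \<open>C\<^sup>1\<close> if it is continuous and if its difference quotient extends
  to a continuous map \<open>g : W' \<rightarrow> F\<close>, where \<open>W' = {(x, v, t) \<in> E \<times> E \<times> \<real>. x \<in> W, x + t v \<in> W}\<close> and
  \<open>f (x + t v) - f x = t g (x, v, t)\<close>; it is \<open>C\<^sup>k\<^sup>+\<^sup>1\<close> if moreover \<open>g\<close> is \<open>C\<^sup>k\<close>.
  The recursion replaces \<open>E\<close> by \<open>E \<times> E \<times> \<real>\<close>. To keep its type fixed, all the spaces occurring in it
  are viewed as linear subspaces of \<open>X = E\<^sup>\<nat> \<times> \<real>\<^sup>\<nat>\<close>, using the linear homeomorphism
  \<open>pack : X \<times> X \<times> \<real> \<rightarrow> X\<close> below, which interleaves coordinates.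
\<close>

type_synonym 'a bgn = "(nat \<Rightarrow> 'a) \<times> (nat \<Rightarrow> real)"

definition pack :: "'a bgn \<Rightarrow> 'a bgn \<Rightarrow> real \<Rightarrow> 'a bgn" where
  "pack x v t =
    ((\<lambda>i. (if even i then fst x else fst v) (i div 2)),
     (\<lambda>i. case i of 0 \<Rightarrow> t | Suc j \<Rightarrow> (if even j then snd x else snd v) (j div 2)))"

definition unpack :: "'a bgn \<Rightarrow> 'a bgn \<times> 'a bgn \<times> real" where
  "unpack p =
    ((\<lambda>i. fst p (2 * i), \<lambda>i. snd p (Suc (2 * i))),
     (\<lambda>i. fst p (Suc (2 * i)), \<lambda>i. snd p (Suc (Suc (2 * i)))),
     snd p 0)"

lemma homeomorphism_pack:
  "homeomorphism UNIV UNIV (\<lambda>(x, v, t). pack x v t)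
     (unpack :: 'a :: real_tvs bgn \<Rightarrow> 'a bgn \<times> 'a bgn \<times> real)"
proof (rule homeomorphismI)
  note cc = continuous_on_product_then_coordinatewise
  have f: "continuous_on UNIV (fst :: 'a bgn \<Rightarrow> _)" and s: "continuous_on UNIV (snd :: 'a bgn \<Rightarrow> _)"
    by (intro continuous_on_fst continuous_on_snd continuous_on_id)+
  show "continuous_on UNIV (unpack :: 'a bgn \<Rightarrow> 'a bgn \<times> 'a bgn \<times> real)"
    unfolding unpack_def
    by (intro continuous_on_Pair continuous_on_coordinatewise_then_product cc[OF f] cc[OF s])
  let ?D = "UNIV :: ('a bgn \<times> 'a bgn \<times> real) set"
  have p: "continuous_on ?D (\<lambda>p. fst (fst p))" "continuous_on ?D (\<lambda>p. snd (fst p))"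
    "continuous_on ?D (\<lambda>p. fst (fst (snd p)))" "continuous_on ?D (\<lambda>p. snd (fst (snd p)))"
    "continuous_on ?D (\<lambda>p. snd (snd p))"
    by (intro continuous_on_fst continuous_on_snd continuous_on_id)+
  have "continuous_on ?D (\<lambda>p. pack (fst p) (fst (snd p)) (snd (snd p)))"
    unfolding pack_def
  proof (intro continuous_on_Pair continuous_on_coordinatewise_then_product)
    fix i :: nat
    show "continuous_on ?D (\<lambda>p. (if even i then fst (fst p) else fst (fst (snd p))) (i div 2))"
      using cc[OF p(1)] cc[OF p(3)] by (cases "even i") simp_all
    show "continuous_on ?D (\<lambda>p. case i of 0 \<Rightarrow> snd (snd p)
        | Suc j \<Rightarrow> (if even j then snd (fst p) else snd (fst (snd p))) (j div 2))"
    proof (cases i)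
      case 0
      then show ?thesis using p(5) by simp
    next
      case (Suc j)
      then show ?thesis
        using cc[OF p(2)] cc[OF p(4)] by (cases "even j") simp_all
    qed
  qed
  then show "continuous_on UNIV (\<lambda>(x, v, t). pack x v t :: 'a bgn)"
    by (simp add: case_prod_unfold)
  show "unpack (case p of (x, v, t) \<Rightarrow> pack x v t) = p" for p :: "'a bgn \<times> 'a bgn \<times> real"
    by (cases p) (auto simp: pack_def unpack_def)
  show "(case unpack q of (x, v, t) \<Rightarrow> pack x v t) = q" for q :: "'a bgn"
    by (cases q) (auto simp: pack_def unpack_def fun_eq_iff split: nat.split)
qed auto

text \<open>
  \<open>BGN_C k S W T f\<close>: the map \<open>f : W \<rightarrow> T\<close> is \<open>C\<^sup>k\<close>, where \<open>W\<close> is a subset of the space \<open>S\<close>. The target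
  space \<open>T\<close> is a parameter because the extended difference quotients must again take values in it.
  As usual, \<open>W\<close> is meant to be open or at least to have dense interior in \<open>S\<close>; the latter
  covers the domains arising from \<open>[0, 1]\<close>.
\<close>

primrec BGN_C :: "nat \<Rightarrow> 'a::real_tvs bgn set \<Rightarrow> 'a bgn set \<Rightarrow> 'b::real_tvs set \<Rightarrow> ('a bgn \<Rightarrow> 'b) \<Rightarrow> bool"
where
  "BGN_C 0 S W T f \<longleftrightarrow> continuous_on W f \<and> f ` W \<subseteq> T"
| "BGN_C (Suc k) S W T f \<longleftrightarrow>
     continuous_on W f \<and> f ` W \<subseteq> T \<and>
     (\<exists>g. (\<forall>x\<in>W. \<forall>v\<in>S. \<forall>t. x + t *\<^sub>R v \<in> W \<longrightarrow> f (x + t *\<^sub>R v) - f x = t *\<^sub>R g (pack x v t)) \<and>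
          BGN_C k {pack x v t |x v t. x \<in> S \<and> v \<in> S}
                  {pack x v t |x v t. x \<in> W \<and> v \<in> S \<and> x + t *\<^sub>R v \<in> W} T g)"

definition bgn_embed :: "'a::real_tvs \<Rightarrow> 'a bgn" where
  "bgn_embed x = ((\<lambda>i. if i = 0 then x else 0), (\<lambda>_. 0))"

definition smooth_on :: "'a::real_tvs set \<Rightarrow> 'a set \<Rightarrow> 'b::real_tvs set \<Rightarrow> ('a \<Rightarrow> 'b) \<Rightarrow> bool" where
  "smooth_on S W T f \<longleftrightarrow>
     (\<forall>k. BGN_C k (bgn_embed ` S) (bgn_embed ` W) T (\<lambda>p. f (fst p 0)))"


section \<open>Smooth manifolds\<close>

record ('m, 'e) manifold =
  mtop :: "'m topology"
  model :: "'e set"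
  atlas :: "('m set \<times> ('m \<Rightarrow> 'e)) set"

definition smooth_manifold :: "('m, 'e::real_tvs) manifold \<Rightarrow> bool" where
  "smooth_manifold M \<longleftrightarrow>
     subspace (model M) \<and>
     (\<forall>(U, \<phi>) \<in> atlas M.
        openin (mtop M) U \<and> openin (top_of_set (model M)) (\<phi> ` U) \<and>
        homeomorphic_map (subtopology (mtop M) U) (top_of_set (\<phi> ` U)) \<phi>) \<and>
     (\<Union>(U, \<phi>) \<in> atlas M. U) = topspace (mtop M) \<and>
     (\<forall>(U, \<phi>) \<in> atlas M. \<forall>(U', \<psi>) \<in> atlas M.
        smooth_on (model M) (\<phi> ` (U \<inter> U')) (model M) (\<psi> \<circ> inv_into U \<phi>))"

text \<open>The domain \<open>D\<close> is an open submanifold of \<open>M\<close>, or a closed strip \<open>N \<times> [0, 1] \<subseteq> N \<times> \<real> = M\<close>.\<close>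

definition smooth_map_on ::
  "'m set \<Rightarrow> ('m, 'e::real_tvs) manifold \<Rightarrow> ('n, 'f::real_tvs) manifold \<Rightarrow> ('m \<Rightarrow> 'n) \<Rightarrow> bool"
where
  "smooth_map_on D M N f \<longleftrightarrow>
     continuous_map (subtopology (mtop M) D) (mtop N) f \<and>
     (\<forall>(U, \<phi>) \<in> atlas M. \<forall>(U', \<psi>) \<in> atlas N.
        smooth_on (model M) (\<phi> ` {x \<in> U \<inter> D. f x \<in> U'}) (model N) (\<psi> \<circ> f \<circ> inv_into U \<phi>))"

definition smooth_map ::
  "('m, 'e::real_tvs) manifold \<Rightarrow> ('n, 'f::real_tvs) manifold \<Rightarrow> ('m \<Rightarrow> 'n) \<Rightarrow> bool"
where
  "smooth_map M N f \<longleftrightarrow> smooth_map_on (topspace (mtop M)) M N f"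

definition real_manifold :: "(real, real) manifold" where
  "real_manifold = \<lparr>mtop = euclideanreal, model = UNIV, atlas = {(UNIV, id)}\<rparr>"

definition prod_manifold ::
  "('m, 'e::real_tvs) manifold \<Rightarrow> ('n, 'f::real_tvs) manifold \<Rightarrow> ('m \<times> 'n, 'e \<times> 'f) manifold"
where
  "prod_manifold M N =
     \<lparr>mtop = prod_topology (mtop M) (mtop N),
      model = model M \<times> model N,
      atlas = {(U \<times> U', map_prod \<phi> \<psi>) |U \<phi> U' \<psi>. (U, \<phi>) \<in> atlas M \<and> (U', \<psi>) \<in> atlas N}\<rparr>"

text \<open>\<open>power_manifold q M\<close> is \<open>M\<^sup>q\<^sup>+\<^sup>1\<close>; its points are the extensional functions on \<open>{0..q}\<close>.\<close>

definition power_manifold ::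
  "nat \<Rightarrow> ('m, 'e::real_tvs) manifold \<Rightarrow> (nat \<Rightarrow> 'm, nat \<Rightarrow> 'e) manifold"
where
  "power_manifold q M =
     \<lparr>mtop = product_topology (\<lambda>_. mtop M) {..q},
      model = {x. (\<forall>i\<le>q. x i \<in> model M) \<and> (\<forall>i>q. x i = 0)},
      atlas = {(\<Pi>\<^sub>E i\<in>{..q}. fst (c i), \<lambda>x i. if i \<le> q then snd (c i) (x i) else 0)
                |c. \<forall>i\<le>q. c i \<in> atlas M}\<rparr>"

definition smoothly_paracompact :: "('m, 'e::real_tvs) manifold \<Rightarrow> bool" where
  "smoothly_paracompact M \<longleftrightarrow>
     (\<forall>\<O>. (\<forall>U\<in>\<O>. openin (mtop M) U) \<and> \<Union>\<O> = topspace (mtop M) \<longrightarrow>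
       (\<exists>\<rho> :: 'm set \<Rightarrow> 'm \<Rightarrow> real.
          let supp = (\<lambda>U. mtop M closure_of {x \<in> topspace (mtop M). \<rho> U x \<noteq> 0}) in
          (\<forall>U\<in>\<O>. smooth_map M real_manifold (\<rho> U) \<and> supp U \<subseteq> U) \<and>
          (\<forall>x\<in>topspace (mtop M). \<exists>N. openin (mtop M) N \<and> x \<in> N \<and>
              finite {U \<in> \<O>. supp U \<inter> N \<noteq> {}}) \<and>
          (\<forall>x\<in>topspace (mtop M). (\<Sum>U\<in>{U \<in> \<O>. \<rho> U x \<noteq> 0}. \<rho> U x) = 1)))"


section \<open>Lie groups\<close>

definition lie_group :: "'g monoid \<Rightarrow> ('g, 'e::real_tvs) manifold \<Rightarrow> bool" where
  "lie_group G M \<longleftrightarrow>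
     group G \<and> smooth_manifold M \<and> topspace (mtop M) = carrier G \<and>
     smooth_map (prod_manifold M M) M (\<lambda>(x, y). x \<otimes>\<^bsub>G\<^esub> y) \<and>
     smooth_map M M (\<lambda>x. inv\<^bsub>G\<^esub> x)"

definition smoothly_loop_contractible :: "'v monoid \<Rightarrow> ('v, 'f::real_tvs) manifold \<Rightarrow> bool" where
  "smoothly_loop_contractible V M \<longleftrightarrow>
     (\<exists>\<Phi>. smooth_map_on (carrier V \<times> {0..1}) (prod_manifold M real_manifold) M \<Phi> \<and>
          (\<forall>v\<in>carrier V. \<Phi> (v, 0) = v \<and> \<Phi> (v, 1) = \<one>\<^bsub>V\<^esub>) \<and>
          (\<forall>t\<in>{0..1}. (\<lambda>v. \<Phi> (v, t)) \<in> hom V V \<and> smooth_map M M (\<lambda>v. \<Phi> (v, t))))"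

text \<open>Filterbases are bases of the filter of identity neighbourhoods; the second condition makes
  them nonempty and downward directed.\<close>

definition open_identity_nhd_filterbase :: "'g monoid \<Rightarrow> 'g topology \<Rightarrow> 'g set set \<Rightarrow> bool" where
  "open_identity_nhd_filterbase G X \<U> \<longleftrightarrow>
     (\<forall>U\<in>\<U>. openin X U \<and> \<one>\<^bsub>G\<^esub> \<in> U) \<and>
     (\<forall>W. openin X W \<and> \<one>\<^bsub>G\<^esub> \<in> W \<longrightarrow> (\<exists>U\<in>\<U>. U \<subseteq> W))"


section \<open>Cochain complexes\<close>

record 'c cochain_complex =
  grp :: "nat \<Rightarrow> 'c monoid"
  diff :: "nat \<Rightarrow> 'c \<Rightarrow> 'c"

definition cocycles :: "'c cochain_complex \<Rightarrow> nat \<Rightarrow> 'c set" where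
  "cocycles C n = kernel (grp C n) (grp C (Suc n)) (diff C n)"

primrec coboundaries :: "'c cochain_complex \<Rightarrow> nat \<Rightarrow> 'c set" where
  "coboundaries C 0 = {\<one>\<^bsub>grp C 0\<^esub>}"
| "coboundaries C (Suc n) = diff C n ` carrier (grp C n)"

definition cohomology :: "'c cochain_complex \<Rightarrow> nat \<Rightarrow> 'c set monoid" where
  "cohomology C n = (grp C n)\<lparr>carrier := cocycles C n\<rparr> Mod coboundaries C n"

text \<open>The map on \<open>n\<close>-th cohomology induced by a map \<open>f\<close> of \<open>n\<close>-cochains into \<open>C'\<close>: the cohomology
  class \<open>K\<close> of \<open>c\<close> is sent to the class of \<open>f c\<close>.\<close>

definition cohomology_map :: "'d cochain_complex \<Rightarrow> nat \<Rightarrow> ('c \<Rightarrow> 'd) \<Rightarrow> 'c set \<Rightarrow> 'd set" where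
  "cohomology_map C' n f K = coboundaries C' n <#>\<^bsub>grp C' n\<^esub> (f ` K)"

text \<open>The complex of \<open>V\<close>-valued functions on a semisimplicial set with \<open>n\<close>-simplices \<open>D n\<close> and face maps
  \<open>face n k\<close> from \<open>D n\<close> to \<open>D (n - 1)\<close> (index conventions as in \<open>singular_face\<close>). The group \<open>V\<close> is
  written multiplicatively.\<close>

definition function_complex ::
  "'v monoid \<Rightarrow> (nat \<Rightarrow> 's set) \<Rightarrow> (nat \<Rightarrow> nat \<Rightarrow> 's \<Rightarrow> 's) \<Rightarrow> ('s \<Rightarrow> 'v) cochain_complex"
where
  "function_complex V D face =
     \<lparr>grp = (\<lambda>n. product_group (D n) (\<lambda>_. V)),
      diff = (\<lambda>n f. \<lambda>s\<in>D (Suc n).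
        \<Otimes>\<^bsub>V\<^esub>k\<in>{..Suc n}. f (face (Suc n) k s) [^]\<^bsub>V\<^esub> ((- 1) ^ k :: int))\<rparr>"

definition translate_cover :: "'g monoid \<Rightarrow> 'g set \<Rightarrow> 'g set set" where
  "translate_cover G U = {g <#\<^bsub>G\<^esub> U |g. g \<in> carrier G}"

definition small_tuples :: "'m set set \<Rightarrow> nat \<Rightarrow> (nat \<Rightarrow> 'm) set" where
  "small_tuples \<UU> q = (\<Union>U\<in>\<UU>. {..q} \<rightarrow>\<^sub>E U)"

text \<open>Omission of the \<open>k\<close>-th entry of a \<open>(q + 1)\<close>-tuple, \<open>q > 0\<close>.\<close>

definition tuple_face :: "nat \<Rightarrow> nat \<Rightarrow> (nat \<Rightarrow> 'm) \<Rightarrow> nat \<Rightarrow> 'm" where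
  "tuple_face q k u = (\<lambda>i\<in>{..q - Suc 0}. if i < k then u i else u (Suc i))"

definition A_complex :: "'m set set \<Rightarrow> 'v monoid \<Rightarrow> ((nat \<Rightarrow> 'm) \<Rightarrow> 'v) cochain_complex" where
  "A_complex \<UU> V = function_complex V (small_tuples \<UU>) tuple_face"

definition As_complex ::
  "('m, 'e::real_tvs) manifold \<Rightarrow> 'm set set \<Rightarrow> 'v monoid \<Rightarrow> ('v, 'f::real_tvs) manifold \<Rightarrow>
     ((nat \<Rightarrow> 'm) \<Rightarrow> 'v) cochain_complex"
where
  "As_complex M \<UU> V N =
     \<lparr>grp = (\<lambda>q. (grp (A_complex \<UU> V) q)
        \<lparr>carrier := {f \<in> carrier (grp (A_complex \<UU> V) q).
                       smooth_map_on (small_tuples \<UU> q) (power_manifold q M) N f}\<rparr>),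
      diff = diff (A_complex \<UU> V)\<rparr>"

definition small_simplices :: "'m topology \<Rightarrow> 'm set set \<Rightarrow> nat \<Rightarrow> ((nat \<Rightarrow> real) \<Rightarrow> 'm) set" where
  "small_simplices X \<UU> n = {\<tau> \<in> singular_simplex_set n X. \<exists>U\<in>\<UU>. \<tau> ` standard_simplex n \<subseteq> U}"

definition S_complex ::
  "'m topology \<Rightarrow> 'm set set \<Rightarrow> 'v monoid \<Rightarrow> (((nat \<Rightarrow> real) \<Rightarrow> 'm) \<Rightarrow> 'v) cochain_complex"
where
  "S_complex X \<UU> V = function_complex V (small_simplices X \<UU>) singular_face"

definition singular_cochain_complex ::
  "'m topology \<Rightarrow> 'v monoid \<Rightarrow> (((nat \<Rightarrow> real) \<Rightarrow> 'm) \<Rightarrow> 'v) cochain_complex"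
where
  "singular_cochain_complex X V = function_complex V (\<lambda>n. singular_simplex_set n X) singular_face"

definition simplex_vertex :: "nat \<Rightarrow> nat \<Rightarrow> real" where
  "simplex_vertex i = (\<lambda>j. if j = i then 1 else 0)"

text \<open>The cochain map written \<open>C(\<lambda>\<^sup>*, V)\<close>: evaluation of a cochain on the vertices of a simplex.\<close>

definition vertex_map ::
  "'m topology \<Rightarrow> 'm set set \<Rightarrow> nat \<Rightarrow> ((nat \<Rightarrow> 'm) \<Rightarrow> 'v) \<Rightarrow> ((nat \<Rightarrow> real) \<Rightarrow> 'm) \<Rightarrow> 'v"
where
  "vertex_map X \<UU> n f = (\<lambda>\<tau>\<in>small_simplices X \<UU> n. f (\<lambda>i\<in>{..n}. \<tau> (simplex_vertex i)))"


section \<open>Directed colimits of groups\<close>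

text \<open>The colimit of groups \<open>H i\<close> over \<open>I\<close>, directed by \<open>pre\<close>, with transition maps
  \<open>r i j : H i \<rightarrow> H j\<close> for \<open>pre i j\<close>.\<close>

definition colim_rel ::
  "'i set \<Rightarrow> ('i \<Rightarrow> 'i \<Rightarrow> bool) \<Rightarrow> ('i \<Rightarrow> 'a monoid) \<Rightarrow> ('i \<Rightarrow> 'i \<Rightarrow> 'a \<Rightarrow> 'a) \<Rightarrow>
     (('i \<times> 'a) \<times> ('i \<times> 'a)) set"
where
  "colim_rel I pre H r =
     {((i, a), (j, b)). i \<in> I \<and> a \<in> carrier (H i) \<and> j \<in> I \<and> b \<in> carrier (H j) \<and>
        (\<exists>k\<in>I. pre i k \<and> pre j k \<and> r i k a = r j k b)}"

definition colim ::
  "'i set \<Rightarrow> ('i \<Rightarrow> 'i \<Rightarrow> bool) \<Rightarrow> ('i \<Rightarrow> 'a monoid) \<Rightarrow> ('i \<Rightarrow> 'i \<Rightarrow> 'a \<Rightarrow> 'a) \<Rightarrow> ('i \<times> 'a) set monoid"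
where
  "colim I pre H r =
     \<lparr>carrier = (SIGMA i:I. carrier (H i)) // colim_rel I pre H r,
      monoid.mult = (\<lambda>P Q. \<Union>{colim_rel I pre H r `` {(k, r i k a \<otimes>\<^bsub>H k\<^esub> r j k b)} |i a j b k.
        (i, a) \<in> P \<and> (j, b) \<in> Q \<and> k \<in> I \<and> pre i k \<and> pre j k}),
      one = (\<Union>i\<in>I. colim_rel I pre H r `` {(i, \<one>\<^bsub>H i\<^esub>)})\<rparr>"

text \<open>Maps out of a colimit into a colimit, respectively into a fixed group, induced by a compatible
  family; these are the usual maps \<open>[i, a] \<mapsto> [i, f i a]\<close> and \<open>[i, a] \<mapsto> f i a\<close>.\<close>

definition colim_map ::
  "(('i \<times> 'b) \<times> ('i \<times> 'b)) set \<Rightarrow> ('i \<Rightarrow> 'a \<Rightarrow> 'b) \<Rightarrow> ('i \<times> 'a) set \<Rightarrow> ('i \<times> 'b) set"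
where
  "colim_map rel f P = (\<Union>(i, a)\<in>P. rel `` {(i, f i a)})"

definition colim_desc :: "('i \<Rightarrow> 'a \<Rightarrow> 'b) \<Rightarrow> ('i \<times> 'a) set \<Rightarrow> 'b" where
  "colim_desc f P = the_elem ((\<lambda>(i, a). f i a) ` P)"


section \<open>The cohomologies of the translation covers\<close>

abbreviation reverse_incl :: "'m set \<Rightarrow> 'm set \<Rightarrow> bool" where
  "reverse_incl U W \<equiv> W \<subseteq> U"

definition H_U :: "'g monoid \<Rightarrow> 'v monoid \<Rightarrow> nat \<Rightarrow> 'g set \<Rightarrow> ((nat \<Rightarrow> 'g) \<Rightarrow> 'v) set monoid" where
  "H_U G V n U = cohomology (A_complex (translate_cover G U) V) n"

definition H_U_restrict ::
  "'g monoid \<Rightarrow> 'v monoid \<Rightarrow> nat \<Rightarrow> 'g set \<Rightarrow> 'g set \<Rightarrow>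
     ((nat \<Rightarrow> 'g) \<Rightarrow> 'v) set \<Rightarrow> ((nat \<Rightarrow> 'g) \<Rightarrow> 'v) set"
where
  "H_U_restrict G V n U W =
     cohomology_map (A_complex (translate_cover G W) V) n
       (\<lambda>f. restrict f (small_tuples (translate_cover G W) n))"

definition Hs_U ::
  "'g monoid \<Rightarrow> ('g, 'e::real_tvs) manifold \<Rightarrow> 'v monoid \<Rightarrow> ('v, 'f::real_tvs) manifold \<Rightarrow>
     nat \<Rightarrow> 'g set \<Rightarrow> ((nat \<Rightarrow> 'g) \<Rightarrow> 'v) set monoid"
where
  "Hs_U G M V N n U = cohomology (As_complex M (translate_cover G U) V N) n"

definition Hs_U_restrict ::
  "'g monoid \<Rightarrow> ('g, 'e::real_tvs) manifold \<Rightarrow> 'v monoid \<Rightarrow> ('v, 'f::real_tvs) manifold \<Rightarrow>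
     nat \<Rightarrow> 'g set \<Rightarrow> 'g set \<Rightarrow> ((nat \<Rightarrow> 'g) \<Rightarrow> 'v) set \<Rightarrow> ((nat \<Rightarrow> 'g) \<Rightarrow> 'v) set"
where
  "Hs_U_restrict G M V N n U W =
     cohomology_map (As_complex M (translate_cover G W) V N) n
       (\<lambda>f. restrict f (small_tuples (translate_cover G W) n))"

definition colim_H :: "'g monoid \<Rightarrow> 'v monoid \<Rightarrow> 'g set set \<Rightarrow> nat \<Rightarrow>
    ('g set \<times> ((nat \<Rightarrow> 'g) \<Rightarrow> 'v) set) set monoid"
where
  "colim_H G V \<U> n = colim \<U> reverse_incl (H_U G V n) (H_U_restrict G V n)"

definition colim_Hs ::
  "'g monoid \<Rightarrow> ('g, 'e::real_tvs) manifold \<Rightarrow> 'v monoid \<Rightarrow> ('v, 'f::real_tvs) manifold \<Rightarrow>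
     'g set set \<Rightarrow> nat \<Rightarrow> ('g set \<times> ((nat \<Rightarrow> 'g) \<Rightarrow> 'v) set) set monoid"
where
  "colim_Hs G M V N \<U> n = colim \<U> reverse_incl (Hs_U G M V N n) (Hs_U_restrict G M V N n)"

definition H_sing :: "'m topology \<Rightarrow> 'v monoid \<Rightarrow> nat \<Rightarrow> (((nat \<Rightarrow> real) \<Rightarrow> 'm) \<Rightarrow> 'v) set monoid" where
  "H_sing X V n = cohomology (singular_cochain_complex X V) n"

text \<open>The map \<open>H\<^sub>s\<^sub>i\<^sub>n\<^sub>g(X; V) \<rightarrow> H(S\<^sup>*(\<UU>; V))\<close> given by restriction to small simplices.\<close>

definition H_sing_restrict ::
  "'m topology \<Rightarrow> 'm set set \<Rightarrow> 'v monoid \<Rightarrow> nat \<Rightarrow>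
     (((nat \<Rightarrow> real) \<Rightarrow> 'm) \<Rightarrow> 'v) set \<Rightarrow> (((nat \<Rightarrow> real) \<Rightarrow> 'm) \<Rightarrow> 'v) set"
where
  "H_sing_restrict X \<UU> V n =
     cohomology_map (S_complex X \<UU> V) n (\<lambda>f. restrict f (small_simplices X \<UU> n))"

text \<open>The map to singular cohomology induced by \<open>C(\<lambda>\<^sup>*, V)\<close> on classes of (smooth or arbitrary)
  cochains, via the identification of \<open>H(S\<^sup>*(\<UU>; V))\<close> with singular cohomology.\<close>

definition vertex_map_sing ::
  "'m topology \<Rightarrow> 'm set set \<Rightarrow> 'v monoid \<Rightarrow> nat \<Rightarrow>
     ((nat \<Rightarrow> 'm) \<Rightarrow> 'v) set \<Rightarrow> (((nat \<Rightarrow> real) \<Rightarrow> 'm) \<Rightarrow> 'v) set"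
where
  "vertex_map_sing X \<UU> V n K =
     inv_into (carrier (H_sing X V n)) (H_sing_restrict X \<UU> V n)
       (cohomology_map (S_complex X \<UU> V) n (vertex_map X \<UU> n) K)"

definition colim_inclusion ::
  "'g monoid \<Rightarrow> 'v monoid \<Rightarrow> 'g set set \<Rightarrow> nat \<Rightarrow>
     ('g set \<times> ((nat \<Rightarrow> 'g) \<Rightarrow> 'v) set) set \<Rightarrow> ('g set \<times> ((nat \<Rightarrow> 'g) \<Rightarrow> 'v) set) set"
where
  "colim_inclusion G V \<U> n =
     colim_map (colim_rel \<U> reverse_incl (H_U G V n) (H_U_restrict G V n))
       (\<lambda>U. cohomology_map (A_complex (translate_cover G U) V) n (\<lambda>f. f))"

definition colim_to_sing ::
  "'g monoid \<Rightarrow> 'g topology \<Rightarrow> 'v monoid \<Rightarrow> nat \<Rightarrow>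
     ('g set \<times> ((nat \<Rightarrow> 'g) \<Rightarrow> 'v) set) set \<Rightarrow> (((nat \<Rightarrow> real) \<Rightarrow> 'g) \<Rightarrow> 'v) set"
where
  "colim_to_sing G X V n = colim_desc (\<lambda>U. vertex_map_sing X (translate_cover G U) V n)"

end

theory Submission imports Defs "HOL-Analysis.Abstract_Topological_Spaces" begin

text \<open>
  Write \<open>W\<close> for an open identity neighbourhood of \<open>G\<close>, and call a tuple or a singular simplex small if it
  lies in a single translate \<open>g W\<close>. All three cohomologies are compared with singular cohomology.

  \<^item> Singular cohomology is computed by small singular simplices. This is iterated subdivision; the
    lemma \<open>H_sing_restrict_iso\<close> extracts from it a chain retraction onto the small chains, which can be
    dualised to cochains with values in any abelian group.

  \<^item> For arbitrary cochains the passage to vertices has an inverse up to homotopy, after shrinking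
    \<open>W\<close>. A chart at the identity gives a contraction of a neighbourhood of \<open>1\<close>, and translating it gives
    a way of coning a small simplex to a nearby point. Iterated cones turn a small tuple \<open>u\<close> into a
    small simplex \<open>straight n u\<close> with vertices \<open>u\<close>, compatibly with all faces, and coning the
    difference produces a chain homotopy between a simplex and the straightening of its vertices. Pulling a
    singular cocycle back along straightening proves \<open>vertex_map_surjective\<close>. Pulling back a singular cochain
    whose coboundary is the vertex cochain of a given cocycle proves \<open>vertex_map_injective\<close>. All choices are made by left translation,
    so one neighbourhood \<open>W\<close> serves for all translates at once.

  \<^item> Smooth cochains are compared with arbitrary ones by averaging. Let \<open>\<rho>\<^sub>i\<close> be a smooth partition
    of unity on \<open>G\<close> with supports in translates \<open>c\<^sub>i W\<close>. The average of a function \<open>F i\<close> with values in \<open>V\<close>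
    with weights \<open>\<rho>\<^sub>i(x)\<close> makes sense although \<open>V\<close> is not a vector space: order the indices, let
    \<open>s\<^sub>i\<close> be the partial sums of the weights and form the product of the elements
    \<open>\<Phi> (F i, \<theta> s\<^sub>i) / \<Phi> (F i, \<theta> (s\<^sub>i - \<rho>\<^sub>i))\<close>, where \<open>\<Phi>\<close> is the contraction of \<open>V\<close> by homomorphisms and
    \<open>\<theta>\<close> is smooth with \<open>\<theta> 0 = 1\<close> and \<open>\<theta> 1 = 0\<close>. The product is multiplicative in \<open>F\<close>, and for
    constant \<open>F\<close> it telescopes to that constant, as an average should. Replacing the arguments
    of a cochain one after the other by averages over the points \<open>c\<^sub>i\<close> gives a smooth cochain, and the prism
    operator of the simplices in between is a homotopy from the identity to smoothing which preserves
    smoothness. Hence every cocycle is cohomologous to a smooth one (\<open>smoothing_cohomologous\<close>), and a smooth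
    cocycle that is a coboundary is the coboundary of a smooth cochain (\<open>smooth_coboundary\<close>), again after
    shrinking \<open>W\<close>.

  Since the colimit over the filterbase ignores a passage to smaller neighbourhoods, these facts say that both
  colimits map isomorphically to singular cohomology (\<open>comparison_iso\<close>). The inclusion of the smooth
  cochains is compatible with the two isomorphisms, so it induces an isomorphism as well.

  The averaging argument rests on the calculus of the Bertram--Gloeckner--Neeb class
  \<open>C\<^sup>k\<close>: composition, products and the local nature of smoothness.
\<close>

section \<open>Evaluating functions on formal sums\<close>

text \<open>The homomorphism from formal sums to \<open>V\<close> that extends \<open>f\<close>. Values of \<open>f\<close> outside \<open>V\<close> are replaced by
  the unit, so that the map is a homomorphism for every \<open>f\<close> and the identities below are unconditional. With
  it, signs and cancellations in coboundaries are computed in free abelian groups, once for all \<open>V\<close>.\<close>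

definition frag_eval :: "('v, 'm) monoid_scheme \<Rightarrow> ('s \<Rightarrow> 'v) \<Rightarrow> ('s \<Rightarrow>\<^sub>0 int) \<Rightarrow> 'v" where
  "frag_eval V f c = (\<Otimes>\<^bsub>V\<^esub>x\<in>Poly_Mapping.keys c.
     (if f x \<in> carrier V then f x else \<one>\<^bsub>V\<^esub>) [^]\<^bsub>V\<^esub> poly_mapping.lookup c x)"

context comm_group
begin

lemma frag_eval_closed [simp]: "frag_eval G f c \<in> carrier G"
  unfolding frag_eval_def by (intro finprod_closed) auto

lemma frag_eval_superset:
  assumes "finite A" "Poly_Mapping.keys c \<subseteq> A"
  shows "frag_eval G f c = (\<Otimes>x\<in>A. (if f x \<in> carrier G then f x else \<one>) [^] poly_mapping.lookup c x)"
  unfolding frag_eval_def using assms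
  by (intro finprod_mono_neutral_cong_left) (auto simp: in_keys_iff)

lemma frag_eval_0 [simp]: "frag_eval G f 0 = \<one>"
  by (simp add: frag_eval_def)

lemma frag_eval_of [simp]: "f x \<in> carrier G \<Longrightarrow> frag_eval G f (frag_of x) = f x"
  by (simp add: frag_eval_def int_pow_1)

lemma frag_eval_add: "frag_eval G f (a + b) = frag_eval G f a \<otimes> frag_eval G f b"
proof -
  let ?A = "Poly_Mapping.keys a \<union> Poly_Mapping.keys b"
  have "Poly_Mapping.keys (a + b) \<subseteq> ?A" by (rule keys_add)
  then show ?thesis
    by (subst (1 2 3) frag_eval_superset[of ?A])
      (auto simp: lookup_add int_pow_mult simp flip: finprod_multf intro!: finprod_cong)
qed

lemma frag_eval_minus: "frag_eval G f (- a) = inv (frag_eval G f a)"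
proof -
  have "frag_eval G f (- a) \<otimes> frag_eval G f a = \<one>"
    by (simp flip: frag_eval_add)
  then show ?thesis
    by (simp add: inv_equality)
qed

lemma frag_eval_diff: "frag_eval G f (a - b) = frag_eval G f a \<otimes> inv (frag_eval G f b)"
  by (metis diff_conv_add_uminus frag_eval_add frag_eval_minus)

lemma frag_eval_cmul: "frag_eval G f (frag_cmul k a) = frag_eval G f a [^] k"
proof (cases "k = 0")
  case False
  then have "Poly_Mapping.keys (frag_cmul k a) = Poly_Mapping.keys a" by auto
  then have *: "frag_eval G f (frag_cmul k a) = (\<Otimes>x\<in>Poly_Mapping.keys a.
     ((if f x \<in> carrier G then f x else \<one>) [^] poly_mapping.lookup a x) [^] k)"
    unfolding frag_eval_def by (intro finprod_cong) (auto simp: int_pow_pow mult.commute)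
  have "(\<Otimes>x\<in>A. h x [^] k) = finprod G h A [^] k" if "h \<in> A \<rightarrow> carrier G" for h :: "'c \<Rightarrow> 'a" and A
    using that
    by (induction A rule: infinite_finite_induct) (auto simp: int_pow_distrib Pi_def)
  from this[of "\<lambda>x. (if f x \<in> carrier G then f x else \<one>) [^] poly_mapping.lookup a x" "Poly_Mapping.keys a"]
  show ?thesis unfolding * by (simp add: frag_eval_def[of G f a] Pi_def)
qed (simp add: int_pow_0)

lemma frag_eval_cong:
  "(\<And>x. x \<in> Poly_Mapping.keys c \<Longrightarrow> f x = g x) \<Longrightarrow> frag_eval G f c = frag_eval G g c"
  unfolding frag_eval_def by (intro finprod_cong) (auto simp: simp_implies_def)

text \<open>This adjunction moves an operator on chains to the dual operator on cochains.\<close>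

lemma frag_eval_extend:
  "frag_eval G f (frag_extend B c) = frag_eval G (\<lambda>x. frag_eval G f (B x)) c"
  using subset_UNIV
  by (induction c rule: frag_induction) (simp_all add: frag_extend_diff frag_eval_diff)

lemma frag_eval_mult:
  assumes "\<And>x. x \<in> Poly_Mapping.keys c \<Longrightarrow> f x \<in> carrier G"
    "\<And>x. x \<in> Poly_Mapping.keys c \<Longrightarrow> g x \<in> carrier G"
  shows "frag_eval G (\<lambda>x. f x \<otimes> g x) c = frag_eval G f c \<otimes> frag_eval G g c"
proof -
  have "Poly_Mapping.keys c \<subseteq> {x. f x \<in> carrier G \<and> g x \<in> carrier G}"
    using assms by blast
  then show ?thesis
    by (induction c rule: frag_induction)
      (simp_all add: frag_eval_diff inv_mult m_ac)
qed

lemma frag_eval_one: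
  "(\<And>x. x \<in> Poly_Mapping.keys c \<Longrightarrow> f x = \<one>) \<Longrightarrow> frag_eval G f c = \<one>"
  unfolding frag_eval_def by (intro finprod_one_eqI) auto

lemma frag_eval_alternating_sum:
  assumes "\<And>k. k \<le> n \<Longrightarrow> f (s k) \<in> carrier G"
  shows "frag_eval G f (\<Sum>k\<le>n. frag_cmul ((- 1) ^ k) (frag_of (s k)))
    = (\<Otimes>k\<in>{..n}. f (s k) [^] ((- 1) ^ k :: int))"
  using assms
  by (induction n) (simp_all add: frag_eval_add frag_eval_cmul finprod_Suc m_comm Pi_def del: finprod_0)

end

section \<open>Cochain complexes and their cohomology\<close>

lemma comm_group_subgroup:
  assumes "comm_group G" "subgroup H G"
  shows "comm_group (G\<lparr>carrier := H\<rparr>)"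
proof -
  interpret comm_group G by fact
  interpret H: subgroup H G by fact
  show ?thesis
    by (rule group.group_comm_groupI[OF subgroup_imp_group[OF assms(2)]]) (simp add: m_comm)
qed

locale cochain_cx =
  fixes C :: "'c cochain_complex"
  assumes comm_grp: "comm_group (grp C n)"
    and diff_hom: "diff C n \<in> hom (grp C n) (grp C (Suc n))"
    and diff_diff: "f \<in> carrier (grp C n) \<Longrightarrow> diff C (Suc n) (diff C n f) = \<one>\<^bsub>grp C (Suc (Suc n))\<^esub>"
begin

definition cls :: "nat \<Rightarrow> 'c \<Rightarrow> 'c set" where
  "cls n z = coboundaries C n #>\<^bsub>grp C n\<^esub> z"

lemma grp_group: "group (grp C n)"
  using comm_grp comm_group_def by blast

lemma grp_hom_diff: "group_hom (grp C n) (grp C (Suc n)) (diff C n)"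
  using grp_group diff_hom by (simp add: group_hom_def group_hom_axioms_def)

lemma cocycles_iff: "z \<in> cocycles C n \<longleftrightarrow> z \<in> carrier (grp C n) \<and> diff C n z = \<one>\<^bsub>grp C (Suc n)\<^esub>"
  by (auto simp: cocycles_def kernel_def)

lemma subgroup_cocycles: "subgroup (cocycles C n) (grp C n)"
  unfolding cocycles_def using group_hom.subgroup_kernel[OF grp_hom_diff] .

lemma coboundaries_cocycles: "coboundaries C n \<subseteq> cocycles C n"
proof (cases n)
  case 0
  then show ?thesis
    using subgroup.one_closed[OF subgroup_cocycles] by simp
next
  case (Suc m)
  then show ?thesis
    using diff_diff hom_in_carrier[OF diff_hom] by (auto simp: cocycles_iff)
qed

lemma subgroup_coboundaries: "subgroup (coboundaries C n) (grp C n)"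
proof (cases n)
  case 0
  then show ?thesis using group.triv_subgroup[OF grp_group] by simp
next
  case (Suc m)
  then show ?thesis
    using group_hom.img_is_subgroup[OF grp_hom_diff] by simp
qed

abbreviation "Zgrp n \<equiv> (grp C n)\<lparr>carrier := cocycles C n\<rparr>"

lemma comm_group_Zgrp: "comm_group (Zgrp n)"
  using comm_group_subgroup[OF comm_grp subgroup_cocycles] .

lemma normal_coboundaries: "coboundaries C n \<lhd> Zgrp n"
proof -
  have "subgroup (coboundaries C n) (Zgrp n)"
    using group.subgroup_incl[OF grp_group subgroup_coboundaries subgroup_cocycles coboundaries_cocycles] .
  then show ?thesis
    by (simp add: comm_group.normal_iff_subgroup[OF comm_group_Zgrp])
qed

lemma group_cohomology: "group (cohomology C n)"
  unfolding cohomology_def using normal.factorgroup_is_group[OF normal_coboundaries] .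

lemma carrier_cohomology: "carrier (cohomology C n) = cls n ` cocycles C n"
  unfolding cohomology_def cls_def carrier_FactGroup by (simp add: r_coset_def)

lemma cls_in [intro]: "z \<in> cocycles C n \<Longrightarrow> cls n z \<in> carrier (cohomology C n)"
  by (simp add: carrier_cohomology)

lemma cls_eq_iff:
  assumes "z \<in> cocycles C n" "w \<in> cocycles C n"
  shows "cls n z = cls n w \<longleftrightarrow> (\<exists>b\<in>coboundaries C n. z = b \<otimes>\<^bsub>grp C n\<^esub> w)"
proof -
  interpret group "grp C n" by (rule grp_group)
  have c: "z \<in> carrier (grp C n)" "w \<in> carrier (grp C n)"
    using assms by (auto simp: cocycles_iff)
  show ?thesis
  proof
    assume "cls n z = cls n w"
    then have "z \<in> cls n w"
      using rcos_self[OF c(1) subgroup_coboundaries] by (simp add: cls_def)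
    then show "\<exists>b\<in>coboundaries C n. z = b \<otimes>\<^bsub>grp C n\<^esub> w"
      by (auto simp: cls_def r_coset_def)
  next
    assume "\<exists>b\<in>coboundaries C n. z = b \<otimes>\<^bsub>grp C n\<^esub> w"
    then have "z \<in> coboundaries C n #>\<^bsub>grp C n\<^esub> w" by (auto simp: r_coset_def)
    then show "cls n z = cls n w"
      unfolding cls_def using repr_independence[OF _ c(2) subgroup_coboundaries] by simp
  qed
qed

lemma cls_mult:
  assumes "z \<in> cocycles C n" "w \<in> cocycles C n"
  shows "cls n z \<otimes>\<^bsub>cohomology C n\<^esub> cls n w = cls n (z \<otimes>\<^bsub>grp C n\<^esub> w)"
proof -
  have "(\<lambda>a. coboundaries C n #>\<^bsub>Zgrp n\<^esub> a) \<in> hom (Zgrp n) (Zgrp n Mod coboundaries C n)"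
    using normal.r_coset_hom_Mod[OF normal_coboundaries] .
  then have "coboundaries C n #>\<^bsub>Zgrp n\<^esub> (z \<otimes>\<^bsub>grp C n\<^esub> w) =
    (coboundaries C n #>\<^bsub>Zgrp n\<^esub> z) \<otimes>\<^bsub>cohomology C n\<^esub> (coboundaries C n #>\<^bsub>Zgrp n\<^esub> w)"
    using assms by (auto simp: hom_def cohomology_def)
  then show ?thesis unfolding cls_def by (simp add: r_coset_def)
qed

lemma one_cohomology: "\<one>\<^bsub>cohomology C n\<^esub> = cls n \<one>\<^bsub>grp C n\<^esub>"
proof -
  interpret group "grp C n" by (rule grp_group)
  show ?thesis
    using subgroup.subset[OF subgroup_coboundaries] by (simp add: cohomology_def cls_def)
qed

lemma cocycles_mult: "z \<in> cocycles C n \<Longrightarrow> w \<in> cocycles C n \<Longrightarrow> z \<otimes>\<^bsub>grp C n\<^esub> w \<in> cocycles C n"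
  using subgroup.m_closed[OF subgroup_cocycles] .

end

text \<open>The conditions under which a map acts on cohomology in one degree. Maps of complexes have them in all
  degrees, but the degreewise form suffices for \<open>cohomology_map\<close>.\<close>

definition cocycle_map :: "'c cochain_complex \<Rightarrow> 'd cochain_complex \<Rightarrow> nat \<Rightarrow> ('c \<Rightarrow> 'd) \<Rightarrow> bool" where
  "cocycle_map C C' n f \<longleftrightarrow> f \<in> hom ((grp C n)\<lparr>carrier := cocycles C n\<rparr>) ((grp C' n)\<lparr>carrier := cocycles C' n\<rparr>)
    \<and> f ` coboundaries C n \<subseteq> coboundaries C' n"

locale cochain_cx_pair = C: cochain_cx C + C': cochain_cx C'
  for C :: "'c cochain_complex" and C' :: "'d cochain_complex"
begin

lemma cohomology_map_cls:
  assumes f: "cocycle_map C C' n f" and z: "z \<in> cocycles C n"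
  shows "cohomology_map C' n f (C.cls n z) = C'.cls n (f z)"
proof -
  interpret G: group "grp C' n" by (rule C'.grp_group)
  interpret B: subgroup "coboundaries C' n" "grp C' n" by (rule C'.subgroup_coboundaries)
  have fc: "f y \<in> carrier (grp C' n)" if "y \<in> cocycles C n" for y
    using f that by (auto simp: cocycle_map_def hom_def C'.cocycles_iff)
  have B: "f b \<in> coboundaries C' n" if "b \<in> coboundaries C n" for b
    using f that by (auto simp: cocycle_map_def)
  have m: "f (b \<otimes>\<^bsub>grp C n\<^esub> z) = f b \<otimes>\<^bsub>grp C' n\<^esub> f z" if "b \<in> coboundaries C n" for b
    using f z that C.coboundaries_cocycles[of n] by (auto simp: cocycle_map_def hom_def)
  have one: "\<one>\<^bsub>grp C n\<^esub> \<in> coboundaries C n"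
    using subgroup.one_closed[OF C.subgroup_coboundaries] .
  have f1: "f \<one>\<^bsub>grp C n\<^esub> \<in> coboundaries C' n" by (rule B[OF one])
  show ?thesis
  proof
    show "cohomology_map C' n f (C.cls n z) \<subseteq> C'.cls n (f z)"
      using z m B fc by (auto simp: cohomology_map_def C.cls_def C'.cls_def r_coset_def set_mult_def
        simp flip: G.m_assoc intro!: B.m_closed)
    \<comment> \<open>The product defining the map only contains \<open>f z\<close> up to the coboundary \<open>f 1\<close>, which is divided out.\<close>
    show "C'.cls n (f z) \<subseteq> cohomology_map C' n f (C.cls n z)"
    proof
      fix x assume "x \<in> C'.cls n (f z)"
      then obtain b where b: "b \<in> coboundaries C' n" "x = b \<otimes>\<^bsub>grp C' n\<^esub> f z"
        by (auto simp: C'.cls_def r_coset_def)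
      have "x = (b \<otimes>\<^bsub>grp C' n\<^esub> inv\<^bsub>grp C' n\<^esub> (f \<one>\<^bsub>grp C n\<^esub>)) \<otimes>\<^bsub>grp C' n\<^esub> f (\<one>\<^bsub>grp C n\<^esub> \<otimes>\<^bsub>grp C n\<^esub> z)"
        unfolding m[OF one] b(2) using fc[OF z] f1 b(1)
        by (simp add: G.m_assoc) (metis B.mem_carrier G.inv_closed G.l_inv G.m_assoc G.l_one)
      moreover have "b \<otimes>\<^bsub>grp C' n\<^esub> inv\<^bsub>grp C' n\<^esub> (f \<one>\<^bsub>grp C n\<^esub>) \<in> coboundaries C' n"
        using b f1 by simp
      ultimately show "x \<in> cohomology_map C' n f (C.cls n z)"
        using one by (auto simp: cohomology_map_def C.cls_def r_coset_def set_mult_def)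
    qed
  qed
qed

lemma cohomology_map_hom:
  assumes f: "cocycle_map C C' n f"
  shows "cohomology_map C' n f \<in> hom (cohomology C n) (cohomology C' n)"
proof (rule homI)
  have fc: "f y \<in> cocycles C' n" if "y \<in> cocycles C n" for y
    using f that by (auto simp: cocycle_map_def hom_def)
  have fm: "f (y \<otimes>\<^bsub>grp C n\<^esub> z) = f y \<otimes>\<^bsub>grp C' n\<^esub> f z" if "y \<in> cocycles C n" "z \<in> cocycles C n" for y z
    using f that by (auto simp: cocycle_map_def hom_def)
  show "cohomology_map C' n f x \<in> carrier (cohomology C' n)" if "x \<in> carrier (cohomology C n)" for x
    using that fc by (auto simp: C.carrier_cohomology C'.carrier_cohomology cohomology_map_cls[OF f])
  show "cohomology_map C' n f (x \<otimes>\<^bsub>cohomology C n\<^esub> y) =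
      cohomology_map C' n f x \<otimes>\<^bsub>cohomology C' n\<^esub> cohomology_map C' n f y"
    if "x \<in> carrier (cohomology C n)" "y \<in> carrier (cohomology C n)" for x y
    using that fc fm by (auto simp: C.carrier_cohomology cohomology_map_cls[OF f] C.cls_mult C'.cls_mult
      C.cocycles_mult)
qed

end

lemma cocycle_mapI:
  assumes "cochain_cx C" "cochain_cx C'"
    and hom: "\<And>n. f n \<in> hom (grp C n) (grp C' n)"
    and comm: "\<And>n c. c \<in> carrier (grp C n) \<Longrightarrow> f (Suc n) (diff C n c) = diff C' n (f n c)"
  shows "cocycle_map C C' n (f n)"
proof -
  interpret C: cochain_cx C by fact
  interpret C': cochain_cx C' by fact
  have one: "f n \<one>\<^bsub>grp C n\<^esub> = \<one>\<^bsub>grp C' n\<^esub>" for n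
    using hom_one[OF hom C.grp_group C'.grp_group] .
  have "f n z \<in> cocycles C' n" if "z \<in> cocycles C n" for z
    using that one[of "Suc n"] comm[of z n] hom_in_carrier[OF hom] by (auto simp: C.cocycles_iff C'.cocycles_iff)
  moreover have "f n ` coboundaries C n \<subseteq> coboundaries C' n"
  proof (cases n)
    case 0
    then show ?thesis using one[of 0] by simp
  next
    case (Suc m)
    then show ?thesis
      using comm[of _ m] hom_in_carrier[OF hom] by fastforce
  qed
  ultimately show ?thesis
    using hom_mult[OF hom] by (auto simp: cocycle_map_def C.cocycles_iff intro!: homI)
qed

lemma subcomplex_cochain_cx:
  assumes "cochain_cx C" and S: "\<And>n. subgroup (S n) (grp C n)"
    and d: "\<And>n f. f \<in> S n \<Longrightarrow> diff C n f \<in> S (Suc n)"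
  shows "cochain_cx \<lparr>grp = (\<lambda>n. (grp C n)\<lparr>carrier := S n\<rparr>), diff = diff C\<rparr>"
proof -
  interpret cochain_cx C by fact
  have Sc: "f \<in> carrier (grp C n)" if "f \<in> S n" for f n
    using subgroup.mem_carrier[OF S that] .
  show ?thesis
  proof (rule cochain_cx.intro)
    show "comm_group (grp \<lparr>grp = (\<lambda>n. (grp C n)\<lparr>carrier := S n\<rparr>), diff = diff C\<rparr> n)" for n
      using comm_group_subgroup[OF comm_grp S] by simp
  qed (auto intro!: homI simp: d Sc hom_mult[OF diff_hom] diff_diff)
qed

subsection \<open>Function complexes of semisimplicial sets\<close>

text \<open>The boundary of a generator, for any face maps. It is \<open>chain_boundary\<close> for singular simplices.\<close>

definition bd :: "(nat \<Rightarrow> nat \<Rightarrow> 's \<Rightarrow> 's) \<Rightarrow> nat \<Rightarrow> 's \<Rightarrow> ('s \<Rightarrow>\<^sub>0 int)" where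
  "bd face n s = (\<Sum>k\<le>n. frag_cmul ((- 1) ^ k) (frag_of (face n k s)))"

text \<open>The simplicial identities enter only through \<open>bd_bd\<close>. In this form it is a
  statement about chains, which for singular simplices is the vanishing of the square of \<open>chain_boundary\<close>.\<close>

locale semisimplicial =
  fixes D :: "nat \<Rightarrow> 's set" and face :: "nat \<Rightarrow> nat \<Rightarrow> 's \<Rightarrow> 's"
  assumes face_in: "s \<in> D (Suc n) \<Longrightarrow> k \<le> Suc n \<Longrightarrow> face (Suc n) k s \<in> D n"
    and bd_bd: "s \<in> D (Suc (Suc n)) \<Longrightarrow> frag_extend (bd face (Suc n)) (bd face (Suc (Suc n)) s) = 0"
begin

lemma keys_bd: "s \<in> D (Suc n) \<Longrightarrow> Poly_Mapping.keys (bd face (Suc n) s) \<subseteq> D n"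
  unfolding bd_def by (rule order_trans[OF keys_sum]) (auto simp: face_in)

end

text \<open>The usual cancellation: the pairs \<open>(x, i)\<close> with \<open>i < x\<close> are matched with those with \<open>x \<le> i\<close> by
  \<open>(x, i) \<mapsto> (i, x - 1)\<close>, and the signs of partners are opposite.\<close>

lemma bd_bd_eq_0:
  assumes "\<And>i j. i \<le> j \<Longrightarrow> j \<le> Suc n \<Longrightarrow>
    face (Suc n) i (face (Suc (Suc n)) (Suc j) s) = face (Suc n) j (face (Suc (Suc n)) i s)"
  shows "frag_extend (bd face (Suc n)) (bd face (Suc (Suc n)) s) = 0"
proof -
  let ?p = "Suc (Suc n)"
  define t where "t = (\<lambda>(x, i). frag_cmul ((- 1) ^ (x + i)) (frag_of (face (Suc n) i (face ?p x s))))"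
  have "frag_extend (bd face (Suc n)) (bd face ?p s) = (\<Sum>x\<le>?p. \<Sum>i\<le>Suc n. t (x, i))"
    by (simp add: bd_def[of face "?p"] frag_extend_sum frag_extend_cmul o_def bd_def[of face "Suc n"]
      frag_cmul_sum t_def power_add del: sum.atMost_Suc)
  also have "\<dots> = sum t ({..?p} \<times> {..Suc n})"
    unfolding sum.cartesian_product by simp
  also have "\<dots> = sum t {(x, i). i < x \<and> x \<le> ?p} + sum t {(x, i). x \<le> i \<and> i \<le> Suc n}"
  proof -
    have *: "{..?p} \<times> {..Suc n} = {(x, i). i < x \<and> x \<le> ?p} \<union> {(x, i). x \<le> i \<and> i \<le> Suc n}" by auto
    have "finite {(x :: nat, i). i < x \<and> x \<le> ?p}"
      by (rule finite_subset[of _ "{..?p} \<times> {..?p}"]) auto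
    moreover have "finite {(x, i). x \<le> i \<and> i \<le> Suc n}"
      by (rule finite_subset[of _ "{..?p} \<times> {..?p}"]) auto
    ultimately show ?thesis
      unfolding * by (rule sum.union_disjoint) auto
  qed
  also have "sum t {(x, i). i < x \<and> x \<le> ?p} = (\<Sum>p\<in>{(x, i). x \<le> i \<and> i \<le> Suc n}. t (Suc (snd p), fst p))"
    by (rule sum.reindex_bij_witness[of _ "\<lambda>(x, i). (Suc i, x)" "\<lambda>(x, i). (i, x - 1)"]) auto
  also have "\<dots> = (\<Sum>p\<in>{(x, i). x \<le> i \<and> i \<le> Suc n}. - t p)"
    by (intro sum.cong refl) (auto simp: t_def assms add.commute)
  finally show ?thesis by (simp add: sum_negf)
qed

context
  fixes V :: "'v monoid"
  assumes V: "comm_group V"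
begin

interpretation comm_group V by (rule V)

lemma diff_function_complex:
  assumes "semisimplicial D face" "f \<in> D n \<rightarrow> carrier V"
  shows "diff (function_complex V D face) n f = (\<lambda>s\<in>D (Suc n). frag_eval V f (bd face (Suc n) s))"
proof -
  interpret semisimplicial D face by fact
  show ?thesis
    unfolding function_complex_def using assms(2) face_in
    by (auto simp: fun_eq_iff bd_def restrict_def Pi_iff simp del: sum.atMost_Suc finprod_Suc
      intro!: frag_eval_alternating_sum[symmetric])
qed

lemma cochain_cx_function_complex:
  assumes "semisimplicial D face"
  shows "cochain_cx (function_complex V D face)"
proof (rule cochain_cx.intro)
  interpret semisimplicial D face by fact
  let ?C = "function_complex V D face"
  have carr: "carrier (grp ?C n) = (D n \<rightarrow>\<^sub>E carrier V)" for n
    by (simp add: function_complex_def)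
  note d = diff_function_complex[OF assms]
  show "comm_group (grp ?C n)" for n
    using m_comm by (auto simp: function_complex_def PiE_iff fun_eq_iff intro!: group.group_comm_groupI)
  show "diff ?C n \<in> hom (grp ?C n) (grp ?C (Suc n))" for n
  proof (rule homI)
    show "diff ?C n f \<in> carrier (grp ?C (Suc n))" if "f \<in> carrier (grp ?C n)" for f
      using that by (simp add: carr d PiE_iff)
    show "diff ?C n (f \<otimes>\<^bsub>grp ?C n\<^esub> g) = diff ?C n f \<otimes>\<^bsub>grp ?C (Suc n)\<^esub> diff ?C n g"
      if "f \<in> carrier (grp ?C n)" "g \<in> carrier (grp ?C n)" for f g
    proof -
      have fg: "f \<in> D n \<rightarrow> carrier V" "g \<in> D n \<rightarrow> carrier V" using that by (auto simp: carr PiE_iff)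
      have "frag_eval V (\<lambda>s\<in>D n. f s \<otimes>\<^bsub>V\<^esub> g s) (bd face (Suc n) s) =
          frag_eval V f (bd face (Suc n) s) \<otimes>\<^bsub>V\<^esub> frag_eval V g (bd face (Suc n) s)" if "s \<in> D (Suc n)" for s
        using keys_bd[OF that] fg
        by (subst frag_eval_mult[symmetric]) (auto intro!: frag_eval_cong)
      moreover have "(\<lambda>s\<in>D n. f s \<otimes>\<^bsub>V\<^esub> g s) \<in> D n \<rightarrow> carrier V" using fg by auto
      ultimately show ?thesis
        using fg by (simp add: function_complex_def[THEN arg_cong[of _ _ grp]] d fun_eq_iff)
    qed
  qed
  show "diff ?C (Suc n) (diff ?C n f) = \<one>\<^bsub>grp ?C (Suc (Suc n))\<^esub>" if "f \<in> carrier (grp ?C n)" for n f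
  proof -
    have f: "f \<in> D n \<rightarrow> carrier V" using that by (auto simp: carr PiE_iff)
    have "frag_eval V (\<lambda>s\<in>D (Suc n). frag_eval V f (bd face (Suc n) s)) (bd face (Suc (Suc n)) s) = \<one>\<^bsub>V\<^esub>"
      if s: "s \<in> D (Suc (Suc n))" for s
    proof -
      have "frag_eval V (\<lambda>s\<in>D (Suc n). frag_eval V f (bd face (Suc n) s)) (bd face (Suc (Suc n)) s)
        = frag_eval V f (frag_extend (bd face (Suc n)) (bd face (Suc (Suc n)) s))"
        unfolding frag_eval_extend using keys_bd[OF s] by (intro frag_eval_cong) auto
      then show ?thesis by (simp add: bd_bd[OF s])
    qed
    moreover have "(\<lambda>s\<in>D (Suc n). frag_eval V f (bd face (Suc n) s)) \<in> D (Suc n) \<rightarrow> carrier V" by auto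
    ultimately show ?thesis
      by (simp add: d f function_complex_def[THEN arg_cong[of _ _ grp]] fun_eq_iff)
  qed
qed

end

section \<open>Directed colimits\<close>

text \<open>\<open>pre i j\<close> means that \<open>j\<close> is further along; for neighbourhoods it is reverse inclusion.\<close>

locale directed_system =
  fixes I :: "'i set" and pre :: "'i \<Rightarrow> 'i \<Rightarrow> bool" and H :: "'i \<Rightarrow> 'a monoid" and r :: "'i \<Rightarrow> 'i \<Rightarrow> 'a \<Rightarrow> 'a"
  assumes nonempty: "I \<noteq> {}"
    and upper: "i \<in> I \<Longrightarrow> j \<in> I \<Longrightarrow> \<exists>k\<in>I. pre i k \<and> pre j k"
    and pre_refl: "i \<in> I \<Longrightarrow> pre i i"
    and pre_trans: "pre i j \<Longrightarrow> pre j k \<Longrightarrow> pre i k"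
    and grp: "i \<in> I \<Longrightarrow> group (H i)"
    and r_hom: "i \<in> I \<Longrightarrow> j \<in> I \<Longrightarrow> pre i j \<Longrightarrow> r i j \<in> hom (H i) (H j)"
    and r_refl: "i \<in> I \<Longrightarrow> a \<in> carrier (H i) \<Longrightarrow> r i i a = a"
    and r_trans: "i \<in> I \<Longrightarrow> j \<in> I \<Longrightarrow> k \<in> I \<Longrightarrow> pre i j \<Longrightarrow> pre j k \<Longrightarrow> a \<in> carrier (H i) \<Longrightarrow>
      r j k (r i j a) = r i k a"
begin

abbreviation "R \<equiv> colim_rel I pre H r"
abbreviation "S \<equiv> SIGMA i:I. carrier (H i)"

lemma r_in: "i \<in> I \<Longrightarrow> j \<in> I \<Longrightarrow> pre i j \<Longrightarrow> a \<in> carrier (H i) \<Longrightarrow> r i j a \<in> carrier (H j)"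
  using r_hom hom_in_carrier by metis

lemma equiv_R: "equiv S R"
proof (rule equivI)
  show "refl_on S R"
    using pre_refl by (auto simp: refl_on_def colim_rel_def)
  show "sym R"
    unfolding sym_def colim_rel_def by fastforce
  show "R \<subseteq> S \<times> S" by (auto simp: colim_rel_def)
  show "trans R"
  proof (rule transI, clarify)
    fix i a j b k c
    assume "((i, a), (j, b)) \<in> R" "((j, b), (k, c)) \<in> R"
    then obtain m n where *: "i \<in> I" "a \<in> carrier (H i)" "j \<in> I" "b \<in> carrier (H j)" "k \<in> I" "c \<in> carrier (H k)"
      "m \<in> I" "pre i m" "pre j m" "r i m a = r j m b" "n \<in> I" "pre j n" "pre k n" "r j n b = r k n c"
      by (auto simp: colim_rel_def)
    obtain l where l: "l \<in> I" "pre m l" "pre n l" using upper * by blast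
    have "r i l a = r m l (r i m a)" "r m l (r j m b) = r j l b" "r j l b = r n l (r j n b)"
      "r n l (r k n c) = r k l c"
      using r_trans[OF *(1,7) l(1) *(8) l(2) *(2)] r_trans[OF *(3,7) l(1) *(9) l(2) *(4)]
        r_trans[OF *(3,11) l(1) *(12) l(3) *(4)] r_trans[OF *(5,11) l(1) *(13) l(3) *(6)] by simp_all
    then have "r i l a = r k l c"
      using * by simp
    moreover have "pre i l" "pre k l" using * l pre_trans by blast+
    ultimately show "((i, a), (k, c)) \<in> R"
      using * l(1) by (auto simp: colim_rel_def)
  qed
qed

definition q :: "'i \<Rightarrow> 'a \<Rightarrow> ('i \<times> 'a) set" where "q i a = R `` {(i, a)}"

lemma q_eq_iff: "i \<in> I \<Longrightarrow> a \<in> carrier (H i) \<Longrightarrow> j \<in> I \<Longrightarrow> b \<in> carrier (H j) \<Longrightarrow>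
    q i a = q j b \<longleftrightarrow> ((i, a), (j, b)) \<in> R"
  unfolding q_def using eq_equiv_class_iff[OF equiv_R] by auto

lemma q_r: "i \<in> I \<Longrightarrow> a \<in> carrier (H i) \<Longrightarrow> k \<in> I \<Longrightarrow> pre i k \<Longrightarrow> q k (r i k a) = q i a"
  by (subst q_eq_iff) (auto simp: r_in colim_rel_def pre_refl r_refl intro!: bexI[of _ k])

lemma mem_q: "p \<in> q i a \<Longrightarrow> \<exists>j b. p = (j, b) \<and> j \<in> I \<and> b \<in> carrier (H j) \<and> q j b = q i a"
proof -
  assume "p \<in> q i a"
  then have pR: "((i, a), p) \<in> R" by (simp add: q_def)
  obtain j b where p: "p = (j, b)" by (cases p)
  have "j \<in> I" "b \<in> carrier (H j)" using pR by (auto simp: p colim_rel_def)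
  moreover have "q j b = q i a"
    unfolding q_def using equiv_class_eq[OF equiv_R pR] by (simp add: p)
  ultimately show ?thesis using p by blast
qed

lemma mem_qD: "(j, b) \<in> q i a \<Longrightarrow> j \<in> I \<and> b \<in> carrier (H j) \<and> (\<exists>k\<in>I. pre i k \<and> pre j k \<and> r i k a = r j k b)"
  by (auto simp: q_def colim_rel_def)

lemma q_self: "i \<in> I \<Longrightarrow> a \<in> carrier (H i) \<Longrightarrow> (i, a) \<in> q i a"
  unfolding q_def using equiv_class_self[OF equiv_R] by auto

lemma carrier_colim: "carrier (colim I pre H r) = {q i a |i a. i \<in> I \<and> a \<in> carrier (H i)}"
  unfolding colim_def quotient_def q_def by auto

text \<open>Any common index computes the product: two choices, and two choices of representatives, become equal at
  some index beyond all of them.\<close>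

lemma mult_colim:
  assumes "i \<in> I" "a \<in> carrier (H i)" "j \<in> I" "b \<in> carrier (H j)" "k \<in> I" "pre i k" "pre j k"
  shows "q i a \<otimes>\<^bsub>colim I pre H r\<^esub> q j b = q k (r i k a \<otimes>\<^bsub>H k\<^esub> r j k b)"
proof -
  let ?F = "{q k (r i' k a' \<otimes>\<^bsub>H k\<^esub> r j' k b') |i' a' j' b' k.
        (i', a') \<in> q i a \<and> (j', b') \<in> q j b \<and> k \<in> I \<and> pre i' k \<and> pre j' k}"
  have "x = q k (r i k a \<otimes>\<^bsub>H k\<^esub> r j k b)" if "x \<in> ?F" for x
  proof -
    from that obtain i' a' j' b' l where
      x: "x = q l (r i' l a' \<otimes>\<^bsub>H l\<^esub> r j' l b')" and
      *: "(i', a') \<in> q i a" "(j', b') \<in> q j b" "l \<in> I" "pre i' l" "pre j' l" by blast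
    have i': "i' \<in> I" "a' \<in> carrier (H i')" "j' \<in> I" "b' \<in> carrier (H j')"
      using mem_q[OF *(1)] mem_q[OF *(2)] by auto
    obtain m n where m: "m \<in> I" "pre i' m" "pre i m" "r i' m a' = r i m a"
      and n: "n \<in> I" "pre j' n" "pre j n" "r j' n b' = r j n b"
      using mem_qD[OF *(1)] mem_qD[OF *(2)] by auto
    obtain o1 where o1: "o1 \<in> I" "pre m o1" "pre n o1" using upper m n by blast
    obtain o2 where o2: "o2 \<in> I" "pre l o2" "pre k o2" using upper *(3) assms by blast
    obtain u where u: "u \<in> I" "pre o1 u" "pre o2 u" using upper o1 o2 by blast
    have p: "pre m u" "pre n u" "pre l u" "pre k u" using o1 o2 u pre_trans by blast+
    have "r i' u a' = r m u (r i' m a')" "r m u (r i m a) = r i u a"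
      "r j' u b' = r n u (r j' n b')" "r n u (r j n b) = r j u b"
      using r_trans[OF i'(1) m(1) u(1) m(2) p(1) i'(2)] r_trans[OF assms(1) m(1) u(1) m(3) p(1) assms(2)]
        r_trans[OF i'(3) n(1) u(1) n(2) p(2) i'(4)] r_trans[OF assms(3) n(1) u(1) n(3) p(2) assms(4)]
      by simp_all
    then have a: "r i' u a' = r i u a" and b: "r j' u b' = r j u b" using m n by simp_all
    have "x = q u (r l u (r i' l a' \<otimes>\<^bsub>H l\<^esub> r j' l b'))"
      unfolding x using *(3-5) i' p u(1) group.is_monoid[OF grp]
      by (intro q_r[symmetric]) (auto intro!: monoid.m_closed r_in)
    also have "r l u (r i' l a' \<otimes>\<^bsub>H l\<^esub> r j' l b') = r i' u a' \<otimes>\<^bsub>H u\<^esub> r j' u b'"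
      using *(3-5) i' p u(1) by (simp add: hom_mult[OF r_hom] r_in r_trans)
    also have "\<dots> = r k u (r i k a \<otimes>\<^bsub>H k\<^esub> r j k b)"
      unfolding a b using assms p u(1) by (simp add: hom_mult[OF r_hom] r_in r_trans)
    also have "q u \<dots> = q k (r i k a \<otimes>\<^bsub>H k\<^esub> r j k b)"
      using assms p u(1) group.is_monoid[OF grp]
      by (intro q_r) (auto intro!: monoid.m_closed r_in)
    finally show ?thesis .
  qed
  moreover have "q k (r i k a \<otimes>\<^bsub>H k\<^esub> r j k b) \<in> ?F"
    using assms q_self by blast
  ultimately have "?F = {q k (r i k a \<otimes>\<^bsub>H k\<^esub> r j k b)}" by blast
  moreover have "q i a \<otimes>\<^bsub>colim I pre H r\<^esub> q j b = \<Union>?F"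
    unfolding colim_def q_def by simp
  ultimately show ?thesis by simp
qed

lemma colim_mult_obtain:
  assumes "x \<in> carrier (colim I pre H r)" "y \<in> carrier (colim I pre H r)"
  obtains k a b where "k \<in> I" "a \<in> carrier (H k)" "b \<in> carrier (H k)" "x = q k a" "y = q k b"
    "x \<otimes>\<^bsub>colim I pre H r\<^esub> y = q k (a \<otimes>\<^bsub>H k\<^esub> b)"
proof -
  obtain i a j b where *: "i \<in> I" "a \<in> carrier (H i)" "j \<in> I" "b \<in> carrier (H j)" "x = q i a" "y = q j b"
    using assms unfolding carrier_colim by blast
  obtain k where k: "k \<in> I" "pre i k" "pre j k" using upper * by blast
  show thesis
    using * k by (intro that[of k "r i k a" "r j k b"]) (auto simp: r_in q_r mult_colim)
qed

lemma colim_desc_q: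
  assumes f: "\<And>i j a. i \<in> I \<Longrightarrow> j \<in> I \<Longrightarrow> pre i j \<Longrightarrow> a \<in> carrier (H i) \<Longrightarrow> f j (r i j a) = f i a"
    and "i \<in> I" "a \<in> carrier (H i)"
  shows "colim_desc f (q i a) = f i a"
proof -
  have "f j b = f i a" if jb: "(j, b) \<in> q i a" for j b
  proof -
    obtain k where k: "j \<in> I" "b \<in> carrier (H j)" "k \<in> I" "pre j k" "pre i k" "r j k b = r i k a"
      using mem_qD[OF jb] by auto
    show ?thesis using f[OF k(1,3,4,2)] f[OF assms(2) k(3,5) assms(3)] k(6) by simp
  qed
  then have "(\<lambda>(i, a). f i a) ` q i a \<subseteq> {f i a}" by auto
  moreover have "f i a \<in> (\<lambda>(i, a). f i a) ` q i a"
    using q_self[OF assms(2,3)] by (rule rev_image_eqI) simp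
  ultimately have "(\<lambda>(i, a). f i a) ` q i a = {f i a}" by blast
  then show ?thesis by (simp add: colim_desc_def)
qed

text \<open>A compatible family of homomorphisms induces an isomorphism if it is jointly surjective and if two
  elements with the same image already agree at a later index.\<close>

theorem colim_desc_iso:
  assumes f: "\<And>i j a. i \<in> I \<Longrightarrow> j \<in> I \<Longrightarrow> pre i j \<Longrightarrow> a \<in> carrier (H i) \<Longrightarrow> f j (r i j a) = f i a"
    and hom: "\<And>i. i \<in> I \<Longrightarrow> f i \<in> hom (H i) K"
    and surj: "\<And>y. y \<in> carrier K \<Longrightarrow> \<exists>i\<in>I. \<exists>a\<in>carrier (H i). f i a = y"
    and inj: "\<And>i a b. i \<in> I \<Longrightarrow> a \<in> carrier (H i) \<Longrightarrow> b \<in> carrier (H i) \<Longrightarrow> f i a = f i b \<Longrightarrow>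
      \<exists>j\<in>I. pre i j \<and> r i j a = r i j b"
  shows "colim_desc f \<in> iso (colim I pre H r) K"
proof (rule isoI)
  note dq = colim_desc_q[where f = f, OF f]
  show "colim_desc f \<in> hom (colim I pre H r) K"
  proof (rule homI)
    show "colim_desc f x \<in> carrier K" if "x \<in> carrier (colim I pre H r)" for x
      using that dq hom_in_carrier[OF hom] by (auto simp: carrier_colim)
    show "colim_desc f (x \<otimes>\<^bsub>colim I pre H r\<^esub> y) = colim_desc f x \<otimes>\<^bsub>K\<^esub> colim_desc f y"
      if xy: "x \<in> carrier (colim I pre H r)" "y \<in> carrier (colim I pre H r)" for x y
      by (rule colim_mult_obtain[OF xy])
        (auto simp: dq hom_mult[OF hom] monoid.m_closed[OF group.is_monoid[OF grp]])
  qed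
  show "bij_betw (colim_desc f) (carrier (colim I pre H r)) (carrier K)"
  proof (rule bij_betw_imageI)
    show "inj_on (colim_desc f) (carrier (colim I pre H r))"
    proof (rule inj_onI)
      fix x y assume xy: "x \<in> carrier (colim I pre H r)" "y \<in> carrier (colim I pre H r)"
        and eq: "colim_desc f x = colim_desc f y"
      obtain k a b where k: "k \<in> I" "a \<in> carrier (H k)" "b \<in> carrier (H k)" "x = q k a" "y = q k b"
        by (rule colim_mult_obtain[OF xy])
      then obtain j where "j \<in> I" "pre k j" "r k j a = r k j b"
        using inj[of k a b] eq dq by auto
      then show "x = y" using k q_r by metis
    qed
    show "colim_desc f ` carrier (colim I pre H r) = carrier K"
    proof
      show "colim_desc f ` carrier (colim I pre H r) \<subseteq> carrier K"
        using dq hom_in_carrier[OF hom] by (auto simp: carrier_colim)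
      show "carrier K \<subseteq> colim_desc f ` carrier (colim I pre H r)"
      proof
        fix y assume "y \<in> carrier K"
        then obtain i a where ia: "i \<in> I" "a \<in> carrier (H i)" "f i a = y" using surj by blast
        then have "y = colim_desc f (q i a)" using dq by simp
        moreover have "q i a \<in> carrier (colim I pre H r)" using ia carrier_colim by blast
        ultimately show "y \<in> colim_desc f ` carrier (colim I pre H r)" by blast
      qed
    qed
  qed
qed

end

locale directed_system_pair = A: directed_system I pre H r + B: directed_system I pre H' r'
  for I :: "'i set" and pre and H :: "'i \<Rightarrow> 'a monoid" and r and H' :: "'i \<Rightarrow> 'b monoid" and r'
begin

lemma colim_map_q:
  assumes g: "\<And>i j a. i \<in> I \<Longrightarrow> j \<in> I \<Longrightarrow> pre i j \<Longrightarrow> a \<in> carrier (H i) \<Longrightarrow> g j (r i j a) = r' i j (g i a)"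
    and hom: "\<And>i. i \<in> I \<Longrightarrow> g i \<in> hom (H i) (H' i)"
    and "i \<in> I" "a \<in> carrier (H i)"
  shows "colim_map B.R g (A.q i a) = B.q i (g i a)"
proof -
  have "B.q j (g j b) = B.q i (g i a)" if jb: "(j, b) \<in> A.q i a" for j b
  proof -
    obtain k where j: "j \<in> I" "b \<in> carrier (H j)" and k: "k \<in> I" "pre j k" "pre i k" "r j k b = r i k a"
      using A.mem_qD[OF jb] by auto
    have "B.q j (g j b) = B.q k (r' j k (g j b))"
      using j k by (intro B.q_r[symmetric]) (auto simp: hom_in_carrier[OF hom])
    also have "\<dots> = B.q k (r' i k (g i a))"
      using g[OF j(1) k(1,2) j(2)] g[OF assms(3) k(1,3) assms(4)] k(4) by simp
    also have "\<dots> = B.q i (g i a)"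
      using assms(3,4) k by (intro B.q_r) (auto simp: hom_in_carrier[OF hom])
    finally show ?thesis .
  qed
  then have "(\<lambda>(j, b). B.q j (g j b)) ` A.q i a \<subseteq> {B.q i (g i a)}" by auto
  moreover have "B.q i (g i a) \<in> (\<lambda>(j, b). B.q j (g j b)) ` A.q i a"
    using A.q_self[OF assms(3,4)] by (rule rev_image_eqI) simp
  ultimately have "(\<lambda>(j, b). B.q j (g j b)) ` A.q i a = {B.q i (g i a)}" by blast
  moreover have "colim_map B.R g (A.q i a) = \<Union> ((\<lambda>(j, b). B.q j (g j b)) ` A.q i a)"
    unfolding colim_map_def B.q_def by auto
  ultimately show ?thesis by simp
qed

text \<open>Two out of three: \<open>colim_map g\<close> composed with the isomorphism induced by \<open>f'\<close> is the one induced by \<open>f\<close>.\<close>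

theorem colim_map_iso:
  assumes g: "\<And>i j a. i \<in> I \<Longrightarrow> j \<in> I \<Longrightarrow> pre i j \<Longrightarrow> a \<in> carrier (H i) \<Longrightarrow> g j (r i j a) = r' i j (g i a)"
    and hom: "\<And>i. i \<in> I \<Longrightarrow> g i \<in> hom (H i) (H' i)"
    and f: "\<And>i j a. i \<in> I \<Longrightarrow> j \<in> I \<Longrightarrow> pre i j \<Longrightarrow> a \<in> carrier (H i) \<Longrightarrow> f j (r i j a) = f i a"
    and f': "\<And>i j a. i \<in> I \<Longrightarrow> j \<in> I \<Longrightarrow> pre i j \<Longrightarrow> a \<in> carrier (H' i) \<Longrightarrow> f' j (r' i j a) = f' i a"
    and fg: "\<And>i a. i \<in> I \<Longrightarrow> a \<in> carrier (H i) \<Longrightarrow> f' i (g i a) = f i a"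
    and iso: "colim_desc f \<in> iso (colim I pre H r) K" and iso': "colim_desc f' \<in> iso (colim I pre H' r') K"
  shows "colim_map B.R g \<in> iso (colim I pre H r) (colim I pre H' r')"
proof (rule isoI)
  note gq = colim_map_q[where g = g, OF g hom]
  have gin: "g i a \<in> carrier (H' i)" if "i \<in> I" "a \<in> carrier (H i)" for i a
    using that hom_in_carrier[OF hom] by auto
  let ?A = "carrier (colim I pre H r)" and ?B = "carrier (colim I pre H' r')"
  have into: "colim_map B.R g x \<in> ?B" if "x \<in> ?A" for x
    using that gin by (auto simp: A.carrier_colim B.carrier_colim gq; blast)
  have comp: "colim_desc f' (colim_map B.R g x) = colim_desc f x" if "x \<in> ?A" for x
    using that gin by (auto simp: A.carrier_colim gq A.colim_desc_q[where f = f, OF f]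
      B.colim_desc_q[where f = f', OF f'] fg)
  show "colim_map B.R g \<in> hom (colim I pre H r) (colim I pre H' r')"
  proof (rule homI)
    show "colim_map B.R g x \<in> ?B" if "x \<in> ?A" for x using into[OF that] .
    show "colim_map B.R g (x \<otimes>\<^bsub>colim I pre H r\<^esub> y) =
        colim_map B.R g x \<otimes>\<^bsub>colim I pre H' r'\<^esub> colim_map B.R g y"
      if xy: "x \<in> ?A" "y \<in> ?A" for x y
    proof (rule A.colim_mult_obtain[OF xy])
      fix k a b assume *: "k \<in> I" "a \<in> carrier (H k)" "b \<in> carrier (H k)" "x = A.q k a" "y = A.q k b"
        "x \<otimes>\<^bsub>colim I pre H r\<^esub> y = A.q k (a \<otimes>\<^bsub>H k\<^esub> b)"
      then show ?thesis
        using monoid.m_closed[OF group.is_monoid[OF A.grp]] gin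
        by (simp add: gq hom_mult[OF hom] B.mult_colim[of k _ k _ k] B.pre_refl B.r_refl)
    qed
  qed
  have bij: "bij_betw (colim_desc f) ?A (carrier K)" "bij_betw (colim_desc f') ?B (carrier K)"
    using iso iso' by (auto simp: iso_def)
  have "bij_betw (colim_desc f' \<circ> colim_map B.R g) ?A (carrier K)"
    using bij(1) by (rule bij_betw_cong[THEN iffD1, rotated]) (simp add: comp)
  then show "bij_betw (colim_map B.R g) ?A ?B"
    using bij(2) into by (metis bij_betw_comp_iff2 image_subsetI)
qed

end

context cochain_cx_pair
begin

lemma cohomology_map_iso:
  assumes f: "cocycle_map C C' n f"
    and surj: "\<And>z. z \<in> cocycles C' n \<Longrightarrow> \<exists>y\<in>cocycles C n. C'.cls n (f y) = C'.cls n z"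
    and inj: "\<And>z. z \<in> cocycles C n \<Longrightarrow> f z \<in> coboundaries C' n \<Longrightarrow> z \<in> coboundaries C n"
  shows "cohomology_map C' n f \<in> iso (cohomology C n) (cohomology C' n)"
proof -
  interpret h: group_hom "cohomology C n" "cohomology C' n" "cohomology_map C' n f"
    using C.group_cohomology C'.group_cohomology cohomology_map_hom[OF f]
    by (simp add: group_hom_def group_hom_axioms_def)
  have fc: "f y \<in> cocycles C' n" if "y \<in> cocycles C n" for y
    using f that by (auto simp: cocycle_map_def hom_def)
  have "inj_on (cohomology_map C' n f) (carrier (cohomology C n))"
    unfolding h.inj_on_one_iff
  proof (intro allI impI)
    fix x assume x: "x \<in> carrier (cohomology C n)" "cohomology_map C' n f x = \<one>\<^bsub>cohomology C' n\<^esub>"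
    then obtain z where z: "z \<in> cocycles C n" "x = C.cls n z" by (auto simp: C.carrier_cohomology)
    interpret G: group "grp C n" by (rule C.grp_group)
    interpret G': group "grp C' n" by (rule C'.grp_group)
    have "C'.cls n (f z) = C'.cls n \<one>\<^bsub>grp C' n\<^esub>"
      using x(2) z by (simp add: cohomology_map_cls[OF f] C'.one_cohomology)
    then obtain b where "b \<in> coboundaries C' n" "f z = b \<otimes>\<^bsub>grp C' n\<^esub> \<one>\<^bsub>grp C' n\<^esub>"
      using C'.cls_eq_iff[OF fc[OF z(1)] subgroup.one_closed[OF C'.subgroup_cocycles]] by auto
    then have "f z \<in> coboundaries C' n"
      using subgroup.mem_carrier[OF C'.subgroup_coboundaries] by auto
    then have "z \<in> coboundaries C n" using inj z(1) by blast
    moreover have "z = z \<otimes>\<^bsub>grp C n\<^esub> \<one>\<^bsub>grp C n\<^esub>" using z(1) by (simp add: C.cocycles_iff)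
    ultimately show "x = \<one>\<^bsub>cohomology C n\<^esub>"
      unfolding z(2) C.one_cohomology
      using C.cls_eq_iff[OF z(1) subgroup.one_closed[OF C.subgroup_cocycles]] by blast
  qed
  moreover have "carrier (cohomology C' n) \<subseteq> cohomology_map C' n f ` carrier (cohomology C n)"
  proof
    fix x assume "x \<in> carrier (cohomology C' n)"
    then obtain z where z: "z \<in> cocycles C' n" "x = C'.cls n z" by (auto simp: C'.carrier_cohomology)
    then obtain y where y: "y \<in> cocycles C n" "C'.cls n (f y) = x" using surj by blast
    then have "x = cohomology_map C' n f (C.cls n y)" by (simp add: cohomology_map_cls[OF f])
    then show "x \<in> cohomology_map C' n f ` carrier (cohomology C n)" using y by blast
  qed
  ultimately show ?thesis
    using h.homh by (auto simp: iso_def bij_betw_def)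
qed

end

subsection \<open>Cochains as functions on simplices\<close>

locale function_cx = semisimplicial D face for D :: "nat \<Rightarrow> 's set" and face +
  fixes V :: "'v monoid"
  assumes V: "comm_group V"
begin

sublocale V: comm_group V by (rule V)

abbreviation "FC \<equiv> function_complex V D face"

sublocale FC: cochain_cx FC
  by (rule cochain_cx_function_complex[OF V semisimplicial_axioms])

lemma carrier_fc [simp]: "carrier (grp FC n) = (D n \<rightarrow>\<^sub>E carrier V)"
  by (simp add: function_complex_def)

lemma mult_fc [simp]: "f \<otimes>\<^bsub>grp FC n\<^esub> g = (\<lambda>s\<in>D n. f s \<otimes>\<^bsub>V\<^esub> g s)"
  by (simp add: function_complex_def)

lemma one_fc [simp]: "\<one>\<^bsub>grp FC n\<^esub> = (\<lambda>s\<in>D n. \<one>\<^bsub>V\<^esub>)"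
  by (simp add: function_complex_def)

lemma diff_fc: "f \<in> D n \<rightarrow> carrier V \<Longrightarrow> diff FC n f = (\<lambda>s\<in>D (Suc n). frag_eval V f (bd face (Suc n) s))"
  by (rule diff_function_complex[OF V semisimplicial_axioms])

lemma cocycles_fc: "f \<in> cocycles FC n \<longleftrightarrow>
    f \<in> D n \<rightarrow>\<^sub>E carrier V \<and> (\<forall>s\<in>D (Suc n). frag_eval V f (bd face (Suc n) s) = \<one>\<^bsub>V\<^esub>)"
  by (auto simp: FC.cocycles_iff diff_fc PiE_iff fun_eq_iff)

lemma cocycle_eval_bd:
  assumes "f \<in> cocycles FC n" "Poly_Mapping.keys c \<subseteq> D (Suc n)"
  shows "frag_eval V f (frag_extend (bd face (Suc n)) c) = \<one>\<^bsub>V\<^esub>"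
  unfolding V.frag_eval_extend using assms by (rule_tac V.frag_eval_one) (auto simp: cocycles_fc)

lemma coboundaries_fc: "f \<in> coboundaries FC (Suc n) \<longleftrightarrow>
    (\<exists>g\<in>D n \<rightarrow>\<^sub>E carrier V. f = (\<lambda>s\<in>D (Suc n). frag_eval V g (bd face (Suc n) s)))"
  using diff_fc[of _ n] by (auto simp: PiE_iff image_iff simp del: diff_fc)

lemma coboundary_eval:
  assumes "Poly_Mapping.keys c \<subseteq> D (Suc n)"
  shows "frag_eval V (\<lambda>s\<in>D (Suc n). frag_eval V g (bd face (Suc n) s)) c
    = frag_eval V g (frag_extend (bd face (Suc n)) c)"
  unfolding V.frag_eval_extend using assms by (intro V.frag_eval_cong) auto

lemma semisimplicial_subset:
  assumes "\<And>n. D' n \<subseteq> D n" "\<And>n k s. s \<in> D' (Suc n) \<Longrightarrow> k \<le> Suc n \<Longrightarrow> face (Suc n) k s \<in> D' n"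
  shows "function_cx D' face V"
proof (unfold_locales)
  show "frag_extend (bd face (Suc n)) (bd face (Suc (Suc n)) s) = 0" if "s \<in> D' (Suc (Suc n))" for s n
    using bd_bd assms(1) that by blast
qed (use assms in auto)

lemma restrict_diff:
  assumes "function_cx D' face V" "\<And>n. D' n \<subseteq> D n" "c \<in> carrier (grp FC n)"
  shows "restrict (diff FC n c) (D' (Suc n)) = diff (function_complex V D' face) n (restrict c (D' n))"
proof -
  interpret D': function_cx D' face V by fact
  have c: "c \<in> D n \<rightarrow> carrier V" "restrict c (D' n) \<in> D' n \<rightarrow> carrier V"
    using assms(3) assms(2)[of n] by (auto simp: PiE_iff)
  have "frag_eval V c (bd face (Suc n) s) = frag_eval V (restrict c (D' n)) (bd face (Suc n) s)"
    if "s \<in> D' (Suc n)" for s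
    using D'.keys_bd[OF that] by (intro V.frag_eval_cong) auto
  then show ?thesis
    using assms(2)[of "Suc n"] by (auto simp: diff_fc[OF c(1)] D'.diff_fc[OF c(2)] fun_eq_iff)
qed

lemma restrict_cocycle_map:
  assumes "function_cx D' face V" "\<And>n. D' n \<subseteq> D n"
  shows "cocycle_map FC (function_complex V D' face) n (\<lambda>f. restrict f (D' n))"
proof (rule cocycle_mapI[OF FC.cochain_cx_axioms])
  interpret D': function_cx D' face V by fact
  show "cochain_cx (function_complex V D' face)" by (rule D'.FC.cochain_cx_axioms)
  show "(\<lambda>f. restrict f (D' n)) \<in> hom (grp FC n) (grp (function_complex V D' face) n)" for n
    using assms(2)[of n] by (intro homI) (auto simp: PiE_iff fun_eq_iff)
qed (rule restrict_diff[OF assms])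

text \<open>A semisimplicial map \<open>v\<close> acts contravariantly on cochains.\<close>

lemma pullback_cocycle_map:
  assumes D': "function_cx D' face' V"
    and v: "\<And>n s. s \<in> D' n \<Longrightarrow> v n s \<in> D n"
    and face: "\<And>n k s. s \<in> D' (Suc n) \<Longrightarrow> k \<le> Suc n \<Longrightarrow> v n (face' (Suc n) k s) = face (Suc n) k (v (Suc n) s)"
  shows "cocycle_map FC (function_complex V D' face') n (\<lambda>f. \<lambda>s\<in>D' n. f (v n s))"
proof (rule cocycle_mapI[OF FC.cochain_cx_axioms])
  interpret D': function_cx D' face' V by (rule D')
  show "cochain_cx D'.FC" by (rule D'.FC.cochain_cx_axioms)
  show "(\<lambda>f. \<lambda>s\<in>D' n. f (v n s)) \<in> hom (grp FC n) (grp D'.FC n)" for n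
    using v by (intro homI) (auto simp: PiE_iff fun_eq_iff)
  show "(\<lambda>s\<in>D' (Suc n). diff FC n c (v (Suc n) s)) = diff D'.FC n (\<lambda>s\<in>D' n. c (v n s))"
    if "c \<in> carrier (grp FC n)" for n c
  proof -
    have c: "c \<in> D n \<rightarrow> carrier V" using that by (auto simp: PiE_iff)
    then have c': "(\<lambda>s\<in>D' n. c (v n s)) \<in> D' n \<rightarrow> carrier V" using v by auto
    have "frag_eval V c (bd face (Suc n) (v (Suc n) s)) = frag_eval V (\<lambda>s\<in>D' n. c (v n s)) (bd face' (Suc n) s)"
      if s: "s \<in> D' (Suc n)" for s
    proof -
      have "bd face (Suc n) (v (Suc n) s) = frag_extend (\<lambda>s. frag_of (v n s)) (bd face' (Suc n) s)"
        using face[OF s] by (simp add: bd_def frag_extend_sum o_def frag_extend_cmul del: sum.atMost_Suc)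
      moreover have "frag_eval V c (frag_of (v n x)) = c (v n x)" if "x \<in> D' n" for x
        using c v[OF that] by (intro V.frag_eval_of) blast
      ultimately show ?thesis
        using D'.keys_bd[OF s]
        by (simp only: V.frag_eval_extend) (intro V.frag_eval_cong, auto)
    qed
    then show ?thesis
      using v[of _ "Suc n"] by (auto simp: diff_fc[OF c] D'.diff_fc[OF c'] fun_eq_iff)
  qed
qed

end

section \<open>Small singular simplices\<close>

lemma bd_singular_face: "bd singular_face (Suc n) s = chain_boundary (Suc n) (frag_of s)"
  by (simp add: bd_def chain_boundary_of del: sum.atMost_Suc)

lemma frag_extend_bd_singular:
  fixes c :: "'a chain"
  shows "frag_extend (bd singular_face (Suc n)) c = chain_boundary (Suc n) c"
proof -
  have "bd singular_face (Suc n) = (\<lambda>f :: (nat \<Rightarrow> real) \<Rightarrow> 'a. \<Sum>k\<le>Suc n. frag_cmul ((- 1) ^ k) (frag_of (singular_face (Suc n) k f)))"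
    by (rule ext) (simp only: bd_def)
  then show ?thesis by (simp add: chain_boundary_def del: sum.atMost_Suc)
qed

lemma function_cx_singular:
  assumes "comm_group V"
  shows "function_cx (\<lambda>n. singular_simplex_set n X) singular_face V"
proof (intro function_cx.intro semisimplicial.intro function_cx_axioms.intro assms)
  show "singular_face (Suc n) k s \<in> singular_simplex_set n X"
    if "s \<in> singular_simplex_set (Suc n) X" "k \<le> Suc n" for s n k
    using that singular_simplex_singular_face[of "Suc n" X s k] by simp
  show "frag_extend (bd singular_face (Suc n)) (bd singular_face (Suc (Suc n)) s) = 0"
    if "s \<in> singular_simplex_set (Suc (Suc n)) X" for s n
    using that unfolding frag_extend_bd_singular bd_singular_face
    by (intro chain_boundary_boundary_alt[of _ X]) (simp add: singular_chain_of)
qed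

lemma small_simplices_subset: "small_simplices X \<UU> n \<subseteq> singular_simplex_set n X"
  by (auto simp: small_simplices_def)

lemma small_simplices_iff:
  "\<tau> \<in> small_simplices X \<UU> n \<longleftrightarrow> (\<exists>U\<in>\<UU>. singular_simplex n (subtopology X U) \<tau>)"
  by (auto simp: small_simplices_def singular_simplex_subtopology)

lemma small_simplices_face:
  assumes "s \<in> small_simplices X \<UU> (Suc n)" "k \<le> Suc n"
  shows "singular_face (Suc n) k s \<in> small_simplices X \<UU> n"
  using assms singular_simplex_singular_face[of "Suc n" _ s k] by (auto simp: small_simplices_iff)

lemma function_cx_small:
  assumes "comm_group V"
  shows "function_cx (small_simplices X \<UU>) singular_face V"
  using function_cx.semisimplicial_subset[OF function_cx_singular[OF assms], of "small_simplices X \<UU>"]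
    small_simplices_subset small_simplices_face by blast

lemma keys_diff_subset: "Poly_Mapping.keys a \<subseteq> S \<Longrightarrow> Poly_Mapping.keys b \<subseteq> S \<Longrightarrow> Poly_Mapping.keys (a - b) \<subseteq> S"
  using keys_diff[of a b] by blast

text \<open>A sufficiently fine subdivision of \<open>z\<close> is small, and the homotopy between subdivision and the identity
  moves the small boundary of \<open>z\<close> within the small chains, because it is natural and so does not leave a
  member of the covering.\<close>

lemma chain_in_small_mod_boundary:
  assumes \<UU>: "\<And>U. U \<in> \<UU> \<Longrightarrow> openin X U" "topspace X \<subseteq> \<Union>\<UU>"
    and z: "singular_chain p X z" "Poly_Mapping.keys (chain_boundary p z) \<subseteq> small_simplices X \<UU> (p - 1)"
  shows "\<exists>d. singular_chain (Suc p) X d \<and>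
    Poly_Mapping.keys (z - chain_boundary (Suc p) d) \<subseteq> small_simplices X \<UU> p"
proof -
  obtain n where n: "\<And>m f. n \<le> m \<Longrightarrow> f \<in> Poly_Mapping.keys ((singular_subdivision p ^^ m) z) \<Longrightarrow>
      \<exists>V \<in> \<UU>. f \<in> standard_simplex p \<rightarrow> V"
    using sufficient_iterated_singular_subdivision_exists[OF \<UU> z(1)] by metis
  obtain h where h: "\<And>p. h p 0 = (0 :: 'a chain)" "\<And>p c1 c2. h p (c1 - c2) = h p c1 - h p c2"
      "\<And>p X c. singular_chain p X c \<Longrightarrow> singular_chain (Suc p) X (h p c)"
      "\<And>p X c. singular_chain p X c \<Longrightarrow>
        chain_boundary (Suc p) (h p c) + h (p - Suc 0) (chain_boundary p c) = (singular_subdivision p ^^ n) c - c"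
    using chain_homotopic_iterated_singular_subdivision[of n] by blast
  have "singular_chain p X ((singular_subdivision p ^^ m) z)" for m
    by (induction m) (simp_all add: z singular_chain_singular_subdivision)
  then have sd: "Poly_Mapping.keys ((singular_subdivision p ^^ n) z) \<subseteq> small_simplices X \<UU> p"
  proof -
    assume *: "\<And>m. singular_chain p X ((singular_subdivision p ^^ m) z)"
    show ?thesis
    proof
      fix \<tau> assume t: "\<tau> \<in> Poly_Mapping.keys ((singular_subdivision p ^^ n) z)"
      then have "singular_simplex p X \<tau>" using *[of n] by (auto simp: singular_chain_def)
      then show "\<tau> \<in> small_simplices X \<UU> p"
        using n[OF order_refl t] by (auto simp: small_simplices_def)
    qed
  qed
  have hs: "Poly_Mapping.keys (h q c) \<subseteq> small_simplices X \<UU> (Suc q)"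
    if "Poly_Mapping.keys c \<subseteq> small_simplices X \<UU> q" for q c
    using that
  proof (induction c rule: frag_induction)
    case (one \<tau>)
    then obtain U where "U \<in> \<UU>" "singular_chain q (subtopology X U) (frag_of \<tau>)"
      by (auto simp: small_simplices_iff singular_chain_of)
    from this(1) h(3)[OF this(2)] show ?case
      unfolding singular_chain_def using small_simplices_iff by blast
  next
    case (diff a b)
    then show ?case by (simp add: h keys_diff_subset)
  qed (auto simp: h)
  have "Poly_Mapping.keys (h (p - Suc 0) (chain_boundary p z)) \<subseteq> small_simplices X \<UU> p"
    using hs[OF z(2)] by (cases p) (auto simp: h chain_boundary_def)
  then have "Poly_Mapping.keys ((singular_subdivision p ^^ n) z - h (p - Suc 0) (chain_boundary p z))
      \<subseteq> small_simplices X \<UU> p"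
    using sd by (rule keys_diff_subset[rotated])
  also have "(singular_subdivision p ^^ n) z - h (p - Suc 0) (chain_boundary p z)
      = z - chain_boundary (Suc p) (- h p z)"
    using h(4)[OF z(1)] by (simp add: chain_boundary_minus algebra_simps)
  finally show ?thesis
    using h(3)[OF z(1)] by (intro exI[of _ "- h p z"]) (simp add: singular_chain_minus)
qed

text \<open>The homotopy of a retraction of the singular chains onto the small ones. It is constructed by recursion on
  the degree: after correcting \<open>\<tau>\<close> by the homotopy of its boundary, the boundary is small, so some chain \<open>d\<close>
  makes the difference small. Choosing \<open>0\<close> on small simplices makes the retraction the identity there. It
  is defined on generators, so that it can be evaluated in an arbitrary group \<open>V\<close>.\<close>

primrec small_homotopy :: "'a topology \<Rightarrow> 'a set set \<Rightarrow> nat \<Rightarrow> ((nat \<Rightarrow> real) \<Rightarrow> 'a) \<Rightarrow> 'a chain" where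
  "small_homotopy X \<UU> 0 = (\<lambda>_. 0)"
| "small_homotopy X \<UU> (Suc p) = (\<lambda>\<tau>. if \<tau> \<in> small_simplices X \<UU> (Suc p) then 0 else
     SOME d. singular_chain (Suc (Suc p)) X d \<and>
       Poly_Mapping.keys (frag_of \<tau> - frag_extend (small_homotopy X \<UU> p) (chain_boundary (Suc p) (frag_of \<tau>))
         - chain_boundary (Suc (Suc p)) d) \<subseteq> small_simplices X \<UU> (Suc p))"

definition small_retraction :: "'a topology \<Rightarrow> 'a set set \<Rightarrow> nat \<Rightarrow> ((nat \<Rightarrow> real) \<Rightarrow> 'a) \<Rightarrow> 'a chain" where
  "small_retraction X \<UU> p \<tau> = frag_of \<tau> - chain_boundary (Suc p) (small_homotopy X \<UU> p \<tau>)
     - frag_extend (small_homotopy X \<UU> (p - 1)) (chain_boundary p (frag_of \<tau>))"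

lemma small_homotopy_small: "\<tau> \<in> small_simplices X \<UU> p \<Longrightarrow> small_homotopy X \<UU> p \<tau> = 0"
  by (cases p) auto

lemma frag_extend_small_retraction:
  "frag_extend (small_retraction X \<UU> p) c = c - chain_boundary (Suc p) (frag_extend (small_homotopy X \<UU> p) c)
     - frag_extend (small_homotopy X \<UU> (p - 1)) (chain_boundary p c)"
  using subset_UNIV
  by (induction c rule: frag_induction)
    (simp_all add: frag_extend_diff chain_boundary_diff small_retraction_def algebra_simps)

context
  fixes X :: "'a topology" and \<UU> :: "'a set set"
  assumes \<UU>: "\<And>U. U \<in> \<UU> \<Longrightarrow> openin X U" "topspace X \<subseteq> \<Union>\<UU>"
begin

lemma small_simplices_0: "small_simplices X \<UU> 0 = singular_simplex_set 0 X"
proof -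
  have "\<tau> \<in> small_simplices X \<UU> 0" if "singular_simplex 0 X \<tau>" for \<tau>
  proof -
    have "\<tau> (\<lambda>j. if j = 0 then 1 else 0) \<in> topspace X"
      using that by (auto simp: singular_simplex_def continuous_map_def standard_simplex_0)
    then show ?thesis
      using that \<UU>(2) by (auto simp: small_simplices_def standard_simplex_0)
  qed
  then show ?thesis using small_simplices_subset by blast
qed

lemma small_homotopy_props:
  assumes "singular_simplex p X \<tau>"
  shows "singular_chain (Suc p) X (small_homotopy X \<UU> p \<tau>)" (is "?A p \<tau>")
    and "Poly_Mapping.keys (small_retraction X \<UU> p \<tau>) \<subseteq> small_simplices X \<UU> p" (is "?B p \<tau>")
proof -
  have "?A p \<tau> \<and> ?B p \<tau>" using assms
  proof (induction p arbitrary: \<tau>)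
    case 0
    then show ?case
      using small_simplices_0 by (auto simp: small_retraction_def chain_boundary_def)
  next
    case (Suc p)
    let ?z = "frag_of \<tau> - frag_extend (small_homotopy X \<UU> p) (chain_boundary (Suc p) (frag_of \<tau>))"
    have b: "singular_chain p X (chain_boundary (Suc p) (frag_of \<tau>))"
      using Suc.prems by (intro singular_chain_boundary_alt) (simp add: singular_chain_of)
    have bb: "chain_boundary p (chain_boundary (Suc p) (frag_of \<tau>)) = 0"
      using Suc.prems by (intro chain_boundary_boundary_alt[of _ X]) (simp add: singular_chain_of)
    have 1: "singular_chain (Suc p) X ?z"
      using Suc b by (intro singular_chain_diff singular_chain_extend) (auto simp: singular_chain_of singular_chain_def)
    have "chain_boundary (Suc p) ?z = frag_extend (small_retraction X \<UU> p) (chain_boundary (Suc p) (frag_of \<tau>))"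
      unfolding frag_extend_small_retraction by (simp add: chain_boundary_diff bb)
    also have "Poly_Mapping.keys \<dots> \<subseteq> small_simplices X \<UU> p"
      using b Suc.IH by (intro order_trans[OF keys_frag_extend]) (auto simp: singular_chain_def)
    finally have 2: "Poly_Mapping.keys (chain_boundary (Suc p) ?z) \<subseteq> small_simplices X \<UU> (Suc p - 1)" by simp
    show ?case
    proof (cases "\<tau> \<in> small_simplices X \<UU> (Suc p)")
      case True
      have "frag_extend (small_homotopy X \<UU> p) (chain_boundary (Suc p) (frag_of \<tau>)) = 0"
        using small_simplices_face[OF True]
        by (simp add: chain_boundary_of frag_extend_sum o_def frag_extend_cmul small_homotopy_small del: sum.atMost_Suc)
      then show ?thesis
        using True by (simp add: small_retraction_def)
    next
      case False
      have "\<exists>d. singular_chain (Suc (Suc p)) X d \<and>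
        Poly_Mapping.keys (?z - chain_boundary (Suc (Suc p)) d) \<subseteq> small_simplices X \<UU> (Suc p)"
        by (rule chain_in_small_mod_boundary[OF \<UU> 1 2])
      from someI_ex[OF this] show ?thesis
        using False by (simp add: small_retraction_def algebra_simps)
    qed
  qed
  then show "?A p \<tau>" "?B p \<tau>" by auto
qed

lemma small_retraction_small:
  assumes "\<tau> \<in> small_simplices X \<UU> p"
  shows "small_retraction X \<UU> p \<tau> = frag_of \<tau>"
proof -
  have "frag_extend (small_homotopy X \<UU> (p - 1)) (chain_boundary p (frag_of \<tau>)) = 0"
    using assms small_simplices_face[of \<tau> X \<UU> "p - 1"]
    by (cases p) (auto simp: chain_boundary_of frag_extend_sum o_def frag_extend_cmul small_homotopy_small
      simp del: sum.atMost_Suc)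
  then show ?thesis by (simp add: small_retraction_def small_homotopy_small assms)
qed

lemma chain_boundary_small_retraction:
  assumes "singular_simplex (Suc p) X \<tau>"
  shows "chain_boundary (Suc p) (small_retraction X \<UU> (Suc p) \<tau>)
    = frag_extend (small_retraction X \<UU> p) (chain_boundary (Suc p) (frag_of \<tau>))"
proof -
  have "chain_boundary (Suc p) (chain_boundary (Suc (Suc p)) (small_homotopy X \<UU> (Suc p) \<tau>)) = 0"
    using small_homotopy_props(1)[OF assms] by (rule chain_boundary_boundary_alt)
  moreover have "chain_boundary p (chain_boundary (Suc p) (frag_of \<tau>)) = 0"
    using assms by (intro chain_boundary_boundary_alt[of _ X]) (simp add: singular_chain_of)
  ultimately show ?thesis
    unfolding frag_extend_small_retraction by (simp add: small_retraction_def chain_boundary_diff)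
qed

text \<open>The retraction extends a cocycle on small simplices to all simplices. If the restriction of \<open>f\<close> is the
  coboundary of \<open>g\<close>, then \<open>f\<close> is the coboundary of the extension of \<open>g\<close>, corrected by the value of \<open>f\<close> on
  the homotopy.\<close>

theorem H_sing_restrict_iso:
  assumes V: "comm_group V"
  shows "H_sing_restrict X \<UU> V n \<in> iso (H_sing X V n) (cohomology (S_complex X \<UU> V) n)"
proof -
  interpret T: function_cx "\<lambda>n. singular_simplex_set n X" singular_face V by (rule function_cx_singular[OF V])
  interpret S: function_cx "small_simplices X \<UU>" singular_face V by (rule function_cx_small[OF V])
  interpret P: cochain_cx_pair T.FC S.FC ..
  let ?ps = "small_retraction X \<UU>" and ?Sm = "small_simplices X \<UU>" and ?D = "small_homotopy X \<UU>"
  have keys: "Poly_Mapping.keys (chain_boundary (Suc m) (frag_of s)) \<subseteq> singular_simplex_set m X"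
    if "singular_simplex (Suc m) X s" for m s
    using T.keys_bd[of s m] that by (simp add: bd_singular_face)
  define pull where "pull = (\<lambda>m f. \<lambda>\<tau>\<in>singular_simplex_set m X. frag_eval V f (?ps m \<tau>))"
  have pull_in: "pull m f \<in> singular_simplex_set m X \<rightarrow>\<^sub>E carrier V" for m f
    by (auto simp: pull_def)
  have pull_eval: "frag_eval V (pull m f) c = frag_eval V f (frag_extend (?ps m) c)"
    if "Poly_Mapping.keys c \<subseteq> singular_simplex_set m X" for m f c
    unfolding T.V.frag_eval_extend using that by (intro T.V.frag_eval_cong) (auto simp: pull_def)
  show ?thesis
    unfolding H_sing_restrict_def H_sing_def S_complex_def singular_cochain_complex_def
  proof (rule P.cohomology_map_iso)
    show "cocycle_map T.FC S.FC n (\<lambda>f. restrict f (?Sm n))"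
      by (rule T.restrict_cocycle_map[OF S.function_cx_axioms small_simplices_subset])
  next
    fix z assume z: "z \<in> cocycles S.FC n"
    have "frag_eval V (pull n z) (bd singular_face (Suc n) s) = \<one>\<^bsub>V\<^esub>" if s: "singular_simplex (Suc n) X s" for s
      using pull_eval[OF keys[OF s], of z] S.cocycle_eval_bd[OF z small_homotopy_props(2)[OF s]]
      by (simp add: bd_singular_face frag_extend_bd_singular chain_boundary_small_retraction[OF s])
    then have "pull n z \<in> cocycles T.FC n"
      using pull_in by (auto simp: T.cocycles_fc)
    moreover have "restrict (pull n z) (?Sm n) = z"
      using z small_simplices_subset[of X \<UU> n]
      by (auto simp: S.cocycles_fc fun_eq_iff PiE_iff pull_def small_retraction_small restrict_def extensional_def)
    ultimately show "\<exists>y\<in>cocycles T.FC n. S.FC.cls n (restrict y (?Sm n)) = S.FC.cls n z"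
      by (intro bexI[of _ "pull n z"]) auto
  next
    fix f assume f: "f \<in> cocycles T.FC n" and res: "restrict f (?Sm n) \<in> coboundaries S.FC n"
    have fin: "f \<in> singular_simplex_set n X \<rightarrow>\<^sub>E carrier V" using f by (simp add: T.cocycles_fc)
    show "f \<in> coboundaries T.FC n"
    proof (cases n)
      case 0
      then show ?thesis
        using res fin small_simplices_0 by (simp add: PiE_restrict)
    next
      case (Suc m)
      obtain g where g: "g \<in> ?Sm m \<rightarrow>\<^sub>E carrier V"
        "restrict f (?Sm n) = (\<lambda>s\<in>?Sm (Suc m). frag_eval V g (bd singular_face (Suc m) s))"
        using res unfolding Suc S.coboundaries_fc by blast
      define k where "k = (\<lambda>\<tau>\<in>singular_simplex_set m X. pull m g \<tau> \<otimes>\<^bsub>V\<^esub> frag_eval V f (?D m \<tau>))"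
      have "f s = frag_eval V k (bd singular_face (Suc m) s)" if s: "singular_simplex (Suc m) X s" for s
      proof -
        let ?b = "chain_boundary (Suc m) (frag_of s)"
        have "frag_of s = ?ps n s + (chain_boundary (Suc n) (?D n s) + frag_extend (?D m) ?b)"
          by (simp add: small_retraction_def Suc)
        then have "f s = frag_eval V f (?ps n s + (chain_boundary (Suc n) (?D n s) + frag_extend (?D m) ?b))"
          using fin s Suc T.V.frag_eval_of[of f s] by (auto simp: PiE_iff)
        also have "\<dots> = frag_eval V f (?ps n s) \<otimes>\<^bsub>V\<^esub> (frag_eval V f (chain_boundary (Suc n) (?D n s))
            \<otimes>\<^bsub>V\<^esub> frag_eval V f (frag_extend (?D m) ?b))"
          by (simp add: T.V.frag_eval_add)
        also have "frag_eval V f (chain_boundary (Suc n) (?D n s)) = \<one>\<^bsub>V\<^esub>"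
          using T.cocycle_eval_bd[OF f, of "?D n s"] small_homotopy_props(1)[of n s] s Suc
          by (simp add: frag_extend_bd_singular singular_chain_def)
        also have "frag_eval V f (?ps n s) = frag_eval V (restrict f (?Sm n)) (?ps n s)"
          using small_homotopy_props(2)[of n s] s Suc by (intro T.V.frag_eval_cong) auto
        also have "\<dots> = frag_eval V g (chain_boundary (Suc m) (?ps n s))"
          unfolding g(2) using small_homotopy_props(2)[of n s] s Suc
          by (subst S.coboundary_eval) (auto simp: frag_extend_bd_singular)
        also have "chain_boundary (Suc m) (?ps n s) = frag_extend (?ps m) ?b"
          using chain_boundary_small_retraction[OF s] Suc by simp
        also have "frag_eval V g (frag_extend (?ps m) ?b) = frag_eval V (pull m g) ?b"
          by (rule pull_eval[OF keys[OF s], symmetric])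
        also have "frag_eval V f (frag_extend (?D m) ?b) = frag_eval V (\<lambda>\<tau>. frag_eval V f (?D m \<tau>)) ?b"
          by (rule T.V.frag_eval_extend)
        also have "frag_eval V (pull m g) ?b \<otimes>\<^bsub>V\<^esub> (\<one>\<^bsub>V\<^esub> \<otimes>\<^bsub>V\<^esub> frag_eval V (\<lambda>\<tau>. frag_eval V f (?D m \<tau>)) ?b)
          = frag_eval V (\<lambda>\<tau>. pull m g \<tau> \<otimes>\<^bsub>V\<^esub> frag_eval V f (?D m \<tau>)) ?b"
          using pull_in[of m g] keys[OF s] by (subst T.V.frag_eval_mult) (auto simp: PiE_iff)
        also have "\<dots> = frag_eval V k ?b"
          using keys[OF s] by (intro T.V.frag_eval_cong) (auto simp: k_def)
        finally show ?thesis by (simp add: bd_singular_face)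
      qed
      moreover have "k \<in> singular_simplex_set m X \<rightarrow>\<^sub>E carrier V"
        using pull_in[of m g] by (auto simp: k_def PiE_iff)
      ultimately show ?thesis
        unfolding Suc T.coboundaries_fc using fin Suc
        by (intro bexI[of _ k]) (auto simp: fun_eq_iff PiE_iff extensional_def)
    qed
  qed
qed

end

section \<open>Complexes of tuples\<close>

lemma tuple_face_in: "u \<in> {..Suc n} \<rightarrow>\<^sub>E U \<Longrightarrow> k \<le> Suc n \<Longrightarrow> tuple_face (Suc n) k u \<in> {..n} \<rightarrow>\<^sub>E U"
  by (auto simp: tuple_face_def PiE_iff)

lemma function_cx_tuples:
  assumes "comm_group V"
  shows "function_cx (small_tuples \<UU>) tuple_face V"
proof (intro function_cx.intro semisimplicial.intro function_cx_axioms.intro assms)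
  show "tuple_face (Suc n) k s \<in> small_tuples \<UU> n" if "s \<in> small_tuples \<UU> (Suc n)" "k \<le> Suc n" for s n k
  proof -
    obtain U where "U \<in> \<UU>" "s \<in> {..Suc n} \<rightarrow>\<^sub>E U" using \<open>s \<in> _\<close> by (auto simp: small_tuples_def)
    then show ?thesis unfolding small_tuples_def using tuple_face_in[of s n U k] \<open>k \<le> _\<close> by blast
  qed
  show "frag_extend (bd tuple_face (Suc n)) (bd tuple_face (Suc (Suc n)) s) = 0"
    if "s \<in> small_tuples \<UU> (Suc (Suc n))" for s n
    by (rule bd_bd_eq_0) (auto simp: tuple_face_def fun_eq_iff)
qed

section \<open>Straightening of small simplices in a locally contractible group\<close>

subsection \<open>Cones\<close>

text \<open>The point of the face opposite to the vertex \<open>0\<close> on the line through that vertex and \<open>x\<close>. The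
  vertex itself has no such point and is treated separately by \<open>cone\<close>.\<close>

definition opp_face :: "(nat \<Rightarrow> real) \<Rightarrow> nat \<Rightarrow> real" where
  "opp_face x = (\<lambda>i. x (Suc i) / (1 - x 0))"

text \<open>The parametrisation of \<open>\<Delta>\<^sup>p\<^sup>+\<^sup>1\<close> as the cone over \<open>\<Delta>\<^sup>p\<close>; the parameter \<open>t\<close> is the barycentric coordinate
  of the cone point.\<close>

definition simplex_join :: "(nat \<Rightarrow> real) \<times> real \<Rightarrow> nat \<Rightarrow> real" where
  "simplex_join = (\<lambda>(y, t) i. case i of 0 \<Rightarrow> t | Suc j \<Rightarrow> (1 - t) * y j)"

lemma sum_standard_simplex_Suc: "x \<in> standard_simplex (Suc p) \<Longrightarrow> (\<Sum>i\<le>p. x (Suc i)) = 1 - x 0"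
  by (simp add: standard_simplex_def sum.atMost_Suc_shift del: sum.atMost_Suc)

lemma opp_face_in:
  assumes "x \<in> standard_simplex (Suc p)" "x 0 \<noteq> 1"
  shows "opp_face x \<in> standard_simplex p"
proof -
  have x: "\<And>i. 0 \<le> x i" "\<And>i. x i \<le> 1" "\<And>i. i > Suc p \<Longrightarrow> x i = 0"
    using assms(1) by (auto simp: standard_simplex_def)
  have pos: "0 < 1 - x 0" using x(2)[of 0] assms(2) by linarith
  have sum: "(\<Sum>i\<le>p. x (Suc i)) = 1 - x 0" by (rule sum_standard_simplex_Suc[OF assms(1)])
  have "x (Suc i) \<le> 1 - x 0" for i
  proof (cases "i \<le> p")
    case True
    then have "x (Suc i) \<le> (\<Sum>i\<le>p. x (Suc i))" by (intro member_le_sum) (auto simp: x)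
    then show ?thesis using sum by simp
  next
    case False
    then show ?thesis using x(3)[of "Suc i"] pos by simp
  qed
  moreover have "(\<Sum>i\<le>p. x (Suc i) / (1 - x 0)) = 1"
    using pos sum by (simp flip: sum_divide_distrib)
  ultimately show ?thesis
    using pos x by (auto simp: opp_face_def standard_simplex_def)
qed

lemma simplex_join_in:
  assumes "y \<in> standard_simplex p" "t \<in> {0..1}"
  shows "simplex_join (y, t) \<in> standard_simplex (Suc p)"
proof -
  have "(1 - t) * y j \<le> 1 * 1" for j
    using assms by (intro mult_mono) (auto simp: standard_simplex_def)
  then show ?thesis
    using assms by (auto simp: simplex_join_def standard_simplex_def sum.atMost_Suc_shift
      split: nat.split simp flip: sum_distrib_left simp del: sum.atMost_Suc)
qed

lemma simplex_join_opp_face: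
  "x 0 \<noteq> 1 \<Longrightarrow> simplex_join (opp_face x, x 0) = x"
  by (auto simp: simplex_join_def opp_face_def fun_eq_iff split: nat.split)

lemma opp_face_simplex_join: "t \<noteq> 1 \<Longrightarrow> opp_face (simplex_join (y, t)) = y"
  by (auto simp: simplex_join_def opp_face_def fun_eq_iff)

lemma simplex_eq_vertex_0:
  assumes "x \<in> standard_simplex (Suc p)" "x 0 = 1"
  shows "x (Suc i) = 0"
proof (cases "i \<le> p")
  case True
  have "(\<Sum>i\<le>p. x (Suc i)) = 0" using sum_standard_simplex_Suc[OF assms(1)] assms(2) by simp
  moreover have "\<And>i. 0 \<le> x i" using assms(1) by (auto simp: standard_simplex_def)
  ultimately show ?thesis using True by (simp add: sum_nonneg_eq_0_iff)
qed (use assms in \<open>auto simp: standard_simplex_def\<close>)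

text \<open>The parametrisation collapses the face \<open>t = 1\<close>. Since a map from a compact space onto a Hausdorff space
  is a quotient map, continuity of a map on the cone can be tested on the cylinder.\<close>

lemma quotient_map_simplex_join:
  "quotient_map (prod_topology (subtopology (powertop_real UNIV) (standard_simplex p)) (top_of_set {0..1}))
     (subtopology (powertop_real UNIV) (standard_simplex (Suc p))) simplex_join"
    (is "quotient_map (prod_topology ?D ?I) ?E _")
proof (rule continuous_imp_quotient_map)
  have 1: "continuous_map (prod_topology ?D ?I) euclideanreal (\<lambda>q. fst q j)" for j
  proof -
    have "continuous_map (subtopology (powertop_real UNIV) (standard_simplex p)) euclideanreal (\<lambda>y. y j)"
      by (intro continuous_map_from_subtopology) (auto intro: continuous_map_product_projection)
    from continuous_map_compose[OF continuous_map_fst this] show ?thesis by (simp add: o_def)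
  qed
  have 2: "continuous_map (prod_topology ?D ?I) euclideanreal snd"
    using continuous_map_compose[OF continuous_map_snd continuous_map_from_subtopology[OF continuous_map_id]]
    by (simp add: o_def id_def)
  have "continuous_map (prod_topology ?D ?I) euclideanreal (\<lambda>q. simplex_join q i)" for i
    by (cases i) (auto simp: simplex_join_def case_prod_unfold 2
        intro!: continuous_map_real_mult continuous_map_diff continuous_map_const[THEN iffD2] 1 2)
  then show "continuous_map (prod_topology ?D ?I) ?E simplex_join"
    by (auto simp: continuous_map_in_subtopology continuous_map_componentwise simplex_join_in)
  have "compact_space ?D"
    using compactin_standard_simplex by (simp add: compact_space_subtopology)
  moreover have "compact_space ?I"
    by (simp add: compact_space_subtopology)
  ultimately show "compact_space (prod_topology ?D ?I)"
    by (simp add: compact_space_prod_topology)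
  show "Hausdorff_space ?E"
    by (intro Hausdorff_space_subtopology) (simp add: Hausdorff_space_product_topology)
  show "simplex_join ` topspace (prod_topology ?D ?I) = topspace ?E"
  proof
    show "simplex_join ` topspace (prod_topology ?D ?I) \<subseteq> topspace ?E"
      using simplex_join_in by auto
    show "topspace ?E \<subseteq> simplex_join ` topspace (prod_topology ?D ?I)"
    proof
      fix x assume "x \<in> topspace ?E"
      then have x: "x \<in> standard_simplex (Suc p)" by simp
      show "x \<in> simplex_join ` topspace (prod_topology ?D ?I)"
      proof (cases "x 0 = 1")
        case True
        obtain y where y: "y \<in> standard_simplex p" using nonempty_standard_simplex by blast
        have "x = simplex_join (y, 1)"
          using simplex_eq_vertex_0[OF x True] True by (auto simp: simplex_join_def fun_eq_iff split: nat.split)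
        then show ?thesis using y by force
      next
        case False
        have "x 0 \<in> {0..1}" using x by (auto simp: standard_simplex_def)
        then show ?thesis
          using opp_face_in[OF x False] simplex_join_opp_face[of x] False by (auto intro!: image_eqI[of x _ "(opp_face x, x 0)"])
      qed
    qed
  qed
qed

locale topological_group = group G for G :: "'g monoid" (structure) +
  fixes X :: "'g topology"
  assumes topspace: "topspace X = carrier G"
    and mult_cont: "continuous_map (prod_topology X X) X (\<lambda>(x, y). x \<otimes> y)"
    and inv_cont: "continuous_map X X (\<lambda>x. inv x)"
begin

abbreviation "nbhd U \<equiv> openin X U \<and> \<one> \<in> U"

lemma nbhd_subset: "openin X U \<Longrightarrow> U \<subseteq> carrier G"
  using openin_subset topspace by blast

lemma left_translation_cont: "g \<in> carrier G \<Longrightarrow> continuous_map X X (\<lambda>x. g \<otimes> x)"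
  using continuous_map_compose[OF _ mult_cont, of X "\<lambda>x. (g, x)"]
  by (simp add: o_def continuous_map_pairwise topspace)

lemma openin_l_coset:
  assumes "g \<in> carrier G" "openin X U"
  shows "openin X (g <# U)"
proof -
  have "g <# U = {x \<in> topspace X. inv g \<otimes> x \<in> U}"
  proof
    have "inv g \<otimes> (g \<otimes> y) = y" if "y \<in> U" for y
      using that nbhd_subset[OF assms(2)] assms(1) by (auto simp flip: m_assoc)
    then show "g <# U \<subseteq> {x \<in> topspace X. inv g \<otimes> x \<in> U}"
      using nbhd_subset[OF assms(2)] assms(1) by (auto simp: l_coset_def topspace)
    have "x = g \<otimes> (inv g \<otimes> x)" if "x \<in> carrier G" for x
      using that assms(1) by (simp flip: m_assoc)
    then show "{x \<in> topspace X. inv g \<otimes> x \<in> U} \<subseteq> g <# U"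
      unfolding l_coset_def topspace by blast
  qed
  then show ?thesis
    using openin_continuous_map_preimage[OF left_translation_cont[of "inv g"] assms(2)] assms(1) by simp
qed

lemma nbhd_mult:
  assumes "nbhd U"
  shows "\<exists>W. nbhd W \<and> (\<forall>x\<in>W. \<forall>y\<in>W. x \<otimes> y \<in> U)"
proof -
  let ?P = "{p \<in> topspace (prod_topology X X). (\<lambda>(x, y). x \<otimes> y) p \<in> U}"
  have "openin (prod_topology X X) ?P"
    using openin_continuous_map_preimage[OF mult_cont] assms by blast
  moreover have "(\<one>, \<one>) \<in> ?P" using assms by (simp add: topspace)
  ultimately obtain A B where *: "openin X A" "openin X B" "\<one> \<in> A" "\<one> \<in> B" "A \<times> B \<subseteq> ?P"
    unfolding openin_prod_topology_alt by meson
  then show ?thesis by (intro exI[of _ "A \<inter> B"]) auto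
qed

lemma nbhd_div:
  assumes "nbhd U"
  shows "\<exists>W. nbhd W \<and> (\<forall>x\<in>W. \<forall>y\<in>W. inv x \<otimes> y \<in> U)"
proof -
  obtain W where W: "nbhd W" "\<forall>x\<in>W. \<forall>y\<in>W. x \<otimes> y \<in> U" using nbhd_mult[OF assms] by blast
  let ?W = "{x \<in> topspace X. inv x \<in> W}"
  have "openin X ?W" using openin_continuous_map_preimage[OF inv_cont] W by blast
  then show ?thesis using W by (intro exI[of _ "?W \<inter> W"]) (auto simp: topspace)
qed

lemma small_tuples_translate:
  "u \<in> small_tuples (translate_cover G W) n \<longleftrightarrow> (\<exists>g\<in>carrier G. u \<in> {..n} \<rightarrow>\<^sub>E g <# W)"
  by (auto simp: small_tuples_def translate_cover_def)

lemma small_tuples_carrier: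
  assumes "openin X W" "u \<in> small_tuples (translate_cover G W) n" "i \<le> n"
  shows "u i \<in> carrier G"
  using assms nbhd_subset[OF openin_l_coset[OF _ assms(1)]] by (auto simp: small_tuples_translate PiE_iff)

lemma small_tuples_mono: "W \<subseteq> U \<Longrightarrow> small_tuples (translate_cover G W) n \<subseteq> small_tuples (translate_cover G U) n"
  unfolding small_tuples_def translate_cover_def
proof clarify
  fix u g assume W: "W \<subseteq> U" and u: "u \<in> {..n} \<rightarrow>\<^sub>E g <# W" and g: "g \<in> carrier G"
  have "g <# W \<subseteq> g <# U" using W by (auto simp: l_coset_def)
  then have "u \<in> {..n} \<rightarrow>\<^sub>E g <# U" using u by (meson PiE_mono subsetD)
  then show "u \<in> (\<Union>U\<in>{g <# U |g. g \<in> carrier G}. {..n} \<rightarrow>\<^sub>E U)" using g by blast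
qed

lemma small_simplices_translate:
  "\<tau> \<in> small_simplices X (translate_cover G W) n \<longleftrightarrow>
    (\<exists>g\<in>carrier G. singular_simplex n (subtopology X (g <# W)) \<tau>)"
  by (auto simp: small_simplices_iff translate_cover_def)

lemma small_simplices_mono: "W \<subseteq> U \<Longrightarrow> small_simplices X (translate_cover G W) n \<subseteq> small_simplices X (translate_cover G U) n"
proof
  fix \<tau> assume W: "W \<subseteq> U" and "\<tau> \<in> small_simplices X (translate_cover G W) n"
  then obtain g where g: "g \<in> carrier G" "singular_simplex n (subtopology X (g <# W)) \<tau>"
    by (auto simp: small_simplices_translate)
  have "g <# W \<subseteq> g <# U" using W by (auto simp: l_coset_def)
  then show "\<tau> \<in> small_simplices X (translate_cover G U) n"
    using g singular_simplex_mono small_simplices_translate by blast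
qed

end

text \<open>The contraction is defined on all of \<open>G\<close> only to make it total; it is continuous on \<open>B\<close>. It fixes
  the identity at all times, so that a small neighbourhood stays small during the contraction. The parameter
  \<open>1\<close> is the end of the contraction, in accordance with the cone coordinate.\<close>

locale locally_contractible_group = topological_group +
  fixes B :: "'a set" and h :: "'a \<times> real \<Rightarrow> 'a"
  assumes B: "openin X B" "\<one> \<in> B"
    and h_cont: "continuous_map (prod_topology (subtopology X B) (top_of_set {0..1})) X h"
    and h_0: "x \<in> carrier G \<Longrightarrow> h (x, 0) = x"
    and h_1: "x \<in> B \<Longrightarrow> h (x, 1) = \<one>"
    and h_one: "t \<in> {0..1} \<Longrightarrow> h (\<one>, t) = \<one>"
    and h_closed: "x \<in> carrier G \<Longrightarrow> t \<in> {0..1} \<Longrightarrow> h (x, t) \<in> carrier G"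
begin

text \<open>The tube lemma, applied to the fibre over the identity, which the contraction leaves fixed.\<close>

lemma contraction_small:
  assumes "nbhd U"
  shows "\<exists>W. nbhd W \<and> W \<subseteq> B \<and> (\<forall>x\<in>W. \<forall>t\<in>{0..1}. h (x, t) \<in> U)"
proof -
  let ?Y = "prod_topology (subtopology X B) (top_of_set {0..1 :: real})"
  let ?P = "{p \<in> topspace ?Y. h p \<in> U}"
  have "openin ?Y ?P" using openin_continuous_map_preimage[OF h_cont] assms by blast
  moreover have "compactin (top_of_set {0..1 :: real}) {0..1}" by (simp add: compactin_subtopology)
  moreover have "\<one> \<in> topspace (subtopology X B)" using B nbhd_subset by (auto simp: topspace)
  moreover have "{\<one>} \<times> {0..1} \<subseteq> ?P" using B assms h_one by (auto simp: topspace)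
  ultimately have "\<exists>U V. openin (subtopology X B) U \<and> openin (top_of_set {0..1}) V \<and> \<one> \<in> U \<and> {0..1} \<subseteq> V \<and> U \<times> V \<subseteq> ?P"
    by (rule tube_lemma_right)
  then obtain W V where *: "openin (subtopology X B) W" "\<one> \<in> W" "{0..1} \<subseteq> V" "W \<times> V \<subseteq> ?P" by blast
  have "h (x, t) \<in> U" if "x \<in> W" "t \<in> {0..1}" for x t
    using *(3,4) that by blast
  moreover have "openin X W" "W \<subseteq> B"
    using *(1) B(1) by (auto simp: openin_open_subtopology)
  ultimately show ?thesis using *(2) by blast
qed

text \<open>The cone over \<open>\<tau>\<close> with cone point \<open>v\<close>: the point \<open>\<tau> y\<close> is moved to \<open>v\<close> along the translate by \<open>v\<close> of the
  contraction. The cone point is the new vertex \<open>0\<close>.\<close>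

definition cone :: "nat \<Rightarrow> 'a \<Rightarrow> ((nat \<Rightarrow> real) \<Rightarrow> 'a) \<Rightarrow> (nat \<Rightarrow> real) \<Rightarrow> 'a" where
  "cone p v \<tau> = (\<lambda>x\<in>standard_simplex (Suc p).
     if x 0 = 1 then v else v \<otimes> h (inv v \<otimes> \<tau> (opp_face x), x 0))"

lemma singular_simplex_cone:
  assumes v: "v \<in> carrier G" and \<tau>: "singular_simplex p X \<tau>"
    and small: "\<And>y. y \<in> standard_simplex p \<Longrightarrow> inv v \<otimes> \<tau> y \<in> B"
  shows "singular_simplex (Suc p) X (cone p v \<tau>)"
proof -
  let ?D = "subtopology (powertop_real UNIV) (standard_simplex p)"
  let ?I = "top_of_set {0..1 :: real}"
  have 1: "continuous_map ?D (subtopology X B) (\<lambda>y. inv v \<otimes> \<tau> y)"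
    using continuous_map_compose[OF _ left_translation_cont[of "inv v"], of ?D \<tau>] \<tau> v small
    by (auto simp: o_def continuous_map_in_subtopology singular_simplex_def)
  have "continuous_map (prod_topology ?D ?I) (prod_topology (subtopology X B) ?I) (\<lambda>q. (inv v \<otimes> \<tau> (fst q), snd q))"
    using continuous_map_compose[OF continuous_map_fst 1] continuous_map_snd
    by (auto simp: continuous_map_pairwise o_def)
  from continuous_map_compose[OF continuous_map_compose[OF this h_cont] left_translation_cont[OF v]]
  have "continuous_map (prod_topology ?D ?I) X (\<lambda>q. v \<otimes> h (inv v \<otimes> \<tau> (fst q), snd q))"
    by (simp add: o_def)
  moreover have "v \<otimes> h (inv v \<otimes> \<tau> (fst q), snd q) = (cone p v \<tau> \<circ> simplex_join) q"
    if "q \<in> topspace (prod_topology ?D ?I)" for q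
  proof -
    obtain y t where q: "q = (y, t)" by (cases q)
    have yt: "y \<in> standard_simplex p" "t \<in> {0..1}" using that q by auto
    have 0: "simplex_join (y, t) 0 = t" by (simp add: simplex_join_def)
    show ?thesis
      using simplex_join_in[OF yt] small[OF yt(1)] v 0
      by (cases "t = 1") (simp_all add: q cone_def opp_face_simplex_join h_1)
  qed
  ultimately have "continuous_map (prod_topology ?D ?I) X (cone p v \<tau> \<circ> simplex_join)"
    by (rule continuous_map_eq)
  from continuous_compose_quotient_map[OF quotient_map_simplex_join this]
  show ?thesis by (simp add: singular_simplex_def cone_def)
qed

text \<open>A point \<open>w'\<close> of \<open>W\<close> is seen from another point \<open>w\<close> as \<open>inv w \<otimes> w'\<close>. This is independent of the translate
  \<open>g W\<close> in which both lie, so one \<open>W\<close> works for all \<open>g\<close>.\<close>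

lemma cone_small:
  assumes "nbhd U"
  shows "\<exists>W. nbhd W \<and> W \<subseteq> U \<and> (\<forall>g\<in>carrier G. \<forall>v\<in>g <# W. \<forall>p \<tau>. singular_simplex p (subtopology X (g <# W)) \<tau> \<longrightarrow>
    singular_simplex (Suc p) (subtopology X (g <# U)) (cone p v \<tau>))"
proof -
  obtain U1 where U1: "nbhd U1" "\<forall>x\<in>U1. \<forall>y\<in>U1. x \<otimes> y \<in> U" using nbhd_mult[OF assms] by blast
  obtain U2 where U2: "nbhd U2" "U2 \<subseteq> B" "\<forall>x\<in>U2. \<forall>t\<in>{0..1}. h (x, t) \<in> U1"
    using contraction_small[OF U1(1)] by blast
  obtain W' where W': "nbhd W'" "\<forall>x\<in>W'. \<forall>y\<in>W'. inv x \<otimes> y \<in> U2" using nbhd_div[OF U2(1)] by blast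
  define W where "W = W' \<inter> U1"
  have W: "nbhd W" using W' U1 by (auto simp: W_def)
  have U1U: "x \<in> U" if "x \<in> U1" for x using U1 that r_one[of x] nbhd_subset by (metis subsetD)
  have c: "x \<in> carrier G" if "x \<in> W \<or> x \<in> U1" for x using that nbhd_subset U1(1) by (auto simp: W_def)
  show ?thesis
  proof (intro exI[of _ W] conjI ballI allI impI)
    show "openin X W" "\<one> \<in> W" "W \<subseteq> U" using W U1U by (auto simp: W_def)
    fix g v p \<tau> assume g: "g \<in> carrier G" and v: "v \<in> g <# W"
      and \<tau>: "singular_simplex p (subtopology X (g <# W)) \<tau>"
    obtain w where w: "w \<in> W" "v = g \<otimes> w" using v by (auto simp: l_coset_def)
    have vc: "v \<in> carrier G" using w g c by auto
    have \<tau>': "singular_simplex p X \<tau>" "\<And>y. y \<in> standard_simplex p \<Longrightarrow> \<tau> y \<in> g <# W"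
      using \<tau> by (auto simp: singular_simplex_subtopology)
    have d: "inv v \<otimes> \<tau> y \<in> U2" if y: "y \<in> standard_simplex p" for y
    proof -
      obtain w' where w': "w' \<in> W" "\<tau> y = g \<otimes> w'" using \<tau>'(2)[OF y] by (auto simp: l_coset_def)
      have "inv v \<otimes> \<tau> y = inv w \<otimes> w'"
        using w w' g c by (simp add: inv_mult_group m_assoc) (simp add: m_assoc[symmetric])
      then show ?thesis using W' w w' by (auto simp: W_def)
    qed
    have "singular_simplex (Suc p) X (cone p v \<tau>)"
      using d U2 by (intro singular_simplex_cone vc \<tau>') auto
    moreover have "cone p v \<tau> x \<in> g <# U" if x: "x \<in> standard_simplex (Suc p)" for x
    proof (cases "x 0 = 1")
      case True
      then show ?thesis using x w U1U by (auto simp: cone_def l_coset_def W_def)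
    next
      case False
      have "x 0 \<in> {0..1}" using x by (auto simp: standard_simplex_def)
      then have *: "h (inv v \<otimes> \<tau> (opp_face x), x 0) \<in> U1"
        using U2(3) d[OF opp_face_in[OF x False]] by blast
      then have "w \<otimes> h (inv v \<otimes> \<tau> (opp_face x), x 0) \<in> U" using U1 w by (auto simp: W_def)
      moreover have "cone p v \<tau> x = g \<otimes> (w \<otimes> h (inv v \<otimes> \<tau> (opp_face x), x 0))"
        using x False w g c * by (simp add: cone_def m_assoc)
      ultimately show ?thesis by (auto simp: l_coset_def)
    qed
    ultimately show "singular_simplex (Suc p) (subtopology X (g <# U)) (cone p v \<tau>)"
      by (auto simp: singular_simplex_subtopology)
  qed
qed

lemma cone_face_0:
  assumes "v \<in> carrier G" "\<tau> \<in> standard_simplex p \<rightarrow>\<^sub>E carrier G"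
  shows "singular_face (Suc p) 0 (cone p v \<tau>) = \<tau>"
proof
  fix y show "singular_face (Suc p) 0 (cone p v \<tau>) y = \<tau> y"
  proof (cases "y \<in> standard_simplex p")
    case True
    have *: "simplical_face 0 y \<in> standard_simplex (Suc p)" "simplical_face 0 y 0 = 0"
      using simplical_face_in_standard_simplex[of "Suc p" 0 y] True by (auto simp: simplical_face_def)
    moreover have "opp_face (simplical_face 0 y) = y" by (simp add: opp_face_def simplical_face_def)
    moreover have "inv v \<otimes> \<tau> y \<in> carrier G" "v \<otimes> (inv v \<otimes> \<tau> y) = \<tau> y"
      using assms True by (auto simp: PiE_iff simp flip: m_assoc)
    ultimately show ?thesis using True by (simp add: singular_face_def cone_def h_0)
  next
    case False
    then show ?thesis using PiE_arb[OF assms(2) False] by (simp add: singular_face_def)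
  qed
qed

lemma cone_face_Suc:
  assumes "k \<le> Suc p"
  shows "singular_face (Suc (Suc p)) (Suc k) (cone (Suc p) v \<tau>) = cone p v (singular_face (Suc p) k \<tau>)"
proof
  fix y show "singular_face (Suc (Suc p)) (Suc k) (cone (Suc p) v \<tau>) y = cone p v (singular_face (Suc p) k \<tau>) y"
  proof (cases "y \<in> standard_simplex (Suc p)")
    case True
    have *: "simplical_face (Suc k) y \<in> standard_simplex (Suc (Suc p))" "simplical_face (Suc k) y 0 = y 0"
      using simplical_face_in_standard_simplex[of "Suc (Suc p)" "Suc k" y] True assms by (auto simp: simplical_face_def)
    moreover have "opp_face (simplical_face (Suc k) y) = simplical_face k (opp_face y)"
      by (auto simp: opp_face_def simplical_face_def fun_eq_iff)
    ultimately show ?thesis using True opp_face_in[OF True] by (simp add: singular_face_def cone_def)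
  next
    case False
    then show ?thesis by (simp add: singular_face_def cone_def)
  qed
qed

lemma cone_closed:
  assumes "v \<in> carrier G" "\<tau> \<in> standard_simplex p \<rightarrow>\<^sub>E carrier G"
  shows "cone p v \<tau> \<in> standard_simplex (Suc p) \<rightarrow>\<^sub>E carrier G"
proof -
  have "v \<otimes> h (inv v \<otimes> \<tau> (opp_face x), x 0) \<in> carrier G" if "x \<in> standard_simplex (Suc p)" "x 0 \<noteq> 1" for x
  proof -
    have "x 0 \<in> {0..1}" using that by (auto simp: standard_simplex_def)
    moreover have "\<tau> (opp_face x) \<in> carrier G" using assms opp_face_in[OF that] by (auto simp: PiE_iff)
    ultimately show ?thesis using assms h_closed by simp
  qed
  then show ?thesis using assms by (auto simp: cone_def)
qed

text \<open>The iterated cone with the given vertices, in their order.\<close>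

primrec straight :: "nat \<Rightarrow> (nat \<Rightarrow> 'a) \<Rightarrow> (nat \<Rightarrow> real) \<Rightarrow> 'a" where
  "straight 0 u = (\<lambda>_\<in>standard_simplex 0. u 0)"
| "straight (Suc p) u = cone p (u 0) (straight p (\<lambda>i. u (Suc i)))"

lemma straight_cong: "(\<And>i. i \<le> p \<Longrightarrow> u i = w i) \<Longrightarrow> straight p u = straight p w"
proof (induction p arbitrary: u w)
  case (Suc p)
  have "straight p (\<lambda>i. u (Suc i)) = straight p (\<lambda>i. w (Suc i))" by (rule Suc.IH) (simp add: Suc.prems)
  then show ?case using Suc.prems[of 0] by simp
qed simp

lemma straight_closed: "(\<And>i. i \<le> p \<Longrightarrow> u i \<in> carrier G) \<Longrightarrow> straight p u \<in> standard_simplex p \<rightarrow>\<^sub>E carrier G"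
proof (induction p arbitrary: u)
  case (Suc p)
  then have "straight p (\<lambda>i. u (Suc i)) \<in> standard_simplex p \<rightarrow>\<^sub>E carrier G" by auto
  then show ?case using Suc.prems cone_closed by simp
qed auto

lemma straight_vertex:
  assumes "\<And>i. i \<le> p \<Longrightarrow> u i \<in> carrier G" "i \<le> p"
  shows "straight p u (simplex_vertex i) = u i"
  using assms
proof (induction p arbitrary: u i)
  case (Suc p)
  have v: "simplex_vertex i \<in> standard_simplex (Suc p)" using Suc.prems(2) by (simp add: simplex_vertex_def)
  show ?case
  proof (cases i)
    case 0
    then show ?thesis using v by (simp add: cone_def) (simp add: simplex_vertex_def)
  next
    case (Suc j)
    have "opp_face (simplex_vertex i) = simplex_vertex j" "simplex_vertex i 0 = 0"
      by (auto simp: Suc opp_face_def simplex_vertex_def fun_eq_iff)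
    moreover have "straight p (\<lambda>i. u (Suc i)) (simplex_vertex j) = u (Suc j)"
      using Suc.prems Suc by (intro Suc.IH) auto
    moreover have "inv (u 0) \<otimes> u i \<in> carrier G" "u 0 \<otimes> (inv (u 0) \<otimes> u i) = u i"
      using Suc.prems by (auto simp flip: m_assoc)
    ultimately show ?thesis using v Suc by (simp add: cone_def h_0)
  qed
qed (simp add: simplex_vertex_def standard_simplex_0)

text \<open>Omitting the cone point leaves the base, and coning commutes with the other faces. The face of a
  \<open>1\<close>-simplex opposite to its last vertex is a separate case: it is the cone point itself, since a point has
  no faces to cone over.\<close>

lemma straight_face:
  assumes "\<And>i. i \<le> Suc p \<Longrightarrow> u i \<in> carrier G" "k \<le> Suc p"
  shows "singular_face (Suc p) k (straight (Suc p) u) = straight p (tuple_face (Suc p) k u)"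
proof (cases k)
  case 0
  have "singular_face (Suc p) k (straight (Suc p) u) = straight p (\<lambda>i. u (Suc i))"
    unfolding 0 straight.simps using assms by (intro cone_face_0 straight_closed) auto
  also have "\<dots> = straight p (tuple_face (Suc p) k u)"
    by (rule straight_cong) (simp add: tuple_face_def 0)
  finally show ?thesis .
next
  case (Suc l)
  then show ?thesis using assms
  proof (induction p arbitrary: u k l)
    case 0
    then have l: "l = 0" by simp
    have "singular_face (Suc 0) (Suc 0) (cone 0 (u 0) (straight 0 (\<lambda>i. u (Suc i)))) y
      = (\<lambda>_\<in>standard_simplex 0. u 0) y" for y
    proof (cases "y \<in> standard_simplex 0")
      case True
      have *: "simplical_face (Suc 0) y \<in> standard_simplex (Suc 0)"
        using simplical_face_in_standard_simplex[of "Suc 0" "Suc 0" y] True by auto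
      have "simplical_face (Suc 0) y 0 = 1" using True by (simp add: simplical_face_def standard_simplex_0)
      then show ?thesis using True * by (simp add: singular_face_def cone_def)
    qed (simp add: singular_face_def)
    then show ?case using 0 l by (simp add: tuple_face_def fun_eq_iff)
  next
    case (Suc p)
    let ?w = "\<lambda>i. u (Suc i)"
    have "singular_face (Suc (Suc p)) k (straight (Suc (Suc p)) u)
      = cone p (u 0) (singular_face (Suc p) l (straight (Suc p) ?w))"
      using Suc.prems by (simp add: cone_face_Suc del: straight.simps(2) add: straight.simps(2)[of "Suc p"])
    also have "singular_face (Suc p) l (straight (Suc p) ?w) = straight p (tuple_face (Suc p) l ?w)"
    proof (cases l)
      case 0
      have "singular_face (Suc p) l (straight (Suc p) ?w) = straight p (\<lambda>i. ?w (Suc i))"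
        unfolding 0 straight.simps using Suc.prems by (intro cone_face_0 straight_closed) auto
      also have "\<dots> = straight p (tuple_face (Suc p) l ?w)"
        by (rule straight_cong) (simp add: tuple_face_def 0)
      finally show ?thesis .
    next
      case (Suc m)
      show ?thesis by (rule Suc.IH[OF Suc]) (use Suc.prems in auto)
    qed
    also have "straight p (tuple_face (Suc p) l ?w) = straight p (\<lambda>i. tuple_face (Suc (Suc p)) k u (Suc i))"
      using Suc.prems by (intro straight_cong) (auto simp: tuple_face_def)
    finally show ?case using Suc.prems by (simp add: tuple_face_def)
  qed
qed

lemma straight_small:
  assumes "nbhd U"
  shows "\<exists>W. nbhd W \<and> W \<subseteq> U \<and> (\<forall>g\<in>carrier G. \<forall>u. (\<forall>i\<le>p. u i \<in> g <# W) \<longrightarrow>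
    singular_simplex p (subtopology X (g <# U)) (straight p u))"
  using assms
proof (induction p arbitrary: U)
  case 0
  have "singular_simplex 0 (subtopology X (g <# U)) (straight 0 u)" if "g \<in> carrier G" "u 0 \<in> g <# U" for g u
    using that nbhd_subset[OF openin_l_coset[of g U]] 0
    by (auto simp: singular_simplex_def topspace subsetD)
  then show ?case using 0 by blast
next
  case (Suc p)
  obtain W1 where W1: "nbhd W1" "W1 \<subseteq> U" "\<forall>g\<in>carrier G. \<forall>v\<in>g <# W1. \<forall>p \<tau>. singular_simplex p (subtopology X (g <# W1)) \<tau> \<longrightarrow>
      singular_simplex (Suc p) (subtopology X (g <# U)) (cone p v \<tau>)"
    using cone_small[OF Suc.prems] by blast
  obtain W2 where W2: "nbhd W2" "W2 \<subseteq> W1" "\<forall>g\<in>carrier G. \<forall>u. (\<forall>i\<le>p. u i \<in> g <# W2) \<longrightarrow>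
      singular_simplex p (subtopology X (g <# W1)) (straight p u)"
    using Suc.IH[OF W1(1)] by blast
  have "singular_simplex (Suc p) (subtopology X (g <# U)) (straight (Suc p) u)"
    if g: "g \<in> carrier G" and u: "\<forall>i\<le>Suc p. u i \<in> g <# W2" for g u
  proof -
    have "u 0 \<in> g <# W1" using u W2(2) by (auto simp: l_coset_def)
    moreover have "singular_simplex p (subtopology X (g <# W1)) (straight p (\<lambda>i. u (Suc i)))"
      using W2(3) g u by simp
    ultimately show ?thesis using W1(3) g by simp
  qed
  then show ?case using W1(2) W2(1,2) by (intro exI[of _ W2]) auto
qed

subsection \<open>The straightening homotopy\<close>

definition cone_chain :: "nat \<Rightarrow> 'a \<Rightarrow> 'a chain \<Rightarrow> 'a chain" where
  "cone_chain p v = frag_extend (\<lambda>\<tau>. frag_of (cone p v \<tau>))"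

text \<open>The cone operator contracts the complex, hence it turns cycles into boundaries.\<close>

lemma chain_boundary_cone_chain:
  assumes v: "v \<in> carrier G" and c: "Poly_Mapping.keys c \<subseteq> standard_simplex (Suc p) \<rightarrow>\<^sub>E carrier G"
  shows "chain_boundary (Suc (Suc p)) (cone_chain (Suc p) v c) = c - cone_chain p v (chain_boundary (Suc p) c)"
  using c
proof (induction c rule: frag_induction)
  case (one \<tau>)
  have "chain_boundary (Suc (Suc p)) (cone_chain (Suc p) v (frag_of \<tau>))
    = frag_of \<tau> + (\<Sum>k\<le>Suc p. frag_cmul ((- 1) ^ Suc k) (frag_of (cone p v (singular_face (Suc p) k \<tau>))))"
    using cone_face_0[OF v one]
    by (simp add: cone_chain_def chain_boundary_of sum.atMost_Suc_shift[of _ "Suc p"] cone_face_Suc del: sum.atMost_Suc)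
  also have "\<dots> = frag_of \<tau> - cone_chain p v (chain_boundary (Suc p) (frag_of \<tau>))"
    by (simp add: cone_chain_def chain_boundary_of frag_extend_sum o_def frag_extend_cmul sum_negf[symmetric] del: sum.atMost_Suc)
  finally show ?case .
qed (simp_all add: cone_chain_def frag_extend_diff chain_boundary_diff algebra_simps)

definition vertices :: "((nat \<Rightarrow> real) \<Rightarrow> 'a) \<Rightarrow> nat \<Rightarrow> 'a" where
  "vertices \<tau> = (\<lambda>i. \<tau> (simplex_vertex i))"

text \<open>Once the homotopy is known on the boundary, the difference to be bounded is a cycle. It lies near the first
  vertex of \<open>\<tau>\<close>, so its cone with that cone point bounds it.\<close>

primrec straight_homotopy :: "nat \<Rightarrow> ((nat \<Rightarrow> real) \<Rightarrow> 'a) \<Rightarrow> 'a chain" where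
  "straight_homotopy 0 = (\<lambda>_. 0)"
| "straight_homotopy (Suc p) = (\<lambda>\<tau>. cone_chain (Suc p) (\<tau> (simplex_vertex 0))
     (frag_of \<tau> - frag_of (straight (Suc p) (vertices \<tau>))
       - frag_extend (straight_homotopy p) (chain_boundary (Suc p) (frag_of \<tau>))))"

lemma vertices_singular_face:
  assumes "k \<le> Suc p" "i \<le> p"
  shows "vertices (singular_face (Suc p) k \<tau>) i = tuple_face (Suc p) k (vertices \<tau>) i"
proof -
  have "simplical_face k (simplex_vertex i) = simplex_vertex (if i < k then i else Suc i)"
    by (auto simp: simplical_face_def simplex_vertex_def fun_eq_iff)
  then show ?thesis
    using assms by (simp add: vertices_def singular_face_def tuple_face_def simplex_vertex_def[of i])
qed

lemma vertices_closed:
  assumes "singular_simplex p (subtopology X S) \<tau>" "i \<le> p"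
  shows "vertices \<tau> i \<in> S \<inter> carrier G"
proof -
  have "simplex_vertex i \<in> standard_simplex p" using assms(2) by (simp add: simplex_vertex_def)
  then show ?thesis
    using assms(1) by (auto simp: singular_simplex_def continuous_map_def vertices_def topspace)
qed

lemma singular_simplex_closed:
  assumes "singular_simplex p (subtopology X S) \<tau>"
  shows "\<tau> \<in> standard_simplex p \<rightarrow>\<^sub>E carrier G"
  using assms by (auto simp: singular_simplex_def continuous_map_def topspace PiE_iff)

lemma straight_vertices_boundary:
  assumes "singular_simplex (Suc p) X \<tau>"
  shows "chain_boundary (Suc p) (frag_of (straight (Suc p) (vertices \<tau>)))
    = frag_extend (\<lambda>\<tau>. frag_of (straight p (vertices \<tau>))) (chain_boundary (Suc p) (frag_of \<tau>))"
proof -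
  have c: "vertices \<tau> i \<in> carrier G" if "i \<le> Suc p" for i
    using vertices_closed[of "Suc p" UNIV \<tau> i] assms that by simp
  have "singular_face (Suc p) k (straight (Suc p) (vertices \<tau>)) = straight p (vertices (singular_face (Suc p) k \<tau>))"
    if "k \<le> Suc p" for k
  proof -
    have "singular_face (Suc p) k (straight (Suc p) (vertices \<tau>)) = straight p (tuple_face (Suc p) k (vertices \<tau>))"
      using c that by (rule straight_face)
    also have "\<dots> = straight p (vertices (singular_face (Suc p) k \<tau>))"
      using that by (intro straight_cong) (simp add: vertices_singular_face)
    finally show ?thesis .
  qed
  then show ?thesis
    by (simp add: chain_boundary_of frag_extend_sum o_def frag_extend_cmul del: sum.atMost_Suc straight.simps)
qed

text \<open>In each degree the neighbourhood is shrunk three times: for the homotopy of the boundary, for the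
  straightening, and for the cone.\<close>

lemma straight_homotopy_small:
  assumes "nbhd U"
  shows "\<exists>W. nbhd W \<and> W \<subseteq> U \<and> (\<forall>g\<in>carrier G. \<forall>\<tau>. singular_simplex p (subtopology X (g <# W)) \<tau> \<longrightarrow>
    singular_chain (Suc p) (subtopology X (g <# U)) (straight_homotopy p \<tau>) \<and>
    chain_boundary (Suc p) (straight_homotopy p \<tau>) =
      frag_of \<tau> - frag_of (straight p (vertices \<tau>))
        - frag_extend (straight_homotopy (p - 1)) (chain_boundary p (frag_of \<tau>)))"
  using assms
proof (induction p arbitrary: U)
  case 0
  have "\<tau> = straight 0 (vertices \<tau>)" if "singular_simplex 0 Y \<tau>" for \<tau> and Y :: "'a topology"
  proof -
    have "\<tau> \<in> extensional (standard_simplex 0)" using that by (simp add: singular_simplex_def)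
    moreover have "simplex_vertex 0 = (\<lambda>j. if j = 0 then 1 else 0)" by (simp add: simplex_vertex_def fun_eq_iff)
    ultimately show ?thesis
      by (intro ext) (auto simp: vertices_def extensional_def standard_simplex_0)
  qed
  then have "frag_of \<tau> = frag_of (straight 0 (vertices \<tau>))" if "singular_simplex 0 Y \<tau>" for \<tau> and Y :: "'a topology"
    using that by metis
  then show ?case
    using 0 by (intro exI[of _ U]) (simp add: chain_boundary_def del: straight.simps)
next
  case (Suc p)
  obtain W1 where W1: "nbhd W1" "W1 \<subseteq> U" "\<forall>g\<in>carrier G. \<forall>v\<in>g <# W1. \<forall>p \<tau>. singular_simplex p (subtopology X (g <# W1)) \<tau> \<longrightarrow>
      singular_simplex (Suc p) (subtopology X (g <# U)) (cone p v \<tau>)"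
    using cone_small[OF Suc.prems] by blast
  obtain W2 where W2: "nbhd W2" "W2 \<subseteq> W1" "\<forall>g\<in>carrier G. \<forall>u. (\<forall>i\<le>Suc p. u i \<in> g <# W2) \<longrightarrow>
      singular_simplex (Suc p) (subtopology X (g <# W1)) (straight (Suc p) u)"
    using straight_small[OF W1(1), of "Suc p"] by blast
  obtain W where W: "nbhd W" "W \<subseteq> W2" "\<And>g \<tau>. g \<in> carrier G \<Longrightarrow> singular_simplex p (subtopology X (g <# W)) \<tau> \<Longrightarrow>
      singular_chain (Suc p) (subtopology X (g <# W2)) (straight_homotopy p \<tau>) \<and>
      chain_boundary (Suc p) (straight_homotopy p \<tau>) =
        frag_of \<tau> - frag_of (straight p (vertices \<tau>))
        - frag_extend (straight_homotopy (p - 1)) (chain_boundary p (frag_of \<tau>))"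
    using Suc.IH[OF W2(1)] by blast
  have mono: "g <# A \<subseteq> g <# B" if "A \<subseteq> B" for A B g using that by (auto simp: l_coset_def)
  show ?case
  proof (intro exI[of _ W] conjI ballI allI impI)
    show "openin X W" "\<one> \<in> W" "W \<subseteq> U" using W W2 W1 by auto
    fix g \<tau> assume g: "g \<in> carrier G" and \<tau>: "singular_simplex (Suc p) (subtopology X (g <# W)) \<tau>"
    let ?b = "chain_boundary (Suc p) (frag_of \<tau>)"
    let ?z = "frag_of \<tau> - frag_of (straight (Suc p) (vertices \<tau>)) - frag_extend (straight_homotopy p) ?b"
    have b: "singular_chain p (subtopology X (g <# W)) ?b"
      using \<tau> by (intro singular_chain_boundary_alt) (simp add: singular_chain_of)
    have bb: "chain_boundary p ?b = 0"
      using \<tau> by (intro chain_boundary_boundary_alt) (simp add: singular_chain_of)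
    have vert: "vertices \<tau> i \<in> g <# W2" if "i \<le> Suc p" for i
      using vertices_closed[OF \<tau> that] mono[OF W(2)] by blast
    have z: "singular_chain (Suc p) (subtopology X (g <# W1)) ?z"
    proof (intro singular_chain_diff singular_chain_extend)
      show "singular_chain (Suc p) (subtopology X (g <# W1)) (frag_of \<tau>)"
        using \<tau> singular_simplex_mono mono W(2) W2(2) by (metis order_trans singular_chain_of)
      show "singular_chain (Suc p) (subtopology X (g <# W1)) (frag_of (straight (Suc p) (vertices \<tau>)))"
        using W2(3) vert g by (simp add: singular_chain_of del: straight.simps)
      show "singular_chain (Suc p) (subtopology X (g <# W1)) (straight_homotopy p c)" if "c \<in> Poly_Mapping.keys ?b" for c
      proof -
        have "singular_simplex p (subtopology X (g <# W)) c" using b that by (auto simp: singular_chain_def)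
        then show ?thesis
          using W(3)[OF g, of c] singular_chain_mono[OF _ mono[OF W2(2)]] by blast
      qed
    qed
    have v0: "\<tau> (simplex_vertex 0) \<in> g <# W1" "\<tau> (simplex_vertex 0) \<in> carrier G"
      using vert[of 0] mono[OF W2(2), of g] vertices_closed[OF \<tau>, of 0] by (auto simp: vertices_def)
    have ext: "chain_boundary (Suc p) (frag_extend (straight_homotopy p) c) =
        c - frag_extend (\<lambda>\<tau>. frag_of (straight p (vertices \<tau>))) c
        - frag_extend (straight_homotopy (p - 1)) (chain_boundary p c)"
      if "singular_chain p (subtopology X (g <# W)) c" for c
      using that unfolding singular_chain_def
    proof (induction c rule: frag_induction)
      case (one \<tau>)
      then show ?case using W(3)[OF g, of \<tau>] by simp
    qed (simp_all add: frag_extend_diff chain_boundary_diff algebra_simps)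
    \<comment> \<open>As a cycle, \<open>?z\<close> is the boundary of the cone over it.\<close>
    have "chain_boundary (Suc p) ?z = 0"
      using straight_vertices_boundary[of p \<tau>] \<tau> ext[OF b] bb
      by (simp add: chain_boundary_diff singular_simplex_subtopology del: straight.simps)
    moreover have "Poly_Mapping.keys ?z \<subseteq> standard_simplex (Suc p) \<rightarrow>\<^sub>E carrier G"
      using z singular_simplex_closed unfolding singular_chain_def by blast
    ultimately show "chain_boundary (Suc (Suc p)) (straight_homotopy (Suc p) \<tau>) =
        frag_of \<tau> - frag_of (straight (Suc p) (vertices \<tau>))
        - frag_extend (straight_homotopy (Suc p - 1)) (chain_boundary (Suc p) (frag_of \<tau>))"
      using chain_boundary_cone_chain[OF v0(2), of ?z p]
      by (simp add: cone_chain_def del: straight.simps)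
    show "singular_chain (Suc (Suc p)) (subtopology X (g <# U)) (straight_homotopy (Suc p) \<tau>)"
      unfolding straight_homotopy.simps cone_chain_def
    proof (rule singular_chain_extend)
      fix \<sigma> assume "\<sigma> \<in> Poly_Mapping.keys ?z"
      then have "singular_simplex (Suc p) (subtopology X (g <# W1)) \<sigma>" using z by (auto simp: singular_chain_def)
      then show "singular_chain (Suc (Suc p)) (subtopology X (g <# U)) (frag_of (cone (Suc p) (\<tau> (simplex_vertex 0)) \<sigma>))"
        using W1(3) g v0(1) by (simp add: singular_chain_of)
    qed
  qed
qed

subsection \<open>Comparison of the complexes of tuples and of singular simplices\<close>

lemma straight_small_tuples:
  assumes "nbhd U"
  shows "\<exists>W. nbhd W \<and> W \<subseteq> U \<and> straight n ` small_tuples (translate_cover G W) n \<subseteq> small_simplices X (translate_cover G U) n"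
proof -
  obtain W where W: "nbhd W" "W \<subseteq> U" "\<forall>g\<in>carrier G. \<forall>u. (\<forall>i\<le>n. u i \<in> g <# W) \<longrightarrow>
    singular_simplex n (subtopology X (g <# U)) (straight n u)"
    using straight_small[OF assms, of n] by blast
  have "straight n u \<in> small_simplices X (translate_cover G U) n" if u: "u \<in> small_tuples (translate_cover G W) n" for u
  proof -
    obtain g where g: "g \<in> carrier G" "u \<in> {..n} \<rightarrow>\<^sub>E g <# W"
      using u unfolding small_tuples_translate by blast
    then have "\<forall>i\<le>n. u i \<in> g <# W" by auto
    then show ?thesis using W(3) g(1) small_simplices_translate by blast
  qed
  then show ?thesis using W(1,2) by (intro exI[of _ W]) auto
qed

lemma bd_straight:
  assumes "\<And>i. i \<le> Suc n \<Longrightarrow> u i \<in> carrier G"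
  shows "bd singular_face (Suc n) (straight (Suc n) u)
    = frag_extend (\<lambda>u. frag_of (straight n u)) (bd tuple_face (Suc n) u)"
  using straight_face[OF assms]
  by (simp add: bd_def frag_extend_sum o_def frag_extend_cmul del: sum.atMost_Suc straight.simps)

lemma frag_eval_bd_straight:
  fixes V :: "'v monoid"
  assumes V: "comm_group V" and W: "openin X W" "u \<in> small_tuples (translate_cover G W) (Suc n)"
    and b: "\<And>w. w \<in> small_tuples (translate_cover G W) n \<Longrightarrow> b (straight n w) \<in> carrier V"
  shows "frag_eval V (\<lambda>w\<in>small_tuples (translate_cover G W) n. b (straight n w)) (bd tuple_face (Suc n) u)
    = frag_eval V b (bd singular_face (Suc n) (straight (Suc n) u))"
proof -
  interpret V: comm_group V by (rule V)
  interpret T: function_cx "small_tuples (translate_cover G W)" tuple_face V by (rule function_cx_tuples[OF V])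
  have u: "u i \<in> carrier G" if "i \<le> Suc n" for i using small_tuples_carrier[OF W that] .
  have e: "bd singular_face (Suc n) (straight (Suc n) u)
    = frag_extend (\<lambda>u. frag_of (straight n u)) (bd tuple_face (Suc n) u)"
    using u by (rule bd_straight)
  show ?thesis
    unfolding e V.frag_eval_extend
    using T.keys_bd[OF W(2)] b by (intro V.frag_eval_cong) (auto simp del: straight.simps)
qed

lemma vertex_map_straight:
  assumes "openin X W" "u \<in> small_tuples (translate_cover G W) n" "straight n u \<in> small_simplices X \<UU> n"
  shows "vertex_map X \<UU> n a (straight n u) = a u"
proof -
  have "(\<lambda>i\<in>{..n}. straight n u (simplex_vertex i)) = u"
    using straight_vertex[of n u] small_tuples_carrier[OF assms(1,2)] assms(2)
    by (auto simp: fun_eq_iff small_tuples_def PiE_iff extensional_def)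
  then show ?thesis using assms(3) by (simp add: vertex_map_def)
qed

text \<open>If the vertex cochain of \<open>a\<close> is the coboundary of \<open>b\<close>, then \<open>a\<close> is the coboundary of \<open>b\<close> composed with
  straightening, on tuples that are so small that their straightenings are \<open>U\<close>-small.\<close>

theorem vertex_map_injective:
  fixes V :: "'v monoid"
  assumes V: "comm_group V" and U: "nbhd U"
    and a: "a \<in> cocycles (A_complex (translate_cover G U) V) n"
    and va: "vertex_map X (translate_cover G U) n a \<in> coboundaries (S_complex X (translate_cover G U) V) n"
  shows "\<exists>W0. nbhd W0 \<and> W0 \<subseteq> U \<and> (\<forall>W. nbhd W \<and> W \<subseteq> W0 \<longrightarrow>
    restrict a (small_tuples (translate_cover G W) n) \<in> coboundaries (A_complex (translate_cover G W) V) n)"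
proof -
  interpret V: comm_group V by (rule V)
  let ?tu = "\<lambda>W. small_tuples (translate_cover G W)" and ?si = "\<lambda>W. small_simplices X (translate_cover G W)"
  interpret SU: function_cx "?si U" singular_face V by (rule function_cx_small[OF V])
  obtain W1 where W1: "nbhd W1" "W1 \<subseteq> U" "straight n ` ?tu W1 n \<subseteq> ?si U n"
    using straight_small_tuples[OF U] by blast
  obtain W2 where W2: "nbhd W2" "W2 \<subseteq> U" "straight (n - 1) ` ?tu W2 (n - 1) \<subseteq> ?si U (n - 1)"
    using straight_small_tuples[OF U] by blast
  have "restrict a (?tu W n) \<in> coboundaries (A_complex (translate_cover G W) V) n"
    if W: "nbhd W" "W \<subseteq> W1 \<inter> W2" for W
  proof -
    interpret AW: function_cx "?tu W" tuple_face V by (rule function_cx_tuples[OF V])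
    have st: "straight n u \<in> ?si U n" if "u \<in> ?tu W n" for u
      using W1(3) small_tuples_mono[of W W1 n] W that by blast
    have au: "a u = vertex_map X (translate_cover G U) n a (straight n u)" if "u \<in> ?tu W n" for u
      using vertex_map_straight[of W u n "translate_cover G U" a] W that st[OF that] by simp
    show ?thesis
    proof (cases n)
      case 0
      have "vertex_map X (translate_cover G U) n a (straight n u) = \<one>\<^bsub>V\<^esub>" if "u \<in> ?tu W n" for u
        using va st[OF that] 0 by (simp add: S_complex_def del: straight.simps)
      then show ?thesis using au 0 by (auto simp: A_complex_def fun_eq_iff)
    next
      case (Suc m)
      obtain b where b: "b \<in> ?si U m \<rightarrow>\<^sub>E carrier V"
        "vertex_map X (translate_cover G U) n a = (\<lambda>s\<in>?si U (Suc m). frag_eval V b (bd singular_face (Suc m) s))"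
        using va unfolding Suc S_complex_def SU.coboundaries_fc by blast
      have sm: "straight m u \<in> ?si U m" if "u \<in> ?tu W m" for u
        using W2(3) small_tuples_mono[of W W2 m] W that Suc by auto
      define b' where "b' = (\<lambda>w\<in>?tu W m. b (straight m w))"
      have "a u = frag_eval V b' (bd tuple_face (Suc m) u)" if u: "u \<in> ?tu W (Suc m)" for u
        unfolding b'_def using frag_eval_bd_straight[OF V _ u, of b] b sm W(1) au[of u] st[of u] u Suc
        by (auto simp: PiE_iff simp del: straight.simps)
      moreover have "b' \<in> ?tu W m \<rightarrow>\<^sub>E carrier V" using b sm by (auto simp: b'_def PiE_iff)
      ultimately show ?thesis
        unfolding Suc A_complex_def AW.coboundaries_fc by (intro bexI[of _ b']) auto
    qed
  qed
  then show ?thesis using W1 W2 by (intro exI[of _ "W1 \<inter> W2"]) auto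
qed

text \<open>The cochain \<open>f\<close> composed with straightening is a cocycle on tuples. By the straightening homotopy, \<open>f\<close>
  differs from its vertex cochain by the coboundary of \<open>f\<close> evaluated on the homotopy.\<close>

theorem vertex_map_surjective:
  fixes V :: "'v monoid"
  assumes V: "comm_group V" and f: "f \<in> cocycles (singular_cochain_complex X V) n"
  shows "\<exists>W0. nbhd W0 \<and> (\<forall>W. nbhd W \<and> W \<subseteq> W0 \<longrightarrow>
    (\<exists>a\<in>cocycles (A_complex (translate_cover G W) V) n. \<exists>b\<in>coboundaries (S_complex X (translate_cover G W) V) n.
      restrict f (small_simplices X (translate_cover G W) n) =
        b \<otimes>\<^bsub>grp (S_complex X (translate_cover G W) V) n\<^esub> vertex_map X (translate_cover G W) n a))"
proof -
  interpret V: comm_group V by (rule V)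
  let ?tu = "\<lambda>W. small_tuples (translate_cover G W)" and ?si = "\<lambda>W. small_simplices X (translate_cover G W)"
  interpret T: function_cx "\<lambda>n. singular_simplex_set n X" singular_face V by (rule function_cx_singular[OF V])
  have f': "f \<in> cocycles T.FC n" using f by (simp add: singular_cochain_complex_def)
  have fin: "f \<in> singular_simplex_set n X \<rightarrow>\<^sub>E carrier V" using f' by (simp add: T.cocycles_fc)
  have C: "nbhd (carrier G)" using topspace openin_topspace[of X] by simp
  obtain W1 where W1: "nbhd W1" "straight n ` ?tu W1 n \<subseteq> ?si (carrier G) n"
    using straight_small_tuples[OF C] by blast
  obtain W2 where W2: "nbhd W2" "straight (Suc n) ` ?tu W2 (Suc n) \<subseteq> ?si (carrier G) (Suc n)"
    using straight_small_tuples[OF C] by blast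
  obtain W3 where W3: "nbhd W3" "\<And>g \<tau>. g \<in> carrier G \<Longrightarrow> singular_simplex n (subtopology X (g <# W3)) \<tau> \<Longrightarrow>
    singular_chain (Suc n) (subtopology X (g <# carrier G)) (straight_homotopy n \<tau>) \<and>
    chain_boundary (Suc n) (straight_homotopy n \<tau>) =
      frag_of \<tau> - frag_of (straight n (vertices \<tau>))
        - frag_extend (straight_homotopy (n - 1)) (chain_boundary n (frag_of \<tau>))"
    using straight_homotopy_small[OF C, of n] by blast
  have "\<exists>a\<in>cocycles (A_complex (translate_cover G W) V) n. \<exists>b\<in>coboundaries (S_complex X (translate_cover G W) V) n.
      restrict f (?si W n) = b \<otimes>\<^bsub>grp (S_complex X (translate_cover G W) V) n\<^esub> vertex_map X (translate_cover G W) n a"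
    if W: "nbhd W" "W \<subseteq> W1 \<inter> W2 \<inter> W3" for W
  proof -
    interpret AW: function_cx "?tu W" tuple_face V by (rule function_cx_tuples[OF V])
    interpret SW: function_cx "?si W" singular_face V by (rule function_cx_small[OF V])
    have s1: "singular_simplex n X (straight n u)" if "u \<in> ?tu W n" for u
      using W1(2) small_tuples_mono[of W W1 n] W that small_simplices_subset by blast
    have s2: "singular_simplex (Suc n) X (straight (Suc n) u)" if "u \<in> ?tu W (Suc n)" for u
      using W2(2) small_tuples_mono[of W W2 "Suc n"] W that small_simplices_subset by blast
    define a where "a = (\<lambda>w\<in>?tu W n. f (straight n w))"
    have "frag_eval V a (bd tuple_face (Suc n) u) = \<one>\<^bsub>V\<^esub>" if u: "u \<in> ?tu W (Suc n)" for u
    proof -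
      have "frag_eval V a (bd tuple_face (Suc n) u) = frag_eval V f (bd singular_face (Suc n) (straight (Suc n) u))"
        unfolding a_def using W(1) u fin s1 by (intro frag_eval_bd_straight[OF V]) (auto simp: PiE_iff)
      also have "\<dots> = \<one>\<^bsub>V\<^esub>" using f' s2[OF u] by (simp add: T.cocycles_fc del: straight.simps)
      finally show ?thesis .
    qed
    moreover have "a \<in> ?tu W n \<rightarrow>\<^sub>E carrier V" using fin s1 by (auto simp: a_def PiE_iff)
    ultimately have a: "a \<in> cocycles (A_complex (translate_cover G W) V) n"
      by (simp add: A_complex_def AW.cocycles_fc)
    \<comment> \<open>For \<open>n = 0\<close> the boundary is \<open>0\<close> and \<open>e\<close> is trivial, as coboundaries in degree \<open>0\<close> must be.\<close>
    define e where "e = (\<lambda>\<tau>\<in>?si W n. frag_eval V f (frag_extend (straight_homotopy (n - 1)) (chain_boundary n (frag_of \<tau>))))"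
    have e: "e \<in> coboundaries (S_complex X (translate_cover G W) V) n"
    proof (cases n)
      case 0
      then show ?thesis by (simp add: e_def S_complex_def chain_boundary_def)
    next
      case (Suc m)
      define b where "b = (\<lambda>\<sigma>\<in>?si W m. frag_eval V f (straight_homotopy m \<sigma>))"
      have "e \<tau> = frag_eval V b (bd singular_face (Suc m) \<tau>)" if "\<tau> \<in> ?si W (Suc m)" for \<tau>
        using SW.keys_bd[OF that] that unfolding bd_singular_face
        by (auto simp: e_def Suc V.frag_eval_extend b_def intro!: V.frag_eval_cong)
      then show ?thesis
        unfolding Suc S_complex_def SW.coboundaries_fc
        by (intro bexI[of _ b]) (auto simp: b_def e_def Suc)
    qed
    have "f \<tau> = e \<tau> \<otimes>\<^bsub>V\<^esub> a (restrict (vertices \<tau>) {..n})" if \<tau>: "\<tau> \<in> ?si W n" for \<tau>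
    proof -
      obtain g where g: "g \<in> carrier G" "singular_simplex n (subtopology X (g <# W)) \<tau>"
        using \<tau> by (auto simp: small_simplices_translate)
      have sub: "g <# W \<subseteq> g <# W3" using W by (auto simp: l_coset_def)
      have rv: "restrict (vertices \<tau>) {..n} \<in> ?tu W n"
        using vertices_closed[OF g(2)] g(1) by (auto simp: small_tuples_translate)
      have sv: "straight n (restrict (vertices \<tau>) {..n}) = straight n (vertices \<tau>)"
        by (rule straight_cong) simp
      note h = W3(2)[OF g(1) singular_simplex_mono[OF g(2) sub]]
      let ?e = "frag_extend (straight_homotopy (n - 1)) (chain_boundary n (frag_of \<tau>))"
      have k: "Poly_Mapping.keys (straight_homotopy n \<tau>) \<subseteq> singular_simplex_set (Suc n) X"
        using h by (auto simp: singular_chain_def singular_simplex_subtopology)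
      have fs: "f (straight n (vertices \<tau>)) \<in> carrier V" using s1[OF rv] fin by (auto simp: sv PiE_iff)
      have "frag_of \<tau> = chain_boundary (Suc n) (straight_homotopy n \<tau>) + (?e + frag_of (straight n (vertices \<tau>)))"
        using h by simp
      from arg_cong[OF this, of "frag_eval V f"]
      have "frag_eval V f (frag_of \<tau>) = frag_eval V f (chain_boundary (Suc n) (straight_homotopy n \<tau>))
          \<otimes>\<^bsub>V\<^esub> (frag_eval V f ?e \<otimes>\<^bsub>V\<^esub> f (straight n (vertices \<tau>)))"
        using fs by (simp only: V.frag_eval_add V.frag_eval_of)
      also have "frag_eval V f (chain_boundary (Suc n) (straight_homotopy n \<tau>)) = \<one>\<^bsub>V\<^esub>"
        using T.cocycle_eval_bd[OF f' k] by (simp add: frag_extend_bd_singular)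
      also have "frag_eval V f (frag_of \<tau>) = f \<tau>"
        using fin g(2) by (intro V.frag_eval_of) (auto simp: PiE_iff singular_simplex_subtopology)
      finally show ?thesis using fs \<tau> rv by (simp add: e_def a_def sv)
    qed
    then have "restrict f (?si W n) =
        e \<otimes>\<^bsub>grp (S_complex X (translate_cover G W) V) n\<^esub> vertex_map X (translate_cover G W) n a"
      by (auto simp: S_complex_def vertex_map_def vertices_def fun_eq_iff restrict_def)
    then show ?thesis using a e by blast
  qed
  then show ?thesis using W1(1) W2(1) W3(1) by (intro exI[of _ "W1 \<inter> W2 \<inter> W3"]) auto
qed

end

section \<open>Calculus of maps of class C^k on subsets of topological vector spaces\<close>

subsection \<open>Continuity in topological vector spaces\<close>

lemma continuous_on_scaleR_tvs [continuous_intros]: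
  fixes g :: "'b::topological_space \<Rightarrow> 'a :: real_tvs"
  assumes "continuous_on A f" "continuous_on A g"
  shows "continuous_on A (\<lambda>x. f x *\<^sub>R g x)"
  using assms unfolding continuous_on_def by (auto intro: tendsto_scaleR_tvs)

text \<open>Continuity must be demanded separately: the spaces may be infinite-dimensional.\<close>

definition cont_linear :: "('a::real_tvs \<Rightarrow> 'b::real_tvs) \<Rightarrow> bool" where
  "cont_linear L \<longleftrightarrow> linear L \<and> continuous_on UNIV L"

lemma cont_linearD:
  assumes "cont_linear L"
  shows "L (x + y) = L x + L y" "L (c *\<^sub>R x) = c *\<^sub>R L x" "L (x - y) = L x - L y" "L 0 = 0" "continuous_on A L"
  using assms linear_diff[of L] linear_0[of L]
  by (auto simp: cont_linear_def linear_add linear_scale intro: continuous_on_subset)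

lemma cont_linearI:
  assumes "\<And>x y. L (x + y) = L x + L y" "\<And>c x. L (c *\<^sub>R x) = c *\<^sub>R L x" "continuous_on UNIV L"
  shows "cont_linear L"
  using assms by (simp add: cont_linear_def linearI)

lemma cont_linear_compose: "cont_linear L \<Longrightarrow> cont_linear M \<Longrightarrow> cont_linear (\<lambda>x. M (L x))"
  using continuous_on_compose2[of UNIV M UNIV L]
  by (auto intro!: cont_linearI simp: cont_linearD)

lemma cont_linear_fst: "cont_linear fst" and cont_linear_snd: "cont_linear snd"
  by (auto intro!: cont_linearI continuous_intros)

lemma cont_linear_Pair: "cont_linear L \<Longrightarrow> cont_linear M \<Longrightarrow> cont_linear (\<lambda>x. (L x, M x))"
  by (intro cont_linearI) (auto simp: cont_linearD intro!: continuous_intros)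

lemma cont_linear_id: "cont_linear (\<lambda>x. x)"
  by (intro cont_linearI) (auto intro: continuous_intros)

lemma cont_linear_fun: "(\<And>i. cont_linear (\<lambda>x. L x i)) \<Longrightarrow> cont_linear L"
proof (intro cont_linearI continuous_on_coordinatewise_then_product ext)
  fix x y c i assume L: "\<And>i. cont_linear (\<lambda>x. L x i)"
  show "L (x + y) i = (L x + L y) i" "L (c *\<^sub>R x) i = (c *\<^sub>R L x) i" "continuous_on UNIV (\<lambda>x. L x i)"
    using cont_linearD[OF L[of i]] by simp_all
qed

lemma cont_linear_apply: "cont_linear (\<lambda>x. x i)"
  by (intro cont_linearI) (auto intro: continuous_on_product_coordinates)

subsection \<open>The coordinates of the packed space\<close>

text \<open>A point of the packed space is a triple: a base point, a direction and a time.\<close>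

definition pt :: "'a::real_tvs bgn \<Rightarrow> 'a bgn" where "pt p = fst (unpack p)"
definition dir :: "'a::real_tvs bgn \<Rightarrow> 'a bgn" where "dir p = fst (snd (unpack p))"
definition time :: "'a::real_tvs bgn \<Rightarrow> real" where "time p = snd (snd (unpack p))"

lemma unpack_pack [simp]: "unpack (pack x v t) = (x, v, t)" for x :: "'a::real_tvs bgn"
  using homeomorphism_apply1[OF homeomorphism_pack, of "(x, v, t)"] by simp

lemma pack_coords [simp]: "pt (pack x v t) = x" "dir (pack x v t) = v" "time (pack x v t) = t"
  by (simp_all add: pt_def dir_def time_def)

lemma pack_pt_dir_time: "pack (pt p) (dir p) (time p) = p"
  using homeomorphism_apply2[OF homeomorphism_pack, of p] by (simp add: pt_def dir_def time_def case_prod_unfold)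

lemma cont_unpack: "continuous_on UNIV (unpack :: 'a::real_tvs bgn \<Rightarrow> _)"
  using homeomorphism_pack homeomorphism_def by blast

lemma cont_linear_unpack: "cont_linear (unpack :: 'a::real_tvs bgn \<Rightarrow> _)"
  by (intro cont_linearI cont_unpack) (auto simp: unpack_def fun_eq_iff)

lemma cont_linear_coords: "cont_linear pt" "cont_linear dir" "cont_linear time"
  unfolding pt_def[abs_def] dir_def[abs_def] time_def[abs_def]
  by (intro cont_linear_compose[OF cont_linear_compose[OF cont_linear_unpack cont_linear_snd]]
    cont_linear_compose[OF cont_linear_unpack] cont_linear_fst cont_linear_snd)+

lemma pack_linear:
  "pack (x + x') (v + v') (t + t') = pack x v t + pack x' v' t'"
  "pack (c *\<^sub>R x) (c *\<^sub>R v) (c * t) = c *\<^sub>R pack x v t" for x :: "'a::real_tvs bgn"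
  by (auto simp: pack_def fun_eq_iff split: nat.split)

lemma cont_linear_pack: "cont_linear (\<lambda>(x, v, t). pack x v t :: 'a::real_tvs bgn)"
proof (intro cont_linearI)
  show "continuous_on UNIV (\<lambda>(x, v, t). pack x v t :: 'a bgn)"
    using homeomorphism_pack homeomorphism_def by blast
qed (simp_all add: case_prod_unfold pack_linear)

text \<open>The model space and the domain of the difference quotient of a map with model space \<open>S\<close> and domain \<open>W\<close>.
  The packing makes both live in the type of \<open>S\<close> again, so that statements about \<open>C\<^sup>k\<close> can be proved by
  induction on \<open>k\<close> with \<open>S\<close> and \<open>W\<close> arbitrary.\<close>

definition next_space :: "'a::real_tvs bgn set \<Rightarrow> 'a bgn set" where
  "next_space S = {pack x v t |x v t. x \<in> S \<and> v \<in> S}"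

definition next_dom :: "'a::real_tvs bgn set \<Rightarrow> 'a bgn set \<Rightarrow> 'a bgn set" where
  "next_dom S W = {pack x v t |x v t. x \<in> W \<and> v \<in> S \<and> x + t *\<^sub>R v \<in> W}"

lemma next_space_iff: "p \<in> next_space S \<longleftrightarrow> pt p \<in> S \<and> dir p \<in> S"
  unfolding next_space_def mem_Collect_eq by (metis pack_coords pack_pt_dir_time)

lemma next_dom_iff: "p \<in> next_dom S W \<longleftrightarrow> pt p \<in> W \<and> dir p \<in> S \<and> pt p + time p *\<^sub>R dir p \<in> W"
  unfolding next_dom_def mem_Collect_eq by (metis pack_coords pack_pt_dir_time)

lemma BGN_C_Suc: "BGN_C (Suc k) S W T f \<longleftrightarrow> continuous_on W f \<and> f ` W \<subseteq> T \<and>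
  (\<exists>g. (\<forall>p\<in>next_dom S W. f (pt p + time p *\<^sub>R dir p) - f (pt p) = time p *\<^sub>R g p) \<and>
    BGN_C k (next_space S) (next_dom S W) T g)"
proof -
  have "(\<forall>x\<in>W. \<forall>v\<in>S. \<forall>t. x + t *\<^sub>R v \<in> W \<longrightarrow> f (x + t *\<^sub>R v) - f x = t *\<^sub>R g (pack x v t)) \<longleftrightarrow>
    (\<forall>p\<in>next_dom S W. f (pt p + time p *\<^sub>R dir p) - f (pt p) = time p *\<^sub>R g p)" for g
  proof (intro iffI ballI allI impI)
    fix p assume *: "\<forall>x\<in>W. \<forall>v\<in>S. \<forall>t. x + t *\<^sub>R v \<in> W \<longrightarrow> f (x + t *\<^sub>R v) - f x = t *\<^sub>R g (pack x v t)"
      and "p \<in> next_dom S W"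
    then have "f (pt p + time p *\<^sub>R dir p) - f (pt p) = time p *\<^sub>R g (pack (pt p) (dir p) (time p))"
      unfolding next_dom_iff by blast
    then show "f (pt p + time p *\<^sub>R dir p) - f (pt p) = time p *\<^sub>R g p"
      by (simp only: pack_pt_dir_time)
  next
    fix x v t assume *: "\<forall>p\<in>next_dom S W. f (pt p + time p *\<^sub>R dir p) - f (pt p) = time p *\<^sub>R g p"
      and "x \<in> W" "v \<in> S" "x + t *\<^sub>R v \<in> W"
    then have "pack x v t \<in> next_dom S W" by (simp add: next_dom_iff)
    from bspec[OF * this] show "f (x + t *\<^sub>R v) - f x = t *\<^sub>R g (pack x v t)" by simp
  qed
  then show ?thesis by (simp add: next_space_def next_dom_def)
qed

lemma BGN_C_SucI:
  assumes "continuous_on W f" "\<And>x. x \<in> W \<Longrightarrow> f x \<in> T"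
    and "\<And>p. p \<in> next_dom S W \<Longrightarrow> f (pt p + time p *\<^sub>R dir p) - f (pt p) = time p *\<^sub>R g p"
    and "BGN_C k (next_space S) (next_dom S W) T g"
  shows "BGN_C (Suc k) S W T f"
  unfolding BGN_C_Suc using assms by (intro conjI exI[of _ g] ballI image_subsetI)

declare BGN_C.simps(2) [simp del]

lemma BGN_C_cont: "BGN_C k S W T f \<Longrightarrow> continuous_on W f"
  by (cases k) (auto simp: BGN_C_Suc)

lemma BGN_C_into: "BGN_C k S W T f \<Longrightarrow> x \<in> W \<Longrightarrow> f x \<in> T"
  by (cases k) (auto simp: BGN_C_Suc)

lemma BGN_C_subset: "BGN_C k S W T f \<Longrightarrow> W' \<subseteq> W \<Longrightarrow> BGN_C k S W' T f"
proof (induction k arbitrary: S W W' f)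
  case (Suc k)
  have "next_dom S W' \<subseteq> next_dom S W" using Suc.prems(2) by (auto simp: next_dom_iff)
  then show ?case using Suc.prems Suc.IH unfolding BGN_C_Suc
    by (meson continuous_on_subset image_mono order_trans subsetD)
qed (auto intro: continuous_on_subset)

lemma BGN_C_cong:
  assumes "BGN_C k S W T f" "\<And>x. x \<in> W \<Longrightarrow> f x = g x"
  shows "BGN_C k S W T g"
proof (cases k)
  case 0
  then show ?thesis using assms by (auto cong: continuous_on_cong)
next
  case (Suc m)
  have "continuous_on W g" "g ` W \<subseteq> T"
    using BGN_C_cont[OF assms(1)] BGN_C_into[OF assms(1)] assms(2) by (auto cong: continuous_on_cong)
  then show ?thesis using assms unfolding Suc BGN_C_Suc by (auto simp: next_dom_iff)
qed

lemma BGN_C_SucD: "BGN_C (Suc k) S W T f \<Longrightarrow> BGN_C k S W T f"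
proof (induction k arbitrary: S W f)
  case (Suc k)
  from Suc.prems show ?case
    unfolding BGN_C_Suc[of "Suc k"] BGN_C_Suc[of k S W] using Suc.IH by blast
qed (simp add: BGN_C_Suc)

lemma BGN_C_const: "c \<in> T \<Longrightarrow> 0 \<in> T \<Longrightarrow> BGN_C k S W T (\<lambda>_. c)"
proof (induction k arbitrary: S W c)
  case (Suc k)
  then show ?case unfolding BGN_C_Suc by (auto intro!: exI[of _ "\<lambda>_. 0"] continuous_intros)
qed (auto intro: continuous_intros)

lemma continuous_on_linear_post: "cont_linear L \<Longrightarrow> continuous_on W f \<Longrightarrow> continuous_on W (\<lambda>x. L (f x))"
  using continuous_on_compose2[OF cont_linearD(5)[of L UNIV], of W f] by simp

lemma continuous_on_linear_pre:
  "cont_linear L \<Longrightarrow> L ` W \<subseteq> W' \<Longrightarrow> continuous_on W' f \<Longrightarrow> continuous_on W (\<lambda>x. f (L x))"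
  using continuous_on_compose2[OF _ cont_linearD(5)[of L W], of W' f] by simp

lemma BGN_C_linear_post:
  assumes L: "cont_linear L" "L ` T \<subseteq> T'"
  shows "BGN_C k S W T f \<Longrightarrow> BGN_C k S W T' (\<lambda>x. L (f x))"
proof (induction k arbitrary: S W f)
  case 0
  then have "L (f x) \<in> T'" if "x \<in> W" for x using L(2) that BGN_C_into[OF 0] by blast
  then show ?case using continuous_on_linear_post[OF L(1) BGN_C_cont[OF 0]] by (simp add: image_subset_iff)
next
  case (Suc k)
  then obtain g where g: "\<forall>p\<in>next_dom S W. f (pt p + time p *\<^sub>R dir p) - f (pt p) = time p *\<^sub>R g p"
    "BGN_C k (next_space S) (next_dom S W) T g" unfolding BGN_C_Suc by blast
  have "continuous_on W (\<lambda>x. L (f x))"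
    by (rule continuous_on_linear_post[OF L(1) BGN_C_cont[OF Suc.prems]])
  moreover have "L (f x) \<in> T'" if "x \<in> W" for x using L(2) that BGN_C_into[OF Suc.prems] by blast
  moreover have "L (f (pt p + time p *\<^sub>R dir p)) - L (f (pt p)) = time p *\<^sub>R L (g p)" if "p \<in> next_dom S W" for p
    using bspec[OF g(1) that] by (metis cont_linearD(2,3)[OF L(1)])
  ultimately show ?case
    using Suc.IH[OF g(2)] by (rule_tac g = "\<lambda>p. L (g p)" in BGN_C_SucI) blast+
qed

text \<open>The difference quotient of \<open>f \<circ> L\<close> is that of \<open>f\<close> composed with the linear map which \<open>L\<close> induces on packed
  triples.\<close>

lemma BGN_C_linear_pre:
  assumes "cont_linear L" "L ` S \<subseteq> S'" "L ` W \<subseteq> W'" "BGN_C k S' W' T f"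
  shows "BGN_C k S W T (\<lambda>x. f (L x))"
  using assms
proof (induction k arbitrary: S W S' W' f L)
  case 0
  then have "f (L x) \<in> T" if "x \<in> W" for x using that BGN_C_into[OF 0(4)] by blast
  then show ?case using continuous_on_linear_pre[OF 0(1,3) BGN_C_cont[OF 0(4)]] by (simp add: image_subset_iff)
next
  case (Suc k)
  note L = Suc.prems(1)
  obtain g where g: "\<And>p. p \<in> next_dom S' W' \<Longrightarrow> f (pt p + time p *\<^sub>R dir p) - f (pt p) = time p *\<^sub>R g p"
    "BGN_C k (next_space S') (next_dom S' W') T g" using Suc.prems(4) unfolding BGN_C_Suc by blast
  let ?L = "\<lambda>p. pack (L (pt p)) (L (dir p)) (time p)"
  have L': "cont_linear ?L"
    using cont_linear_compose[OF cont_linear_Pair[OF cont_linear_compose[OF cont_linear_coords(1) L]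
        cont_linear_Pair[OF cont_linear_compose[OF cont_linear_coords(2) L] cont_linear_coords(3)]] cont_linear_pack]
    by simp
  have nd: "?L p \<in> next_dom S' W'" if "p \<in> next_dom S W" for p
  proof -
    have "L (pt p) + time p *\<^sub>R L (dir p) = L (pt p + time p *\<^sub>R dir p)" by (simp add: cont_linearD[OF L])
    then show ?thesis
      using that Suc.prems(2,3) unfolding next_dom_iff pack_coords image_subset_iff by metis
  qed
  have "BGN_C k (next_space S) (next_dom S W) T (\<lambda>p. g (?L p))"
    using Suc.prems(2) nd by (intro Suc.IH[OF L' _ _ g(2)]) (simp_all add: next_space_iff image_subset_iff)
  moreover have "f (L (pt p + time p *\<^sub>R dir p)) - f (L (pt p)) = time p *\<^sub>R g (?L p)" if "p \<in> next_dom S W" for p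
    using g(1)[OF nd[OF that]] by (simp add: cont_linearD[OF L])
  moreover have "continuous_on W (\<lambda>x. f (L x))"
    by (rule continuous_on_linear_pre[OF L Suc.prems(3) BGN_C_cont[OF Suc.prems(4)]])
  moreover have "f (L x) \<in> T" if "x \<in> W" for x using BGN_C_into[OF Suc.prems(4)] that Suc.prems(3) by blast
  ultimately show ?case by (rule_tac g = "\<lambda>p. g (?L p)" in BGN_C_SucI) blast+
qed

lemma BGN_C_linear:
  assumes "cont_linear L" "L ` S \<subseteq> T" "L ` W \<subseteq> T"
  shows "BGN_C k S W T L"
  using assms
proof (induction k arbitrary: S W L)
  case 0
  then show ?case using cont_linearD(5) by simp
next
  case (Suc k)
  have "BGN_C k (next_space S) (next_dom S W) T (\<lambda>p. L (dir p))"
    using Suc.prems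
    by (intro Suc.IH cont_linear_compose[OF cont_linear_coords(2)]) (simp_all add: next_space_iff next_dom_iff image_subset_iff)
  moreover have "L (pt p + time p *\<^sub>R dir p) - L (pt p) = time p *\<^sub>R L (dir p)" for p
    by (simp add: cont_linearD[OF Suc.prems(1)])
  ultimately show ?case
    using Suc.prems(3) cont_linearD(5)[OF Suc.prems(1)] by (rule_tac g = "\<lambda>p. L (dir p)" in BGN_C_SucI) blast+
qed

lemma BGN_C_Pair:
  "BGN_C k S W T1 f \<Longrightarrow> BGN_C k S W T2 g \<Longrightarrow> BGN_C k S W (T1 \<times> T2) (\<lambda>x. (f x, g x))"
proof (induction k arbitrary: S W f g)
  case (Suc k)
  obtain f1 g1 where *: "\<forall>p\<in>next_dom S W. f (pt p + time p *\<^sub>R dir p) - f (pt p) = time p *\<^sub>R f1 p"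
    "BGN_C k (next_space S) (next_dom S W) T1 f1"
    "\<forall>p\<in>next_dom S W. g (pt p + time p *\<^sub>R dir p) - g (pt p) = time p *\<^sub>R g1 p"
    "BGN_C k (next_space S) (next_dom S W) T2 g1"
    using Suc.prems unfolding BGN_C_Suc by blast
  have "(f (pt p + time p *\<^sub>R dir p), g (pt p + time p *\<^sub>R dir p)) - (f (pt p), g (pt p)) = time p *\<^sub>R (f1 p, g1 p)"
    if "p \<in> next_dom S W" for p
    using bspec[OF *(1) that] bspec[OF *(3) that] by simp
  moreover have "continuous_on W (\<lambda>x. (f x, g x))"
    using Suc.prems[THEN BGN_C_cont] by (rule continuous_on_Pair)
  moreover have "(\<lambda>x. (f x, g x)) ` W \<subseteq> T1 \<times> T2"
    using BGN_C_into[OF Suc.prems(1)] BGN_C_into[OF Suc.prems(2)] by blast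
  ultimately show ?case
    using Suc.IH[OF *(2,4)] by (rule_tac g = "\<lambda>p. (f1 p, g1 p)" in BGN_C_SucI) blast+
qed (simp add: image_subset_iff continuous_on_Pair)

lemma BGN_C_fun:
  "(\<And>i. BGN_C k S W (T i) (\<lambda>x. f x i)) \<Longrightarrow> BGN_C k S W {y. \<forall>i. y i \<in> T i} f"
proof (induction k arbitrary: S W f)
  case 0
  then show ?case by (simp add: image_subset_iff continuous_on_coordinatewise_then_product)
next
  case (Suc k)
  have "\<forall>i. \<exists>g. (\<forall>p\<in>next_dom S W. f (pt p + time p *\<^sub>R dir p) i - f (pt p) i = time p *\<^sub>R g p) \<and>
    BGN_C k (next_space S) (next_dom S W) (T i) g"
    using Suc.prems unfolding BGN_C_Suc by blast
  then obtain g where g: "\<And>i. \<forall>p\<in>next_dom S W. f (pt p + time p *\<^sub>R dir p) i - f (pt p) i = time p *\<^sub>R g i p"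
    "\<And>i. BGN_C k (next_space S) (next_dom S W) (T i) (g i)" by metis
  have "BGN_C k (next_space S) (next_dom S W) {y. \<forall>i. y i \<in> T i} (\<lambda>p i. g i p)"
    by (intro Suc.IH g(2))
  moreover have "f (pt p + time p *\<^sub>R dir p) - f (pt p) = time p *\<^sub>R (\<lambda>i. g i p)" if "p \<in> next_dom S W" for p
    using g(1) that by (simp add: fun_eq_iff)
  moreover have "continuous_on W f"
    using Suc.prems[THEN BGN_C_cont] by (rule continuous_on_coordinatewise_then_product)
  moreover have "f ` W \<subseteq> {y. \<forall>i. y i \<in> T i}" using Suc.prems[THEN BGN_C_into] by blast
  ultimately show ?case
    by (rule_tac g = "\<lambda>p i. g i p" in BGN_C_SucI) blast+
qed

lemma BGN_C_pack:
  assumes "BGN_C k S W T1 f" "BGN_C k S W T1 g" "BGN_C k S W UNIV r"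
  shows "BGN_C k S W (next_space T1) (\<lambda>x. pack (f x) (g x) (r x))"
proof -
  have 1: "BGN_C k S W (T1 \<times> T1 \<times> UNIV) (\<lambda>x. (f x, g x, r x))"
    by (intro BGN_C_Pair assms)
  have 2: "(\<lambda>(x, v, t). pack x v t) ` (T1 \<times> T1 \<times> UNIV) \<subseteq> next_space T1"
    by (simp add: image_subset_iff next_space_iff)
  show ?thesis using BGN_C_linear_post[OF cont_linear_pack 2 1] by simp
qed

text \<open>The chain rule: the difference quotient of \<open>h \<circ> f\<close> at \<open>p\<close> is that of \<open>h\<close> at the point \<open>f (pt p)\<close>, in the
  direction of the difference quotient of \<open>f\<close>, for the same time. The triple made of these is again \<open>C\<^sup>k\<close>.\<close>

theorem BGN_C_compose:
  assumes "BGN_C k S W S' f" "f ` W \<subseteq> W'" "BGN_C k S' W' T h"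
  shows "BGN_C k S W T (\<lambda>x. h (f x))"
  using assms
proof (induction k arbitrary: S W S' W' f h)
  case 0
  have "continuous_on W (\<lambda>x. h (f x))"
    by (rule continuous_on_compose2[OF BGN_C_cont[OF 0(3)] BGN_C_cont[OF 0(1)] 0(2)])
  moreover have "h (f x) \<in> T" if "x \<in> W" for x using BGN_C_into[OF 0(3)] that 0(2) by blast
  ultimately show ?case by (simp add: image_subset_iff)
next
  case (Suc k)
  obtain f1 where f: "\<And>p. p \<in> next_dom S W \<Longrightarrow> f (pt p + time p *\<^sub>R dir p) - f (pt p) = time p *\<^sub>R f1 p"
    "BGN_C k (next_space S) (next_dom S W) S' f1"
    using Suc.prems(1) unfolding BGN_C_Suc by blast
  obtain h1 where h: "\<And>p. p \<in> next_dom S' W' \<Longrightarrow> h (pt p + time p *\<^sub>R dir p) - h (pt p) = time p *\<^sub>R h1 p"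
    "BGN_C k (next_space S') (next_dom S' W') T h1"
    using Suc.prems(3) unfolding BGN_C_Suc by blast
  let ?F = "\<lambda>p. pack (f (pt p)) (f1 p) (time p)"
  have fp: "f (pt p) + time p *\<^sub>R f1 p = f (pt p + time p *\<^sub>R dir p)" if "p \<in> next_dom S W" for p
    using f(1)[OF that] by (simp add: algebra_simps)
  have nd: "?F p \<in> next_dom S' W'" if "p \<in> next_dom S W" for p
    using that fp[OF that] BGN_C_into[OF f(2) that] Suc.prems(2) by (simp add: next_dom_iff image_subset_iff)
  have "BGN_C k (next_space S) (next_dom S W) S' (\<lambda>p. f (pt p))"
    by (rule BGN_C_linear_pre[OF cont_linear_coords(1) _ _ BGN_C_SucD[OF Suc.prems(1)]])
      (simp_all add: next_space_iff next_dom_iff image_subset_iff)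
  moreover have "BGN_C k (next_space S) (next_dom S W) UNIV time"
    by (rule BGN_C_linear[OF cont_linear_coords(3)]) auto
  ultimately have "BGN_C k (next_space S) (next_dom S W) (next_space S') ?F"
    using f(2) by (intro BGN_C_pack)
  then have "BGN_C k (next_space S) (next_dom S W) T (\<lambda>p. h1 (?F p))"
    using nd by (intro Suc.IH[OF _ _ h(2)]) blast+
  moreover have "h (f (pt p + time p *\<^sub>R dir p)) - h (f (pt p)) = time p *\<^sub>R h1 (?F p)" if "p \<in> next_dom S W" for p
    using h(1)[OF nd[OF that]] fp[OF that] by simp
  moreover have "continuous_on W (\<lambda>x. h (f x))"
    by (rule continuous_on_compose2[OF BGN_C_cont[OF Suc.prems(3)] BGN_C_cont[OF Suc.prems(1)] Suc.prems(2)])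
  moreover have "h (f x) \<in> T" if "x \<in> W" for x using BGN_C_into[OF Suc.prems(3)] that Suc.prems(2) by blast
  ultimately show ?case by (rule_tac g = "\<lambda>p. h1 (?F p)" in BGN_C_SucI) blast+
qed

lemma BGN_C_add:
  fixes f g :: "'a::real_tvs bgn \<Rightarrow> 'b::real_tvs"
  assumes "subspace T" "BGN_C k S W T f" "BGN_C k S W T g"
  shows "BGN_C k S W T (\<lambda>x. f x + g x)"
proof -
  have "cont_linear (\<lambda>q :: 'b \<times> 'b. fst q + snd q)"
    by (intro cont_linearI) (auto simp: algebra_simps intro!: continuous_intros)
  from BGN_C_linear_post[OF this _ BGN_C_Pair[OF assms(2,3)]] show ?thesis
    using assms(1) by (simp add: image_subset_iff subspace_add)
qed

lemma cont_linear_uminus: "cont_linear (\<lambda>x :: 'b::real_tvs. - x)"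
  by (intro cont_linearI) (auto intro!: continuous_intros)

lemma BGN_C_uminus:
  assumes "subspace T" "BGN_C k S W T f"
  shows "BGN_C k S W T (\<lambda>x. - f x)"
  using BGN_C_linear_post[OF cont_linear_uminus _ assms(2)] subspace_neg[OF assms(1)] by blast

lemma BGN_C_diff:
  assumes "subspace T" "BGN_C k S W T f" "BGN_C k S W T g"
  shows "BGN_C k S W T (\<lambda>x. f x - g x)"
  using BGN_C_add[OF assms(1,2) BGN_C_uminus[OF assms(1,3)]] by simp

text \<open>The product rule for difference quotients; besides the two usual terms it has a term with the factor
  \<open>time p\<close>.\<close>

lemma BGN_C_scaleR:
  assumes T: "subspace T"
  shows "BGN_C k S W UNIV a \<Longrightarrow> BGN_C k S W T f \<Longrightarrow> BGN_C k S W T (\<lambda>x. a x *\<^sub>R f x)"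
proof (induction k arbitrary: S W a f)
  case 0
  then show ?case using T by (simp add: image_subset_iff subspace_scale continuous_on_scaleR_tvs)
next
  case (Suc k)
  obtain a1 where a: "\<And>p. p \<in> next_dom S W \<Longrightarrow> a (pt p + time p *\<^sub>R dir p) - a (pt p) = time p *\<^sub>R a1 p"
    "BGN_C k (next_space S) (next_dom S W) UNIV a1"
    using Suc.prems(1) unfolding BGN_C_Suc by blast
  obtain f1 where f: "\<And>p. p \<in> next_dom S W \<Longrightarrow> f (pt p + time p *\<^sub>R dir p) - f (pt p) = time p *\<^sub>R f1 p"
    "BGN_C k (next_space S) (next_dom S W) T f1"
    using Suc.prems(2) unfolding BGN_C_Suc by blast
  have 1: "BGN_C k (next_space S) (next_dom S W) T (\<lambda>p. f (pt p))"
    by (rule BGN_C_linear_pre[OF cont_linear_coords(1) _ _ BGN_C_SucD[OF Suc.prems(2)]])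
      (simp_all add: next_space_iff next_dom_iff image_subset_iff)
  have 2: "BGN_C k (next_space S) (next_dom S W) UNIV (\<lambda>p. a (pt p))"
    by (rule BGN_C_linear_pre[OF cont_linear_coords(1) _ _ BGN_C_SucD[OF Suc.prems(1)]])
      (simp_all add: next_space_iff next_dom_iff image_subset_iff)
  have 3: "BGN_C k (next_space S) (next_dom S W) UNIV time"
    by (rule BGN_C_linear[OF cont_linear_coords(3)]) auto
  let ?g = "\<lambda>p. a1 p *\<^sub>R f (pt p) + (a (pt p) *\<^sub>R f1 p + time p *\<^sub>R (a1 p *\<^sub>R f1 p))"
  have "BGN_C k (next_space S) (next_dom S W) T ?g"
    by (intro BGN_C_add[OF T] Suc.IH 1 2 3 a f)
  moreover have "a (pt p + time p *\<^sub>R dir p) *\<^sub>R f (pt p + time p *\<^sub>R dir p) - a (pt p) *\<^sub>R f (pt p) = time p *\<^sub>R ?g p"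
    if p: "p \<in> next_dom S W" for p
  proof -
    have "a (pt p + time p *\<^sub>R dir p) = a (pt p) + time p *\<^sub>R a1 p"
      "f (pt p + time p *\<^sub>R dir p) = f (pt p) + time p *\<^sub>R f1 p"
      using a(1)[OF p] f(1)[OF p] by (simp_all add: algebra_simps)
    then show ?thesis by (simp add: algebra_simps)
  qed
  moreover have "continuous_on W (\<lambda>x. a x *\<^sub>R f x)"
    using Suc.prems[THEN BGN_C_cont] by (rule continuous_on_scaleR_tvs)
  moreover have "a x *\<^sub>R f x \<in> T" if "x \<in> W" for x
    using BGN_C_into[OF Suc.prems(2) that] T by (simp add: subspace_scale)
  ultimately show ?case by (rule_tac g = ?g in BGN_C_SucI) blast+
qed

text \<open>The difference quotient of \<open>1 / a\<close> is \<open>- a1 / (a (x) a (x + t v))\<close>. The value of \<open>a\<close> at the end point is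
  written as \<open>a + t a1\<close>, which is visibly \<open>C\<^sup>k\<close>.\<close>

lemma BGN_C_inverse:
  fixes a :: "'a::real_tvs bgn \<Rightarrow> real"
  shows "BGN_C k S W UNIV a \<Longrightarrow> (\<And>x. x \<in> W \<Longrightarrow> a x \<noteq> 0) \<Longrightarrow> BGN_C k S W UNIV (\<lambda>x. inverse (a x))"
proof (induction k arbitrary: S W a)
  case 0
  then show ?case by (simp add: continuous_on_inverse)
next
  case (Suc k)
  obtain a1 where a: "\<And>p. p \<in> next_dom S W \<Longrightarrow> a (pt p + time p *\<^sub>R dir p) - a (pt p) = time p *\<^sub>R a1 p"
    "BGN_C k (next_space S) (next_dom S W) UNIV a1"
    using Suc.prems(1) unfolding BGN_C_Suc by blast
  have 2: "BGN_C k (next_space S) (next_dom S W) UNIV (\<lambda>p. a (pt p))"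
    by (rule BGN_C_linear_pre[OF cont_linear_coords(1) _ _ BGN_C_SucD[OF Suc.prems(1)]])
      (simp_all add: next_space_iff next_dom_iff image_subset_iff)
  have 3: "BGN_C k (next_space S) (next_dom S W) UNIV time"
    by (rule BGN_C_linear[OF cont_linear_coords(3)]) auto
  have e: "a (pt p) + time p *\<^sub>R a1 p = a (pt p + time p *\<^sub>R dir p)" if "p \<in> next_dom S W" for p
    using a(1)[OF that] by simp
  let ?b = "\<lambda>p. a (pt p) + time p *\<^sub>R a1 p"
  let ?g = "\<lambda>p. - (a1 p *\<^sub>R (inverse (a (pt p)) *\<^sub>R inverse (?b p)))"
  have U: "subspace (UNIV :: real set)" by simp
  have "BGN_C k (next_space S) (next_dom S W) UNIV ?g"
  proof (intro BGN_C_uminus[OF U] BGN_C_scaleR[OF U] a(2) Suc.IH 2 BGN_C_add[OF U] 3)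
    show "a (pt p) \<noteq> 0" if "p \<in> next_dom S W" for p using Suc.prems(2) that by (simp add: next_dom_iff)
    show "?b p \<noteq> 0" if "p \<in> next_dom S W" for p
      using Suc.prems(2) that unfolding e[OF that] by (simp add: next_dom_iff)
  qed
  moreover have "inverse (a (pt p + time p *\<^sub>R dir p)) - inverse (a (pt p)) = time p *\<^sub>R ?g p"
    if p: "p \<in> next_dom S W" for p
  proof -
    have "a (pt p) \<noteq> 0" "a (pt p) + time p * a1 p \<noteq> 0"
      using Suc.prems(2)[of "pt p"] Suc.prems(2)[of "pt p + time p *\<^sub>R dir p"] p e[OF p] by (simp_all add: next_dom_iff)
    then show ?thesis unfolding e[OF p, symmetric] by (simp add: field_simps)
  qed
  moreover have "continuous_on W (\<lambda>x. inverse (a x))"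
    using BGN_C_cont[OF Suc.prems(1)] Suc.prems(2) by (intro continuous_on_inverse) blast+
  ultimately show ?case by (rule_tac g = ?g in BGN_C_SucI) blast+
qed

subsection \<open>Locality\<close>

lemma continuous_on_locally:
  assumes "\<And>x. x \<in> W \<Longrightarrow> \<exists>Q. openin (top_of_set W) Q \<and> x \<in> Q \<and> continuous_on Q f"
  shows "continuous_on W f"
  unfolding continuous_on_def
proof
  fix x assume x: "x \<in> W"
  then obtain Q where Q: "openin (top_of_set W) Q" "x \<in> Q" "continuous_on Q f" using assms by blast
  then obtain Q' where Q': "open Q'" "Q = W \<inter> Q'" by (auto simp: openin_open)
  have "at x within W = at x within Q" using Q Q' x by (intro at_within_nhd[of x Q']) auto
  moreover have "(f \<longlongrightarrow> f x) (at x within Q)" using Q by (simp add: continuous_on_def)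
  ultimately show "(f \<longlongrightarrow> f x) (at x within W)" by simp
qed

text \<open>The second point at which a difference quotient evaluates the function.\<close>

definition endpoint :: "'a::real_tvs bgn \<Rightarrow> 'a bgn" where "endpoint p = pt p + time p *\<^sub>R dir p"

lemma continuous_on_coords: "continuous_on A pt" "continuous_on A dir" "continuous_on A time"
  using cont_linear_coords cont_linearD(5) by blast+

lemma continuous_on_endpoint: "continuous_on A endpoint"
  unfolding endpoint_def[abs_def] by (intro continuous_intros continuous_on_coords)

lemma endpoint_in: "subspace S \<Longrightarrow> p \<in> next_space S \<Longrightarrow> endpoint p \<in> S"
  by (auto simp: endpoint_def next_space_iff subspace_def)

lemma next_dom_endpoint: "next_dom S W = {p \<in> next_space S. pt p \<in> W \<and> endpoint p \<in> W}" if "W \<subseteq> S"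
  using that by (auto simp: next_dom_iff next_space_iff endpoint_def)

lemma openin_next_preimage:
  assumes S: "subspace S" and O1: "openin (top_of_set S) O1" and O2: "openin (top_of_set S) O2"
  shows "openin (top_of_set (next_space S)) {p \<in> next_space S. pt p \<in> O1 \<and> endpoint p \<in> O2}"
proof -
  have "openin (top_of_set (next_space S)) (next_space S \<inter> pt -` O1)"
    using O1 continuous_on_coords(1) by (rule_tac continuous_openin_preimage[where T = S]) (auto simp: next_space_iff)
  moreover have "openin (top_of_set (next_space S)) (next_space S \<inter> endpoint -` O2)"
    using O2 continuous_on_endpoint endpoint_in[OF S] by (rule_tac continuous_openin_preimage[where T = S]) auto
  ultimately have "openin (top_of_set (next_space S)) ((next_space S \<inter> pt -` O1) \<inter> (next_space S \<inter> endpoint -` O2))"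
    by (rule openin_Int)
  moreover have "(next_space S \<inter> pt -` O1) \<inter> (next_space S \<inter> endpoint -` O2) = {p \<in> next_space S. pt p \<in> O1 \<and> endpoint p \<in> O2}"
    by auto
  ultimately show ?thesis by simp
qed

lemma openin_next_dom:
  assumes "subspace S" "openin (top_of_set S) W"
  shows "openin (top_of_set (next_space S)) (next_dom S W)"
  using openin_next_preimage[OF assms(1,2,2)] next_dom_endpoint[of W S] openin_imp_subset[OF assms(2)] by simp

lemma subspace_next_space: "subspace S \<Longrightarrow> subspace (next_space S)"
  unfolding subspace_def
  by (simp add: next_space_iff cont_linearD[OF cont_linear_coords(1)] cont_linearD[OF cont_linear_coords(2)])

text \<open>For nonzero times a difference quotient is determined by \<open>f\<close>. At time \<open>0\<close> it is determined by continuity,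
  because \<open>x + s v\<close> stays in an open set for small \<open>s\<close>; here the target must be Hausdorff.\<close>

lemma difference_quotient_unique:
  fixes f :: "'a::real_tvs bgn \<Rightarrow> 'b::real_tvs"
  assumes S: "subspace S" and O1: "openin (top_of_set S) O1" and O2: "openin (top_of_set S) O2"
    and x: "x \<in> O1" "x \<in> O2" and v: "v \<in> S"
    and g1: "\<And>p. p \<in> next_dom S O1 \<Longrightarrow> f (endpoint p) - f (pt p) = time p *\<^sub>R g1 p" "continuous_on (next_dom S O1) g1"
    and g2: "\<And>p. p \<in> next_dom S O2 \<Longrightarrow> f (endpoint p) - f (pt p) = time p *\<^sub>R g2 p" "continuous_on (next_dom S O2) g2"
  shows "g1 (pack x v 0) = g2 (pack x v 0)"
proof -
  let ?c = "\<lambda>s :: real. pack x v s"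
  have "continuous_on UNIV ((\<lambda>(x, v, t). pack x v t) \<circ> (\<lambda>s :: real. (x, v, s)))"
    by (intro continuous_on_compose continuous_intros cont_linearD(5)[OF cont_linear_pack])
  then have cc: "continuous_on UNIV ?c" by (simp add: o_def)
  have lim: "(?c \<longlongrightarrow> pack x v 0) (at 0)"
    using cc by (metis UNIV_I continuous_on_def)
  have *: "(\<lambda>s. g (?c s)) \<midarrow>0\<rightarrow> g (pack x v 0) \<and> (\<forall>\<^sub>F s in at 0. ?c s \<in> next_dom S Q)"
    if Q: "openin (top_of_set S) Q" "x \<in> Q" and g: "continuous_on (next_dom S Q) g" for Q and g :: "'a bgn \<Rightarrow> 'b"
  proof
    obtain N where N: "open N" "next_dom S Q = next_space S \<inter> N"
      using openin_next_dom[OF S Q(1)] by (auto simp: openin_open)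
    have QS: "Q \<subseteq> S" using Q(1) openin_imp_subset by blast
    have p0: "pack x v 0 \<in> next_dom S Q" using Q v by (simp add: next_dom_iff)
    then have "\<forall>\<^sub>F s in at 0. ?c s \<in> N" using lim N topological_tendstoD by blast
    moreover have "?c s \<in> next_space S" for s using Q QS v by (auto simp: next_space_iff)
    ultimately show ev: "\<forall>\<^sub>F s in at 0. ?c s \<in> next_dom S Q" using N by (simp add: eventually_mono)
    show "(\<lambda>s. g (?c s)) \<midarrow>0\<rightarrow> g (pack x v 0)"
      by (rule continuous_on_tendsto_compose[OF g lim p0 ev])
  qed
  have "\<forall>\<^sub>F s in at 0. g1 (?c s) = g2 (?c s)"
  proof -
    have "\<forall>\<^sub>F s in at (0::real). s \<noteq> 0" by (simp add: eventually_at_filter)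
    then show ?thesis
      using *[OF O1 x(1) g1(2), THEN conjunct2] *[OF O2 x(2) g2(2), THEN conjunct2]
    proof eventually_elim
      case (elim s)
      then have "s *\<^sub>R g1 (?c s) = s *\<^sub>R g2 (?c s)" using g1(1)[of "?c s"] g2(1)[of "?c s"] by simp
      then show ?case using elim by simp
    qed
  qed
  then have "((\<lambda>s. g1 (?c s)) \<longlongrightarrow> g2 (pack x v 0)) (at 0)"
    using *[OF O2 x(2) g2(2), THEN conjunct1] by (rule_tac iffD2[OF filterlim_cong[OF refl refl]])
  from LIM_unique[OF *[OF O1 x(1) g1(2), THEN conjunct1] this] show ?thesis .
qed

text \<open>The difference quotients of the local pieces agree at time \<open>0\<close>, so they glue to a function \<open>G\<close> there. At
  nonzero times \<open>G\<close> is the honest quotient, for which the two evaluation points may lie in different pieces;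
  it is \<open>C\<^sup>k\<close> as a composition of maps already known to be \<open>C\<^sup>k\<close>. The points with time \<open>0\<close> have
  neighbourhoods in which a single piece suffices.\<close>

theorem BGN_C_locally:
  fixes f :: "'a::real_tvs bgn \<Rightarrow> 'b::real_tvs"
  assumes "subspace S" "openin (top_of_set S) W" "subspace T"
    and "\<And>x. x \<in> W \<Longrightarrow> \<exists>Q. openin (top_of_set W) Q \<and> x \<in> Q \<and> BGN_C k S Q T f"
  shows "BGN_C k S W T f"
  using assms
proof (induction k arbitrary: S W f)
  case 0
  have "continuous_on W f"
    using 0(4) by (intro continuous_on_locally) fastforce
  moreover have "f ` W \<subseteq> T" using 0(4) by fastforce
  ultimately show ?case by simp
next
  case (Suc k)
  note S = Suc.prems(1) and W = Suc.prems(2) and T = Suc.prems(3)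
  have WS: "W \<subseteq> S" using W openin_imp_subset by blast
  have "\<forall>x\<in>W. \<exists>Q g. openin (top_of_set W) Q \<and> x \<in> Q \<and> BGN_C (Suc k) S Q T f \<and>
      (\<forall>p\<in>next_dom S Q. f (endpoint p) - f (pt p) = time p *\<^sub>R g p) \<and> BGN_C k (next_space S) (next_dom S Q) T g"
    using Suc.prems(4) unfolding BGN_C_Suc endpoint_def by metis
  then obtain Q g where Q: "\<And>x. x \<in> W \<Longrightarrow> openin (top_of_set W) (Q x)" "\<And>x. x \<in> W \<Longrightarrow> x \<in> Q x"
      "\<And>x. x \<in> W \<Longrightarrow> BGN_C (Suc k) S (Q x) T f"
      and g: "\<And>x p. x \<in> W \<Longrightarrow> p \<in> next_dom S (Q x) \<Longrightarrow> f (endpoint p) - f (pt p) = time p *\<^sub>R g x p"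
      "\<And>x. x \<in> W \<Longrightarrow> BGN_C k (next_space S) (next_dom S (Q x)) T (g x)"
    by metis
  have QS: "openin (top_of_set S) (Q x)" if "x \<in> W" for x using Q(1)[OF that] W by (rule openin_trans)
  \<comment> \<open>At time \<open>0\<close> the piece around the base point is used; by uniqueness any other piece gives the same value.\<close>
  define G where "G = (\<lambda>p. if time p = 0 then g (pt p) p else inverse (time p) *\<^sub>R (f (endpoint p) - f (pt p)))"
  have eq: "f (endpoint p) - f (pt p) = time p *\<^sub>R G p" if "p \<in> next_dom S W" for p
    by (cases "time p = 0") (auto simp: G_def endpoint_def)
  have nd: "next_dom S W = {p \<in> next_space S. pt p \<in> W \<and> endpoint p \<in> W}" by (rule next_dom_endpoint[OF WS])
  have "BGN_C k (next_space S) (next_dom S W) T G"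
  proof (rule Suc.IH[OF subspace_next_space[OF S] openin_next_dom[OF S W] T])
    fix p assume p: "p \<in> next_dom S W"
    have xy: "pt p \<in> W" "endpoint p \<in> W" using p by (auto simp: nd)
    show "\<exists>P. openin (top_of_set (next_dom S W)) P \<and> p \<in> P \<and> BGN_C k (next_space S) P T G"
    proof (cases "time p = 0")
      case True
      let ?P = "next_dom S (Q (pt p))"
      have QW: "Q (pt p) \<subseteq> W" using Q(1)[OF xy(1)] openin_imp_subset by blast
      have sub: "?P \<subseteq> next_dom S W" using QW by (auto simp: next_dom_iff)
      have "openin (top_of_set (next_dom S W)) ?P"
        using openin_next_dom[OF S QS[OF xy(1)]] sub openin_subset_trans[of "next_space S" ?P "next_dom S W"]
        by (auto simp: nd)
      moreover have "p \<in> ?P" using True p Q(2)[OF xy(1)] by (simp add: next_dom_iff)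
      moreover have "g (pt p) q = G q" if q: "q \<in> ?P" for q
      proof (cases "time q = 0")
        case True
        have qx: "pt q \<in> Q (pt p)" "pt q \<in> W" "dir q \<in> S" using q QW by (auto simp: next_dom_iff)
        have "g (pt p) (pack (pt q) (dir q) 0) = g (pt q) (pack (pt q) (dir q) 0)"
          using g(1)[OF xy(1)] g(1)[OF qx(2)] BGN_C_cont[OF g(2)[OF xy(1)]] BGN_C_cont[OF g(2)[OF qx(2)]]
          by (rule_tac difference_quotient_unique[OF S QS[OF xy(1)] QS[OF qx(2)] qx(1) Q(2)[OF qx(2)] qx(3)])
        then show ?thesis using pack_pt_dir_time[of q] True by (simp add: G_def)
      next
        case False
        then show ?thesis using g(1)[OF xy(1) q] by (simp add: G_def)
      qed
      then have "BGN_C k (next_space S) ?P T G" by (rule BGN_C_cong[OF g(2)[OF xy(1)]])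
      ultimately show ?thesis by blast
    next
      case False
      let ?P = "{q \<in> next_space S. pt q \<in> Q (pt p) \<and> endpoint q \<in> Q (endpoint p)} \<inter> (next_space S \<inter> time -` (- {0}))"
      have QW: "Q (pt p) \<subseteq> W" "Q (endpoint p) \<subseteq> W" using Q(1) xy openin_imp_subset by blast+
      have sub: "?P \<subseteq> next_dom S W" using QW by (auto simp: nd)
      have "openin (top_of_set (next_space S)) (next_space S \<inter> time -` (- {0}))"
        by (rule continuous_openin_preimage_gen[OF continuous_on_coords(3)]) auto
      then have "openin (top_of_set (next_space S)) ?P"
        using openin_next_preimage[OF S QS[OF xy(1)] QS[OF xy(2)]] by (rule openin_Int[rotated])
      then have "openin (top_of_set (next_dom S W)) ?P"
        using sub openin_subset_trans[of "next_space S" ?P "next_dom S W"] by (auto simp: nd)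
      moreover have "p \<in> ?P" using False p Q(2) xy by (auto simp: nd)
      moreover have "BGN_C k (next_space S) ?P T (\<lambda>q. inverse (time q) *\<^sub>R (f (endpoint q) - f (pt q)))"
      proof (intro BGN_C_scaleR[OF T] BGN_C_inverse BGN_C_diff[OF T])
        show time: "BGN_C k (next_space S) ?P UNIV time"
          by (rule BGN_C_linear[OF cont_linear_coords(3)]) auto
        show "BGN_C k (next_space S) ?P T (\<lambda>q. f (pt q))"
          by (rule BGN_C_linear_pre[OF cont_linear_coords(1) _ _ BGN_C_SucD[OF Q(3)[OF xy(1)]]])
            (auto simp: next_space_iff)
        have "BGN_C k (next_space S) ?P S endpoint"
          unfolding endpoint_def[abs_def]
          by (intro BGN_C_add[OF S] BGN_C_scaleR[OF S] time BGN_C_linear cont_linear_coords) (auto simp: next_space_iff)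
        then show "BGN_C k (next_space S) ?P T (\<lambda>q. f (endpoint q))"
          by (rule BGN_C_compose[OF _ _ BGN_C_SucD[OF Q(3)[OF xy(2)]]]) auto
      qed auto
      then have "BGN_C k (next_space S) ?P T G"
        by (rule BGN_C_cong) (auto simp: G_def)
      ultimately show ?thesis by blast
    qed
  qed
  moreover have "continuous_on W f"
  proof (rule continuous_on_locally)
    show "\<exists>Q. openin (top_of_set W) Q \<and> x \<in> Q \<and> continuous_on Q f" if "x \<in> W" for x
      using Q[OF that] BGN_C_cont by blast
  qed
  moreover have "f x \<in> T" if "x \<in> W" for x using BGN_C_into[OF Q(3)[OF that] Q(2)[OF that]] .
  ultimately show ?case using eq unfolding endpoint_def by (rule_tac g = G in BGN_C_SucI) blast+
qed

subsection \<open>Smooth maps\<close>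

text \<open>With this projection, smoothness of \<open>f\<close> becomes the statement that \<open>f \<circ> bgn_proj\<close> is \<open>C\<^sup>k\<close> for all \<open>k\<close>,
  and closure properties are inherited from the packed space.\<close>

definition bgn_proj :: "'a bgn \<Rightarrow> 'a" where "bgn_proj p = fst p 0"

lemma bgn_proj_embed [simp]: "bgn_proj (bgn_embed x) = x"
  by (simp add: bgn_proj_def bgn_embed_def)

lemma smooth_on_iff: "smooth_on S W T f \<longleftrightarrow> (\<forall>k. BGN_C k (bgn_embed ` S) (bgn_embed ` W) T (\<lambda>p. f (bgn_proj p)))"
  by (simp add: smooth_on_def bgn_proj_def)

lemma cont_linear_bgn_proj: "cont_linear bgn_proj"
  unfolding bgn_proj_def[abs_def] by (intro cont_linear_compose[OF cont_linear_fst] cont_linear_apply)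

lemma cont_linear_bgn_embed: "cont_linear bgn_embed"
  unfolding bgn_embed_def[abs_def]
proof (intro cont_linear_Pair cont_linear_fun)
  show "cont_linear (\<lambda>x. if i = 0 then x else 0 :: 'a)" for i :: nat
    by (cases "i = 0") (auto intro!: cont_linearI continuous_intros)
  show "cont_linear (\<lambda>_ :: 'a. 0 :: real)" by (auto intro!: cont_linearI continuous_intros)
qed

lemma smooth_on_subset: "smooth_on S W T f \<Longrightarrow> W' \<subseteq> W \<Longrightarrow> smooth_on S W' T f"
  unfolding smooth_on_iff using BGN_C_subset image_mono by metis

lemma smooth_on_cong: "smooth_on S W T f \<Longrightarrow> (\<And>x. x \<in> W \<Longrightarrow> f x = g x) \<Longrightarrow> smooth_on S W T g"
  unfolding smooth_on_iff by (auto intro: BGN_C_cong)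

lemma smooth_on_compose:
  assumes "smooth_on S W S' f" "f ` W \<subseteq> W'" "smooth_on S' W' T h"
  shows "smooth_on S W T (\<lambda>x. h (f x))"
  unfolding smooth_on_iff
proof
  fix k
  have "BGN_C k (bgn_embed ` S) (bgn_embed ` W) (bgn_embed ` S') (\<lambda>p. bgn_embed (f (bgn_proj p)))"
    using assms(1) by (intro BGN_C_linear_post[OF cont_linear_bgn_embed order_refl]) (auto simp: smooth_on_iff)
  moreover have "BGN_C k (bgn_embed ` S') (bgn_embed ` W') T (\<lambda>p. h (bgn_proj p))"
    using assms(3) by (auto simp: smooth_on_iff)
  ultimately have "BGN_C k (bgn_embed ` S) (bgn_embed ` W) T (\<lambda>p. h (bgn_proj (bgn_embed (f (bgn_proj p)))))"
    using assms(2) by (elim BGN_C_compose) auto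
  then show "BGN_C k (bgn_embed ` S) (bgn_embed ` W) T (\<lambda>p. h (f (bgn_proj p)))" by simp
qed

lemma smooth_on_linear:
  assumes "cont_linear L" "L ` S \<subseteq> T" "L ` W \<subseteq> T"
  shows "smooth_on S W T L"
  unfolding smooth_on_iff using assms
  by (intro allI BGN_C_linear cont_linear_compose[OF cont_linear_bgn_proj]) auto

lemma smooth_on_const: "c \<in> T \<Longrightarrow> 0 \<in> T \<Longrightarrow> smooth_on S W T (\<lambda>_. c)"
  unfolding smooth_on_iff by (auto intro: BGN_C_const)

lemma smooth_on_Pair: "smooth_on S W T1 f \<Longrightarrow> smooth_on S W T2 g \<Longrightarrow> smooth_on S W (T1 \<times> T2) (\<lambda>x. (f x, g x))"
  unfolding smooth_on_iff by (auto intro: BGN_C_Pair)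

lemma smooth_on_fun: "(\<And>i. smooth_on S W (T i) (\<lambda>x. f x i)) \<Longrightarrow> smooth_on S W {y. \<forall>i. y i \<in> T i} f"
  unfolding smooth_on_iff by (auto intro: BGN_C_fun)

lemma smooth_on_add:
  "subspace T \<Longrightarrow> smooth_on S W T f \<Longrightarrow> smooth_on S W T g \<Longrightarrow> smooth_on S W T (\<lambda>x. f x + g x)"
  unfolding smooth_on_iff by (auto intro: BGN_C_add)

lemma smooth_on_diff:
  "subspace T \<Longrightarrow> smooth_on S W T f \<Longrightarrow> smooth_on S W T g \<Longrightarrow> smooth_on S W T (\<lambda>x. f x - g x)"
  unfolding smooth_on_iff by (auto intro: BGN_C_diff)

lemma smooth_on_mult:
  fixes f g :: "'a::real_tvs \<Rightarrow> real"
  assumes "smooth_on S W UNIV f" "smooth_on S W UNIV g"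
  shows "smooth_on S W UNIV (\<lambda>x. f x * g x)"
  unfolding smooth_on_iff
proof
  fix k
  have "BGN_C k (bgn_embed ` S) (bgn_embed ` W) UNIV (\<lambda>p. f (bgn_proj p) *\<^sub>R g (bgn_proj p))"
    using assms by (intro BGN_C_scaleR) (simp_all add: smooth_on_iff)
  then show "BGN_C k (bgn_embed ` S) (bgn_embed ` W) UNIV (\<lambda>p. f (bgn_proj p) * g (bgn_proj p))" by simp
qed

lemma smooth_on_inverse:
  fixes f :: "'a::real_tvs \<Rightarrow> real"
  shows "smooth_on S W UNIV f \<Longrightarrow> (\<And>x. x \<in> W \<Longrightarrow> f x \<noteq> 0) \<Longrightarrow> smooth_on S W UNIV (\<lambda>x. inverse (f x))"
  unfolding smooth_on_iff by (auto intro: BGN_C_inverse)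

lemma openin_bgn_embed:
  assumes "openin (top_of_set S) W"
  shows "openin (top_of_set (bgn_embed ` S)) (bgn_embed ` W)"
proof -
  obtain Q where Q: "open Q" "W = S \<inter> Q" using assms by (auto simp: openin_open)
  have "open (bgn_proj -` Q)"
    using Q(1) cont_linearD(5)[OF cont_linear_bgn_proj, of UNIV] by (rule open_vimage)
  moreover have "bgn_embed ` W = bgn_embed ` S \<inter> bgn_proj -` Q" using Q(2) by auto
  ultimately show ?thesis by (auto simp: openin_open)
qed

theorem smooth_on_locally:
  fixes f :: "'a::real_tvs \<Rightarrow> 'b::real_tvs"
  assumes S: "subspace S" and W: "openin (top_of_set S) W" and T: "subspace T"
    and loc: "\<And>x. x \<in> W \<Longrightarrow> \<exists>Q. openin (top_of_set S) Q \<and> x \<in> Q \<and> smooth_on S (W \<inter> Q) T f"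
  shows "smooth_on S W T f"
  unfolding smooth_on_iff
proof
  fix k
  have "linear (bgn_embed :: 'a \<Rightarrow> 'a bgn)"     by (rule conjunct1[OF cont_linear_bgn_embed[unfolded cont_linear_def]])
  then have "subspace (bgn_embed ` S)" using S linear_subspace_image by blast
  then show "BGN_C k (bgn_embed ` S) (bgn_embed ` W) T (\<lambda>p. f (bgn_proj p))"
  proof (rule BGN_C_locally[OF _ openin_bgn_embed[OF W] T])
    fix p assume "p \<in> (bgn_embed ` W :: 'a bgn set)"
    then obtain x where x: "x \<in> W" "p = bgn_embed x" by auto
    obtain Q where Q: "openin (top_of_set S) Q" "x \<in> Q" "smooth_on S (W \<inter> Q) T f" using loc[OF x(1)] by blast
    have "openin (top_of_set (bgn_embed ` W)) (bgn_embed ` (W \<inter> Q))"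
      using Q(1) openin_imp_subset[OF W]
      by (intro openin_bgn_embed) (auto simp: openin_open)
    then show "\<exists>Q. openin (top_of_set (bgn_embed ` W)) Q \<and> p \<in> Q \<and> BGN_C k (bgn_embed ` S) Q T (\<lambda>p. f (bgn_proj p))"
      using Q x unfolding smooth_on_iff by blast
  qed
qed

section \<open>Smooth maps between manifolds\<close>

text \<open>The part of the manifold structure that composition of smooth maps needs of the manifold in the middle.
  It is easier to check than being a smooth manifold, which matters for products with \<open>\<real>\<close>.\<close>

definition charted :: "('m, 'e::real_tvs) manifold \<Rightarrow> bool" where
  "charted M \<longleftrightarrow> (\<forall>U \<phi>. (U, \<phi>) \<in> atlas M \<longrightarrow> openin (mtop M) U \<and> inj_on \<phi> U) \<and>
     (\<forall>x\<in>topspace (mtop M). \<exists>U \<phi>. (U, \<phi>) \<in> atlas M \<and> x \<in> U)"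

lemma chartedD:
  assumes "charted M"
  shows "(U, \<phi>) \<in> atlas M \<Longrightarrow> openin (mtop M) U" "(U, \<phi>) \<in> atlas M \<Longrightarrow> inj_on \<phi> U"
    "x \<in> topspace (mtop M) \<Longrightarrow> \<exists>U \<phi>. (U, \<phi>) \<in> atlas M \<and> x \<in> U"
  using assms unfolding charted_def by blast+

locale smooth_mfd =
  fixes M :: "('m, 'e::real_tvs) manifold"
  assumes smooth_manifold: "smooth_manifold M"
begin

lemma subspace_model: "subspace (model M)"
  using smooth_manifold unfolding smooth_manifold_def by blast

lemma chart:
  assumes "(U, \<phi>) \<in> atlas M"
  shows chart_open: "openin (mtop M) U"
    and chart_image: "openin (top_of_set (model M)) (\<phi> ` U)"
    and chart_homeo: "homeomorphic_map (subtopology (mtop M) U) (top_of_set (\<phi> ` U)) \<phi>"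
proof -
  have "\<forall>p\<in>atlas M. openin (mtop M) (fst p) \<and> openin (top_of_set (model M)) (snd p ` fst p) \<and>
      homeomorphic_map (subtopology (mtop M) (fst p)) (top_of_set (snd p ` fst p)) (snd p)"
    using smooth_manifold unfolding smooth_manifold_def case_prod_unfold by blast
  from bspec[OF this assms] show "openin (mtop M) U" "openin (top_of_set (model M)) (\<phi> ` U)"
    "homeomorphic_map (subtopology (mtop M) U) (top_of_set (\<phi> ` U)) \<phi>" by simp_all
qed

lemma chart_subset: "(U, \<phi>) \<in> atlas M \<Longrightarrow> U \<subseteq> topspace (mtop M)"
  using chart_open openin_subset by blast

lemma chart_inj: assumes "(U, \<phi>) \<in> atlas M" shows "inj_on \<phi> U"
  using homeomorphic_imp_injective_map[OF chart_homeo[OF assms]] chart_subset[OF assms]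
  by (simp add: Int_absorb1)

lemma chart_inv_cont:
  assumes c: "(U, \<phi>) \<in> atlas M"
  shows "continuous_map (top_of_set (\<phi> ` U)) (mtop M) (inv_into U \<phi>)"
proof -
  obtain g where g: "homeomorphic_maps (subtopology (mtop M) U) (top_of_set (\<phi> ` U)) \<phi> g"
    using chart_homeo[OF c] homeomorphic_map_maps by blast
  then have "continuous_map (top_of_set (\<phi> ` U)) (mtop M) g"
    by (auto simp: homeomorphic_maps_def continuous_map_in_subtopology)
  moreover have "g y = inv_into U \<phi> y" if y: "y \<in> topspace (top_of_set (\<phi> ` U))" for y
  proof -
    obtain x where x: "x \<in> U" "y = \<phi> x" using y by auto
    then have "g y = x"
      using g chart_subset[OF c] by (auto simp: homeomorphic_maps_def)
    then show ?thesis using inv_into_f_f[OF chart_inj[OF c] x(1)] x(2) by simp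
  qed
  ultimately show ?thesis by (rule continuous_map_eq)
qed

lemma chart_model: "(U, \<phi>) \<in> atlas M \<Longrightarrow> x \<in> U \<Longrightarrow> \<phi> x \<in> model M"
  using openin_imp_subset[OF chart_image] by blast

lemma chart_image_openin:
  assumes c: "(U, \<phi>) \<in> atlas M" and A: "openin (mtop M) A" "A \<subseteq> U"
  shows "openin (top_of_set (model M)) (\<phi> ` A)"
proof -
  have "openin (subtopology (mtop M) U) A"
    using A chart_open[OF c] by (simp add: openin_open_subtopology)
  then have "openin (top_of_set (\<phi> ` U)) (\<phi> ` A)"
    using homeomorphic_imp_open_map[OF chart_homeo[OF c]] by (simp add: open_map_def)
  then show ?thesis using chart_image[OF c] by (rule openin_trans)
qed

lemma chart_cover: "x \<in> topspace (mtop M) \<Longrightarrow> \<exists>U \<phi>. (U, \<phi>) \<in> atlas M \<and> x \<in> U"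
proof -
  assume "x \<in> topspace (mtop M)"
  moreover have "(\<Union>(U, \<phi>)\<in>atlas M. U) = topspace (mtop M)"
    using smooth_manifold unfolding smooth_manifold_def by (elim conjE)
  ultimately show ?thesis by blast
qed

lemma charted: "charted M"
  unfolding charted_def using chart_open chart_inj chart_cover by blast

lemma transition:
  assumes "(U, \<phi>) \<in> atlas M" "(U', \<psi>) \<in> atlas M"
  shows "smooth_on (model M) (\<phi> ` (U \<inter> U')) (model M) (\<lambda>y. \<psi> (inv_into U \<phi> y))"
proof -
  have "\<forall>p\<in>atlas M. \<forall>p'\<in>atlas M.
      smooth_on (model M) (snd p ` (fst p \<inter> fst p')) (model M) (snd p' \<circ> inv_into (fst p) (snd p))"
    using smooth_manifold unfolding smooth_manifold_def case_prod_unfold by blast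
  from bspec[OF bspec[OF this assms(1)] assms(2)] show ?thesis by (simp add: o_def)
qed

end

lemma smooth_map_on_iff:
  "smooth_map_on D M N f \<longleftrightarrow> continuous_map (subtopology (mtop M) D) (mtop N) f \<and>
     (\<forall>U \<phi> U' \<psi>. (U, \<phi>) \<in> atlas M \<longrightarrow> (U', \<psi>) \<in> atlas N \<longrightarrow>
        smooth_on (model M) (\<phi> ` {x \<in> U \<inter> D. f x \<in> U'}) (model N) (\<lambda>y. \<psi> (f (inv_into U \<phi> y))))"
  unfolding smooth_map_on_def o_def by fast

lemma smooth_map_onD:
  assumes "smooth_map_on D M N f"
  shows "continuous_map (subtopology (mtop M) D) (mtop N) f"
    "(U, \<phi>) \<in> atlas M \<Longrightarrow> (U', \<psi>) \<in> atlas N \<Longrightarrow>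
        smooth_on (model M) (\<phi> ` {x \<in> U \<inter> D. f x \<in> U'}) (model N) (\<lambda>y. \<psi> (f (inv_into U \<phi> y)))"
  using assms unfolding smooth_map_on_iff by blast+

lemma smooth_map_on_subset:
  assumes "smooth_map_on D M N f" "D' \<subseteq> D"
  shows "smooth_map_on D' M N f"
  unfolding smooth_map_on_iff
proof (intro conjI allI impI)
  show "continuous_map (subtopology (mtop M) D') (mtop N) f"
    using smooth_map_onD(1)[OF assms(1)] assms(2) by (rule continuous_map_from_subtopology_mono)
  show "smooth_on (model M) (\<phi> ` {x \<in> U \<inter> D'. f x \<in> U'}) (model N) (\<lambda>y. \<psi> (f (inv_into U \<phi> y)))"
    if "(U, \<phi>) \<in> atlas M" "(U', \<psi>) \<in> atlas N" for U \<phi> U' \<psi>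
    by (rule smooth_on_subset[OF smooth_map_onD(2)[OF assms(1) that]]) (use assms(2) in blast)
qed

lemma (in smooth_mfd) smooth_map_on_cong:
  assumes "smooth_map_on D M N f" "\<And>x. x \<in> D \<Longrightarrow> f x = g x"
  shows "smooth_map_on D M N g"
  unfolding smooth_map_on_iff
proof (intro conjI allI impI)
  show "continuous_map (subtopology (mtop M) D) (mtop N) g"
    using smooth_map_onD(1)[OF assms(1)] by (rule continuous_map_eq) (simp add: assms(2))
  fix U \<phi> U' \<psi> assume c: "(U, \<phi>) \<in> atlas M" "(U', \<psi>) \<in> atlas N"
  have "{x \<in> U \<inter> D. g x \<in> U'} = {x \<in> U \<inter> D. f x \<in> U'}" using assms(2) by auto
  then show "smooth_on (model M) (\<phi> ` {x \<in> U \<inter> D. g x \<in> U'}) (model N) (\<lambda>y. \<psi> (g (inv_into U \<phi> y)))"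
    using smooth_map_onD(2)[OF assms(1) c]
    by (simp only:) (erule smooth_on_cong, use assms(2) inv_into_f_f[OF chart_inj[OF c(1)]] in auto)
qed

lemma openin_continuous_preimage_sub:
  assumes "openin X D" "continuous_map (subtopology X D) Y f" "openin Y V"
  shows "openin X {x \<in> D. f x \<in> V}"
proof -
  have "openin (subtopology X D) {x \<in> topspace (subtopology X D). f x \<in> V}"
    using openin_continuous_map_preimage[OF assms(2,3)] .
  moreover have "{x \<in> topspace (subtopology X D). f x \<in> V} = {x \<in> D. f x \<in> V}"
    using openin_subset[OF assms(1)] by auto
  ultimately show ?thesis using assms(1) by (simp add: openin_open_subtopology)
qed

text \<open>Between the given pair of charts and any other one there are smooth transitions on both sides, and
  smoothness is local.\<close>

theorem smooth_map_on_in_charts: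
  assumes M: "smooth_manifold M" and N: "smooth_manifold N" and D: "openin (mtop M) D"
    and cont: "continuous_map (subtopology (mtop M) D) (mtop N) f"
    and loc: "\<And>x. x \<in> D \<Longrightarrow> \<exists>U \<phi> U' \<psi> Q. (U, \<phi>) \<in> atlas M \<and> (U', \<psi>) \<in> atlas N \<and> x \<in> U \<and> f x \<in> U' \<and>
      openin (mtop M) Q \<and> x \<in> Q \<and>
      smooth_on (model M) (\<phi> ` (Q \<inter> {x \<in> U \<inter> D. f x \<in> U'})) (model N) (\<lambda>y. \<psi> (f (inv_into U \<phi> y)))"
  shows "smooth_map_on D M N f"
  unfolding smooth_map_on_iff
proof (intro conjI cont allI impI)
  interpret M: smooth_mfd M by unfold_locales (rule M)
  interpret N: smooth_mfd N by unfold_locales (rule N)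
  fix U1 \<phi>1 U1' \<psi>1 assume c1: "(U1, \<phi>1) \<in> atlas M" "(U1', \<psi>1) \<in> atlas N"
  have pre: "openin (mtop M) {x \<in> D. f x \<in> V}" if "openin (mtop N) V" for V
    by (rule openin_continuous_preimage_sub[OF D cont that])
  define A1 where "A1 = {x \<in> U1 \<inter> D. f x \<in> U1'}"
  have A1: "openin (mtop M) A1"
  proof -
    have "A1 = U1 \<inter> {x \<in> D. f x \<in> U1'}" by (auto simp: A1_def)
    then show ?thesis using M.chart_open[OF c1(1)] pre[OF N.chart_open[OF c1(2)]] by auto
  qed
  have A1U: "A1 \<subseteq> U1" by (auto simp: A1_def)
  show "smooth_on (model M) (\<phi>1 ` A1) (model N) (\<lambda>y. \<psi>1 (f (inv_into U1 \<phi>1 y)))"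
  proof (rule smooth_on_locally[OF M.subspace_model M.chart_image_openin[OF c1(1) A1 A1U] N.subspace_model])
    fix y assume "y \<in> \<phi>1 ` A1"
    then obtain x where x: "x \<in> A1" "y = \<phi>1 x" by blast
    then have xD: "x \<in> D" by (simp add: A1_def)
    obtain U \<phi> U' \<psi> Q where c: "(U, \<phi>) \<in> atlas M" "(U', \<psi>) \<in> atlas N" and xU: "x \<in> U" "f x \<in> U'"
      and Q: "openin (mtop M) Q" "x \<in> Q"
      and sm: "smooth_on (model M) (\<phi> ` (Q \<inter> {x \<in> U \<inter> D. f x \<in> U'})) (model N) (\<lambda>y. \<psi> (f (inv_into U \<phi> y)))"
      using loc[OF xD] by blast
    define A where "A = Q \<inter> (U \<inter> {x \<in> D. f x \<in> U'}) \<inter> A1"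
    have A: "openin (mtop M) A"
      unfolding A_def using Q(1) M.chart_open[OF c(1)] pre[OF N.chart_open[OF c(2)]] A1 by (intro openin_Int)
    have AU: "A \<subseteq> U1" "A \<subseteq> U" using A1U by (auto simp: A_def)
    have inv1: "inv_into U1 \<phi>1 (\<phi>1 z) = z" if "z \<in> A" for z
      using inv_into_f_f[OF M.chart_inj[OF c1(1)]] AU that by blast
    have inv: "inv_into U \<phi> (\<phi> z) = z" if "z \<in> A" for z
      using inv_into_f_f[OF M.chart_inj[OF c(1)]] AU that by blast
    have inv': "inv_into U' \<psi> (\<psi> z) = z" if "z \<in> U'" for z
      using inv_into_f_f[OF N.chart_inj[OF c(2)]] that by blast
    have "smooth_on (model M) (\<phi>1 ` A) (model M) (\<lambda>y. \<phi> (inv_into U1 \<phi>1 y))"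
      by (rule smooth_on_subset[OF M.transition[OF c1(1) c(1)]]) (use AU in blast)
    moreover have "(\<lambda>y. \<phi> (inv_into U1 \<phi>1 y)) ` \<phi>1 ` A \<subseteq> \<phi> ` (Q \<inter> {x \<in> U \<inter> D. f x \<in> U'})"
      using inv1 by (auto simp: A_def)
    ultimately have "smooth_on (model M) (\<phi>1 ` A) (model N) (\<lambda>y. \<psi> (f (inv_into U \<phi> (\<phi> (inv_into U1 \<phi>1 y)))))"
      using sm by (rule smooth_on_compose)
    moreover have "(\<lambda>y. \<psi> (f (inv_into U \<phi> (\<phi> (inv_into U1 \<phi>1 y))))) ` \<phi>1 ` A \<subseteq> \<psi> ` (U' \<inter> U1')"
      using inv1 inv by (auto simp: A_def A1_def)
    ultimately have "smooth_on (model M) (\<phi>1 ` A) (model N)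
        (\<lambda>y. \<psi>1 (inv_into U' \<psi> (\<psi> (f (inv_into U \<phi> (\<phi> (inv_into U1 \<phi>1 y)))))))"
      using N.transition[OF c(2) c1(2)] by (rule smooth_on_compose)
    then have "smooth_on (model M) (\<phi>1 ` A) (model N) (\<lambda>y. \<psi>1 (f (inv_into U1 \<phi>1 y)))"
      by (rule smooth_on_cong) (use inv1 inv inv' in \<open>auto simp: A_def\<close>)
    moreover have "\<phi>1 ` A1 \<inter> \<phi>1 ` A = \<phi>1 ` A" by (auto simp: A_def)
    moreover have "openin (top_of_set (model M)) (\<phi>1 ` A)" by (rule M.chart_image_openin[OF c1(1) A AU(1)])
    moreover have "y \<in> \<phi>1 ` A" using x xU Q xD by (auto simp: A_def)
    ultimately show "\<exists>Q. openin (top_of_set (model M)) Q \<and> y \<in> Q \<and>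
        smooth_on (model M) (\<phi>1 ` A1 \<inter> Q) (model N) (\<lambda>y. \<psi>1 (f (inv_into U1 \<phi>1 y)))"
      by (intro exI[of _ "\<phi>1 ` A"]) simp
  qed
qed

lemma smooth_map_on_locally:
  assumes M: "smooth_manifold M" and N: "smooth_manifold N" and D: "openin (mtop M) D"
    and loc: "\<And>x. x \<in> D \<Longrightarrow> \<exists>Q. openin (mtop M) Q \<and> x \<in> Q \<and> smooth_map_on (D \<inter> Q) M N f"
  shows "smooth_map_on D M N f"
proof (rule smooth_map_on_in_charts[OF M N D])
  interpret M: smooth_mfd M by unfold_locales (rule M)
  interpret N: smooth_mfd N by unfold_locales (rule N)
  have DM: "D \<subseteq> topspace (mtop M)" using D openin_subset by blast
  show cont: "continuous_map (subtopology (mtop M) D) (mtop N) f"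
    unfolding continuous_map_def
  proof (intro conjI allI impI Pi_I)
    show "f x \<in> topspace (mtop N)" if x: "x \<in> topspace (subtopology (mtop M) D)" for x
    proof -
      obtain Q where Q: "x \<in> Q" "smooth_map_on (D \<inter> Q) M N f" using loc[of x] x by auto
      then show ?thesis using smooth_map_onD(1)[OF Q(2)] x by (auto simp: continuous_map_def)
    qed
    fix V assume V: "openin (mtop N) V"
    have "openin (mtop M) {x \<in> D. f x \<in> V}"
    proof (subst openin_subopen, intro ballI)
      fix x assume x: "x \<in> {x \<in> D. f x \<in> V}"
      then obtain Q where Q: "openin (mtop M) Q" "x \<in> Q" "smooth_map_on (D \<inter> Q) M N f" using loc[of x] by auto
      have "openin (mtop M) {x \<in> D \<inter> Q. f x \<in> V}"
        by (rule openin_continuous_preimage_sub[OF openin_Int[OF D Q(1)] smooth_map_onD(1)[OF Q(3)] V])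
      then show "\<exists>T. openin (mtop M) T \<and> x \<in> T \<and> T \<subseteq> {x \<in> D. f x \<in> V}"
        using x Q by (intro exI[of _ "{x \<in> D \<inter> Q. f x \<in> V}"]) auto
    qed
    moreover have "{x \<in> topspace (subtopology (mtop M) D). f x \<in> V} = {x \<in> D. f x \<in> V}" using DM by auto
    ultimately show "openin (subtopology (mtop M) D) {x \<in> topspace (subtopology (mtop M) D). f x \<in> V}"
      using D by (auto simp: openin_open_subtopology)
  qed
  fix x assume x: "x \<in> D"
  obtain Q where Q: "openin (mtop M) Q" "x \<in> Q" "smooth_map_on (D \<inter> Q) M N f" using loc[OF x] by auto
  obtain U \<phi> where U: "(U, \<phi>) \<in> atlas M" "x \<in> U" using M.chart_cover x DM by blast
  have "f x \<in> topspace (mtop N)" using cont x DM by (auto simp: continuous_map_def)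
  then obtain U' \<psi> where U': "(U', \<psi>) \<in> atlas N" "f x \<in> U'" using N.chart_cover by blast
  have eq: "{x \<in> U \<inter> (D \<inter> Q). f x \<in> U'} = Q \<inter> {x \<in> U \<inter> D. f x \<in> U'}" by auto
  show "\<exists>U \<phi> U' \<psi> Q. (U, \<phi>) \<in> atlas M \<and> (U', \<psi>) \<in> atlas N \<and> x \<in> U \<and> f x \<in> U' \<and>
      openin (mtop M) Q \<and> x \<in> Q \<and>
      smooth_on (model M) (\<phi> ` (Q \<inter> {x \<in> U \<inter> D. f x \<in> U'})) (model N) (\<lambda>y. \<psi> (f (inv_into U \<phi> y)))"
    using smooth_map_onD(2)[OF Q(3) U(1) U'(1), unfolded eq] U U' Q(1,2) by blast
qed

text \<open>A chart of \<open>N\<close> at \<open>f x\<close> factors the local representative of \<open>h \<circ> f\<close> near \<open>x\<close>.\<close>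

theorem smooth_map_on_compose:
  assumes M: "smooth_manifold M" and N: "charted N" and P: "smooth_manifold P" and D: "openin (mtop M) D"
    and f: "smooth_map_on D M N f" and fD: "f ` D \<subseteq> D'" and h: "smooth_map_on D' N P h"
  shows "smooth_map_on D M P (\<lambda>x. h (f x))"
proof (rule smooth_map_on_in_charts[OF M P D])
  interpret M: smooth_mfd M by unfold_locales (rule M)
  interpret P: smooth_mfd P by unfold_locales (rule P)
  have DM: "D \<subseteq> topspace (mtop M)" using D openin_subset by blast
  have "continuous_map (subtopology (mtop M) D) (subtopology (mtop N) D') f"
    using smooth_map_onD(1)[OF f] fD by (auto simp: continuous_map_in_subtopology)
  from continuous_map_compose[OF this smooth_map_onD(1)[OF h]]
  show cont: "continuous_map (subtopology (mtop M) D) (mtop P) (\<lambda>x. h (f x))" by (simp add: o_def)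
  fix x assume x: "x \<in> D"
  obtain U \<phi> where U: "(U, \<phi>) \<in> atlas M" "x \<in> U" using M.chart_cover x DM by blast
  have "f x \<in> topspace (mtop N)" using smooth_map_onD(1)[OF f] x DM by (auto simp: continuous_map_def)
  then obtain V \<psi> where V: "(V, \<psi>) \<in> atlas N" "f x \<in> V" using chartedD(3)[OF N] by blast
  have "h (f x) \<in> topspace (mtop P)" using cont x DM by (auto simp: continuous_map_def)
  then obtain W \<xi> where W: "(W, \<xi>) \<in> atlas P" "h (f x) \<in> W" using P.chart_cover by blast
  define Q where "Q = {x \<in> D. f x \<in> V}"
  have Q: "openin (mtop M) Q"
    unfolding Q_def using openin_continuous_preimage_sub[OF D smooth_map_onD(1)[OF f] chartedD(1)[OF N V(1)]] .
  let ?A = "Q \<inter> {x \<in> U \<inter> D. h (f x) \<in> W}"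
  have inv: "inv_into U \<phi> (\<phi> z) = z" if "z \<in> U" for z
    using inv_into_f_f[OF M.chart_inj[OF U(1)]] that by blast
  have inv': "inv_into V \<psi> (\<psi> z) = z" if "z \<in> V" for z
    using inv_into_f_f[OF chartedD(2)[OF N V(1)]] that by blast
  have "smooth_on (model M) (\<phi> ` ?A) (model N) (\<lambda>y. \<psi> (f (inv_into U \<phi> y)))"
    by (rule smooth_on_subset[OF smooth_map_onD(2)[OF f U(1) V(1)]]) (auto simp: Q_def)
  moreover have "(\<lambda>y. \<psi> (f (inv_into U \<phi> y))) ` \<phi> ` ?A \<subseteq> \<psi> ` {z \<in> V \<inter> D'. h z \<in> W}"
    using inv fD by (auto simp: Q_def)
  ultimately have "smooth_on (model M) (\<phi> ` ?A) (model P) (\<lambda>y. \<xi> (h (inv_into V \<psi> (\<psi> (f (inv_into U \<phi> y))))))"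
    using smooth_map_onD(2)[OF h V(1) W(1)] by (rule smooth_on_compose)
  then have "smooth_on (model M) (\<phi> ` ?A) (model P) (\<lambda>y. \<xi> (h (f (inv_into U \<phi> y))))"
    by (rule smooth_on_cong) (use inv inv' in \<open>auto simp: Q_def\<close>)
  moreover have "x \<in> Q" using x V by (simp add: Q_def)
  ultimately show "\<exists>U \<phi> U' \<psi> Q. (U, \<phi>) \<in> atlas M \<and> (U', \<psi>) \<in> atlas P \<and> x \<in> U \<and> h (f x) \<in> U' \<and>
      openin (mtop M) Q \<and> x \<in> Q \<and>
      smooth_on (model M) (\<phi> ` (Q \<inter> {x \<in> U \<inter> D. h (f x) \<in> U'})) (model P) (\<lambda>y. \<psi> (h (f (inv_into U \<phi> y))))"
    using U W Q by blast
qed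

subsection \<open>Products\<close>

lemma prod_manifold_simps [simp]:
  "mtop (prod_manifold M N) = prod_topology (mtop M) (mtop N)"
  "model (prod_manifold M N) = model M \<times> model N"
  by (simp_all add: prod_manifold_def)

lemma atlas_prod_manifold: "(W, \<xi>) \<in> atlas (prod_manifold M N) \<longleftrightarrow>
  (\<exists>U \<phi> U' \<psi>. W = U \<times> U' \<and> \<xi> = map_prod \<phi> \<psi> \<and> (U, \<phi>) \<in> atlas M \<and> (U', \<psi>) \<in> atlas N)"
  by (auto simp: prod_manifold_def)

lemma charted_prod_manifold:
  assumes "charted M" "charted N"
  shows "charted (prod_manifold M N)"
  unfolding charted_def
proof (intro conjI allI impI ballI)
  fix W \<xi> assume "(W, \<xi>) \<in> atlas (prod_manifold M N)"
  then obtain U \<phi> U' \<psi> where c: "W = U \<times> U'" "\<xi> = map_prod \<phi> \<psi>" "(U, \<phi>) \<in> atlas M" "(U', \<psi>) \<in> atlas N"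
    unfolding atlas_prod_manifold by blast
  show "openin (mtop (prod_manifold M N)) W"
    using chartedD(1)[OF assms(1) c(3)] chartedD(1)[OF assms(2) c(4)] by (simp add: c openin_prod_Times_iff)
  show "inj_on \<xi> W"
    using chartedD(2)[OF assms(1) c(3)] chartedD(2)[OF assms(2) c(4)] by (simp add: c map_prod_inj_on)
next
  fix x assume "x \<in> topspace (mtop (prod_manifold M N))"
  then have "fst x \<in> topspace (mtop M)" "snd x \<in> topspace (mtop N)" by auto
  then obtain U \<phi> U' \<psi> where "(U, \<phi>) \<in> atlas M" "fst x \<in> U" "(U', \<psi>) \<in> atlas N" "snd x \<in> U'"
    using chartedD(3)[OF assms(1)] chartedD(3)[OF assms(2)] by blast
  then show "\<exists>U \<phi>. (U, \<phi>) \<in> atlas (prod_manifold M N) \<and> x \<in> U"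
    unfolding atlas_prod_manifold by (intro exI[of _ "U \<times> U'"] exI[of _ "map_prod \<phi> \<psi>"]) (auto simp: mem_Times_iff)
qed

lemma smooth_map_on_Pair:
  assumes "smooth_map_on D M N1 f" "smooth_map_on D M N2 g"
  shows "smooth_map_on D M (prod_manifold N1 N2) (\<lambda>x. (f x, g x))"
  unfolding smooth_map_on_iff
proof (intro conjI allI impI)
  show "continuous_map (subtopology (mtop M) D) (mtop (prod_manifold N1 N2)) (\<lambda>x. (f x, g x))"
    using assms[THEN smooth_map_onD(1)] by (simp add: continuous_map_pairwise o_def)
  fix U \<phi> W \<xi> assume c: "(U, \<phi>) \<in> atlas M" "(W, \<xi>) \<in> atlas (prod_manifold N1 N2)"
  obtain V \<psi> V' \<psi>' where v: "W = V \<times> V'" "\<xi> = map_prod \<psi> \<psi>'" "(V, \<psi>) \<in> atlas N1" "(V', \<psi>') \<in> atlas N2"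
    using c(2) unfolding atlas_prod_manifold by blast
  let ?A = "\<phi> ` {x \<in> U \<inter> D. (f x, g x) \<in> W}"
  have "smooth_on (model M) ?A (model N1) (\<lambda>y. \<psi> (f (inv_into U \<phi> y)))"
    by (rule smooth_on_subset[OF smooth_map_onD(2)[OF assms(1) c(1) v(3)]]) (auto simp: v)
  moreover have "smooth_on (model M) ?A (model N2) (\<lambda>y. \<psi>' (g (inv_into U \<phi> y)))"
    by (rule smooth_on_subset[OF smooth_map_onD(2)[OF assms(2) c(1) v(4)]]) (auto simp: v)
  ultimately show "smooth_on (model M) ?A (model (prod_manifold N1 N2)) (\<lambda>y. \<xi> (f (inv_into U \<phi> y), g (inv_into U \<phi> y)))"
    using smooth_on_Pair by (simp add: v(2))
qed

subsection \<open>Real functions\<close>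

lemma charted_real_manifold: "charted real_manifold"
  by (auto simp: charted_def real_manifold_def)

lemma smooth_map_on_real_iff:
  "smooth_map_on D M real_manifold r \<longleftrightarrow> continuous_map (subtopology (mtop M) D) euclideanreal r \<and>
     (\<forall>U \<phi>. (U, \<phi>) \<in> atlas M \<longrightarrow> smooth_on (model M) (\<phi> ` (U \<inter> D)) UNIV (\<lambda>y. r (inv_into U \<phi> y)))"
  by (simp add: smooth_map_on_iff real_manifold_def Int_def)

lemma smooth_real_const: "smooth_map_on D M real_manifold (\<lambda>_. c)"
  by (auto simp: smooth_map_on_real_iff intro: smooth_on_const)

lemma smooth_real_add:
  "smooth_map_on D M real_manifold r \<Longrightarrow> smooth_map_on D M real_manifold s \<Longrightarrow>
    smooth_map_on D M real_manifold (\<lambda>x. r x + s x)"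
  unfolding smooth_map_on_real_iff by (auto intro: smooth_on_add continuous_map_add)

lemma smooth_real_diff:
  "smooth_map_on D M real_manifold r \<Longrightarrow> smooth_map_on D M real_manifold s \<Longrightarrow>
    smooth_map_on D M real_manifold (\<lambda>x. r x - s x)"
  unfolding smooth_map_on_real_iff by (auto intro: smooth_on_diff continuous_map_diff)

lemma smooth_real_mult:
  "smooth_map_on D M real_manifold r \<Longrightarrow> smooth_map_on D M real_manifold s \<Longrightarrow>
    smooth_map_on D M real_manifold (\<lambda>x. r x * s x)"
  unfolding smooth_map_on_real_iff by (auto intro: smooth_on_mult continuous_map_real_mult)

lemma smooth_real_sum:
  "(\<And>i. i \<in> I \<Longrightarrow> smooth_map_on D M real_manifold (r i)) \<Longrightarrow> smooth_map_on D M real_manifold (\<lambda>x. \<Sum>i\<in>I. r i x)"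
  by (induction I rule: infinite_finite_induct) (auto intro: smooth_real_add smooth_real_const)

lemma smooth_real_inverse:
  assumes "smooth_map_on D M real_manifold r" "\<And>x. r x \<noteq> 0"
  shows "smooth_map_on D M real_manifold (\<lambda>x. inverse (r x))"
  using assms unfolding smooth_map_on_real_iff
  by (auto intro!: smooth_on_inverse continuous_map_real_inverse)

subsection \<open>Powers\<close>

lemma power_manifold_simps [simp]:
  "mtop (power_manifold q M) = product_topology (\<lambda>_. mtop M) {..q}"
  "model (power_manifold q M) = {x. (\<forall>i\<le>q. x i \<in> model M) \<and> (\<forall>i>q. x i = 0)}"
  by (simp_all add: power_manifold_def)

lemma model_power_fun: "model (power_manifold q M) = {y. \<forall>i. y i \<in> (if i \<le> q then model M else {0})}"
  unfolding power_manifold_simps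
proof (intro Collect_cong iffI conjI allI impI)
  fix x i assume *: "\<forall>i. x i \<in> (if i \<le> q then model M else {0})"
  show "x i \<in> model M" if "i \<le> q" using *[rule_format, of i] that by simp
  show "x i = 0" if "i > q" using *[rule_format, of i] that by simp
qed auto

lemma atlas_power_manifold: "(W, \<xi>) \<in> atlas (power_manifold q M) \<longleftrightarrow>
  (\<exists>U \<phi>. (\<forall>i\<le>q. (U i, \<phi> i) \<in> atlas M) \<and> W = (\<Pi>\<^sub>E i\<in>{..q}. U i) \<and> \<xi> = (\<lambda>x i. if i \<le> q then \<phi> i (x i) else 0))"
proof
  assume "(W, \<xi>) \<in> atlas (power_manifold q M)"
  then obtain c where "W = (\<Pi>\<^sub>E i\<in>{..q}. fst (c i))" "\<xi> = (\<lambda>x i. if i \<le> q then snd (c i) (x i) else 0)" "\<forall>i\<le>q. c i \<in> atlas M"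
    by (auto simp: power_manifold_def)
  then show "\<exists>U \<phi>. (\<forall>i\<le>q. (U i, \<phi> i) \<in> atlas M) \<and> W = (\<Pi>\<^sub>E i\<in>{..q}. U i) \<and> \<xi> = (\<lambda>x i. if i \<le> q then \<phi> i (x i) else 0)"
    by (intro exI[of _ "\<lambda>i. fst (c i)"] exI[of _ "\<lambda>i. snd (c i)"]) simp
next
  assume "\<exists>U \<phi>. (\<forall>i\<le>q. (U i, \<phi> i) \<in> atlas M) \<and> W = (\<Pi>\<^sub>E i\<in>{..q}. U i) \<and> \<xi> = (\<lambda>x i. if i \<le> q then \<phi> i (x i) else 0)"
  then obtain U \<phi> where "\<forall>i\<le>q. (U i, \<phi> i) \<in> atlas M" "W = (\<Pi>\<^sub>E i\<in>{..q}. U i)" "\<xi> = (\<lambda>x i. if i \<le> q then \<phi> i (x i) else 0)"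
    by blast
  then show "(W, \<xi>) \<in> atlas (power_manifold q M)"
    unfolding power_manifold_def by (simp) (rule exI[of _ "\<lambda>i. (U i, \<phi> i)"], simp add: fun_eq_iff)
qed

context smooth_mfd
begin

context
  fixes q :: nat and U :: "nat \<Rightarrow> 'm set" and \<phi> :: "nat \<Rightarrow> 'm \<Rightarrow> 'e"
  assumes c: "\<And>i. i \<le> q \<Longrightarrow> (U i, \<phi> i) \<in> atlas M"
begin

abbreviation "pU \<equiv> (\<Pi>\<^sub>E i\<in>{..q}. U i)"
abbreviation "p\<phi> \<equiv> (\<lambda>x i. if i \<le> q then \<phi> i (x i) else 0)"
abbreviation "pinv \<equiv> (\<lambda>y. \<lambda>i\<in>{..q}. inv_into (U i) (\<phi> i) (y i))"

lemma pinv_p\<phi>: "x \<in> pU \<Longrightarrow> pinv (p\<phi> x) = x"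
  using inv_into_f_f[OF chart_inj[OF c]] by (auto simp: PiE_iff fun_eq_iff extensional_def)

lemma power_chart_inj: "inj_on p\<phi> pU"
  by (rule inj_on_inverseI[of _ pinv]) (rule pinv_p\<phi>)

lemma power_chart_inv: "y \<in> p\<phi> ` pU \<Longrightarrow> inv_into pU p\<phi> y = pinv y"
  using inv_into_f_f[OF power_chart_inj] pinv_p\<phi> by auto

lemma power_chart_image: "p\<phi> ` pU = {y. (\<forall>i\<le>q. y i \<in> \<phi> i ` U i) \<and> (\<forall>i>q. y i = 0)}"
proof
  show "p\<phi> ` pU \<subseteq> {y. (\<forall>i\<le>q. y i \<in> \<phi> i ` U i) \<and> (\<forall>i>q. y i = 0)}" by (auto simp: PiE_iff)
  show "{y. (\<forall>i\<le>q. y i \<in> \<phi> i ` U i) \<and> (\<forall>i>q. y i = 0)} \<subseteq> p\<phi> ` pU"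
  proof
    fix y assume y: "y \<in> {y. (\<forall>i\<le>q. y i \<in> \<phi> i ` U i) \<and> (\<forall>i>q. y i = 0)}"
    then have a: "pinv y \<in> pU" by (auto simp: inv_into_into)
    have b: "p\<phi> (pinv y) = y" using y by (auto simp: fun_eq_iff f_inv_into_f)
    have "p\<phi> (pinv y) \<in> p\<phi> ` pU" by (rule imageI[OF a])
    then show "y \<in> p\<phi> ` pU" by (simp only: b)
  qed
qed

lemma power_chart_open: "openin (mtop (power_manifold q M)) pU"
  using chart_open[OF c] by (simp add: openin_PiE)

lemma power_chart_image_open: "openin (top_of_set (model (power_manifold q M))) (p\<phi> ` pU)"
proof -
  have "\<forall>i\<le>q. \<exists>Q. open Q \<and> \<phi> i ` U i = model M \<inter> Q"
    using chart_image[OF c] by (auto simp: openin_open)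
  then obtain Q where Q: "\<And>i. i \<le> q \<Longrightarrow> open (Q i)" "\<And>i. i \<le> q \<Longrightarrow> \<phi> i ` U i = model M \<inter> Q i"
    by metis
  have "open (\<Inter>i\<in>{..q}. {y :: nat \<Rightarrow> 'e. y i \<in> Q i})"
    using Q(1) by (intro open_INT finite_atMost ballI open_coordinate_vimage) auto
  moreover have "p\<phi> ` pU = model (power_manifold q M) \<inter> (\<Inter>i\<in>{..q}. {y. y i \<in> Q i})"
    unfolding power_chart_image using Q(2) by auto
  ultimately show ?thesis unfolding openin_open by blast
qed

lemma power_chart_homeo: "homeomorphic_map (subtopology (mtop (power_manifold q M)) pU) (top_of_set (p\<phi> ` pU)) p\<phi>"
proof -
  let ?X = "subtopology (product_topology (\<lambda>_. mtop M) {..q}) pU"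
  have sub: "pU \<subseteq> topspace (product_topology (\<lambda>_. mtop M) {..q})"
    using power_chart_open openin_subset by fastforce
  have 1: "continuous_map ?X (top_of_set (p\<phi> ` pU)) p\<phi>"
  proof -
    have "continuous_map ?X euclidean (\<lambda>x. p\<phi> x i)" for i
    proof (cases "i \<le> q")
      case True
      have a: "continuous_map ?X (subtopology (mtop M) (U i)) (\<lambda>x. x i)"
        using True by (auto simp: continuous_map_in_subtopology PiE_iff
          intro!: continuous_map_from_subtopology continuous_map_product_projection)
      have "continuous_map (subtopology (mtop M) (U i)) euclidean (\<phi> i)"
        using homeomorphic_imp_continuous_map[OF chart_homeo[OF c[OF True]]] by (simp add: continuous_map_in_subtopology)
      from continuous_map_compose[OF a this] show ?thesis
        using True by (simp add: o_def)
    qed simp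
    then have "continuous_map ?X (product_topology (\<lambda>_ :: nat. euclidean :: 'e topology) UNIV) p\<phi>"
      unfolding continuous_map_componentwise_UNIV by blast
    then show ?thesis by (auto simp: euclidean_product_topology continuous_map_in_subtopology)
  qed
  have 2: "continuous_map (top_of_set (p\<phi> ` pU)) ?X pinv"
  proof -
    have "continuous_map (top_of_set (p\<phi> ` pU)) (mtop M) (\<lambda>y. inv_into (U i) (\<phi> i) (y i))" if i: "i \<le> q" for i
    proof -
      have a: "continuous_map (top_of_set (p\<phi> ` pU)) (top_of_set (\<phi> i ` U i)) (\<lambda>y. y i)"
        using i continuous_on_subset[OF continuous_on_product_coordinates[of i] subset_UNIV, of "p\<phi> ` pU"]
        by (auto simp: continuous_map_in_subtopology PiE_iff)
      have b: "continuous_map (top_of_set (\<phi> i ` U i)) (mtop M) (inv_into (U i) (\<phi> i))"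
        by (rule chart_inv_cont[OF c[OF i]])
      from continuous_map_compose[OF a b] show ?thesis by (simp add: o_def)
    qed
    then have "continuous_map (top_of_set (p\<phi> ` pU)) (product_topology (\<lambda>_. mtop M) {..q}) pinv"
      unfolding continuous_map_componentwise by (auto intro: continuous_map_eq)
    then show ?thesis
      using pinv_p\<phi> by (auto simp: continuous_map_in_subtopology)
  qed
  have "homeomorphic_maps ?X (top_of_set (p\<phi> ` pU)) p\<phi> pinv"
    unfolding homeomorphic_maps_def using 1 2 pinv_p\<phi> sub by auto
  then show ?thesis using homeomorphic_maps_map by fastforce
qed

end

lemma power_coordinate_smooth:
  assumes c: "\<And>i. i \<le> q \<Longrightarrow> (U i, \<phi> i) \<in> atlas M" and k: "k \<le> q" and c': "(U', \<psi>) \<in> atlas M"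
  shows "smooth_on (model (power_manifold q M)) ((\<lambda>x i. if i \<le> q then \<phi> i (x i) else 0) ` {x \<in> (\<Pi>\<^sub>E i\<in>{..q}. U i). x k \<in> U'})
    (model M) (\<lambda>y. \<psi> (inv_into (\<Pi>\<^sub>E i\<in>{..q}. U i) (\<lambda>x i. if i \<le> q then \<phi> i (x i) else 0) y k))"
    (is "smooth_on ?S ?W ?T ?f")
proof -
  have "smooth_on ?S ?W (model M) (\<lambda>y. y k)"
    using k chart_model[OF c] by (intro smooth_on_linear cont_linear_apply) (auto simp: PiE_iff)
  moreover have "(\<lambda>y. y k) ` ?W \<subseteq> \<phi> k ` (U k \<inter> U')" using k by (auto simp: PiE_iff)
  ultimately have "smooth_on ?S ?W (model M) (\<lambda>y. \<psi> (inv_into (U k) (\<phi> k) (y k)))"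
    using transition[OF c[OF k] c'] by (rule smooth_on_compose)
  then show ?thesis
  proof (rule smooth_on_cong)
    fix y assume "y \<in> ?W"
    then have "y \<in> (\<lambda>x i. if i \<le> q then \<phi> i (x i) else 0) ` (\<Pi>\<^sub>E i\<in>{..q}. U i)" by blast
    from power_chart_inv[OF c this] show "\<psi> (inv_into (U k) (\<phi> k) (y k)) = ?f y" using k by simp
  qed
qed

text \<open>A chart of the power is a product of charts, padded by zeros beyond the index \<open>q\<close>. It is open because the
  product is finite, and its transitions are smooth because they are so in each coordinate.\<close>

theorem smooth_manifold_power: "smooth_manifold (power_manifold q M)"
  unfolding smooth_manifold_def
proof (intro conjI ballI)
  let ?P = "power_manifold q M"
  note model_fun = model_power_fun[of q M]
  show "subspace (model ?P)"
    using subspace_model by (simp add: subspace_def)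
  show "case p of (U, \<phi>) \<Rightarrow> openin (mtop ?P) U \<and> openin (top_of_set (model ?P)) (\<phi> ` U) \<and>
      homeomorphic_map (subtopology (mtop ?P) U) (top_of_set (\<phi> ` U)) \<phi>" if pA: "p \<in> atlas ?P" for p
  proof -
    obtain W \<xi> where p: "p = (W, \<xi>)" by (cases p)
    obtain U \<phi> where c: "\<And>i. i \<le> q \<Longrightarrow> (U i, \<phi> i) \<in> atlas M"
      and W: "W = (\<Pi>\<^sub>E i\<in>{..q}. U i)" "\<xi> = (\<lambda>x i. if i \<le> q then \<phi> i (x i) else 0)"
      using pA unfolding p atlas_power_manifold by blast
    show ?thesis unfolding p prod.case W
      by (intro conjI power_chart_open[of q U \<phi>] power_chart_image_open[of q U \<phi>] power_chart_homeo[of q U \<phi>] c)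
  qed
  show "(\<Union>(U, \<phi>)\<in>atlas ?P. U) = topspace (mtop ?P)"
  proof
    show "(\<Union>(U, \<phi>)\<in>atlas ?P. U) \<subseteq> topspace (mtop ?P)"
    proof clarify
      fix x W \<xi> assume x: "x \<in> W" and "(W, \<xi>) \<in> atlas ?P"
      then obtain U \<phi> where "\<And>i. i \<le> q \<Longrightarrow> (U i, \<phi> i) \<in> atlas M" "W = (\<Pi>\<^sub>E i\<in>{..q}. U i)"
        unfolding atlas_power_manifold by blast
      then show "x \<in> topspace (mtop ?P)"
        using x chart_subset by (fastforce simp: PiE_iff)
    qed
    show "topspace (mtop ?P) \<subseteq> (\<Union>(U, \<phi>)\<in>atlas ?P. U)"
    proof
      fix x assume "x \<in> topspace (mtop ?P)"
      then have x: "x \<in> (\<Pi>\<^sub>E i\<in>{..q}. topspace (mtop M))" by simp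
      have "\<forall>i\<in>{..q}. \<exists>c. (fst c, snd c) \<in> atlas M \<and> x i \<in> fst c"
      proof
        fix i assume "i \<in> {..q}"
        then have "x i \<in> topspace (mtop M)" using x by (auto simp: PiE_iff)
        from chart_cover[OF this] obtain U \<phi> where "(U, \<phi>) \<in> atlas M" "x i \<in> U" by blast
        then show "\<exists>c. (fst c, snd c) \<in> atlas M \<and> x i \<in> fst c" by (intro exI[of _ "(U, \<phi>)"]) simp
      qed
      then obtain c where c: "\<forall>i\<in>{..q}. (fst (c i), snd (c i)) \<in> atlas M \<and> x i \<in> fst (c i)"
        by metis
      let ?W = "\<Pi>\<^sub>E i\<in>{..q}. fst (c i)" and ?\<xi> = "\<lambda>x i. if i \<le> q then snd (c i) (x i) else 0"
      have "(?W, ?\<xi>) \<in> atlas ?P"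
        unfolding atlas_power_manifold using c
        by (intro exI[of _ "\<lambda>i. fst (c i)"] exI[of _ "\<lambda>i. snd (c i)"]) simp
      moreover have "x \<in> ?W" using x c by (auto simp: PiE_iff)
      ultimately show "x \<in> (\<Union>(U, \<phi>)\<in>atlas ?P. U)" by blast
    qed
  qed
  show "case p of (U, \<phi>) \<Rightarrow> \<forall>(U', \<psi>)\<in>atlas ?P. smooth_on (model ?P) (\<phi> ` (U \<inter> U')) (model ?P) (\<psi> \<circ> inv_into U \<phi>)"
    if pA: "p \<in> atlas ?P" for p
  proof (unfold case_prod_unfold, intro ballI)
    fix p' assume "p' \<in> atlas ?P"
    then obtain W' \<xi>' where p': "p' = (W', \<xi>')" "(W', \<xi>') \<in> atlas ?P" by (cases p') auto
    obtain W \<xi> where p: "p = (W, \<xi>)" by (cases p)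
    obtain U \<phi> where c: "\<And>i. i \<le> q \<Longrightarrow> (U i, \<phi> i) \<in> atlas M"
      and W: "W = (\<Pi>\<^sub>E i\<in>{..q}. U i)" "\<xi> = (\<lambda>x i. if i \<le> q then \<phi> i (x i) else 0)"
      using pA unfolding p atlas_power_manifold by blast
    obtain U' \<psi> where c': "\<And>i. i \<le> q \<Longrightarrow> (U' i, \<psi> i) \<in> atlas M"
      and W': "W' = (\<Pi>\<^sub>E i\<in>{..q}. U' i)" "\<xi>' = (\<lambda>x i. if i \<le> q then \<psi> i (x i) else 0)"
      using p'(2) unfolding atlas_power_manifold by blast
    have "smooth_on (model ?P) (\<xi> ` (W \<inter> W')) (if i \<le> q then model M else {0}) (\<lambda>y. \<xi>' (inv_into W \<xi> y) i)" for i
    proof (cases "i \<le> q")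
      case True
      have "smooth_on (model ?P) (\<xi> ` (W \<inter> W')) (model M) (\<lambda>y. \<psi> i (inv_into W \<xi> y i))"
        using power_coordinate_smooth[OF c True c'[OF True]] unfolding W
        by (rule smooth_on_subset) (use True W' in \<open>auto simp: PiE_iff\<close>)
      then show ?thesis using True by (simp add: W')
    next
      case False
      then show ?thesis by (simp add: W' smooth_on_const)
    qed
    then have "smooth_on (model ?P) (\<xi> ` (W \<inter> W')) (model ?P) (\<lambda>y. \<xi>' (inv_into W \<xi> y))"
      unfolding model_fun by (rule smooth_on_fun)
    then show "smooth_on (model ?P) (snd p ` (fst p \<inter> fst p')) (model ?P) (snd p' \<circ> inv_into (fst p) (snd p))"
      by (simp add: p p' o_def)
  qed
qed

lemma smooth_power_coordinate:
  assumes "k \<le> q"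
  shows "smooth_map_on D (power_manifold q M) M (\<lambda>u. u k)"
  unfolding smooth_map_on_iff
proof (intro conjI allI impI)
  show "continuous_map (subtopology (mtop (power_manifold q M)) D) (mtop M) (\<lambda>u. u k)"
    using assms by (auto intro!: continuous_map_from_subtopology continuous_map_product_projection)
  fix W \<xi> U' \<psi> assume "(W, \<xi>) \<in> atlas (power_manifold q M)" and c': "(U', \<psi>) \<in> atlas M"
  then obtain U \<phi> where c: "\<And>i. i \<le> q \<Longrightarrow> (U i, \<phi> i) \<in> atlas M"
      and W: "W = (\<Pi>\<^sub>E i\<in>{..q}. U i)" "\<xi> = (\<lambda>x i. if i \<le> q then \<phi> i (x i) else 0)"
    unfolding atlas_power_manifold by blast
  show "smooth_on (model (power_manifold q M)) (\<xi> ` {x \<in> W \<inter> D. x k \<in> U'}) (model M) (\<lambda>y. \<psi> (inv_into W \<xi> y k))"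
    using power_coordinate_smooth[OF c assms c'] unfolding W
    by (rule smooth_on_subset) (assumption | rule image_mono | blast)+
qed

lemma smooth_const:
  assumes g: "g \<in> topspace (mtop M)"
  shows "smooth_map_on D P M (\<lambda>_. g)"
  unfolding smooth_map_on_iff
proof (intro conjI allI impI)
  show "continuous_map (subtopology (mtop P) D) (mtop M) (\<lambda>_. g)" using g by simp
  fix U \<phi> U' \<psi> assume c: "(U, \<phi>) \<in> atlas P" "(U', \<psi>) \<in> atlas M"
  show "smooth_on (model P) (\<phi> ` {x \<in> U \<inter> D. g \<in> U'}) (model M) (\<lambda>y. \<psi> g)"
  proof (cases "g \<in> U'")
    case True
    then show ?thesis using chart_model[OF c(2)] subspace_0[OF subspace_model] by (intro smooth_on_const) auto
  next
    case False
    have "smooth_on (model P) {} (model M) (\<lambda>y. 0)" using subspace_0[OF subspace_model] by (intro smooth_on_const)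
    moreover have "\<phi> ` {x \<in> U \<inter> D. g \<in> U'} = {}" using False by simp
    ultimately show ?thesis by (simp only:) (erule smooth_on_cong, simp)
  qed
qed

lemma smooth_tuple:
  assumes "\<And>i. i \<le> m \<Longrightarrow> smooth_map_on D P M (\<lambda>u. e u i)"
  shows "smooth_map_on D P (power_manifold m M) (\<lambda>u. \<lambda>i\<in>{..m}. e u i)"
  unfolding smooth_map_on_iff
proof (intro conjI allI impI)
  have "continuous_map (subtopology (mtop P) D) (mtop M) (\<lambda>u. restrict (e u) {..m} i)" if "i \<in> {..m}" for i
    using smooth_map_onD(1)[OF assms[of i]] that by simp
  then show "continuous_map (subtopology (mtop P) D) (mtop (power_manifold m M)) (\<lambda>u. \<lambda>i\<in>{..m}. e u i)"
    unfolding power_manifold_simps continuous_map_componentwise by (intro conjI ballI image_subsetI) simp_all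
  fix U \<phi> W \<xi> assume c: "(U, \<phi>) \<in> atlas P" and "(W, \<xi>) \<in> atlas (power_manifold m M)"
  then obtain U' \<psi> where c': "\<And>i. i \<le> m \<Longrightarrow> (U' i, \<psi> i) \<in> atlas M"
      and W: "W = (\<Pi>\<^sub>E i\<in>{..m}. U' i)" "\<xi> = (\<lambda>x i. if i \<le> m then \<psi> i (x i) else 0)"
    unfolding atlas_power_manifold by blast
  let ?A = "\<phi> ` {x \<in> U \<inter> D. (\<lambda>i\<in>{..m}. e x i) \<in> W}"
  note model_fun = model_power_fun[of m M]
  have "smooth_on (model P) ?A (if i \<le> m then model M else {0}) (\<lambda>y. \<xi> (\<lambda>i\<in>{..m}. e (inv_into U \<phi> y) i) i)" for i
  proof (cases "i \<le> m")
    case True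
    have "smooth_on (model P) ?A (model M) (\<lambda>y. \<psi> i (e (inv_into U \<phi> y) i))"
      by (rule smooth_on_subset[OF smooth_map_onD(2)[OF assms[OF True] c c'[OF True]]])
        (use True in \<open>auto simp: W PiE_iff\<close>)
    then show ?thesis using True by (simp add: W)
  next
    case False
    then show ?thesis by (simp add: W smooth_on_const)
  qed
  then show "smooth_on (model P) ?A (model (power_manifold m M)) (\<lambda>y. \<xi> (\<lambda>i\<in>{..m}. e (inv_into U \<phi> y) i))"
    unfolding model_fun by (rule smooth_on_fun)
qed

end

section \<open>Averaging cochains\<close>

text \<open>A smooth function that interpolates from \<open>1\<close> at \<open>0\<close> to \<open>0\<close> at \<open>1\<close>. It has values in \<open>[0, 1]\<close> on all of \<open>\<real>\<close>, since
  the functions of a partition of unity, and thus their partial sums, may leave \<open>[0, 1]\<close>.\<close>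

definition cutoff :: "real \<Rightarrow> real" where
  "cutoff s = (1 - s)\<^sup>2 / (s\<^sup>2 + (1 - s)\<^sup>2)"

lemma cutoff_denom: "s\<^sup>2 + (1 - s)\<^sup>2 > (0 :: real)"
proof (cases "s = 0")
  case False
  then have "s\<^sup>2 > 0" by simp
  then show ?thesis using zero_le_power2[of "1 - s"] by linarith
qed simp

lemma cutoff_0_1 [simp]: "cutoff 0 = 1" "cutoff 1 = 0"
  by (simp_all add: cutoff_def)

lemma cutoff_in: "cutoff s \<in> {0..1}"
  using cutoff_denom[of s] by (simp add: cutoff_def)

lemma finite_linear_order_max:
  assumes "linear_order r" "finite J" "J \<noteq> {}"
  shows "\<exists>m\<in>J. \<forall>j\<in>J. (j, m) \<in> r"
  using assms(2,3)
proof (induction J rule: finite_ne_induct)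
  case (singleton x)
  then show ?case using assms(1) by (simp add: order_on_defs refl_on_def)
next
  case (insert x F)
  then obtain m where m: "m \<in> F" "\<forall>j\<in>F. (j, m) \<in> r" by blast
  have "x \<noteq> m" using insert.hyps m by blast
  then have "(x, m) \<in> r \<or> (m, x) \<in> r"
    using assms(1) unfolding order_on_defs total_on_def by blast
  moreover have "(x, x) \<in> r" using assms(1) by (simp add: order_on_defs refl_on_def)
  moreover have "trans r" using assms(1) by (simp add: order_on_defs)
  ultimately show ?case using m by (auto dest: transD)
qed

text \<open>The lower partial sum of an index is the upper partial sum of its predecessor.\<close>

lemma (in comm_group) finprod_telescope:
  fixes w :: "'i \<Rightarrow> real" and a :: "real \<Rightarrow> 'a"
  assumes r: "linear_order r" and a: "\<And>s. a s \<in> carrier G" and J: "finite J"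
  shows "(\<Otimes>i\<in>J. a (\<Sum>j\<in>{j \<in> J. (j, i) \<in> r}. w j) \<otimes> inv (a ((\<Sum>j\<in>{j \<in> J. (j, i) \<in> r}. w j) - w i)))
    = a (\<Sum>j\<in>J. w j) \<otimes> inv (a 0)"
  using J
proof (induction "card J" arbitrary: J)
  case 0
  then show ?case using a by simp
next
  case (Suc n)
  then have "J \<noteq> {}" by auto
  then obtain m where m: "m \<in> J" "\<forall>j\<in>J. (j, m) \<in> r"
    using finite_linear_order_max[OF r Suc.prems] by blast
  let ?J = "J - {m}"
  let ?t = "\<lambda>J i. a (\<Sum>j\<in>{j \<in> J. (j, i) \<in> r}. w j) \<otimes> inv (a ((\<Sum>j\<in>{j \<in> J. (j, i) \<in> r}. w j) - w i))"
  have "{j \<in> J. (j, i) \<in> r} = {j \<in> ?J. (j, i) \<in> r}" if "i \<in> ?J" for i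
    using that m r by (auto simp: order_on_defs antisym_def)
  then have e: "?t J i = ?t ?J i" if "i \<in> ?J" for i using that by simp
  have sm: "(\<Sum>j\<in>J. w j) - w m = (\<Sum>j\<in>?J. w j)" using Suc.prems m by (simp add: sum_diff1)
  have "{j \<in> J. (j, m) \<in> r} = J" using m by auto
  then have tm: "?t J m = a (\<Sum>j\<in>J. w j) \<otimes> inv (a (\<Sum>j\<in>?J. w j))" by (simp add: sm)
  have IH: "(\<Otimes>i\<in>?J. ?t ?J i) = a (\<Sum>j\<in>?J. w j) \<otimes> inv (a 0)"
    using Suc.hyps(2) Suc.prems m by (intro Suc.hyps(1)) auto
  have "(\<Otimes>i\<in>J. ?t J i) = (\<Otimes>i\<in>insert m ?J. ?t J i)" using m by (simp add: insert_absorb)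
  also have "\<dots> = ?t J m \<otimes> (\<Otimes>i\<in>?J. ?t J i)"
    using Suc.prems a by (intro finprod_insert) auto
  also have "(\<Otimes>i\<in>?J. ?t J i) = (\<Otimes>i\<in>?J. ?t ?J i)"
    using a e by (intro finprod_cong) (auto simp: simp_implies_def)
  also have "?t J m \<otimes> \<dots> = a (\<Sum>j\<in>J. w j) \<otimes> inv (a 0)"
    unfolding IH tm using a by (simp add: m_assoc) (simp add: m_assoc[symmetric])
  finally show ?case .
qed

text \<open>Face and degeneracy operators on sequences. Cochains on tuples are extended to sequences here, so that
  replacing an entry cannot leave the domain.\<close>

definition omit :: "nat \<Rightarrow> (nat \<Rightarrow> 'g) \<Rightarrow> nat \<Rightarrow> 'g" where
  "omit k u = (\<lambda>i. if i < k then u i else u (Suc i))"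

definition dup :: "nat \<Rightarrow> (nat \<Rightarrow> 'g) \<Rightarrow> nat \<Rightarrow> 'g" where
  "dup k u = (\<lambda>i. if i \<le> k then u i else u (i - 1))"

lemma omit_dup:
  "k < i \<Longrightarrow> omit k (dup i u) = dup (i - 1) (omit k u)"
  "omit i (dup i u) = u" "omit (Suc i) (dup i u) = u"
  "Suc i < k \<Longrightarrow> omit k (dup i u) = dup i (omit (k - 1) u)"
  by (auto simp: omit_def dup_def fun_eq_iff)

text \<open>The points \<open>c i\<close> sample the arguments of cochains, with the weights \<open>\<rho> i\<close>; \<open>\<Phi>\<close> contracts \<open>V\<close> by
  homomorphisms. The linear order on the indices is arbitrary.\<close>

locale averaging =
  fixes V :: "'v monoid" and \<Phi> :: "'v \<times> real \<Rightarrow> 'v" and X :: "'g set"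
    and I :: "'i set" and r :: "('i \<times> 'i) set" and \<rho> :: "'i \<Rightarrow> 'g \<Rightarrow> real" and c :: "'i \<Rightarrow> 'g"
  assumes V: "comm_group V"
    and Phi_hom: "t \<in> {0..1} \<Longrightarrow> (\<lambda>v. \<Phi> (v, t)) \<in> hom V V"
    and Phi_0: "v \<in> carrier V \<Longrightarrow> \<Phi> (v, 0) = v"
    and Phi_1: "v \<in> carrier V \<Longrightarrow> \<Phi> (v, 1) = \<one>\<^bsub>V\<^esub>"
    and order: "linear_order r"
    and fin: "x \<in> X \<Longrightarrow> finite {i \<in> I. \<rho> i x \<noteq> 0}"
    and sum_1: "x \<in> X \<Longrightarrow> (\<Sum>i\<in>{i \<in> I. \<rho> i x \<noteq> 0}. \<rho> i x) = 1"
begin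

sublocale V: comm_group V by (rule V)

definition act :: "'g \<Rightarrow> 'i set" where "act x = {i \<in> I. \<rho> i x \<noteq> 0}"

text \<open>The finite set \<open>J\<close> is a parameter, since one set of indices must serve all points near a given one when
  smoothness is proved.\<close>

definition psum :: "'i set \<Rightarrow> 'g \<Rightarrow> 'i \<Rightarrow> real" where
  "psum J x i = (\<Sum>j\<in>{j \<in> J. (j, i) \<in> r}. \<rho> j x)"

definition term_on :: "'i set \<Rightarrow> 'g \<Rightarrow> ('i \<Rightarrow> 'v) \<Rightarrow> 'i \<Rightarrow> 'v" where
  "term_on J x F i = \<Phi> (F i, cutoff (psum J x i)) \<otimes>\<^bsub>V\<^esub> inv\<^bsub>V\<^esub> \<Phi> (F i, cutoff (psum J x i - \<rho> i x))"

text \<open>The weighted average of \<open>F\<close> at \<open>x\<close>. If \<open>V\<close> is a vector space and \<open>\<Phi> (v, t) = (1 - t) v\<close>, the coefficient of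
  \<open>F i\<close> is the increment of \<open>1 - cutoff\<close> over the interval of length \<open>\<rho> i x\<close> belonging to \<open>i\<close>.\<close>

definition avg :: "'g \<Rightarrow> ('i \<Rightarrow> 'v) \<Rightarrow> 'v" where
  "avg x F = (\<Otimes>\<^bsub>V\<^esub>i\<in>act x. term_on (act x) x F i)"

lemma Phi_closed: "v \<in> carrier V \<Longrightarrow> \<Phi> (v, cutoff s) \<in> carrier V"
  using hom_in_carrier[OF Phi_hom[OF cutoff_in]] .

lemma Phi_mult: "v \<in> carrier V \<Longrightarrow> w \<in> carrier V \<Longrightarrow> \<Phi> (v \<otimes>\<^bsub>V\<^esub> w, cutoff s) = \<Phi> (v, cutoff s) \<otimes>\<^bsub>V\<^esub> \<Phi> (w, cutoff s)"
  using hom_mult[OF Phi_hom[OF cutoff_in]] .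

lemma term_on_closed: "F i \<in> carrier V \<Longrightarrow> term_on J x F i \<in> carrier V"
  by (simp add: term_on_def Phi_closed)

lemma avg_closed: "(\<And>i. i \<in> act x \<Longrightarrow> F i \<in> carrier V) \<Longrightarrow> avg x F \<in> carrier V"
  unfolding avg_def by (intro V.finprod_closed) (auto intro: term_on_closed)

lemma avg_cong: "(\<And>i. i \<in> act x \<Longrightarrow> F i = F' i) \<Longrightarrow> (\<And>i. i \<in> act x \<Longrightarrow> F' i \<in> carrier V) \<Longrightarrow> avg x F = avg x F'"
  unfolding avg_def by (intro V.finprod_cong) (auto simp: simp_implies_def term_on_def Phi_closed)

text \<open>An index with weight \<open>0\<close> contributes a quotient of equal elements and does not change partial sums.\<close>

lemma avg_superset:
  assumes J: "finite J" "J \<subseteq> I" "act x \<subseteq> J" and F: "\<And>i. i \<in> J \<Longrightarrow> F i \<in> carrier V"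
  shows "avg x F = (\<Otimes>\<^bsub>V\<^esub>i\<in>J. term_on J x F i)"
proof -
  have ps: "psum J x i = psum (act x) x i" for i
    unfolding psum_def using J by (intro sum.mono_neutral_right) (auto simp: act_def)
  have "avg x F = (\<Otimes>\<^bsub>V\<^esub>i\<in>act x. term_on J x F i)"
    unfolding avg_def term_on_def ps ..
  also have "\<dots> = (\<Otimes>\<^bsub>V\<^esub>i\<in>J. term_on J x F i)"
    using J F by (intro V.finprod_mono_neutral_cong_left)
      (auto simp: act_def term_on_def Phi_closed)
  finally show ?thesis .
qed

text \<open>The product telescopes to \<open>\<Phi> (v, cutoff 1) / \<Phi> (v, cutoff 0)\<close>, that is, to \<open>\<Phi> (v, 0) / \<Phi> (v, 1) = v\<close>.\<close>

lemma avg_const: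
  assumes x: "x \<in> X" and v: "v \<in> carrier V"
  shows "avg x (\<lambda>_. v) = v"
proof -
  have "avg x (\<lambda>_. v) = \<Phi> (v, cutoff (\<Sum>j\<in>act x. \<rho> j x)) \<otimes>\<^bsub>V\<^esub> inv\<^bsub>V\<^esub> \<Phi> (v, cutoff 0)"
    unfolding avg_def term_on_def psum_def
    using V.finprod_telescope[OF order, of "\<lambda>s. \<Phi> (v, cutoff s)" "act x" "\<lambda>i. \<rho> i x"] v fin[OF x]
    by (simp add: Phi_closed act_def)
  then show ?thesis using sum_1[OF x] v by (simp add: act_def Phi_0 Phi_1)
qed

lemma avg_mult:
  assumes "\<And>i. i \<in> act x \<Longrightarrow> F i \<in> carrier V" "\<And>i. i \<in> act x \<Longrightarrow> F' i \<in> carrier V"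
  shows "avg x (\<lambda>i. F i \<otimes>\<^bsub>V\<^esub> F' i) = avg x F \<otimes>\<^bsub>V\<^esub> avg x F'"
proof -
  have "term_on (act x) x (\<lambda>i. F i \<otimes>\<^bsub>V\<^esub> F' i) i = term_on (act x) x F i \<otimes>\<^bsub>V\<^esub> term_on (act x) x F' i"
    if "i \<in> act x" for i
    using assms that by (simp add: term_on_def Phi_mult Phi_closed V.inv_mult V.m_ac)
  then have "avg x (\<lambda>i. F i \<otimes>\<^bsub>V\<^esub> F' i) = (\<Otimes>\<^bsub>V\<^esub>i\<in>act x. term_on (act x) x F i \<otimes>\<^bsub>V\<^esub> term_on (act x) x F' i)"
    unfolding avg_def using assms by (intro V.finprod_cong) (auto simp: simp_implies_def term_on_closed)
  then show ?thesis
    unfolding avg_def using assms by (simp add: term_on_closed Pi_def)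
qed

lemma avg_inv:
  assumes "x \<in> X" "\<And>i. F i \<in> carrier V"
  shows "avg x (\<lambda>i. inv\<^bsub>V\<^esub> F i) = inv\<^bsub>V\<^esub> avg x F"
proof -
  have "avg x (\<lambda>i. inv\<^bsub>V\<^esub> F i) \<otimes>\<^bsub>V\<^esub> avg x F = \<one>\<^bsub>V\<^esub>"
    using avg_const[OF assms(1), of "\<one>\<^bsub>V\<^esub>"] assms(2) by (simp flip: avg_mult)
  then show ?thesis using assms by (simp add: V.inv_equality avg_closed)
qed

lemma avg_frag_eval:
  assumes "x \<in> X" "\<And>s i. f s i \<in> carrier V"
  shows "avg x (\<lambda>i. frag_eval V (\<lambda>s. f s i) ch) = frag_eval V (\<lambda>s. avg x (f s)) ch"
  using subset_UNIV
proof (induction ch rule: frag_induction)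
  case (one s)
  have "avg x (\<lambda>i. f s i) \<in> carrier V" using assms by (intro avg_closed)
  then show ?case using assms(2) by simp
qed (simp_all add: V.frag_eval_diff avg_mult avg_inv avg_const assms)

text \<open>The first \<open>k\<close> arguments of \<open>f\<close> are replaced by sample points and averaged, with the weights at the
  original arguments.\<close>

primrec Av :: "nat \<Rightarrow> (nat \<Rightarrow> 'g) \<Rightarrow> ((nat \<Rightarrow> 'g) \<Rightarrow> 'v) \<Rightarrow> 'v" where
  "Av 0 u f = f u"
| "Av (Suc k) u f = Av k u (\<lambda>w. avg (u k) (\<lambda>i. f (w(k := c i))))"

lemma Av_closed: "(\<And>w. f w \<in> carrier V) \<Longrightarrow> Av k u f \<in> carrier V"
  by (induction k arbitrary: f) (simp_all add: avg_closed)

text \<open>The sequences at which an iterated average evaluates its argument.\<close>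

definition active :: "nat \<Rightarrow> (nat \<Rightarrow> 'g) \<Rightarrow> (nat \<Rightarrow> 'g) set" where
  "active k u = {w. (\<forall>j<k. \<exists>i\<in>act (u j). w j = c i) \<and> (\<forall>j\<ge>k. w j = u j)}"

lemma Av_cong:
  assumes "\<And>w. f' w \<in> carrier V" "\<And>w. w \<in> active k u \<Longrightarrow> f w = f' w"
  shows "Av k u f = Av k u f'"
  using assms
proof (induction k arbitrary: f f')
  case (Suc k)
  show ?case unfolding Av.simps
  proof (rule Suc.IH)
    show "avg (u k) (\<lambda>i. f' (w(k := c i))) \<in> carrier V" for w using Suc.prems by (intro avg_closed)
    show "avg (u k) (\<lambda>i. f (w(k := c i))) = avg (u k) (\<lambda>i. f' (w(k := c i)))" if w: "w \<in> active k u" for w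
    proof (rule avg_cong)
      fix i assume i: "i \<in> act (u k)"
      have "w(k := c i) \<in> active (Suc k) u"
        using w i by (auto simp: active_def less_Suc_eq)
      then show "f (w(k := c i)) = f' (w(k := c i))" by (rule Suc.prems)
    qed (rule Suc.prems)
  qed
qed (simp add: active_def)

lemma Av_frag_eval:
  assumes "\<And>j. j < k \<Longrightarrow> u j \<in> X" "\<And>s w. f s w \<in> carrier V"
  shows "Av k u (\<lambda>w. frag_eval V (\<lambda>s. f s w) ch) = frag_eval V (\<lambda>s. Av k u (f s)) ch"
  using assms
proof (induction k arbitrary: f)
  case (Suc k)
  have "Av k u (\<lambda>w. avg (u k) (\<lambda>i. frag_eval V (\<lambda>s. f s (w(k := c i))) ch))
    = Av k u (\<lambda>w. frag_eval V (\<lambda>s. avg (u k) (\<lambda>i. f s (w(k := c i)))) ch)"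
    using Suc.prems by (intro Av_cong avg_frag_eval) auto
  also have "\<dots> = frag_eval V (\<lambda>s. Av k u (\<lambda>w. avg (u k) (\<lambda>i. f s (w(k := c i))))) ch"
    using Suc.prems by (intro Suc.IH avg_closed) auto
  finally show ?case by simp
qed simp

lemma Av_omit_ge:
  assumes "m \<le> l"
  shows "Av m u (\<lambda>w. f (omit l w)) = Av m (omit l u) f"
  using assms
proof (induction m arbitrary: f)
  case (Suc m)
  have e: "omit l (w(m := x)) = (omit l w)(m := x)" for w x
    using Suc.prems by (auto simp: omit_def fun_eq_iff)
  have "omit l u m = u m" using Suc.prems by (simp add: omit_def)
  then show ?case
    using Suc.prems Suc.IH[of "\<lambda>w. avg (u m) (\<lambda>i. f (w(m := c i)))"] by (simp add: e)
qed simp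

text \<open>If \<open>f\<close> does not depend on an averaged argument, averaging over it has no effect, by \<open>avg_const\<close>.\<close>

lemma Av_omit_less:
  assumes "l < m" "\<And>j. j < m \<Longrightarrow> u j \<in> X" "\<And>w. f w \<in> carrier V"
  shows "Av m u (\<lambda>w. f (omit l w)) = Av (m - 1) (omit l u) f"
  using assms
proof (induction m arbitrary: f)
  case (Suc m)
  show ?case
  proof (cases "l = m")
    case True
    have "omit m (w(m := x)) = omit m w" for w and x :: 'g by (auto simp: omit_def fun_eq_iff)
    then have "Av (Suc m) u (\<lambda>w. f (omit l w)) = Av m u (\<lambda>w. avg (u m) (\<lambda>_. f (omit m w)))"
      by (simp add: True)
    also have "\<dots> = Av m u (\<lambda>w. f (omit m w))"
      using Suc.prems by (intro Av_cong avg_const) auto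
    also have "\<dots> = Av m (omit m u) f" by (rule Av_omit_ge) simp
    finally show ?thesis by (simp add: True)
  next
    case False
    then obtain m' where m': "m = Suc m'" "l \<le> m'" using Suc.prems(1) by (cases m) auto
    have e: "omit l (w(m := x)) = (omit l w)(m' := x)" for w x
      using m' by (auto simp: omit_def fun_eq_iff)
    have "Av (Suc m) u (\<lambda>w. f (omit l w)) = Av m u (\<lambda>w. avg (u m) (\<lambda>i. f ((omit l w)(m' := c i))))"
      by (simp add: e)
    also have "\<dots> = Av (m - 1) (omit l u) (\<lambda>w. avg (u m) (\<lambda>i. f (w(m' := c i))))"
      using Suc.prems m' by (intro Suc.IH[where f = "\<lambda>w. avg (u m) (\<lambda>i. f (w(m' := c i)))"] avg_closed) auto
    also have "u m = omit l u m'" using m' by (simp add: omit_def)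
    finally show ?thesis by (simp only: m' diff_Suc_1 Av.simps)
  qed
qed simp

subsection \<open>The prism operator\<close>

text \<open>The prism between a simplex and its smoothing. The generator \<open>(m, w)\<close> stands for the sequence \<open>w\<close> of
  which the first \<open>m\<close> entries are to be averaged; \<open>dup i\<close> repeats the entry \<open>i\<close>, once averaged and once as
  it is.\<close>

definition prism :: "nat \<Rightarrow> (nat \<Rightarrow> 'g) \<Rightarrow> (nat \<times> (nat \<Rightarrow> 'g)) \<Rightarrow>\<^sub>0 int" where
  "prism n u = (\<Sum>i<n. frag_cmul ((- 1) ^ i) (frag_of (Suc i, dup i u)))"

lemma keys_prism: "p \<in> Poly_Mapping.keys (prism n u) \<Longrightarrow> \<exists>i<n. p = (Suc i, dup i u)"
proof -
  assume "p \<in> Poly_Mapping.keys (prism n u)"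
  then have "p \<in> (\<Union>i\<in>{..<n}. Poly_Mapping.keys (frag_cmul ((- 1) ^ i) (frag_of (Suc i, dup i u))))"
    unfolding prism_def using keys_sum by (rule subsetD[rotated])
  then show ?thesis by auto
qed

text \<open>The boundary of a sequence, and the boundary of a partly averaged sequence: omitting an averaged entry
  decreases the number of averaged entries.\<close>

definition obd :: "nat \<Rightarrow> (nat \<Rightarrow> 'g) \<Rightarrow> (nat \<Rightarrow> 'g) \<Rightarrow>\<^sub>0 int" where
  "obd n u = (\<Sum>k\<le>n. frag_cmul ((- 1) ^ k) (frag_of (omit k u)))"

definition sbd :: "nat \<Rightarrow> nat \<times> (nat \<Rightarrow> 'g) \<Rightarrow> (nat \<times> (nat \<Rightarrow> 'g)) \<Rightarrow>\<^sub>0 int" where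
  "sbd n = (\<lambda>(m, w). \<Sum>k\<le>n. frag_cmul ((- 1) ^ k) (frag_of (if k < m then m - 1 else m, omit k w)))"

text \<open>Of the faces of the prism, those which omit one of the two copies of an entry cancel in a telescope up to
  the bottom and the top; the others make up the prism over the boundary.\<close>

lemma prism_identity:
  "frag_extend (sbd (Suc n)) (prism (Suc n) u) + frag_extend (prism n) (obd n u) = frag_of (0, u) - frag_of (Suc n, u)"
proof -
  define t where "t = (\<lambda>(i, k). frag_cmul ((- 1) ^ (i + k)) (frag_of (Suc i, dup i (omit k u))))"
  define T where "T = (\<lambda>(i, k). frag_cmul ((- 1) ^ (i + k)) (frag_of (if k < Suc i then Suc i - 1 else Suc i, omit k (dup i u))))"
  have L2: "frag_extend (prism n) (obd n u) = sum t ({..<n} \<times> {..n})"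
  proof -
    have "frag_extend (prism n) (obd n u) = (\<Sum>k\<le>n. \<Sum>i<n. t (i, k))"
      by (simp add: obd_def frag_extend_sum o_def frag_extend_cmul prism_def frag_cmul_sum t_def power_add mult.commute)
    also have "\<dots> = (\<Sum>i<n. \<Sum>k\<le>n. t (i, k))" by (rule sum.swap)
    finally show ?thesis by (simp add: sum.cartesian_product)
  qed
  have L1: "frag_extend (sbd (Suc n)) (prism (Suc n) u) = sum T ({..n} \<times> {..Suc n})"
  proof -
    have "frag_extend (sbd (Suc n)) (prism (Suc n) u) = (\<Sum>i\<le>n. \<Sum>k\<le>Suc n. T (i, k))"
      by (simp add: prism_def lessThan_Suc_atMost frag_extend_sum o_def frag_extend_cmul sbd_def frag_cmul_sum T_def
        power_add del: sum.atMost_Suc diff_Suc_1 diff_Suc_Suc)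
    then show ?thesis unfolding sum.cartesian_product by simp
  qed
  \<comment> \<open>In \<open>?C\<close> and \<open>?D\<close> one of the two copies of the entry \<open>i\<close> is omitted.\<close>
  let ?A = "{(i, k). i \<le> n \<and> k < i}" and ?B = "{(i, k). i \<le> n \<and> Suc i < k \<and> k \<le> Suc n}"
  let ?C = "(\<lambda>i. (i, i)) ` {..n}" and ?D = "(\<lambda>i. (i, Suc i)) ` {..n}"
  have fin: "finite ?A" "finite ?B"
    by (rule finite_subset[of _ "{..n} \<times> {..Suc n}"], auto)+
  have split: "{..n} \<times> {..Suc n} = (?A \<union> ?B) \<union> (?C \<union> ?D)" by (auto simp: image_iff)
  have "sum T ({..n} \<times> {..Suc n}) = sum T (?A \<union> ?B) + sum T (?C \<union> ?D)"
  proof -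
    have "finite (?A \<union> ?B)" "finite (?C \<union> ?D)" using fin by simp_all
    moreover have "(?A \<union> ?B) \<inter> (?C \<union> ?D) = {}" by (auto simp: image_iff)
    ultimately show ?thesis unfolding split by (rule sum.union_disjoint)
  qed
  also have "sum T (?A \<union> ?B) = sum T ?A + sum T ?B"
    by (rule sum.union_disjoint[OF fin]) auto
  also have "sum T (?C \<union> ?D) = sum T ?C + sum T ?D"
    by (rule sum.union_disjoint) auto
  also have "sum T ?C + sum T ?D = (\<Sum>i\<le>n. frag_of (i, u) - frag_of (Suc i, u))"
  proof -
    have s: "(- 1) ^ (i + i) = (1 :: int)" for i by (simp flip: mult_2)
    have "sum T ?C = (\<Sum>i\<le>n. frag_of (i, u))"
      by (subst sum.reindex) (simp_all add: inj_on_def T_def omit_dup s)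
    moreover have "sum T ?D = (\<Sum>i\<le>n. - frag_of (Suc i, u))"
      by (subst sum.reindex) (simp_all add: inj_on_def T_def omit_dup s)
    ultimately show ?thesis by (simp add: sum_subtractf sum_negf)
  qed
  also have "\<dots> = frag_of (0, u) - frag_of (Suc n, u)"
    by (rule sum_telescope)
  also have "sum T ?A = (\<Sum>p\<in>{(i, k). i < n \<and> k \<le> i}. - t p)"
    by (rule sum.reindex_bij_witness[of _ "\<lambda>(i, k). (Suc i, k)" "\<lambda>(i, k). (i - 1, k)"])
      (auto simp: T_def t_def omit_dup dest!: less_imp_Suc_add)
  also have "sum T ?B = (\<Sum>p\<in>{(i, k). i < n \<and> i < k \<and> k \<le> n}. - t p)"
    by (rule sum.reindex_bij_witness[of _ "\<lambda>(i, k). (i, Suc k)" "\<lambda>(i, k). (i, k - 1)"])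
      (auto simp: T_def t_def omit_dup dest!: less_imp_Suc_add)
  also have "(\<Sum>p\<in>{(i, k). i < n \<and> k \<le> i}. - t p) + (\<Sum>p\<in>{(i, k). i < n \<and> i < k \<and> k \<le> n}. - t p)
    = (\<Sum>p\<in>{..<n} \<times> {..n}. - t p)"
  proof -
    have e: "{..<n} \<times> {..n} = {(i, k). i < n \<and> k \<le> i} \<union> {(i, k). i < n \<and> i < k \<and> k \<le> n}" by auto
    have fin': "finite {(i, k). i < n \<and> k \<le> i}" "finite {(i, k). i < n \<and> i < k \<and> k \<le> n}"
      by (rule finite_subset[of _ "{..n} \<times> {..n}"], auto)+
    show ?thesis unfolding e by (rule sum.union_disjoint[OF fin', symmetric]) auto
  qed
  finally show ?thesis unfolding L1 L2 by (simp add: sum_negf)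
qed

definition cobd :: "nat \<Rightarrow> ((nat \<Rightarrow> 'g) \<Rightarrow> 'v) \<Rightarrow> (nat \<Rightarrow> 'g) \<Rightarrow> 'v" where
  "cobd n f w = frag_eval V f (obd n w)"

definition homot :: "nat \<Rightarrow> ((nat \<Rightarrow> 'g) \<Rightarrow> 'v) \<Rightarrow> (nat \<Rightarrow> 'g) \<Rightarrow> 'v" where
  "homot n f u = frag_eval V (\<lambda>(m, w). Av m w f) (prism n u)"

text \<open>The average of a face is a face of the average, with one variable fewer to be averaged if the omitted one
  was among them.\<close>

lemma Av_cobd:
  assumes f: "\<And>w. f w \<in> carrier V" and w: "\<And>j. j < m \<Longrightarrow> w j \<in> X"
  shows "Av m w (cobd n f) = frag_eval V (\<lambda>(m, w). Av m w f) (sbd n (m, w))"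
proof -
  have *: "frag_eval V g (\<Sum>k\<le>n. frag_cmul ((- 1) ^ k) (frag_of (s k)))
      = frag_eval V (\<lambda>k. g (s k)) (\<Sum>k\<le>n. frag_cmul ((- 1) ^ k) (frag_of k))"
    if "\<And>k. g (s k) \<in> carrier V" for g :: "'s \<Rightarrow> 'v" and s :: "nat \<Rightarrow> 's"
    by (simp only: V.frag_eval_alternating_sum[of n g s, OF that]
      V.frag_eval_alternating_sum[of n "\<lambda>k. g (s k)" "\<lambda>k. k", OF that])
  let ?c = "\<Sum>k\<le>n. frag_cmul ((- 1) ^ k) (frag_of k)"
  have "Av m w (cobd n f) = Av m w (\<lambda>w. frag_eval V (\<lambda>k. f (omit k w)) ?c)"
  proof -
    have "cobd n f = (\<lambda>w. frag_eval V (\<lambda>k. f (omit k w)) ?c)"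
      unfolding cobd_def[abs_def] obd_def by (rule ext, rule *) (rule f)
    then show ?thesis by simp
  qed
  also have "\<dots> = frag_eval V (\<lambda>k. Av m w (\<lambda>w. f (omit k w))) ?c"
    using f w by (intro Av_frag_eval) auto
  also have "\<dots> = frag_eval V (\<lambda>k. (\<lambda>(m, w). Av m w f) (if k < m then m - 1 else m, omit k w)) ?c"
    using f w by (intro V.frag_eval_cong) (auto simp: Av_omit_less Av_omit_ge)
  also have "\<dots> = frag_eval V (\<lambda>(m, w). Av m w f) (sbd n (m, w))"
  proof -
    let ?s = "\<lambda>k. (if k < m then m - 1 else m, omit k w)"
    have "(\<lambda>(m, w). Av m w f) (?s k) \<in> carrier V" for k using f by (simp add: Av_closed)
    from *[of "\<lambda>(m, w). Av m w f" ?s, OF this] show ?thesis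
      unfolding sbd_def by (simp only: prod.case)
  qed
  finally show ?thesis .
qed

text \<open>The prism identity, evaluated on \<open>f\<close>.\<close>

theorem homotopy_identity:
  assumes f: "\<And>w. f w \<in> carrier V" and u: "\<And>j. j \<le> n \<Longrightarrow> u j \<in> X"
  shows "f u = homot (Suc n) (cobd (Suc n) f) u \<otimes>\<^bsub>V\<^esub> cobd n (homot n f) u \<otimes>\<^bsub>V\<^esub> Av (Suc n) u f"
proof -
  let ?A = "\<lambda>(m, w). Av m w f"
  have A: "?A p \<in> carrier V" for p using f by (cases p) (auto intro: Av_closed)
  have 1: "homot (Suc n) (cobd (Suc n) f) u = frag_eval V ?A (frag_extend (sbd (Suc n)) (prism (Suc n) u))"
    unfolding homot_def V.frag_eval_extend
  proof (rule V.frag_eval_cong)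
    fix p assume "p \<in> Poly_Mapping.keys (prism (Suc n) u)"
    then obtain i where i: "i \<le> n" "p = (Suc i, dup i u)"
      using keys_prism less_Suc_eq_le by blast
    have "dup i u j \<in> X" if "j < Suc i" for j using that i u by (simp add: dup_def)
    then show "(case p of (m, w) \<Rightarrow> Av m w (cobd (Suc n) f)) = frag_eval V ?A (sbd (Suc n) p)"
      using Av_cobd[OF f, of "Suc i" "dup i u" "Suc n"] i by simp
  qed
  have 2: "cobd n (homot n f) u = frag_eval V ?A (frag_extend (prism n) (obd n u))"
    unfolding cobd_def homot_def[abs_def] V.frag_eval_extend ..
  have "homot (Suc n) (cobd (Suc n) f) u \<otimes>\<^bsub>V\<^esub> cobd n (homot n f) u = f u \<otimes>\<^bsub>V\<^esub> inv\<^bsub>V\<^esub> Av (Suc n) u f"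
    unfolding 1 2 V.frag_eval_add[symmetric] prism_identity V.frag_eval_diff
    using A[of "(0, u)"] A[of "(Suc n, u)"] by (simp del: Av.simps(2))
  then show ?thesis using f Av_closed[OF f, of "Suc n" u] by (simp add: V.m_assoc del: Av.simps(2))
qed

lemma Av_cobd_full:
  assumes f: "\<And>w. f w \<in> carrier V" and u: "\<And>j. j \<le> Suc n \<Longrightarrow> u j \<in> X"
  shows "Av (Suc (Suc n)) u (cobd (Suc n) f) = cobd (Suc n) (\<lambda>w. Av (Suc n) w f) u"
proof -
  have "sbd (Suc n) (Suc (Suc n), u) = frag_extend (\<lambda>w. frag_of (Suc n, w)) (obd (Suc n) u)"
    by (simp add: sbd_def obd_def frag_extend_sum o_def frag_extend_cmul less_Suc_eq_le del: sum.atMost_Suc)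
  moreover have "frag_eval V (\<lambda>(m, w). Av m w f) (frag_of (Suc n, w)) = Av (Suc n) w f" for w
    using Av_closed[OF f] by (simp del: Av.simps(2))
  ultimately show ?thesis
    using Av_cobd[OF f, of "Suc (Suc n)" u "Suc n"] u
    by (simp add: cobd_def V.frag_eval_extend less_Suc_eq_le del: Av.simps(2))
qed

lemma homot_cong:
  assumes f': "\<And>w. f' w \<in> carrier V" and "\<And>i w. i < n \<Longrightarrow> w \<in> active (Suc i) (dup i u) \<Longrightarrow> f w = f' w"
  shows "homot n f u = homot n f' u"
  unfolding homot_def
proof (rule V.frag_eval_cong)
  fix p assume "p \<in> Poly_Mapping.keys (prism n u)"
  then obtain i where i: "i < n" "p = (Suc i, dup i u)"
    using keys_prism by blast
  show "(case p of (m, w) \<Rightarrow> Av m w f) = (case p of (m, w) \<Rightarrow> Av m w f')"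
    unfolding i(2) prod.case using assms i(1) by (intro Av_cong)
qed

lemma homot_one: "(\<And>j. j < n \<Longrightarrow> u j \<in> X) \<Longrightarrow> homot n (\<lambda>_. \<one>\<^bsub>V\<^esub>) u = \<one>\<^bsub>V\<^esub>"
proof -
  assume u: "\<And>j. j < n \<Longrightarrow> u j \<in> X"
  have *: "Av k w (\<lambda>_. \<one>\<^bsub>V\<^esub>) = \<one>\<^bsub>V\<^esub>" if "\<And>j. j < k \<Longrightarrow> w j \<in> X" for k w
    using that by (induction k) (simp_all add: avg_const)
  show ?thesis
    unfolding homot_def
  proof (rule V.frag_eval_one)
    fix p assume "p \<in> Poly_Mapping.keys (prism n u)"
    then obtain i where i: "i < n" "p = (Suc i, dup i u)"
      using keys_prism by blast
    show "(case p of (m, w) \<Rightarrow> Av m w (\<lambda>_. \<one>\<^bsub>V\<^esub>)) = \<one>\<^bsub>V\<^esub>"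
      unfolding i(2) prod.case using u i(1) by (intro *) (simp add: dup_def)
  qed
qed

end

section \<open>Smoothness of averaged cochains\<close>

lemma smooth_manifold_real: "smooth_manifold real_manifold"
proof -
  have "homeomorphic_map (subtopology euclideanreal UNIV) (top_of_set (id ` UNIV)) id"
    by (simp add: homeomorphic_map_id)
  moreover have "smooth_on UNIV (id ` (UNIV \<inter> UNIV)) UNIV (id \<circ> inv_into UNIV (id :: real \<Rightarrow> real))"
    using smooth_on_linear[OF cont_linear_id, of UNIV UNIV UNIV] by (simp add: inv_id o_def id_def)
  ultimately show ?thesis by (simp add: smooth_manifold_def real_manifold_def)
qed

lemma lie_groupD:
  assumes "lie_group G M"
  shows "group G" "smooth_manifold M" "topspace (mtop M) = carrier G"
    "smooth_map (prod_manifold M M) M (\<lambda>(x, y). x \<otimes>\<^bsub>G\<^esub> y)" "smooth_map M M (\<lambda>x. inv\<^bsub>G\<^esub> x)"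
  using assms unfolding lie_group_def by blast+

lemma topological_group_lie_group:
  assumes "lie_group G M"
  shows "topological_group G (mtop M)"
proof -
  note l = lie_groupD[OF assms]
  have "continuous_map (prod_topology (mtop M) (mtop M)) (mtop M) (\<lambda>(x, y). x \<otimes>\<^bsub>G\<^esub> y)"
    using smooth_map_onD(1)[OF l(4)[unfolded smooth_map_def]] subtopology_topspace[of "prod_topology (mtop M) (mtop M)"]
    by (simp del: topspace_prod_topology)
  moreover have "continuous_map (mtop M) (mtop M) (\<lambda>x. inv\<^bsub>G\<^esub> x)"
    using smooth_map_onD(1)[OF l(5)[unfolded smooth_map_def]] by simp
  ultimately show ?thesis
    using l by (simp add: topological_group_def topological_group_axioms_def)
qed

text \<open>Pointwise operations on smooth functions with values in \<open>V\<close> are smooth.\<close>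

locale lie_comm_group =
  fixes V :: "'v monoid" and N :: "('v, 'f::real_tvs) manifold"
  assumes V_lie: "lie_group V N" and V_comm: "comm_group V"
begin

sublocale V: comm_group V by (rule V_comm)
sublocale N: smooth_mfd N using lie_groupD(2)[OF V_lie] by unfold_locales

lemma topspace_N: "topspace (mtop N) = carrier V" by (rule lie_groupD(3)[OF V_lie])

context
  fixes P :: "('p, 'a::real_tvs) manifold" and Q :: "'p set"
  assumes P: "smooth_manifold P" and Q: "openin (mtop P) Q"
begin

lemma smooth_map_in:
  assumes "smooth_map_on Q P N f" "u \<in> Q"
  shows "f u \<in> carrier V"
  using smooth_map_onD(1)[OF assms(1)] assms(2) openin_subset[OF Q] topspace_N
  by (auto simp: continuous_map_def)

lemma smooth_mult:
  assumes "smooth_map_on Q P N a" "smooth_map_on Q P N b"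
  shows "smooth_map_on Q P N (\<lambda>u. a u \<otimes>\<^bsub>V\<^esub> b u)"
proof -
  have "smooth_map_on Q P N (\<lambda>u. (\<lambda>(x, y). x \<otimes>\<^bsub>V\<^esub> y) (a u, b u))"
    using smooth_map_in[OF assms(1)] smooth_map_in[OF assms(2)]
    by (intro smooth_map_on_compose[OF P charted_prod_manifold[OF N.charted N.charted] N.smooth_manifold Q
        smooth_map_on_Pair[OF assms] _ lie_groupD(4)[OF V_lie, unfolded smooth_map_def]]) (auto simp: topspace_N)
  then show ?thesis by simp
qed

lemma smooth_inv:
  assumes "smooth_map_on Q P N a"
  shows "smooth_map_on Q P N (\<lambda>u. inv\<^bsub>V\<^esub> a u)"
  using smooth_map_in[OF assms]
  by (intro smooth_map_on_compose[OF P N.charted N.smooth_manifold Q assms _ lie_groupD(5)[OF V_lie, unfolded smooth_map_def]])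
    (auto simp: topspace_N)

lemma smooth_finprod:
  assumes "finite J" "\<And>i. i \<in> J \<Longrightarrow> smooth_map_on Q P N (a i)"
  shows "smooth_map_on Q P N (\<lambda>u. \<Otimes>\<^bsub>V\<^esub>i\<in>J. a i u)"
proof -
  interpret P: smooth_mfd P by unfold_locales (rule P)
  show ?thesis
    using assms
  proof (induction J)
    case empty
    then show ?case using N.smooth_const[of "\<one>\<^bsub>V\<^esub>"] topspace_N by simp
  next
    case (insert i J)
    have "smooth_map_on Q P N (\<lambda>u. a i u \<otimes>\<^bsub>V\<^esub> (\<Otimes>\<^bsub>V\<^esub>i\<in>J. a i u))"
      using insert by (intro smooth_mult) auto
    then show ?case
    proof (rule P.smooth_map_on_cong)
      fix u assume u: "u \<in> Q"
      have "a j u \<in> carrier V" if "j \<in> insert i J" for j using smooth_map_in[OF insert.prems[OF that] u] .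
      then show "a i u \<otimes>\<^bsub>V\<^esub> (\<Otimes>\<^bsub>V\<^esub>i\<in>J. a i u) = (\<Otimes>\<^bsub>V\<^esub>i\<in>insert i J. a i u)"
        using insert.hyps by (subst V.finprod_insert) auto
    qed
  qed
qed

lemma smooth_power_sign:
  assumes "smooth_map_on Q P N a"
  shows "smooth_map_on Q P N (\<lambda>u. a u [^]\<^bsub>V\<^esub> ((- 1) ^ k :: int))"
proof -
  interpret P: smooth_mfd P by unfold_locales (rule P)
  show ?thesis
  proof (cases "even k")
    case True
    show ?thesis
      by (rule P.smooth_map_on_cong[OF assms]) (simp add: True V.int_pow_1 smooth_map_in[OF assms])
  next
    case False
    show ?thesis
      by (rule P.smooth_map_on_cong[OF smooth_inv[OF assms]])
        (simp add: False V.int_pow_neg V.int_pow_1 smooth_map_in[OF assms])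
  qed
qed

end

end

lemma cocycles_As:
  "f \<in> cocycles (As_complex M \<UU> V N) n \<longleftrightarrow>
    f \<in> cocycles (A_complex \<UU> V) n \<and> smooth_map_on (small_tuples \<UU> n) (power_manifold n M) N f"
  by (auto simp: cocycles_def kernel_def As_complex_def)

text \<open>In the assumption \<open>local\<close>, the set \<open>Q\<close> meets only finitely many supports, and lies in the
  translate belonging to each of them. The functions \<open>\<rho> i\<close> are smooth on \<open>G\<close> viewed as its first power, the form in which partitions of unity
  on powers are given.\<close>

locale smooth_averaging = averaging V \<Phi> "carrier G" I r \<rho> c
  for V :: "'v monoid" and \<Phi> :: "'v \<times> real \<Rightarrow> 'v" and G :: "'g monoid"
    and I :: "'i set" and r :: "('i \<times> 'i) set" and \<rho> :: "'i \<Rightarrow> 'g \<Rightarrow> real" and c :: "'i \<Rightarrow> 'g" +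
  fixes M :: "('g, 'e::real_tvs) manifold" and N :: "('v, 'f::real_tvs) manifold" and W0 :: "'g set"
  assumes G_lie: "lie_group G M" and V_lie: "lie_group V N"
    and Phi_smooth: "smooth_map_on (carrier V \<times> {0..1}) (prod_manifold N real_manifold) N \<Phi>"
    and c_in: "i \<in> I \<Longrightarrow> c i \<in> carrier G"
    and local: "x \<in> carrier G \<Longrightarrow> \<exists>Q J. openin (mtop M) Q \<and> x \<in> Q \<and> finite J \<and> J \<subseteq> I \<and>
      (\<forall>y\<in>Q. (\<forall>i\<in>I - J. \<rho> i y = 0) \<and> (\<forall>i\<in>J. y \<in> c i <#\<^bsub>G\<^esub> W0))"
    and rho_smooth: "i \<in> I \<Longrightarrow> smooth_map (power_manifold 0 M) real_manifold (\<lambda>x. \<rho> i (x 0))"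
begin

sublocale TG: topological_group G "mtop M" by (rule topological_group_lie_group[OF G_lie])
sublocale M: smooth_mfd M using lie_groupD(2)[OF G_lie] by unfold_locales
sublocale VN: lie_comm_group V N using V_lie V by unfold_locales

context
  fixes P :: "('p, 'a::real_tvs) manifold" and Q :: "'p set"
  assumes P: "smooth_manifold P" and Q: "openin (mtop P) Q"
begin

lemma smooth_cutoff:
  assumes "smooth_map_on Q P real_manifold s"
  shows "smooth_map_on Q P real_manifold (\<lambda>u. cutoff (s u))"
proof -
  have 1: "smooth_map_on Q P real_manifold (\<lambda>u. (1 - s u) * (1 - s u))"
    by (intro smooth_real_mult smooth_real_diff smooth_real_const assms)
  have "s u * s u + (1 - s u) * (1 - s u) \<noteq> 0" for u
    using cutoff_denom[of "s u"] by (simp add: power2_eq_square)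
  then have "smooth_map_on Q P real_manifold (\<lambda>u. inverse (s u * s u + (1 - s u) * (1 - s u)))"
    by (intro smooth_real_inverse smooth_real_add smooth_real_mult smooth_real_diff smooth_real_const assms)
  from smooth_real_mult[OF 1 this] show ?thesis
    by (simp add: cutoff_def power2_eq_square divide_inverse)
qed

lemma smooth_Phi:
  assumes "smooth_map_on Q P N a" "smooth_map_on Q P real_manifold s"
  shows "smooth_map_on Q P N (\<lambda>u. \<Phi> (a u, cutoff (s u)))"
  using VN.smooth_map_in[OF P Q assms(1)] cutoff_in
  by (intro smooth_map_on_compose[OF P charted_prod_manifold[OF VN.N.charted charted_real_manifold] VN.N.smooth_manifold Q
      smooth_map_on_Pair[OF assms(1) smooth_cutoff[OF assms(2)]] _ Phi_smooth]) blast

lemma smooth_rho: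
  assumes e: "smooth_map_on Q P M e" and i: "i \<in> I"
  shows "smooth_map_on Q P real_manifold (\<lambda>u. \<rho> i (e u))"
proof -
  have T: "smooth_map_on Q P (power_manifold 0 M) (\<lambda>u. \<lambda>_\<in>{..0::nat}. e u)"
    using e by (intro M.smooth_tuple)
  have ch: "charted (power_manifold 0 M)"
    using M.smooth_manifold_power by (intro smooth_mfd.charted smooth_mfd.intro)
  have "(\<lambda>u. \<lambda>_\<in>{..0::nat}. e u) ` Q \<subseteq> topspace (mtop (power_manifold 0 M))"
    using smooth_map_onD(1)[OF T] openin_subset[OF Q] by (auto simp: continuous_map_def)
  from smooth_map_on_compose[OF P ch smooth_manifold_real Q T this rho_smooth[OF i, unfolded smooth_map_def]]
  show ?thesis by simp
qed

lemma smooth_avg: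
  assumes e: "smooth_map_on Q P M e" and J: "finite J" "J \<subseteq> I"
    and zero: "\<And>u i. u \<in> Q \<Longrightarrow> i \<in> I - J \<Longrightarrow> \<rho> i (e u) = 0"
    and F: "\<And>i. i \<in> J \<Longrightarrow> smooth_map_on Q P N (\<lambda>u. F u i)"
  shows "smooth_map_on Q P N (\<lambda>u. avg (e u) (F u))"
proof -
  interpret P: smooth_mfd P by unfold_locales (rule P)
  have ps: "smooth_map_on Q P real_manifold (\<lambda>u. psum J (e u) i)" for i
    unfolding psum_def using J by (intro smooth_real_sum smooth_rho[OF e]) auto
  have "smooth_map_on Q P N (\<lambda>u. \<Otimes>\<^bsub>V\<^esub>i\<in>J. term_on J (e u) (F u) i)"
    unfolding term_on_def using J
    by (intro VN.smooth_finprod[OF P Q] VN.smooth_mult[OF P Q] VN.smooth_inv[OF P Q] smooth_Phi F ps smooth_real_diff smooth_rho[OF e]) auto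
  then show ?thesis
  proof (rule P.smooth_map_on_cong)
    fix u assume u: "u \<in> Q"
    have "act (e u) \<subseteq> J" using zero[OF u] by (auto simp: act_def)
    then show "(\<Otimes>\<^bsub>V\<^esub>i\<in>J. term_on J (e u) (F u) i) = avg (e u) (F u)"
      using J VN.smooth_map_in[OF P Q F u] by (intro avg_superset[symmetric]) auto
  qed
qed

text \<open>Near a given point only finitely many sample points \<open>\<kappa>\<close> occur. With the averaged arguments frozen at sample
  points, \<open>f\<close> has to be smooth in the remaining ones.\<close>

lemma smooth_Av:
  assumes "\<And>j. j < k \<Longrightarrow> smooth_map_on Q P M (\<lambda>u. e u j)"
    and "\<And>j. j < k \<Longrightarrow> finite (J j) \<and> J j \<subseteq> I"
    and "\<And>u j i. u \<in> Q \<Longrightarrow> j < k \<Longrightarrow> i \<in> I - J j \<Longrightarrow> \<rho> i (e u j) = 0"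
    and "\<And>\<kappa>. (\<And>j. j < k \<Longrightarrow> \<kappa> j \<in> c ` J j) \<Longrightarrow> smooth_map_on Q P N (\<lambda>u. f u (\<lambda>j. if j < k then \<kappa> j else e u j))"
  shows "smooth_map_on Q P N (\<lambda>u. Av k (e u) (f u))"
  using assms
proof (induction k arbitrary: f)
  case 0
  then show ?case by simp
next
  case (Suc k)
  have "smooth_map_on Q P N (\<lambda>u. Av k (e u) (\<lambda>w. avg (e u k) (\<lambda>i. f u (w(k := c i)))))"
  proof (rule Suc.IH)
    fix \<kappa> :: "nat \<Rightarrow> 'g" assume \<kappa>: "\<And>j. j < k \<Longrightarrow> \<kappa> j \<in> c ` J j"
    show "smooth_map_on Q P N (\<lambda>u. avg (e u k) (\<lambda>i. f u ((\<lambda>j. if j < k then \<kappa> j else e u j)(k := c i))))"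
    proof (rule smooth_avg[where J = "J k"])
      fix i assume i: "i \<in> J k"
      have "smooth_map_on Q P N (\<lambda>u. f u (\<lambda>j. if j < Suc k then (\<kappa>(k := c i)) j else e u j))"
        using \<kappa> i by (intro Suc.prems(4)) auto
      moreover have "(\<lambda>j. if j < Suc k then (\<kappa>(k := c i)) j else e u j)
        = (\<lambda>j. if j < k then \<kappa> j else e u j)(k := c i)" for u by (auto simp: fun_eq_iff)
      ultimately show "smooth_map_on Q P N (\<lambda>u. f u ((\<lambda>j. if j < k then \<kappa> j else e u j)(k := c i)))" by simp
    qed (use Suc.prems(1-3) in auto)
  qed (use Suc.prems(1-3) in auto)
  then show ?case by simp
qed

end

subsection \<open>Averaging small cochains\<close>

abbreviation "tu W n \<equiv> small_tuples (translate_cover G W) n"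

lemma openin_small_tuples: "openin (mtop M) W \<Longrightarrow> openin (mtop (power_manifold n M)) (tu W n)"
  unfolding small_tuples_def translate_cover_def
  by (intro openin_Union) (auto simp: openin_PiE intro!: TG.openin_l_coset)

text \<open>The extension of a cochain from small tuples to all sequences by the unit. All values that matter below
  are those at small tuples.\<close>

definition ext :: "'g set \<Rightarrow> nat \<Rightarrow> ((nat \<Rightarrow> 'g) \<Rightarrow> 'v) \<Rightarrow> (nat \<Rightarrow> 'g) \<Rightarrow> 'v" where
  "ext U n f w = (if restrict w {..n} \<in> tu U n then f (restrict w {..n}) else \<one>\<^bsub>V\<^esub>)"

lemma ext_closed: "f \<in> tu U n \<rightarrow> carrier V \<Longrightarrow> ext U n f w \<in> carrier V"
  by (auto simp: ext_def)

lemma ext_local: "(\<And>j. j \<le> n \<Longrightarrow> w j = w' j) \<Longrightarrow> ext U n f w = ext U n f w'"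
proof -
  assume "\<And>j. j \<le> n \<Longrightarrow> w j = w' j"
  then have "restrict w {..n} = restrict w' {..n}" by (auto simp: fun_eq_iff)
  then show ?thesis by (simp add: ext_def)
qed

lemma tu_restrict: "u \<in> tu W n \<Longrightarrow> restrict u {..n} = u"
  by (auto simp: small_tuples_def PiE_iff extensional_restrict)

lemma ext_eq: "u \<in> tu U n \<Longrightarrow> ext U n f u = f u"
  by (simp add: ext_def tu_restrict)

lemma cobd_local:
  assumes g: "\<And>w w'. (\<And>j. j \<le> n \<Longrightarrow> w j = w' j) \<Longrightarrow> g w = g w'" "\<And>w. g w \<in> carrier V"
    and u: "u \<in> tu W (Suc n)" and w: "\<And>j. j \<le> Suc n \<Longrightarrow> w j = u j"
  shows "cobd (Suc n) g w = frag_eval V (\<lambda>v\<in>tu W n. g v) (bd tuple_face (Suc n) u)"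
proof -
  interpret T: function_cx "small_tuples (translate_cover G W)" tuple_face V by (rule function_cx_tuples[OF V])
  have f: "tuple_face (Suc n) k u \<in> tu W n" if "k \<le> Suc n" for k using T.face_in[OF u that] .
  have "g (omit k w) = (\<lambda>v\<in>tu W n. g v) (tuple_face (Suc n) k u)" if "k \<le> Suc n" for k
    using f[OF that] w by (auto intro!: g(1) simp: omit_def tuple_face_def)
  then show ?thesis
    unfolding cobd_def obd_def bd_def using g(2) f
    by (subst (1 2) V.frag_eval_alternating_sum) (auto intro!: V.finprod_cong simp: simp_implies_def simp del: V.finprod_Suc)
qed

lemma Av_local:
  assumes "\<And>w w'. (\<And>j. j < K \<Longrightarrow> w j = w' j) \<Longrightarrow> f w = f w'" "k \<le> K" "\<And>j. j < K \<Longrightarrow> u j = u' j"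
  shows "Av k u f = Av k u' f"
  using assms
proof (induction k arbitrary: f)
  case 0
  show ?case unfolding Av.simps using 0(3) by (rule 0(1))
next
  case (Suc k)
  have "Av k u (\<lambda>w. avg (u k) (\<lambda>i. f (w(k := c i)))) = Av k u' (\<lambda>w. avg (u k) (\<lambda>i. f (w(k := c i))))"
  proof (rule Suc.IH)
    fix w w' :: "nat \<Rightarrow> 'g" assume "\<And>j. j < K \<Longrightarrow> w j = w' j"
    then have "f (w(k := c i)) = f (w'(k := c i))" for i by (intro Suc.prems(1)) auto
    then show "avg (u k) (\<lambda>i. f (w(k := c i))) = avg (u k) (\<lambda>i. f (w'(k := c i)))" by simp
  qed (use Suc.prems in auto)
  then show ?case using Suc.prems(2,3) by simp
qed

lemma homot_local:
  assumes f: "\<And>w w'. (\<And>j. j \<le> n \<Longrightarrow> w j = w' j) \<Longrightarrow> f w = f w'" "\<And>w. f w \<in> carrier V"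
    and u: "\<And>j. j < n \<Longrightarrow> u j = u' j"
  shows "homot n f u = homot n f u'"
proof (cases n)
  case (Suc m)
  have "Av (Suc i) (dup i u) f = Av (Suc i) (dup i u') f" if "i \<le> m" for i
    using that u Suc by (intro Av_local[where K = "Suc n"] f(1)) (auto simp: dup_def)
  then show ?thesis
    unfolding homot_def prism_def Suc lessThan_Suc_atMost using f(2)
    by (subst (1 2) V.frag_eval_alternating_sum)
      (auto intro!: V.finprod_cong Av_closed simp: simp_implies_def simp del: V.finprod_Suc Av.simps)
qed (simp add: homot_def prism_def)

context
  fixes U W :: "'g set"
  assumes UW: "TG.nbhd W0" "TG.nbhd U" "\<And>x y. x \<in> W0 \<Longrightarrow> y \<in> W0 \<Longrightarrow> x \<otimes>\<^bsub>G\<^esub> inv\<^bsub>G\<^esub> y \<in> U"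
    and W: "TG.nbhd W" "W \<subseteq> W0"
begin

lemma W0_U: "W0 \<subseteq> U"
proof
  fix x assume x: "x \<in> W0"
  then have "x \<otimes>\<^bsub>G\<^esub> inv\<^bsub>G\<^esub> \<one>\<^bsub>G\<^esub> \<in> U" using UW by blast
  then show "x \<in> U" using x TG.nbhd_subset[of W0] UW(1) by auto
qed

lemma act_near: "x \<in> carrier G \<Longrightarrow> i \<in> act x \<Longrightarrow> x \<in> c i <#\<^bsub>G\<^esub> W0"
  using local[of x] by (auto simp: act_def)

text \<open>A sample point \<open>c i\<close> lies near a point of \<open>u\<close> if \<open>i\<close> contributes there: then \<open>u l\<close> lies in \<open>c i W0\<close> and in
  \<open>g W\<close>, so \<open>c i\<close> lies in \<open>g W W0\<^sup>-\<^sup>1\<close>, which is contained in \<open>g U\<close> by the choice of \<open>W0\<close>.\<close>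

lemma tuple_small:
  assumes u: "u \<in> tu W n"
    and w: "\<And>j. j \<le> m \<Longrightarrow> \<exists>l\<le>n. w j = u l \<or> (\<exists>i\<in>I. w j = c i \<and> u l \<in> c i <#\<^bsub>G\<^esub> W0)"
  shows "restrict w {..m} \<in> tu U m"
proof -
  obtain g where g: "g \<in> carrier G" "u \<in> {..n} \<rightarrow>\<^sub>E g <#\<^bsub>G\<^esub> W" using u unfolding TG.small_tuples_translate by blast
  have WC: "x \<in> carrier G" if "x \<in> W0" for x using that TG.nbhd_subset UW(1) by blast
  have "w j \<in> g <#\<^bsub>G\<^esub> U" if j: "j \<le> m" for j
  proof -
    obtain l where l: "l \<le> n" "w j = u l \<or> (\<exists>i\<in>I. w j = c i \<and> u l \<in> c i <#\<^bsub>G\<^esub> W0)" using w[OF j] by blast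
    have "u l \<in> g <#\<^bsub>G\<^esub> W" using g(2) l(1) by auto
    then obtain x where x: "x \<in> W" "u l = g \<otimes>\<^bsub>G\<^esub> x" by (auto simp: l_coset_def)
    from l(2) show ?thesis
    proof
      assume "w j = u l"
      then show ?thesis using x W(2) W0_U by (auto simp: l_coset_def)
    next
      assume "\<exists>i\<in>I. w j = c i \<and> u l \<in> c i <#\<^bsub>G\<^esub> W0"
      then obtain i y where i: "i \<in> I" "w j = c i" "y \<in> W0" "u l = c i \<otimes>\<^bsub>G\<^esub> y" by (auto simp: l_coset_def)
      have xC: "x \<in> carrier G" "y \<in> carrier G" "c i \<in> carrier G" using x i W(2) WC c_in by auto
      have "c i = g \<otimes>\<^bsub>G\<^esub> x \<otimes>\<^bsub>G\<^esub> inv\<^bsub>G\<^esub> y"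
        using i(4) x(2) xC g(1) by (metis TG.inv_solve_right TG.m_closed)
      then have "w j = g \<otimes>\<^bsub>G\<^esub> (x \<otimes>\<^bsub>G\<^esub> inv\<^bsub>G\<^esub> y)" using xC g(1) i(2) by (simp add: TG.m_assoc)
      then show ?thesis using UW(3)[of x y] x(1) W(2) i(3) by (auto simp: l_coset_def)
    qed
  qed
  then show ?thesis using g(1) by (auto simp: TG.small_tuples_translate)
qed

lemma tu_W_U: "tu W n \<subseteq> tu U n"
  using TG.small_tuples_mono W(2) W0_U by blast

lemma tu_carrier: "u \<in> tu W n \<Longrightarrow> j \<le> n \<Longrightarrow> u j \<in> carrier G"
  using TG.small_tuples_carrier W(1) by blast

text \<open>A product of neighbourhoods of the entries of \<open>u\<close>, in each of which a fixed finite set of indices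
  contributes.\<close>

lemma local_box:
  assumes u: "u \<in> tu W n"
  obtains Q J where "openin (mtop (power_manifold n M)) Q" "u \<in> Q" "Q \<subseteq> tu W n"
    "\<And>j. j \<le> n \<Longrightarrow> finite (J j) \<and> J j \<subseteq> I"
    "\<And>v j i. v \<in> Q \<Longrightarrow> j \<le> n \<Longrightarrow> i \<in> I - J j \<Longrightarrow> \<rho> i (v j) = 0"
    "\<And>v j i. v \<in> Q \<Longrightarrow> j \<le> n \<Longrightarrow> i \<in> J j \<Longrightarrow> v j \<in> c i <#\<^bsub>G\<^esub> W0"
proof -
  have "\<forall>j\<in>{..n}. \<exists>Q J. openin (mtop M) Q \<and> u j \<in> Q \<and> finite J \<and> J \<subseteq> I \<and>
      (\<forall>y\<in>Q. (\<forall>i\<in>I - J. \<rho> i y = 0) \<and> (\<forall>i\<in>J. y \<in> c i <#\<^bsub>G\<^esub> W0))"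
    using local tu_carrier[OF u] by simp
  then obtain Q J where QJ: "\<forall>j\<in>{..n}. openin (mtop M) (Q j) \<and> u j \<in> Q j \<and> finite (J j) \<and> J j \<subseteq> I \<and>
      (\<forall>y\<in>Q j. (\<forall>i\<in>I - J j. \<rho> i y = 0) \<and> (\<forall>i\<in>J j. y \<in> c i <#\<^bsub>G\<^esub> W0))"
    by metis
  let ?B = "(\<Pi>\<^sub>E j\<in>{..n}. Q j) \<inter> tu W n"
  have "openin (mtop (power_manifold n M)) ?B"
    using QJ openin_small_tuples[of W n] W(1) by (intro openin_Int) (auto simp: openin_PiE)
  moreover have "u \<in> ?B" using u QJ by (auto simp: small_tuples_def PiE_iff)
  moreover have "\<rho> i (v j) = 0" if "v \<in> ?B" "j \<le> n" "i \<in> I - J j" for v j i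
    using QJ that by (auto simp: PiE_iff)
  moreover have "v j \<in> c i <#\<^bsub>G\<^esub> W0" if "v \<in> ?B" "j \<le> n" "i \<in> J j" for v j i
    using QJ that by (auto simp: PiE_iff)
  ultimately show thesis using QJ by (intro that[of ?B J]) auto
qed

text \<open>Even a discontinuous \<open>f\<close> becomes smooth: all its arguments are sample points, hence locally constant, and the
  dependence on \<open>u\<close> is only through the weights.\<close>

lemma smooth_average_cochain:
  assumes f: "f \<in> tu U n \<rightarrow> carrier V"
  shows "smooth_map_on (tu W n) (power_manifold n M) N (\<lambda>u. Av (Suc n) u (ext U n f))"
proof (rule smooth_map_on_locally[OF M.smooth_manifold_power VN.N.smooth_manifold])
  show "openin (mtop (power_manifold n M)) (tu W n)" using openin_small_tuples W(1) by blast
  fix u assume u: "u \<in> tu W n"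
  obtain Q J where Q: "openin (mtop (power_manifold n M)) Q" "u \<in> Q" "Q \<subseteq> tu W n"
    "\<And>j. j \<le> n \<Longrightarrow> finite (J j) \<and> J j \<subseteq> I"
    "\<And>v j i. v \<in> Q \<Longrightarrow> j \<le> n \<Longrightarrow> i \<in> I - J j \<Longrightarrow> \<rho> i (v j) = 0"
    using local_box[OF u] by metis
  interpret P: smooth_mfd "power_manifold n M" by unfold_locales (rule M.smooth_manifold_power)
  have "smooth_map_on Q (power_manifold n M) N (\<lambda>u. Av (Suc n) u (ext U n f))"
  proof (rule smooth_Av[OF M.smooth_manifold_power Q(1), where J = J])
    show "smooth_map_on Q (power_manifold n M) M (\<lambda>u. u j)" if "j < Suc n" for j
      using that by (intro M.smooth_power_coordinate) simp
    fix \<kappa> :: "nat \<Rightarrow> 'g"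
    have "ext U n f (\<lambda>j. if j < Suc n then \<kappa> j else u j) = ext U n f \<kappa>" for u
      by (rule ext_local) simp
    then show "smooth_map_on Q (power_manifold n M) N (\<lambda>u. ext U n f (\<lambda>j. if j < Suc n then \<kappa> j else u j))"
      using VN.N.smooth_const[of "ext U n f \<kappa>"] ext_closed[OF f] VN.topspace_N by simp
  qed (use Q in auto)
  then show "\<exists>Q. openin (mtop (power_manifold n M)) Q \<and> u \<in> Q \<and>
      smooth_map_on (tu W n \<inter> Q) (power_manifold n M) N (\<lambda>u. Av (Suc n) u (ext U n f))"
    using Q(1-3) by (intro exI[of _ Q]) (simp add: Int_absorb1)
qed

text \<open>Here the averaged arguments are sample points, but the others are entries of \<open>u\<close>, so \<open>f\<close> has to be
  smooth.\<close>

lemma smooth_homotopy_cochain: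
  assumes f: "f \<in> tu U (Suc n) \<rightarrow> carrier V" and smooth: "smooth_map_on (tu U (Suc n)) (power_manifold (Suc n) M) N f"
  shows "smooth_map_on (tu W n) (power_manifold n M) N (homot (Suc n) (ext U (Suc n) f))"
proof (rule smooth_map_on_locally[OF M.smooth_manifold_power VN.N.smooth_manifold])
  show "openin (mtop (power_manifold n M)) (tu W n)" using openin_small_tuples W(1) by blast
  fix u assume u: "u \<in> tu W n"
  obtain Q J where Q: "openin (mtop (power_manifold n M)) Q" "u \<in> Q" "Q \<subseteq> tu W n"
    "\<And>j. j \<le> n \<Longrightarrow> finite (J j) \<and> J j \<subseteq> I"
    "\<And>v j i. v \<in> Q \<Longrightarrow> j \<le> n \<Longrightarrow> i \<in> I - J j \<Longrightarrow> \<rho> i (v j) = 0"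
    "\<And>v j i. v \<in> Q \<Longrightarrow> j \<le> n \<Longrightarrow> i \<in> J j \<Longrightarrow> v j \<in> c i <#\<^bsub>G\<^esub> W0"
    using local_box[OF u] by metis
  interpret P: smooth_mfd "power_manifold n M" by unfold_locales (rule M.smooth_manifold_power)
  let ?P = "power_manifold n M" and ?f = "ext U (Suc n) f"
  have fc: "?f w \<in> carrier V" for w by (rule ext_closed[OF f])
  have 1: "smooth_map_on Q ?P N (\<lambda>u. Av (Suc i) (dup i u) ?f)" if i: "i \<le> n" for i
  proof (rule smooth_Av[OF M.smooth_manifold_power Q(1), where J = J])
    show "smooth_map_on Q ?P M (\<lambda>u. dup i u j)" if "j < Suc i" for j
      using that i M.smooth_power_coordinate[of j n] by (simp add: dup_def)
    show "\<rho> l (dup i v j) = 0" if "v \<in> Q" "j < Suc i" "l \<in> I - J j" for v j l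
      using Q(5)[of v j l] that i by (simp add: dup_def)
    fix \<kappa> :: "nat \<Rightarrow> 'g" assume \<kappa>: "\<And>j. j < Suc i \<Longrightarrow> \<kappa> j \<in> c ` J j"
    define T where "T = (\<lambda>u :: nat \<Rightarrow> 'g. \<lambda>j\<in>{..Suc n}. if j < Suc i then \<kappa> j else u (j - 1))"
    have T: "smooth_map_on Q ?P (power_manifold (Suc n) M) T"
      unfolding T_def
    proof (rule M.smooth_tuple)
      fix j assume j: "j \<le> Suc n"
      show "smooth_map_on Q ?P M (\<lambda>u. if j < Suc i then \<kappa> j else u (j - 1))"
      proof (cases "j < Suc i")
        case True
        obtain l where "l \<in> J j" "\<kappa> j = c l" using \<kappa>[OF True] by blast
        then have "\<kappa> j \<in> topspace (mtop M)" using Q(4)[of j] True i c_in TG.topspace by auto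
        then show ?thesis using True M.smooth_const by simp
      next
        case False
        then show ?thesis using j M.smooth_power_coordinate[of "j - 1" n] by simp
      qed
    qed
    have TU: "T v \<in> tu U (Suc n)" if v: "v \<in> Q" for v
    proof -
      have vW: "v \<in> tu W n" using Q(3) v by blast
      show ?thesis
        unfolding T_def
      proof (rule tuple_small[OF vW])
        fix j assume j: "j \<le> Suc n"
        show "\<exists>l\<le>n. (if j < Suc i then \<kappa> j else v (j - 1)) = v l \<or>
            (\<exists>i'\<in>I. (if j < Suc i then \<kappa> j else v (j - 1)) = c i' \<and> v l \<in> c i' <#\<^bsub>G\<^esub> W0)"
        proof (cases "j < Suc i")
          case True
          then obtain l where l: "l \<in> J j" "\<kappa> j = c l" using \<kappa> by blast
          have "j \<le> n" using True i by simp
          then show ?thesis using True l Q(4)[of j] Q(6)[OF v, of j l] by (intro exI[of _ j]) auto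
        next
          case False
          then show ?thesis using j by (intro exI[of _ "j - 1"]) auto
        qed
      qed
    qed
    have "smooth_map_on Q ?P N (\<lambda>u. f (T u))"
      using TU
      by (intro smooth_map_on_compose[OF M.smooth_manifold_power smooth_mfd.charted VN.N.smooth_manifold Q(1) T _ smooth])
        (auto simp: smooth_mfd_def M.smooth_manifold_power)
    then show "smooth_map_on Q ?P N (\<lambda>u. ?f (\<lambda>j. if j < Suc i then \<kappa> j else dup i u j))"
    proof (rule P.smooth_map_on_cong)
      fix v assume v: "v \<in> Q"
      have "restrict (\<lambda>j. if j < Suc i then \<kappa> j else dup i v j) {..Suc n} = T v"
        by (auto simp: T_def dup_def fun_eq_iff)
      then show "f (T v) = ?f (\<lambda>j. if j < Suc i then \<kappa> j else dup i v j)" using TU[OF v] by (simp add: ext_def)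
    qed
  qed (use Q(4) i in auto)
  have 2: "smooth_map_on Q ?P N (\<lambda>u. Av (Suc i) (dup i u) ?f [^]\<^bsub>V\<^esub> ((- 1) ^ i :: int))" if i: "i \<le> n" for i
    by (rule VN.smooth_power_sign[OF M.smooth_manifold_power Q(1) 1[OF i]])
  have "homot (Suc n) ?f = (\<lambda>u. \<Otimes>\<^bsub>V\<^esub>i\<in>{..n}. Av (Suc i) (dup i u) ?f [^]\<^bsub>V\<^esub> ((- 1) ^ i :: int))"
    unfolding homot_def[abs_def] prism_def lessThan_Suc_atMost using Av_closed[of ?f, OF fc]
    by (intro HOL.ext, subst V.frag_eval_alternating_sum) (auto simp del: Av.simps)
  then have "smooth_map_on Q ?P N (homot (Suc n) ?f)"
    using VN.smooth_finprod[OF M.smooth_manifold_power Q(1), of "{..n}"] 2 by (simp del: Av.simps V.finprod_Suc)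
  then show "\<exists>Q. openin (mtop ?P) Q \<and> u \<in> Q \<and> smooth_map_on (tu W n \<inter> Q) ?P N (homot (Suc n) ?f)"
    using Q(1-3) by (intro exI[of _ Q]) (simp add: Int_absorb1)
qed

lemma active_small:
  assumes u: "u \<in> tu W n" and w: "w \<in> active k e"
    and e: "\<And>j. j \<le> m \<Longrightarrow> \<exists>l\<le>n. e j = u l"
  shows "restrict w {..m} \<in> tu U m"
proof (rule tuple_small[OF u])
  fix j assume j: "j \<le> m"
  obtain l where l: "l \<le> n" "e j = u l" using e[OF j] by blast
  show "\<exists>l\<le>n. w j = u l \<or> (\<exists>i\<in>I. w j = c i \<and> u l \<in> c i <#\<^bsub>G\<^esub> W0)"
  proof (cases "j < k")
    case True
    then obtain i where "i \<in> act (u l)" "w j = c i" using w l by (auto simp: active_def)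
    then show ?thesis using act_near[OF tu_carrier[OF u l(1)]] l(1) by (auto simp: act_def)
  next
    case False
    then show ?thesis using w l by (auto simp: active_def)
  qed
qed

lemma cobd_ext:
  assumes f: "f \<in> tu U n \<rightarrow>\<^sub>E carrier V" and w: "restrict w {..Suc n} \<in> tu U (Suc n)"
  shows "cobd (Suc n) (ext U n f) w = frag_eval V f (bd tuple_face (Suc n) (restrict w {..Suc n}))"
proof -
  have "(\<lambda>v\<in>tu U n. ext U n f v) = f"
    using f by (auto simp: fun_eq_iff ext_eq PiE_iff extensional_def)
  moreover have "cobd (Suc n) (ext U n f) w
      = frag_eval V (\<lambda>v\<in>tu U n. ext U n f v) (bd tuple_face (Suc n) (restrict w {..Suc n}))"
  proof (rule cobd_local[OF _ _ w])
    show "ext U n f v = ext U n f v'" if "\<And>j. j \<le> n \<Longrightarrow> v j = v' j" for v v' using that by (rule ext_local)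
    show "ext U n f v \<in> carrier V" for v using f by (intro ext_closed) (simp add: PiE_iff Pi_iff)
  qed simp
  ultimately show ?thesis by simp
qed

lemma Av_one: "(\<And>j. j < k \<Longrightarrow> w j \<in> carrier G) \<Longrightarrow> Av k w (\<lambda>_. \<one>\<^bsub>V\<^esub>) = \<one>\<^bsub>V\<^esub>"
  by (induction k) (simp_all add: avg_const)

abbreviation "CU \<equiv> A_complex (translate_cover G U) V"
abbreviation "CW \<equiv> A_complex (translate_cover G W) V"

definition smoothing :: "nat \<Rightarrow> ((nat \<Rightarrow> 'g) \<Rightarrow> 'v) \<Rightarrow> (nat \<Rightarrow> 'g) \<Rightarrow> 'v" where
  "smoothing n f = (\<lambda>u\<in>tu W n. Av (Suc n) u (ext U n f))"

lemma smoothing_bd: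
  assumes f: "f \<in> tu U n \<rightarrow>\<^sub>E carrier V" and u: "u \<in> tu W (Suc n)"
  shows "frag_eval V (smoothing n f) (bd tuple_face (Suc n) u) = Av (Suc (Suc n)) u (cobd (Suc n) (ext U n f))"
proof -
  have fc: "ext U n f w \<in> carrier V" for w using f by (intro ext_closed) (auto simp: PiE_iff)
  have "frag_eval V (smoothing n f) (bd tuple_face (Suc n) u) = cobd (Suc n) (\<lambda>w. Av (Suc n) w (ext U n f)) u"
    unfolding smoothing_def
    by (rule cobd_local[symmetric, OF _ _ u])
      (auto intro!: Av_closed fc Av_local[where K = "Suc n"] ext_local simp del: Av.simps)
  also have "\<dots> = Av (Suc (Suc n)) u (cobd (Suc n) (ext U n f))"
    using Av_cobd_full[OF fc, of n u] tu_carrier[OF u] by (simp del: Av.simps)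
  finally show ?thesis .
qed

lemma Av_cobd_ext:
  assumes f: "f \<in> tu U n \<rightarrow>\<^sub>E carrier V" and u: "u \<in> tu W (Suc n)"
  shows "Av (Suc (Suc n)) u (cobd (Suc n) (ext U n f)) = Av (Suc (Suc n)) u
    (ext U (Suc n) (\<lambda>s\<in>tu U (Suc n). frag_eval V f (bd tuple_face (Suc n) s)))"
proof (rule Av_cong)
  fix w assume "w \<in> active (Suc (Suc n)) u"
  then have "restrict w {..Suc n} \<in> tu U (Suc n)" using u by (rule_tac active_small) auto
  then show "cobd (Suc n) (ext U n f) w = ext U (Suc n) (\<lambda>s\<in>tu U (Suc n). frag_eval V f (bd tuple_face (Suc n) s)) w"
    using cobd_ext[OF f] by (simp add: ext_def)
qed (auto intro!: ext_closed)

text \<open>The extension of a cocycle by the unit need not be a cocycle, but its coboundary vanishes at all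
  sequences that occur in the averages of \<open>W\<close>-small tuples, as these are \<open>U\<close>-small.\<close>

lemma smoothing_homotopy:
  assumes f: "f \<in> cocycles CU n"
  shows "smoothing n f \<in> cocycles CW n"
    and "u \<in> tu W n \<Longrightarrow> f u = cobd n (homot n (ext U n f)) u \<otimes>\<^bsub>V\<^esub> smoothing n f u"
proof -
  interpret CU: function_cx "tu U" tuple_face V by (rule function_cx_tuples[OF V])
  interpret CW: function_cx "tu W" tuple_face V by (rule function_cx_tuples[OF V])
  have f': "f \<in> tu U n \<rightarrow>\<^sub>E carrier V" "\<And>s. s \<in> tu U (Suc n) \<Longrightarrow> frag_eval V f (bd tuple_face (Suc n) s) = \<one>\<^bsub>V\<^esub>"
    using f by (auto simp: A_complex_def CU.cocycles_fc)
  have fc: "ext U n f w \<in> carrier V" for w using f' by (intro ext_closed) (auto simp: PiE_iff)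
  have "frag_eval V (smoothing n f) (bd tuple_face (Suc n) u) = \<one>\<^bsub>V\<^esub>" if u: "u \<in> tu W (Suc n)" for u
  proof -
    have "frag_eval V (smoothing n f) (bd tuple_face (Suc n) u)
      = Av (Suc (Suc n)) u (ext U (Suc n) (\<lambda>s\<in>tu U (Suc n). frag_eval V f (bd tuple_face (Suc n) s)))"
      unfolding smoothing_bd[OF f'(1) u] by (rule Av_cobd_ext[OF f'(1) u])
    also have "ext U (Suc n) (\<lambda>s\<in>tu U (Suc n). frag_eval V f (bd tuple_face (Suc n) s)) = (\<lambda>_. \<one>\<^bsub>V\<^esub>)"
      using f'(2) by (auto simp: ext_def fun_eq_iff)
    also have "Av (Suc (Suc n)) u (\<lambda>_. \<one>\<^bsub>V\<^esub>) = \<one>\<^bsub>V\<^esub>"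
      using tu_carrier[OF u] by (intro Av_one) auto
    finally show ?thesis .
  qed
  moreover have "smoothing n f \<in> tu W n \<rightarrow>\<^sub>E carrier V"
    using fc by (auto simp: smoothing_def intro!: Av_closed simp del: Av.simps)
  ultimately show "smoothing n f \<in> cocycles CW n" by (simp add: A_complex_def CW.cocycles_fc)
  show "f u = cobd n (homot n (ext U n f)) u \<otimes>\<^bsub>V\<^esub> smoothing n f u" if u: "u \<in> tu W n"
  proof -
    have "homot (Suc n) (cobd (Suc n) (ext U n f)) u = homot (Suc n) (\<lambda>_. \<one>\<^bsub>V\<^esub>) u"
    proof (rule homot_cong)
      fix i w assume i: "i < Suc n" and w: "w \<in> active (Suc i) (dup i u)"
      have "restrict w {..Suc n} \<in> tu U (Suc n)"
      proof (rule active_small[OF u w])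
        show "\<exists>l\<le>n. dup i u j = u l" if "j \<le> Suc n" for j
          using that i by (intro exI[of _ "if j \<le> i then j else j - 1"]) (auto simp: dup_def)
      qed
      then show "cobd (Suc n) (ext U n f) w = \<one>\<^bsub>V\<^esub>" using cobd_ext[OF f'(1)] f'(2) by simp
    qed simp
    also have "\<dots> = \<one>\<^bsub>V\<^esub>" using tu_carrier[OF u] by (intro homot_one) auto
    finally have 1: "homot (Suc n) (cobd (Suc n) (ext U n f)) u = \<one>\<^bsub>V\<^esub>" .
    have "ext U n f u = f u" using u tu_W_U by (intro ext_eq) blast
    then show ?thesis
      using homotopy_identity[of "ext U n f" n u, OF fc] tu_carrier[OF u] u 1
      by (simp add: smoothing_def cobd_def del: Av.simps)
  qed
qed

lemma cobd_homot_bd: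
  assumes f: "f \<in> tu U (Suc m) \<rightarrow>\<^sub>E carrier V" and u: "u \<in> tu W (Suc m)"
  shows "cobd (Suc m) (homot (Suc m) (ext U (Suc m) f)) u
    = frag_eval V (\<lambda>v\<in>tu W m. homot (Suc m) (ext U (Suc m) f) v) (bd tuple_face (Suc m) u)"
proof (rule cobd_local[OF _ _ u])
  have fc: "ext U (Suc m) f w \<in> carrier V" for w using f by (intro ext_closed) (auto simp: PiE_iff)
  show "homot (Suc m) (ext U (Suc m) f) w = homot (Suc m) (ext U (Suc m) f) w'" if "\<And>j. j \<le> m \<Longrightarrow> w j = w' j" for w w'
    using that by (intro homot_local fc) (auto intro: ext_local)
qed (simp_all add: homot_def)

lemma cobd_homot_coboundary:
  assumes f: "f \<in> tu U n \<rightarrow>\<^sub>E carrier V"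
  shows "(\<lambda>u\<in>tu W n. cobd n (homot n (ext U n f)) u) \<in> coboundaries CW n"
proof -
  interpret CW: function_cx "tu W" tuple_face V by (rule function_cx_tuples[OF V])
  show ?thesis
  proof (cases n)
    case 0
    have "cobd 0 (homot 0 (ext U 0 f)) u = \<one>\<^bsub>V\<^esub>" for u
      unfolding cobd_def by (rule V.frag_eval_one) (simp add: homot_def prism_def)
    then show ?thesis by (simp add: 0 A_complex_def)
  next
    case (Suc m)
    let ?h = "\<lambda>v\<in>tu W m. homot (Suc m) (ext U (Suc m) f) v"
    have "?h \<in> tu W m \<rightarrow>\<^sub>E carrier V" by (auto simp: homot_def)
    moreover have "(\<lambda>u\<in>tu W (Suc m). cobd (Suc m) (homot (Suc m) (ext U (Suc m) f)) u)
      = (\<lambda>u\<in>tu W (Suc m). frag_eval V ?h (bd tuple_face (Suc m) u))"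
      using cobd_homot_bd[of f m] f Suc by (intro restrict_ext) auto
    ultimately show ?thesis unfolding Suc A_complex_def CW.coboundaries_fc by blast
  qed
qed

abbreviation "SW \<equiv> As_complex M (translate_cover G W) V N"

lemma smoothing_smooth:
  assumes f: "f \<in> tu U n \<rightarrow> carrier V"
  shows "smooth_map_on (tu W n) (power_manifold n M) N (smoothing n f)"
proof -
  interpret P: smooth_mfd "power_manifold n M" by unfold_locales (rule M.smooth_manifold_power)
  show ?thesis
    by (rule P.smooth_map_on_cong[OF smooth_average_cochain[OF f]]) (simp add: smoothing_def del: Av.simps)
qed

lemma smoothing_cocycle:
  assumes f: "f \<in> cocycles CU n"
  shows "smoothing n f \<in> cocycles SW n"
proof -
  interpret CU: function_cx "tu U" tuple_face V by (rule function_cx_tuples[OF V])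
  have "f \<in> tu U n \<rightarrow> carrier V" using f by (auto simp: A_complex_def CU.cocycles_fc PiE_iff)
  then show ?thesis using smoothing_homotopy(1)[OF f] smoothing_smooth by (simp add: cocycles_As)
qed

lemma smoothing_cohomologous:
  assumes f: "f \<in> cocycles CU n"
  shows "\<exists>e\<in>coboundaries CW n. restrict f (tu W n) = e \<otimes>\<^bsub>grp CW n\<^esub> smoothing n f"
proof -
  interpret CU: function_cx "tu U" tuple_face V by (rule function_cx_tuples[OF V])
  interpret CW: function_cx "tu W" tuple_face V by (rule function_cx_tuples[OF V])
  let ?e = "\<lambda>u\<in>tu W n. cobd n (homot n (ext U n f)) u"
  have "f \<in> tu U n \<rightarrow>\<^sub>E carrier V" using f by (simp add: A_complex_def CU.cocycles_fc)
  then have "?e \<in> coboundaries CW n" by (rule cobd_homot_coboundary)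
  moreover have "restrict f (tu W n) = ?e \<otimes>\<^bsub>grp CW n\<^esub> smoothing n f"
    unfolding A_complex_def CW.mult_fc by (rule restrict_ext) (simp add: smoothing_homotopy(2)[OF f])
  ultimately show ?thesis by blast
qed

text \<open>If \<open>a\<close> is smooth and is the coboundary of \<open>\<beta>\<close>, then \<open>\<beta>\<close> need not be smooth. But \<open>a\<close> differs from its smoothing
  by the coboundary of the smooth homotopy cochain, and its smoothing is the coboundary of the smoothing of \<open>\<beta>\<close>.\<close>

lemma smooth_coboundary:
  assumes a: "a \<in> coboundaries CU n" and smooth: "smooth_map_on (tu U n) (power_manifold n M) N a"
  shows "restrict a (tu W n) \<in> coboundaries SW n"
proof -
  interpret CU: function_cx "tu U" tuple_face V by (rule function_cx_tuples[OF V])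
  interpret CW: function_cx "tu W" tuple_face V by (rule function_cx_tuples[OF V])
  show ?thesis
  proof (cases n)
    case 0
    then show ?thesis
      using a tu_W_U[of 0] by (auto simp: A_complex_def As_complex_def fun_eq_iff)
  next
    case (Suc m)
    interpret P: smooth_mfd "power_manifold m M" by unfold_locales (rule M.smooth_manifold_power)
    obtain \<beta> where \<beta>: "\<beta> \<in> tu U m \<rightarrow>\<^sub>E carrier V" and a_eq: "a = (\<lambda>s\<in>tu U (Suc m). frag_eval V \<beta> (bd tuple_face (Suc m) s))"
      using a unfolding Suc A_complex_def CU.coboundaries_fc by blast
    have \<beta>': "\<beta> \<in> tu U m \<rightarrow> carrier V" using \<beta> by (simp add: PiE_iff Pi_iff)
    have ac: "a \<in> tu U (Suc m) \<rightarrow>\<^sub>E carrier V" by (auto simp: a_eq)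
    then have ac': "a \<in> tu U (Suc m) \<rightarrow> carrier V" by (simp add: PiE_iff Pi_iff)
    have az: "a \<in> cocycles CU (Suc m)"
      using a CU.FC.coboundaries_cocycles[of n] unfolding A_complex_def Suc by blast
    let ?h = "homot (Suc m) (ext U (Suc m) a)"
    define g where "g = (\<lambda>v\<in>tu W m. ?h v \<otimes>\<^bsub>V\<^esub> smoothing m \<beta> v)"
    have hs: "smooth_map_on (tu W m) (power_manifold m M) N ?h"
      by (rule smooth_homotopy_cochain[OF ac']) (use smooth Suc in simp)
    have ss: "smooth_map_on (tu W m) (power_manifold m M) N (smoothing m \<beta>)" by (rule smoothing_smooth[OF \<beta>'])
    have o: "openin (mtop (power_manifold m M)) (tu W m)" using openin_small_tuples W(1) by blast
    have sc: "smoothing m \<beta> v \<in> carrier V" "?h v \<in> carrier V" if "v \<in> tu W m" for v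
      using VN.smooth_map_in[OF M.smooth_manifold_power o] ss hs that by blast+
    have gs: "smooth_map_on (tu W m) (power_manifold m M) N g"
      by (rule P.smooth_map_on_cong[OF VN.smooth_mult[OF M.smooth_manifold_power o hs ss]]) (simp add: g_def)
    have gc: "g \<in> tu W m \<rightarrow>\<^sub>E carrier V" using sc by (auto simp: g_def)
    have "a u = frag_eval V g (bd tuple_face (Suc m) u)" if u: "u \<in> tu W (Suc m)" for u
    proof -
      have "a u = cobd (Suc m) ?h u \<otimes>\<^bsub>V\<^esub> smoothing (Suc m) a u" by (rule smoothing_homotopy(2)[OF az u])
      also have "cobd (Suc m) ?h u = frag_eval V (\<lambda>v\<in>tu W m. ?h v) (bd tuple_face (Suc m) u)"
        by (rule cobd_homot_bd[OF ac u])
      also have "smoothing (Suc m) a u = Av (Suc (Suc m)) u (ext U (Suc m) a)"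
        using u by (simp add: smoothing_def del: Av.simps)
      also have "\<dots> = Av (Suc (Suc m)) u (cobd (Suc m) (ext U m \<beta>))"
        unfolding a_eq by (rule Av_cobd_ext[OF \<beta> u, symmetric])
      also have "\<dots> = frag_eval V (smoothing m \<beta>) (bd tuple_face (Suc m) u)"
        by (rule smoothing_bd[OF \<beta> u, symmetric])
      also have "frag_eval V (\<lambda>v\<in>tu W m. ?h v) (bd tuple_face (Suc m) u) \<otimes>\<^bsub>V\<^esub> \<dots>
        = frag_eval V (\<lambda>v. (\<lambda>v\<in>tu W m. ?h v) v \<otimes>\<^bsub>V\<^esub> smoothing m \<beta> v) (bd tuple_face (Suc m) u)"
      proof (rule V.frag_eval_mult[symmetric])
        fix v assume "v \<in> Poly_Mapping.keys (bd tuple_face (Suc m) u)"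
        then have "v \<in> tu W m" using CW.keys_bd[OF u] by blast
        then show "(\<lambda>v\<in>tu W m. ?h v) v \<in> carrier V" "smoothing m \<beta> v \<in> carrier V" using sc by simp_all
      qed
      also have "\<dots> = frag_eval V g (bd tuple_face (Suc m) u)"
      proof (rule V.frag_eval_cong)
        fix v assume "v \<in> Poly_Mapping.keys (bd tuple_face (Suc m) u)"
        then have "v \<in> tu W m" using CW.keys_bd[OF u] by blast
        then show "(\<lambda>v\<in>tu W m. ?h v) v \<otimes>\<^bsub>V\<^esub> smoothing m \<beta> v = g v" by (simp add: g_def)
      qed
      finally show ?thesis .
    qed
    then have "restrict a (tu W (Suc m)) = (\<lambda>s\<in>tu W (Suc m). frag_eval V g (bd tuple_face (Suc m) s))"
      by (intro restrict_ext)
    also have "\<dots> = diff SW m g"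
      using gc by (simp add: As_complex_def A_complex_def CW.diff_fc PiE_iff Pi_iff)
    finally have "restrict a (tu W (Suc m)) = diff SW m g" .
    moreover have "g \<in> carrier (grp SW m)" using gc gs by (simp add: As_complex_def A_complex_def)
    ultimately show ?thesis by (simp add: Suc)
  qed
qed

end

end

section \<open>Contractions of identity neighbourhoods in Lie groups\<close>

text \<open>In a chart at the identity the straight line contraction towards the image of the identity stays in the
  chart for all points near it, by the tube lemma.\<close>

lemma locally_contractible_lie_group:
  assumes "lie_group G M"
  shows "\<exists>B h. locally_contractible_group G (mtop M) B h"
proof -
  interpret TG: topological_group G "mtop M" by (rule topological_group_lie_group[OF assms])
  interpret M: smooth_mfd M using lie_groupD(2)[OF assms] by unfold_locales
  obtain U \<phi> where c: "(U, \<phi>) \<in> atlas M" and U1: "\<one>\<^bsub>G\<^esub> \<in> U"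
    using M.chart_cover TG.topspace TG.one_closed by metis
  let ?S = "model M" and ?O = "\<phi> ` U" and ?I = "{0..1 :: real}"
  define y0 where "y0 = \<phi> \<one>\<^bsub>G\<^esub>"
  define q where "q = (\<lambda>p :: 'b \<times> real. y0 + (1 - snd p) *\<^sub>R (fst p - y0))"
  have q_cont: "continuous_on A q" for A
    unfolding q_def by (intro continuous_intros)
  have y0: "y0 \<in> ?S" "y0 \<in> ?O" using M.chart_model[OF c U1] U1 by (auto simp: y0_def)
  have q_in: "q p \<in> ?S" if "fst p \<in> ?S" for p
    using M.subspace_model that y0(1) unfolding q_def
    by (intro subspace_add subspace_scale subspace_diff)
  have q_map: "continuous_map (prod_topology (top_of_set ?S) (top_of_set ?I)) (top_of_set ?S) q"
    using q_cont[of "?S \<times> ?I"] q_in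
    by (auto simp: continuous_map_in_subtopology q_in simp flip: subtopology_Times)
  let ?P = "{p \<in> topspace (prod_topology (top_of_set ?S) (top_of_set ?I)). q p \<in> ?O}"
  have "openin (prod_topology (top_of_set ?S) (top_of_set ?I)) ?P"
    by (rule openin_continuous_map_preimage[OF q_map M.chart_image[OF c]])
  moreover have "compactin (top_of_set ?I) ?I" by (simp add: compactin_subtopology)
  moreover have "y0 \<in> topspace (top_of_set ?S)" using y0 by simp
  moreover have "{y0} \<times> ?I \<subseteq> ?P" using y0 by (auto simp: q_def)
  ultimately have "\<exists>A C. openin (top_of_set ?S) A \<and> openin (top_of_set ?I) C \<and> y0 \<in> A \<and> ?I \<subseteq> C \<and> A \<times> C \<subseteq> ?P"
    by (rule tube_lemma_right)
  then obtain A C where A: "openin (top_of_set ?S) A" "y0 \<in> A" "?I \<subseteq> C" "A \<times> C \<subseteq> ?P" by blast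
  have AO: "q (y, t) \<in> ?O" if "y \<in> A" "t \<in> ?I" for y t using A(3,4) that by blast
  define B where "B = {x \<in> U. \<phi> x \<in> A}"
  have BU: "B \<subseteq> U" by (auto simp: B_def)
  have \<phi>_cont: "continuous_map (subtopology (mtop M) U) (top_of_set ?O) \<phi>"
    by (rule homeomorphic_imp_continuous_map[OF M.chart_homeo[OF c]])
  have B: "openin (mtop M) B"
  proof -
    have "continuous_map (subtopology (mtop M) U) (top_of_set ?S) \<phi>"
      using \<phi>_cont M.chart_model[OF c] by (auto simp: continuous_map_in_subtopology)
    then show ?thesis
      using openin_continuous_preimage_sub[OF M.chart_open[OF c] _ A(1)] by (simp add: B_def)
  qed
  have inv: "inv_into U \<phi> (\<phi> x) = x" if "x \<in> U" for x using inv_into_f_f[OF M.chart_inj[OF c] that] .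
  define h where "h = (\<lambda>p. if fst p \<in> B then inv_into U \<phi> (q (\<phi> (fst p), snd p)) else fst p)"
  have "locally_contractible_group G (mtop M) B h"
  proof (unfold_locales)
    show "openin (mtop M) B" by (rule B)
    show "\<one>\<^bsub>G\<^esub> \<in> B" using U1 A(2) by (simp add: B_def y0_def)
    show "h (x, 0) = x" if "x \<in> carrier G" for x
      using inv[of x] BU by (auto simp: h_def q_def)
    show "h (x, 1) = \<one>\<^bsub>G\<^esub>" if "x \<in> B" for x
      using inv[OF U1] that by (simp add: h_def q_def y0_def)
    show "h (\<one>\<^bsub>G\<^esub>, t) = \<one>\<^bsub>G\<^esub>" for t
      using inv[OF U1] by (simp add: h_def q_def y0_def)
    show "h (x, t) \<in> carrier G" if "x \<in> carrier G" "t \<in> {0..1}" for x t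
    proof (cases "x \<in> B")
      case True
      then have "q (\<phi> x, t) \<in> ?O" using AO that by (simp add: B_def)
      then have "inv_into U \<phi> (q (\<phi> x, t)) \<in> U" by (rule inv_into_into)
      then show ?thesis using True M.chart_subset[OF c] TG.topspace by (auto simp: h_def)
    qed (simp add: h_def that)
    let ?Y = "prod_topology (subtopology (mtop M) B) (top_of_set ?I)"
    have "continuous_map ?Y euclidean (\<lambda>p. \<phi> (fst p))"
    proof -
      have "continuous_map (subtopology (mtop M) B) euclidean \<phi>"
        using continuous_map_from_subtopology_mono[OF _ BU] \<phi>_cont by (auto simp: continuous_map_in_subtopology)
      from continuous_map_compose[OF continuous_map_fst this] show ?thesis by (simp add: o_def)
    qed
    moreover have "continuous_map ?Y euclidean snd"
      using continuous_map_compose[OF continuous_map_snd continuous_map_from_subtopology[OF continuous_map_id]]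
      by (simp add: o_def id_def)
    ultimately have "continuous_map ?Y euclidean (\<lambda>p. (\<phi> (fst p), snd p))"
      by (simp add: continuous_map_pairwise o_def flip: euclidean_product_topology prod_topology_euclidean)
    from continuous_map_compose[OF this, of euclidean q] q_cont[of UNIV]
    have "continuous_map ?Y euclidean (\<lambda>p. q (\<phi> (fst p), snd p))" by (simp add: o_def)
    then have "continuous_map ?Y (top_of_set ?O) (\<lambda>p. q (\<phi> (fst p), snd p))"
      using AO by (auto simp: continuous_map_in_subtopology B_def)
    from continuous_map_compose[OF this M.chart_inv_cont[OF c]]
    have "continuous_map ?Y (mtop M) (\<lambda>p. inv_into U \<phi> (q (\<phi> (fst p), snd p)))" by (simp add: o_def)
    then show "continuous_map ?Y (mtop M) h"
      by (rule continuous_map_eq) (auto simp: h_def)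
  qed
  then show ?thesis by blast
qed

section \<open>Partitions of unity subordinate to translates\<close>

text \<open>The partition of unity subordinate to the translates of \<open>W0\<close>, on the first power of \<open>G\<close>, is indexed by the
  members of the covering; \<open>c\<close> chooses a translating element for each. The linear order is a
  well-order of all indices.\<close>

lemma smooth_averaging_exists:
  fixes G :: "'g monoid" and V :: "'v monoid" and M :: "('g, 'e::real_tvs) manifold" and N :: "('v, 'f::real_tvs) manifold"
  assumes G: "lie_group G M" and par: "smoothly_paracompact (power_manifold 0 M)"
    and V: "lie_group V N" "comm_group V" and \<Phi>: "smooth_map_on (carrier V \<times> {0..1}) (prod_manifold N real_manifold) N \<Phi>"
      "\<forall>v\<in>carrier V. \<Phi> (v, 0) = v \<and> \<Phi> (v, 1) = \<one>\<^bsub>V\<^esub>" "\<forall>t\<in>{0..1}. (\<lambda>v. \<Phi> (v, t)) \<in> hom V V"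
    and W0: "openin (mtop M) W0" "\<one>\<^bsub>G\<^esub> \<in> W0"
  shows "\<exists>(I :: (nat \<Rightarrow> 'g) set set) r \<rho> c. smooth_averaging V \<Phi> G I r \<rho> c M N W0"
proof -
  interpret TG: topological_group G "mtop M" by (rule topological_group_lie_group[OF G])
  interpret M: smooth_mfd M using lie_groupD(2)[OF G] by unfold_locales
  interpret P: smooth_mfd "power_manifold 0 M" by unfold_locales (rule M.smooth_manifold_power)
  let ?X = "mtop (power_manifold 0 M)"
  define I where "I = {{..0::nat} \<rightarrow>\<^sub>E (g <#\<^bsub>G\<^esub> W0) |g. g \<in> carrier G}"
  define hat where "hat = (\<lambda>x :: 'g. \<lambda>_\<in>{..0::nat}. x)"
  have hat_in: "hat x \<in> topspace ?X" if "x \<in> carrier G" for x using that by (simp add: hat_def TG.topspace)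
  have hat_0: "hat (x 0) = x" if "x \<in> topspace ?X" for x
    using that by (auto simp: hat_def fun_eq_iff PiE_iff extensional_def)
  have I_open: "openin ?X U" if "U \<in> I" for U
    using that TG.openin_l_coset[OF _ W0(1)] by (auto simp: I_def openin_PiE)
  have I_cover: "\<Union>I = topspace ?X"
  proof
    show "\<Union>I \<subseteq> topspace ?X" using I_open openin_subset by blast
    show "topspace ?X \<subseteq> \<Union>I"
    proof
      fix x assume x: "x \<in> topspace ?X"
      then have "x 0 \<in> carrier G" by (auto simp: TG.topspace)
      moreover from this have "x 0 \<in> x 0 <#\<^bsub>G\<^esub> W0" using W0(2) by (force simp: l_coset_def)
      then have "x \<in> {..0} \<rightarrow>\<^sub>E (x 0 <#\<^bsub>G\<^esub> W0)" using x by (auto simp: PiE_iff)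
      ultimately show "x \<in> \<Union>I" unfolding I_def by blast
    qed
  qed
  define su where "su = (\<lambda>\<rho>' :: (nat \<Rightarrow> 'g) set \<Rightarrow> (nat \<Rightarrow> 'g) \<Rightarrow> real. \<lambda>U. ?X closure_of {x \<in> topspace ?X. \<rho>' U x \<noteq> 0})"
  have "(\<forall>U\<in>I. openin ?X U) \<and> \<Union>I = topspace ?X" using I_open I_cover by blast
  from par[unfolded smoothly_paracompact_def Let_def, THEN spec, THEN mp, OF this]
  obtain \<rho>' :: "(nat \<Rightarrow> 'g) set \<Rightarrow> (nat \<Rightarrow> 'g) \<Rightarrow> real" where
    \<rho>': "\<forall>U\<in>I. smooth_map (power_manifold 0 M) real_manifold (\<rho>' U) \<and> su \<rho>' U \<subseteq> U"
      "\<forall>x\<in>topspace ?X. \<exists>Nb. openin ?X Nb \<and> x \<in> Nb \<and> finite {U \<in> I. su \<rho>' U \<inter> Nb \<noteq> {}}"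
      "\<forall>x\<in>topspace ?X. (\<Sum>U\<in>{U \<in> I. \<rho>' U x \<noteq> 0}. \<rho>' U x) = 1"
    unfolding su_def by (elim exE conjE)
  have sm: "smooth_map (power_manifold 0 M) real_manifold (\<rho>' U)" and supp: "su \<rho>' U \<subseteq> U" if "U \<in> I" for U
    using \<rho>'(1) that by blast+
  define c where "c = (\<lambda>U. SOME g. g \<in> carrier G \<and> U = {..0::nat} \<rightarrow>\<^sub>E (g <#\<^bsub>G\<^esub> W0))"
  have c: "c U \<in> carrier G \<and> U = {..0::nat} \<rightarrow>\<^sub>E (c U <#\<^bsub>G\<^esub> W0)" if "U \<in> I" for U
  proof -
    have "\<exists>g. g \<in> carrier G \<and> U = {..0::nat} \<rightarrow>\<^sub>E (g <#\<^bsub>G\<^esub> W0)" using that by (auto simp: I_def)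
    from someI_ex[OF this] show ?thesis by (simp add: c_def)
  qed
  define \<rho> where "\<rho> = (\<lambda>U x. \<rho>' U (hat x))"
  obtain r :: "((nat \<Rightarrow> 'g) set \<times> (nat \<Rightarrow> 'g) set) set" where "well_order_on UNIV r"
    using well_order_on by blast
  then have r: "linear_order r" by (simp add: well_order_on_def)
  have hat_cont: "continuous_map (mtop M) ?X hat"
    by (simp add: hat_def continuous_map_componentwise image_subset_iff)
  have "smooth_averaging V \<Phi> G I r \<rho> c M N W0"
  proof (intro smooth_averaging.intro averaging.intro smooth_averaging_axioms.intro)
    show "comm_group V" "lie_group G M" "lie_group V N"
      "smooth_map_on (carrier V \<times> {0..1}) (prod_manifold N real_manifold) N \<Phi>" "linear_order r"
      by (fact V G \<Phi> r)+
    show "(\<lambda>v. \<Phi> (v, t)) \<in> hom V V" if "t \<in> {0..1}" for t using \<Phi>(3) that by blast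
    show "\<Phi> (v, 0) = v" "\<Phi> (v, 1) = \<one>\<^bsub>V\<^esub>" if "v \<in> carrier V" for v using \<Phi>(2) that by blast+
    show s1: "(\<Sum>i\<in>{i \<in> I. \<rho> i x \<noteq> 0}. \<rho> i x) = 1" if "x \<in> carrier G" for x
      using \<rho>'(3) hat_in[OF that] by (simp add: \<rho>_def)
    show "finite {i \<in> I. \<rho> i x \<noteq> 0}" if "x \<in> carrier G" for x
    proof (rule ccontr)
      assume "infinite {i \<in> I. \<rho> i x \<noteq> 0}"
      then have "(\<Sum>i\<in>{i \<in> I. \<rho> i x \<noteq> 0}. \<rho> i x) = 0" by (rule sum.infinite)
      then show False using s1[OF that] by linarith
    qed
    show "c i \<in> carrier G" if "i \<in> I" for i using c[OF that] by blast
    show "smooth_map (power_manifold 0 M) real_manifold (\<lambda>x. \<rho> i (x 0))" if "i \<in> I" for i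
      unfolding smooth_map_def
      by (rule P.smooth_map_on_cong[OF sm[OF that, unfolded smooth_map_def]]) (simp only: \<rho>_def hat_0)
    fix x assume x: "x \<in> carrier G"
    obtain Nb where Nb: "openin ?X Nb" "hat x \<in> Nb" "finite {U \<in> I. su \<rho>' U \<inter> Nb \<noteq> {}}"
      using \<rho>'(2) hat_in[OF x] by blast
    define F where "F = {U \<in> I. su \<rho>' U \<inter> Nb \<noteq> {}}"
    define J where "J = {U \<in> F. hat x \<in> U}"
    have F: "finite F" "F \<subseteq> I" using Nb(3) by (auto simp: F_def)
    have J: "J \<subseteq> F" by (auto simp: J_def)
    \<comment> \<open>Remove from \<open>Nb\<close> the supports that do not contribute at \<open>x\<close>, and stay in the members of the covering
        around \<open>x\<close>.\<close>
    define Q where "Q = Nb \<inter> \<Inter>(J \<union> (\<lambda>U. topspace ?X - su \<rho>' U) ` (F - J))"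
    have "openin ?X Q"
      unfolding Q_def
    proof (rule openin_Int_Inter)
      show "finite (J \<union> (\<lambda>U. topspace ?X - su \<rho>' U) ` (F - J))" using F(1) J finite_subset by auto
      show "openin ?X T" if "T \<in> J \<union> (\<lambda>U. topspace ?X - su \<rho>' U) ` (F - J)" (is "?T T") for T
      proof -
        consider "T \<in> J" | U where "U \<in> F - J" "T = topspace ?X - su \<rho>' U" using \<open>?T T\<close> by blast
        then show ?thesis
        proof cases
          case 1
          then show ?thesis using I_open F(2) J by blast
        next
          case 2
          show ?thesis unfolding 2(2) su_def by (intro openin_diff openin_topspace closedin_closure_of)
        qed
      qed
    qed (rule Nb)
    then have Q: "openin (mtop M) {y \<in> topspace (mtop M). hat y \<in> Q}"
      by (rule openin_continuous_map_preimage[OF hat_cont])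
    have xQ: "hat x \<in> Q"
      using Nb(2) hat_in[OF x] supp F(2) by (auto simp: Q_def J_def su_def)
    show "\<exists>Q J. openin (mtop M) Q \<and> x \<in> Q \<and> finite J \<and> J \<subseteq> I \<and>
      (\<forall>y\<in>Q. (\<forall>i\<in>I - J. \<rho> i y = 0) \<and> (\<forall>i\<in>J. y \<in> c i <#\<^bsub>G\<^esub> W0))"
    proof (intro exI conjI ballI)
      show "openin (mtop M) {y \<in> topspace (mtop M). hat y \<in> Q}" by (rule Q)
      show "x \<in> {y \<in> topspace (mtop M). hat y \<in> Q}" using x xQ by (simp add: TG.topspace)
      show "finite J" "J \<subseteq> I" using F J finite_subset by auto
      fix y assume y: "y \<in> {y \<in> topspace (mtop M). hat y \<in> Q}"
      then have yG: "y \<in> carrier G" by (simp add: TG.topspace)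
      show "\<rho> i y = 0" if i: "i \<in> I - J" for i
      proof (rule ccontr)
        assume "\<rho> i y \<noteq> 0"
        then have "hat y \<in> {x \<in> topspace ?X. \<rho>' i x \<noteq> 0}" using hat_in[OF yG] by (simp add: \<rho>_def)
        then have *: "hat y \<in> su \<rho>' i"
          unfolding su_def using closure_of_subset[of "{x \<in> topspace ?X. \<rho>' i x \<noteq> 0}" ?X] by blast
        moreover have yQ: "hat y \<in> Q" using y by blast
        then have "hat y \<in> Nb" unfolding Q_def by (rule IntD1)
        ultimately have "su \<rho>' i \<inter> Nb \<noteq> {}" by blast
        then have "i \<in> F - J" using i by (simp add: F_def)
        then have "hat y \<in> topspace ?X - su \<rho>' i" using yQ unfolding Q_def by blast
        then show False using * by (elim DiffE) (rule notE)
      qed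
      show "y \<in> c i <#\<^bsub>G\<^esub> W0" if i: "i \<in> J" for i
      proof -
        have "hat y \<in> Q" using y by blast
        then have "hat y \<in> i" using i unfolding Q_def by blast
        then have "hat y \<in> {..0::nat} \<rightarrow>\<^sub>E (c i <#\<^bsub>G\<^esub> W0)" using c[of i] i J F(2) by blast
        then have "hat y 0 \<in> c i <#\<^bsub>G\<^esub> W0" by (rule PiE_mem) simp
        then show ?thesis by (simp add: hat_def)
      qed
    qed
  qed
  then show ?thesis by blast
qed

section \<open>Passage to cohomology\<close>

lemma simplex_vertex_in: "i \<le> n \<Longrightarrow> simplex_vertex i \<in> standard_simplex n"
  by (simp add: simplex_vertex_def)

lemma vertices_small_tuple:
  assumes "\<tau> \<in> small_simplices X \<UU> n"
  shows "(\<lambda>i\<in>{..n}. \<tau> (simplex_vertex i)) \<in> small_tuples \<UU> n"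
proof -
  obtain U where U: "U \<in> \<UU>" "\<tau> ` standard_simplex n \<subseteq> U" using assms by (auto simp: small_simplices_def)
  have "(\<lambda>i\<in>{..n}. \<tau> (simplex_vertex i)) \<in> {..n} \<rightarrow>\<^sub>E U" using U(2) simplex_vertex_in by auto
  then show ?thesis using U(1) unfolding small_tuples_def by blast
qed

lemma vertex_map_cocycle_map:
  fixes V :: "'v monoid"
  assumes V: "comm_group V"
  shows "cocycle_map (A_complex \<UU> V) (S_complex X \<UU> V) n (vertex_map X \<UU> n)"
proof -
  interpret A: function_cx "small_tuples \<UU>" tuple_face V by (rule function_cx_tuples[OF V])
  have "(\<lambda>i\<in>{..n}. singular_face (Suc n) k \<tau> (simplex_vertex i))
      = tuple_face (Suc n) k (\<lambda>i\<in>{..Suc n}. \<tau> (simplex_vertex i))" if "k \<le> Suc n" for n k and \<tau> :: "(nat \<Rightarrow> real) \<Rightarrow> 'a"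
  proof -
    have "simplical_face k (simplex_vertex i) = simplex_vertex (if i < k then i else Suc i)" for i
      by (auto simp: simplical_face_def simplex_vertex_def fun_eq_iff)
    then show ?thesis
      by (intro ext) (simp add: singular_face_def tuple_face_def simplex_vertex_in)
  qed
  from A.pullback_cocycle_map[OF function_cx_small[OF V], of X \<UU> "\<lambda>n \<tau>. \<lambda>i\<in>{..n}. \<tau> (simplex_vertex i)", OF vertices_small_tuple[of _ X] this]
  show ?thesis unfolding A_complex_def S_complex_def vertex_map_def by blast
qed

text \<open>The smooth cochains are a subcomplex: the coboundary is a product of compositions with smooth projections.\<close>

lemma (in lie_comm_group) cochain_cx_As:
  assumes G: "lie_group G M" and W: "openin (mtop M) W"
  shows "cochain_cx (As_complex M (translate_cover G W) V N)"
proof -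
  interpret TG: topological_group G "mtop M" by (rule topological_group_lie_group[OF G])
  interpret M: smooth_mfd M using lie_groupD(2)[OF G] by unfold_locales
  let ?tu = "small_tuples (translate_cover G W)"
  interpret A: function_cx ?tu tuple_face V by (rule function_cx_tuples[OF V_comm])
  let ?S = "\<lambda>n. {f \<in> carrier (grp A.FC n). smooth_map_on (?tu n) (power_manifold n M) N f}"
  have o: "openin (mtop (power_manifold n M)) (?tu n)" for n
    unfolding small_tuples_def translate_cover_def using W
    by (intro openin_Union) (auto simp: openin_PiE intro!: TG.openin_l_coset)
  have P: "smooth_manifold (power_manifold n M)" for n by (rule M.smooth_manifold_power)
  have ch: "charted (power_manifold n M)" for n using P by (intro smooth_mfd.charted smooth_mfd.intro)
  have cong: "smooth_map_on (?tu n) (power_manifold n M) N g"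
    if "smooth_map_on (?tu n) (power_manifold n M) N f" "\<And>u. u \<in> ?tu n \<Longrightarrow> f u = g u" for f g n
    using smooth_mfd.smooth_map_on_cong[OF _ that] P by (simp add: smooth_mfd_def)
  have "cochain_cx \<lparr>grp = (\<lambda>n. (grp A.FC n)\<lparr>carrier := ?S n\<rparr>), diff = diff A.FC\<rparr>"
  proof (rule subcomplex_cochain_cx[OF A.FC.cochain_cx_axioms, where S = ?S])
    fix n
    interpret group "grp A.FC n" by (rule A.FC.grp_group)
    show "subgroup (?S n) (grp A.FC n)"
    proof (rule subgroupI)
      have "smooth_map_on (?tu n) (power_manifold n M) N (\<lambda>s\<in>?tu n. \<one>\<^bsub>V\<^esub>)"
        by (rule cong[OF N.smooth_const]) (simp_all add: topspace_N)
      then show "?S n \<noteq> {}" using one_closed by fastforce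
      fix f assume f: "f \<in> ?S n"
      have "smooth_map_on (?tu n) (power_manifold n M) N (\<lambda>s\<in>?tu n. inv\<^bsub>V\<^esub> f s)"
        by (rule cong[OF smooth_inv[OF P o]]) (use f in auto)
      then show "inv\<^bsub>grp A.FC n\<^esub> f \<in> ?S n"
        using f inv_closed[of f] by (simp add: function_complex_def)
      fix g assume g: "g \<in> ?S n"
      have "smooth_map_on (?tu n) (power_manifold n M) N (\<lambda>s\<in>?tu n. f s \<otimes>\<^bsub>V\<^esub> g s)"
        by (rule cong[OF smooth_mult[OF P o]]) (use f g in auto)
      then show "f \<otimes>\<^bsub>grp A.FC n\<^esub> g \<in> ?S n" using f g m_closed[of f g] by simp
    qed auto
    fix f assume f: "f \<in> ?S n"
    have fc: "f \<in> ?tu n \<rightarrow> carrier V" using f by (auto simp: PiE_iff)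
    have face: "smooth_map_on (?tu (Suc n)) (power_manifold (Suc n) M) N (\<lambda>s. f (tuple_face (Suc n) k s))" if k: "k \<le> Suc n" for k
    proof (rule smooth_map_on_compose[OF P ch N.smooth_manifold o, where h = f and f = "tuple_face (Suc n) k"])

      show "smooth_map_on (?tu (Suc n)) (power_manifold (Suc n) M) (power_manifold n M) (tuple_face (Suc n) k)"
        unfolding tuple_face_def[abs_def] diff_Suc_Suc diff_zero
      proof (rule M.smooth_tuple)
        fix i assume i: "i \<le> n"
        have *: "smooth_map_on (?tu (Suc n)) (power_manifold (Suc n) M) M (\<lambda>u. u (if i < k then i else Suc i))"
          using i by (intro M.smooth_power_coordinate) auto
        then show "smooth_map_on (?tu (Suc n)) (power_manifold (Suc n) M) M (\<lambda>u. if i < k then u i else u (Suc i))"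
          by (cases "i < k") simp_all
      qed
      show "tuple_face (Suc n) k ` ?tu (Suc n) \<subseteq> ?tu n" using A.face_in k by blast
      show "smooth_map_on (?tu n) (power_manifold n M) N f" using f by simp
    qed
    have "smooth_map_on (?tu (Suc n)) (power_manifold (Suc n) M) N
        (\<lambda>s. \<Otimes>\<^bsub>V\<^esub>k\<in>{..Suc n}. f (tuple_face (Suc n) k s) [^]\<^bsub>V\<^esub> ((- 1) ^ k :: int))"
      by (intro smooth_finprod[OF P o] smooth_power_sign[OF P o] face) auto
    then have "smooth_map_on (?tu (Suc n)) (power_manifold (Suc n) M) N (diff A.FC n f)"
      by (rule cong) (simp add: function_complex_def del: V.finprod_Suc)
    then show "diff A.FC n f \<in> ?S (Suc n)"
      using f hom_in_carrier[OF A.FC.diff_hom, of f n] by simp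
  qed
  then show ?thesis by (simp add: As_complex_def A_complex_def)
qed

section \<open>The comparison map on cohomology classes\<close>

lemma cocycle_map_compose:
  assumes "cocycle_map C D n f" "cocycle_map D E n g"
  shows "cocycle_map C E n (\<lambda>x. g (f x))"
proof -
  have f: "f \<in> hom ((grp C n)\<lparr>carrier := cocycles C n\<rparr>) ((grp D n)\<lparr>carrier := cocycles D n\<rparr>)"
    and fB: "f ` coboundaries C n \<subseteq> coboundaries D n"
    and g: "g \<in> hom ((grp D n)\<lparr>carrier := cocycles D n\<rparr>) ((grp E n)\<lparr>carrier := cocycles E n\<rparr>)"
    and gB: "g ` coboundaries D n \<subseteq> coboundaries E n"
    using assms unfolding cocycle_map_def by blast+
  have "g \<circ> f \<in> hom ((grp C n)\<lparr>carrier := cocycles C n\<rparr>) ((grp E n)\<lparr>carrier := cocycles E n\<rparr>)"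
    by (rule hom_compose[OF f g])
  moreover have "(\<lambda>x. g (f x)) ` coboundaries C n \<subseteq> coboundaries E n" using fB gB by blast
  ultimately show ?thesis unfolding cocycle_map_def by (simp add: o_def)
qed

lemma cocycle_map_in: "cocycle_map C D n f \<Longrightarrow> z \<in> cocycles C n \<Longrightarrow> f z \<in> cocycles D n"
  unfolding cocycle_map_def by (auto dest: hom_in_carrier)

lemma cocycle_map_coboundary: "cocycle_map C D n f \<Longrightarrow> z \<in> coboundaries C n \<Longrightarrow> f z \<in> coboundaries D n"
  unfolding cocycle_map_def by blast

lemma cocycle_map_mult: "cocycle_map C D n f \<Longrightarrow> z \<in> cocycles C n \<Longrightarrow> w \<in> cocycles C n \<Longrightarrow>
    f (z \<otimes>\<^bsub>grp C n\<^esub> w) = f z \<otimes>\<^bsub>grp D n\<^esub> f w"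
  unfolding cocycle_map_def using hom_mult[of f "(grp C n)\<lparr>carrier := cocycles C n\<rparr>" "(grp D n)\<lparr>carrier := cocycles D n\<rparr>" z w]
  by simp

lemma (in cochain_cx) cls_eq_one_iff:
  assumes "z \<in> cocycles C n"
  shows "cls n z = \<one>\<^bsub>cohomology C n\<^esub> \<longleftrightarrow> z \<in> coboundaries C n"
proof -
  interpret group "grp C n" by (rule grp_group)
  have "\<one>\<^bsub>grp C n\<^esub> \<in> cocycles C n" by (rule subgroup.one_closed[OF subgroup_cocycles])
  then have "cls n z = \<one>\<^bsub>cohomology C n\<^esub> \<longleftrightarrow> (\<exists>b\<in>coboundaries C n. z = b \<otimes>\<^bsub>grp C n\<^esub> \<one>\<^bsub>grp C n\<^esub>)"
    unfolding one_cohomology by (rule cls_eq_iff[OF assms])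
  also have "\<dots> \<longleftrightarrow> z \<in> coboundaries C n"
    using subgroup.mem_carrier[OF subgroup_coboundaries] by auto
  finally show ?thesis .
qed

locale cover_cochains = topological_group G X for G :: "'g monoid" (structure) and X :: "'g topology" +
  fixes V :: "'v monoid"
  assumes V: "comm_group V"
begin

abbreviation "cov \<equiv> translate_cover G"
abbreviation "tup U n \<equiv> small_tuples (cov U) n"
abbreviation "sim U n \<equiv> small_simplices X (cov U) n"
abbreviation "A U \<equiv> A_complex (cov U) V"
abbreviation "S U \<equiv> S_complex X (cov U) V"
abbreviation "Sg \<equiv> singular_cochain_complex X V"
abbreviation "vm U n \<equiv> vertex_map X (cov U) n"

lemma cochain_cx_A: "cochain_cx (A U)"
  unfolding A_complex_def by (rule cochain_cx_function_complex[OF V function_cx.axioms(1)[OF function_cx_tuples[OF V]]])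

lemma cochain_cx_S: "cochain_cx (S U)"
  unfolding S_complex_def by (rule cochain_cx_function_complex[OF V function_cx.axioms(1)[OF function_cx_small[OF V]]])

lemma cochain_cx_Sg: "cochain_cx Sg"
  unfolding singular_cochain_complex_def
  by (rule cochain_cx_function_complex[OF V function_cx.axioms(1)[OF function_cx_singular[OF V]]])

lemma restrict_A: "W \<subseteq> U \<Longrightarrow> cocycle_map (A U) (A W) n (\<lambda>f. restrict f (tup W n))"
  unfolding A_complex_def
  by (rule function_cx.restrict_cocycle_map[OF function_cx_tuples[OF V] function_cx_tuples[OF V] small_tuples_mono])

lemma restrict_Sg: "cocycle_map Sg (S U) n (\<lambda>f. restrict f (sim U n))"
  unfolding S_complex_def singular_cochain_complex_def
  by (rule function_cx.restrict_cocycle_map[OF function_cx_singular[OF V] function_cx_small[OF V] small_simplices_subset])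

lemma restrict_S: "W \<subseteq> U \<Longrightarrow> cocycle_map (S U) (S W) n (\<lambda>f. restrict f (sim W n))"
  unfolding S_complex_def
  by (rule function_cx.restrict_cocycle_map[OF function_cx_small[OF V] function_cx_small[OF V] small_simplices_mono])

lemma restrict_vertex_map: "W \<subseteq> U \<Longrightarrow> restrict (vm U n a) (sim W n) = vm W n (restrict a (tup W n))"
  using small_simplices_mono[of W U n] by (auto simp: vertex_map_def fun_eq_iff vertices_small_tuple)

lemma translates_cover:
  assumes U: "nbhd U"
  shows "\<And>T. T \<in> cov U \<Longrightarrow> openin X T" "topspace X \<subseteq> \<Union>(cov U)"
proof -
  show "openin X T" if "T \<in> cov U" for T using that U openin_l_coset by (auto simp: translate_cover_def)
  show "topspace X \<subseteq> \<Union>(cov U)"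
  proof
    fix x assume "x \<in> topspace X"
    then have x: "x \<in> carrier G" by (simp add: topspace)
    then have "x \<in> x <# U" using U by (force simp: l_coset_def)
    then show "x \<in> \<Union>(cov U)" using x unfolding translate_cover_def by blast
  qed
qed

lemma H_sing_restrict_translates:
  assumes U: "nbhd U"
  shows "H_sing_restrict X (cov U) V n \<in> iso (H_sing X V n) (cohomology (S U) n)"
  using translates_cover[OF U] V by (rule H_sing_restrict_iso)

end

text \<open>What the comparison with singular cohomology requires of a family of subcomplexes \<open>C U\<close> of the cochains on
  small tuples. It is used for all cochains and for the smooth ones.\<close>

locale comparison_family = cover_cochains G X V
  for G :: "'g monoid" (structure) and X :: "'g topology" and V :: "'v monoid" +
  fixes C :: "'g set \<Rightarrow> ((nat \<Rightarrow> 'g) \<Rightarrow> 'v) cochain_complex" and n :: nat and \<U>1 :: "'g set set"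
  assumes base: "open_identity_nhd_filterbase G X \<U>1"
    and cochain_cx: "nbhd U \<Longrightarrow> cochain_cx (C U)"
    and incl: "nbhd U \<Longrightarrow> cocycle_map (C U) (A U) n (\<lambda>f. f)"
    and restr: "nbhd U \<Longrightarrow> nbhd W \<Longrightarrow> W \<subseteq> U \<Longrightarrow> cocycle_map (C U) (C W) n (\<lambda>f. restrict f (tup W n))"
    and locally_inj: "nbhd U \<Longrightarrow> a \<in> cocycles (C U) n \<Longrightarrow> vm U n a \<in> coboundaries (S U) n \<Longrightarrow>
      \<exists>W0. nbhd W0 \<and> (\<forall>W. nbhd W \<and> W \<subseteq> W0 \<longrightarrow> restrict a (tup W n) \<in> coboundaries (C W) n)"
    and locally_surj: "z \<in> cocycles Sg n \<Longrightarrow>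
      \<exists>W0. nbhd W0 \<and> (\<forall>W. nbhd W \<and> W \<subseteq> W0 \<longrightarrow> (\<exists>a\<in>cocycles (C W) n. \<exists>b\<in>coboundaries (S W) n.
        restrict z (sim W n) = b \<otimes>\<^bsub>grp (S W) n\<^esub> vm W n a))"
begin

abbreviation "H U \<equiv> cohomology (C U) n"
abbreviation "res U W \<equiv> cohomology_map (C W) n (\<lambda>f. restrict f (tup W n))"
abbreviation "vs U \<equiv> vertex_map_sing X (cov U) V n"
abbreviation "cl U \<equiv> cochain_cx.cls (C U) n"
abbreviation "clS \<equiv> cochain_cx.cls Sg n"

lemma base_nbhd: "U \<in> \<U>1 \<Longrightarrow> nbhd U"
  using base unfolding open_identity_nhd_filterbase_def by blast

lemma base_below: "nbhd W \<Longrightarrow> \<exists>U\<in>\<U>1. U \<subseteq> W"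
  using base unfolding open_identity_nhd_filterbase_def by blast

lemma pair: "nbhd U \<Longrightarrow> nbhd W \<Longrightarrow> cochain_cx_pair (C U) (C W)"
  using cochain_cx unfolding cochain_cx_pair_def by blast

lemma carrier_H: "nbhd U \<Longrightarrow> carrier (H U) = cl U ` cocycles (C U) n"
  using cochain_cx.carrier_cohomology[OF cochain_cx] .

lemma res_cl: "nbhd U \<Longrightarrow> nbhd W \<Longrightarrow> W \<subseteq> U \<Longrightarrow> a \<in> cocycles (C U) n \<Longrightarrow> res U W (cl U a) = cl W (restrict a (tup W n))"
  by (rule cochain_cx_pair.cohomology_map_cls[OF pair restr])

lemma vertex_C: "nbhd U \<Longrightarrow> cocycle_map (C U) (S U) n (vm U n)"
  by (rule cocycle_map_compose[OF incl vertex_map_cocycle_map[OF V]])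

lemma restrict_self: "nbhd U \<Longrightarrow> a \<in> cocycles (C U) n \<Longrightarrow> restrict a (tup U n) = a"
proof -
  assume "nbhd U" "a \<in> cocycles (C U) n"
  then have "a \<in> cocycles (A U) n" using cocycle_map_in[OF incl] by blast
  then show ?thesis
    unfolding A_complex_def function_cx.cocycles_fc[OF function_cx_tuples[OF V]]
    using PiE_restrict by blast
qed

sublocale D: directed_system \<U>1 reverse_incl H res
proof (rule directed_system.intro)
  have "nbhd (carrier G)" using openin_topspace[of X] by (simp add: topspace)
  then show "\<U>1 \<noteq> {}" using base_below by blast
  show "\<exists>k\<in>\<U>1. k \<subseteq> i \<and> k \<subseteq> j" if "i \<in> \<U>1" "j \<in> \<U>1" for i j
    using base_below[of "i \<inter> j"] base_nbhd[OF that(1)] base_nbhd[OF that(2)] by auto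
  show "group (H i)" if "i \<in> \<U>1" for i
    by (rule cochain_cx.group_cohomology[OF cochain_cx[OF base_nbhd[OF that]]])
  show "res i j \<in> hom (H i) (H j)" if "i \<in> \<U>1" "j \<in> \<U>1" "j \<subseteq> i" for i j
    using base_nbhd that by (intro cochain_cx_pair.cohomology_map_hom[OF pair restr]) auto
  show "res i i a = a" if "i \<in> \<U>1" "a \<in> carrier (H i)" for i a
    using that base_nbhd[OF that(1)] by (auto simp: carrier_H res_cl restrict_self)
  show "res j k (res i j a) = res i k a"
    if ijk: "i \<in> \<U>1" "j \<in> \<U>1" "k \<in> \<U>1" "j \<subseteq> i" "k \<subseteq> j" and a: "a \<in> carrier (H i)" for i j k a
  proof -
    have nb: "nbhd i" "nbhd j" "nbhd k" using base_nbhd ijk by blast+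
    have ki: "k \<subseteq> i" using ijk by blast
    obtain c where c: "c \<in> cocycles (C i) n" "a = cl i c" using a carrier_H[OF nb(1)] by blast
    have "restrict (restrict c (tup j n)) (tup k n) = restrict c (tup k n)"
      using small_tuples_mono[OF ijk(5), of n] by (auto simp: fun_eq_iff)
    then show ?thesis
      using cocycle_map_in[OF restr[OF nb(1,2) ijk(4)] c(1)] c
      by (simp add: res_cl[OF nb(1,2) ijk(4)] res_cl[OF nb(2,3) ijk(5)] res_cl[OF nb(1,3) ki])
  qed
qed auto

context
  fixes U :: "'g set"
  assumes U: "nbhd U"
begin

interpretation CU: cochain_cx "C U" by (rule cochain_cx[OF U])
interpretation SU: cochain_cx "S U" by (rule cochain_cx_S)
interpretation Sg: cochain_cx Sg by (rule cochain_cx_Sg)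
interpretation P: cochain_cx_pair "C U" "S U" ..
interpretation Q: cochain_cx_pair Sg "S U" ..

lemma vs_hom: "vs U \<in> hom (H U) (H_sing X V n)"
proof -
  interpret g: group "H_sing X V n" unfolding H_sing_def by (rule Sg.group_cohomology)
  have "inv_into (carrier (H_sing X V n)) (H_sing_restrict X (cov U) V n) \<in> iso (cohomology (S U) n) (H_sing X V n)"
    by (rule g.iso_set_sym[OF H_sing_restrict_translates[OF U]])
  then have "inv_into (carrier (H_sing X V n)) (H_sing_restrict X (cov U) V n) \<in> hom (cohomology (S U) n) (H_sing X V n)"
    by (simp add: iso_def)
  from Group.hom_compose[OF P.cohomology_map_hom[OF vertex_C[OF U]] this]
  show ?thesis unfolding vertex_map_sing_def[abs_def] by (simp add: o_def)
qed

text \<open>The comparison map is only described through the inverse of an isomorphism. On cocycles, a class with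
  representative \<open>a\<close> goes to the class of \<open>z\<close> if \<open>z\<close> and \<open>a\<close> agree on small simplices up to a coboundary.\<close>

lemma vs_cl_iff:
  assumes a: "a \<in> cocycles (C U) n" and z: "z \<in> cocycles Sg n"
  shows "vs U (cl U a) = clS z \<longleftrightarrow> (\<exists>b\<in>coboundaries (S U) n. restrict z (sim U n) = b \<otimes>\<^bsub>grp (S U) n\<^esub> vm U n a)"
proof -
  let ?\<rho> = "H_sing_restrict X (cov U) V n"
  have bij: "bij_betw ?\<rho> (carrier (H_sing X V n)) (carrier (cohomology (S U) n))"
    using H_sing_restrict_translates[OF U, of n] by (simp add: iso_def)
  have va: "vm U n a \<in> cocycles (S U) n" by (rule cocycle_map_in[OF vertex_C[OF U] a])
  have zs: "restrict z (sim U n) \<in> cocycles (S U) n" by (rule cocycle_map_in[OF restrict_Sg z])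
  have zH: "clS z \<in> carrier (H_sing X V n)" unfolding H_sing_def by (rule Sg.cls_in[OF z])
  have \<rho>z: "?\<rho> (clS z) = SU.cls n (restrict z (sim U n))"
    unfolding H_sing_restrict_def by (rule Q.cohomology_map_cls[OF restrict_Sg z])
  have "vs U (cl U a) = inv_into (carrier (H_sing X V n)) ?\<rho> (SU.cls n (vm U n a))"
    unfolding vertex_map_sing_def P.cohomology_map_cls[OF vertex_C[OF U] a] ..
  also have "\<dots> = clS z \<longleftrightarrow> SU.cls n (restrict z (sim U n)) = SU.cls n (vm U n a)"
    using bij_betw_inv_into_left[OF bij zH] bij_betw_inv_into_right[OF bij SU.cls_in[OF va]] \<rho>z by metis
  finally show ?thesis unfolding SU.cls_eq_iff[OF zs va] .
qed

lemma vs_cl_eq_one: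
  assumes a: "a \<in> cocycles (C U) n" and 1: "vs U (cl U a) = \<one>\<^bsub>H_sing X V n\<^esub>"
  shows "vm U n a \<in> coboundaries (S U) n"
proof -
  let ?\<rho> = "H_sing_restrict X (cov U) V n"
  interpret g: group_hom "H_sing X V n" "cohomology (S U) n" ?\<rho>
    using H_sing_restrict_translates[OF U, of n] Sg.group_cohomology SU.group_cohomology
    by (simp add: group_hom_def group_hom_axioms_def iso_def H_sing_def)
  have bij: "bij_betw ?\<rho> (carrier (H_sing X V n)) (carrier (cohomology (S U) n))"
    using H_sing_restrict_translates[OF U, of n] by (simp add: iso_def)
  have va: "vm U n a \<in> cocycles (S U) n" by (rule cocycle_map_in[OF vertex_C[OF U] a])
  have "SU.cls n (vm U n a) = ?\<rho> (vs U (cl U a))"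
    unfolding vertex_map_sing_def P.cohomology_map_cls[OF vertex_C[OF U] a]
    using bij_betw_inv_into_right[OF bij SU.cls_in[OF va]] by simp
  then have "SU.cls n (vm U n a) = \<one>\<^bsub>cohomology (S U) n\<^esub>" by (simp add: 1)
  then show ?thesis using SU.cls_eq_one_iff[OF va] by blast
qed

end

lemma vs_res:
  assumes UW: "U \<in> \<U>1" "W \<in> \<U>1" "W \<subseteq> U" and \<alpha>: "\<alpha> \<in> carrier (H U)"
  shows "vs W (res U W \<alpha>) = vs U \<alpha>"
proof -
  have nb: "nbhd U" "nbhd W" using base_nbhd UW by blast+
  interpret SU: cochain_cx "S U" by (rule cochain_cx_S)
  interpret Sg: cochain_cx Sg by (rule cochain_cx_Sg)
  obtain a where a: "a \<in> cocycles (C U) n" "\<alpha> = cl U a" using \<alpha> carrier_H[OF nb(1)] by blast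
  have "vs U \<alpha> \<in> carrier (H_sing X V n)" by (rule hom_in_carrier[OF vs_hom[OF nb(1)] \<alpha>])
  then obtain z where z: "z \<in> cocycles Sg n" "vs U \<alpha> = clS z" unfolding H_sing_def Sg.carrier_cohomology by blast
  then obtain b where b: "b \<in> coboundaries (S U) n" "restrict z (sim U n) = b \<otimes>\<^bsub>grp (S U) n\<^esub> vm U n a"
    using vs_cl_iff[OF nb(1) a(1) z(1)] a(2) by blast
  have bz: "b \<in> cocycles (S U) n" using b(1) SU.coboundaries_cocycles by blast
  have "restrict z (sim W n) = restrict (restrict z (sim U n)) (sim W n)"
    using small_simplices_mono[OF UW(3), of n] by (auto simp: fun_eq_iff)
  also have "\<dots> = restrict b (sim W n) \<otimes>\<^bsub>grp (S W) n\<^esub> restrict (vm U n a) (sim W n)"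
    unfolding b(2) by (rule cocycle_map_mult[OF restrict_S[OF UW(3)] bz cocycle_map_in[OF vertex_C[OF nb(1)] a(1)]])
  also have "restrict (vm U n a) (sim W n) = vm W n (restrict a (tup W n))" by (rule restrict_vertex_map[OF UW(3)])
  finally have "\<exists>b\<in>coboundaries (S W) n. restrict z (sim W n) = b \<otimes>\<^bsub>grp (S W) n\<^esub> vm W n (restrict a (tup W n))"
    using cocycle_map_coboundary[OF restrict_S[OF UW(3)] b(1)] by blast
  then have "vs W (cl W (restrict a (tup W n))) = clS z"
    using vs_cl_iff[OF nb(2) cocycle_map_in[OF restr[OF nb UW(3)] a(1)] z(1)] by blast
  then show ?thesis using z(2) a res_cl[OF nb UW(3) a(1)] by simp
qed

text \<open>Two classes with the same image differ by a class in the kernel. The vertex cochain of a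
  representative is a coboundary, and therefore so is the representative after shrinking the neighbourhood.\<close>

theorem comparison_iso: "colim_desc vs \<in> iso (colim \<U>1 reverse_incl H res) (H_sing X V n)"
proof (rule D.colim_desc_iso)
  show "vs j (res i j a) = vs i a" if "i \<in> \<U>1" "j \<in> \<U>1" "j \<subseteq> i" "a \<in> carrier (H i)" for i j a
    using that by (rule vs_res)
  show "vs i \<in> hom (H i) (H_sing X V n)" if "i \<in> \<U>1" for i by (rule vs_hom[OF base_nbhd[OF that]])
  interpret Sg: cochain_cx Sg by (rule cochain_cx_Sg)
  show "\<exists>i\<in>\<U>1. \<exists>a\<in>carrier (H i). vs i a = y" if y: "y \<in> carrier (H_sing X V n)" for y
  proof -
    obtain z where z: "z \<in> cocycles Sg n" "y = clS z" using y unfolding H_sing_def Sg.carrier_cohomology by blast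
    obtain W0 where W0: "nbhd W0" "\<And>W. nbhd W \<and> W \<subseteq> W0 \<Longrightarrow> \<exists>a\<in>cocycles (C W) n. \<exists>b\<in>coboundaries (S W) n.
        restrict z (sim W n) = b \<otimes>\<^bsub>grp (S W) n\<^esub> vm W n a"
      using locally_surj[OF z(1)] by blast
    obtain W where W: "W \<in> \<U>1" "W \<subseteq> W0" using base_below[OF W0(1)] by blast
    obtain a where a: "a \<in> cocycles (C W) n"
      "\<exists>b\<in>coboundaries (S W) n. restrict z (sim W n) = b \<otimes>\<^bsub>grp (S W) n\<^esub> vm W n a"
      using W0(2)[of W] base_nbhd[OF W(1)] W(2) by blast
    have "vs W (cl W a) = y" using vs_cl_iff[OF base_nbhd[OF W(1)] a(1) z(1)] a(2) z(2) by blast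
    moreover have "cl W a \<in> carrier (H W)" unfolding carrier_H[OF base_nbhd[OF W(1)]] using a(1) by (rule imageI)
    ultimately show ?thesis using W(1) by blast
  qed
  show "\<exists>j\<in>\<U>1. j \<subseteq> i \<and> res i j a = res i j b"
    if i: "i \<in> \<U>1" and ab: "a \<in> carrier (H i)" "b \<in> carrier (H i)" and eq: "vs i a = vs i b" for i a b
  proof -
    have nb: "nbhd i" by (rule base_nbhd[OF i])
    interpret h: group_hom "H i" "H_sing X V n" "vs i"
      using vs_hom[OF nb] D.grp[OF i] Sg.group_cohomology[of n]
      by (simp add: group_hom_def group_hom_axioms_def H_sing_def)
    let ?d = "a \<otimes>\<^bsub>H i\<^esub> inv\<^bsub>H i\<^esub> b"
    have d: "?d \<in> carrier (H i)" "vs i ?d = \<one>\<^bsub>H_sing X V n\<^esub>" using ab eq by simp_all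
    obtain c where c: "c \<in> cocycles (C i) n" "?d = cl i c" using d(1) carrier_H[OF nb] by blast
    have "vm i n c \<in> coboundaries (S i) n" using vs_cl_eq_one[OF nb c(1)] d(2) c(2) by simp
    from locally_inj[OF nb c(1) this] obtain W0 where
      W0: "nbhd W0" "\<And>W. nbhd W \<and> W \<subseteq> W0 \<Longrightarrow> restrict c (tup W n) \<in> coboundaries (C W) n" by blast
    obtain W where W: "W \<in> \<U>1" "W \<subseteq> W0 \<inter> i" using base_below[of "W0 \<inter> i"] W0(1) nb by auto
    have nbW: "nbhd W" and Wi: "W \<subseteq> i" using base_nbhd[OF W(1)] W(2) by blast+
    interpret CW: cochain_cx "C W" by (rule cochain_cx[OF nbW])
    interpret r: group_hom "H i" "H W" "res i W"
      using D.r_hom[OF i W(1) Wi] D.grp[OF i] D.grp[OF W(1)] by (simp add: group_hom_def group_hom_axioms_def)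
    have "restrict c (tup W n) \<in> coboundaries (C W) n" using W0(2)[of W] nbW W(2) by blast
    then have "res i W ?d = \<one>\<^bsub>H W\<^esub>"
      unfolding c(2) res_cl[OF nb nbW Wi c(1)]
      using CW.cls_eq_one_iff[OF cocycle_map_in[OF restr[OF nb nbW Wi] c(1)]] by blast
    moreover have "a = ?d \<otimes>\<^bsub>H i\<^esub> b" using ab by (simp add: h.G.m_assoc)
    then have "res i W a = res i W ?d \<otimes>\<^bsub>H W\<^esub> res i W b"
      using r.hom_mult[OF d(1) ab(2)] by simp
    ultimately have "res i W a = res i W b" using r.hom_closed[OF ab(2)] by simp
    then show ?thesis using W(1) Wi by blast
  qed
qed

end


section \<open>The comparison theorem\<close>

lemma (in topological_group) nbhd_right_div:
  assumes "nbhd U"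
  shows "\<exists>W. nbhd W \<and> (\<forall>x\<in>W. \<forall>y\<in>W. x \<otimes> inv y \<in> U)"
proof -
  obtain W where W: "nbhd W" "\<forall>x\<in>W. \<forall>y\<in>W. x \<otimes> y \<in> U" using nbhd_mult[OF assms] by blast
  let ?W = "{x \<in> topspace X. inv x \<in> W}"
  have "openin X ?W" using openin_continuous_map_preimage[OF inv_cont] W by blast
  then show ?thesis using W by (intro exI[of _ "W \<inter> ?W"]) (auto simp: topspace)
qed

locale lie_comparison = lie_comm_group V N
  for V :: "'v monoid" and N :: "('v, 'f::real_tvs) manifold" +
  fixes G :: "'g monoid" and M :: "('g, 'e::real_tvs) manifold" and \<U>1 :: "'g set set"
  assumes G_lie: "lie_group G M"
    and par: "smoothly_paracompact (power_manifold 0 M)"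
    and base: "open_identity_nhd_filterbase G (mtop M) \<U>1"
    and contractible: "smoothly_loop_contractible V N"
begin

sublocale cover_cochains G "mtop M" V
  using topological_group_lie_group[OF G_lie] V_comm
  by (simp add: cover_cochains_def cover_cochains_axioms_def)

sublocale M: smooth_mfd M using lie_groupD(2)[OF G_lie] by unfold_locales

abbreviation "As U \<equiv> As_complex M (translate_cover G U) V N"

lemma smooth_averaging_nbhd:
  assumes "nbhd U"
  obtains W0 \<Phi> and I :: "(nat \<Rightarrow> 'g) set set" and r \<rho> c where
    "smooth_averaging V \<Phi> G I r \<rho> c M N W0" "nbhd W0" "\<And>x y. x \<in> W0 \<Longrightarrow> y \<in> W0 \<Longrightarrow> x \<otimes>\<^bsub>G\<^esub> inv\<^bsub>G\<^esub> y \<in> U"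
proof -
  obtain \<Phi> where \<Phi>: "smooth_map_on (carrier V \<times> {0..1}) (prod_manifold N real_manifold) N \<Phi>"
    "\<forall>v\<in>carrier V. \<Phi> (v, 0) = v \<and> \<Phi> (v, 1) = \<one>\<^bsub>V\<^esub>"
    "\<forall>t\<in>{0..1}. (\<lambda>v. \<Phi> (v, t)) \<in> hom V V \<and> smooth_map N N (\<lambda>v. \<Phi> (v, t))"
    using contractible unfolding smoothly_loop_contractible_def by (elim exE conjE)
  have hom: "\<forall>t\<in>{0..1}. (\<lambda>v. \<Phi> (v, t)) \<in> hom V V" using \<Phi>(3) by blast
  obtain W0 where W0: "nbhd W0" "\<forall>x\<in>W0. \<forall>y\<in>W0. x \<otimes>\<^bsub>G\<^esub> inv\<^bsub>G\<^esub> y \<in> U" using nbhd_right_div[OF assms] by blast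
  obtain I :: "(nat \<Rightarrow> 'g) set set" and r \<rho> c where "smooth_averaging V \<Phi> G I r \<rho> c M N W0"
    using smooth_averaging_exists[OF G_lie par V_lie V_comm \<Phi>(1,2) hom] W0(1) by blast
  then show thesis using W0 by (intro that) auto
qed

lemma incl_As: "cocycle_map (As U) (A U) n (\<lambda>f. f)"
proof -
  have "coboundaries (As U) n \<subseteq> coboundaries (A U) n"
    by (cases n) (auto simp: As_complex_def)
  moreover have "(\<lambda>f. f) \<in> hom ((grp (As U) n)\<lparr>carrier := cocycles (As U) n\<rparr>) ((grp (A U) n)\<lparr>carrier := cocycles (A U) n\<rparr>)"
    by (intro homI) (auto simp: cocycles_As, simp add: As_complex_def)
  ultimately show ?thesis by (simp add: cocycle_map_def)
qed

lemma restrict_As: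
  assumes U: "nbhd U" and W: "nbhd W" "W \<subseteq> U"
  shows "cocycle_map (As U) (As W) n (\<lambda>f. restrict f (tup W n))"
proof (rule cocycle_mapI[OF cochain_cx_As cochain_cx_As])
  have sm: "smooth_map_on (tup W n) (power_manifold n M) N (restrict f (tup W n))"
    if f: "smooth_map_on (tup U n) (power_manifold n M) N f" for f n
  proof -
    interpret P: smooth_mfd "power_manifold n M" by unfold_locales (rule M.smooth_manifold_power)
    have "smooth_map_on (tup W n) (power_manifold n M) N f"
      using smooth_map_on_subset f small_tuples_mono[OF W(2)] by blast
    then show ?thesis by (rule P.smooth_map_on_cong) simp
  qed
  have sub: "tup W n \<subseteq> tup U n" for n by (rule small_tuples_mono[OF W(2)])
  show "(\<lambda>f. restrict f (tup W n)) \<in> hom (grp (As U) n) (grp (As W) n)" for n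
    using sub[of n] sm[of n]
    by (intro homI) (auto simp: As_complex_def A_complex_def function_complex_def PiE_iff fun_eq_iff)
  show "restrict (diff (As U) n c) (tup W (Suc n)) = diff (As W) n (restrict c (tup W n))"
    if c: "c \<in> carrier (grp (As U) n)" for n c
  proof -
    have "c \<in> carrier (grp (A U) n)" using c by (simp add: As_complex_def)
    then show ?thesis
      using function_cx.restrict_diff[OF function_cx_tuples[OF V] function_cx_tuples[OF V] sub]
      by (simp add: As_complex_def A_complex_def)
  qed
qed (use U W G_lie in auto)

sublocale cA: comparison_family G "mtop M" V "A" n \<U>1 for n
proof (intro comparison_family.intro comparison_family_axioms.intro cover_cochains_axioms)
  obtain B h where "locally_contractible_group G (mtop M) B h" using locally_contractible_lie_group[OF G_lie] by blast
  then interpret L: locally_contractible_group G "mtop M" B h .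
  show "open_identity_nhd_filterbase G (mtop M) \<U>1" by (rule base)
  show "cochain_cx (A U)" for U by (rule cochain_cx_A)
  show "cocycle_map (A U) (A U) n (\<lambda>f. f)" for U
    by (simp add: cocycle_map_def hom_def)
  show "cocycle_map (A U) (A W) n (\<lambda>f. restrict f (tup W n))" if "W \<subseteq> U" for U W by (rule restrict_A[OF that])
  show "\<exists>W0. nbhd W0 \<and> (\<forall>W. nbhd W \<and> W \<subseteq> W0 \<longrightarrow> restrict a (tup W n) \<in> coboundaries (A W) n)"
    if "nbhd U" "a \<in> cocycles (A U) n" "vm U n a \<in> coboundaries (S U) n" for U a
    using L.vertex_map_injective[OF V that] by blast
  show "\<exists>W0. nbhd W0 \<and> (\<forall>W. nbhd W \<and> W \<subseteq> W0 \<longrightarrow> (\<exists>a\<in>cocycles (A W) n. \<exists>b\<in>coboundaries (S W) n.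
      restrict z (sim W n) = b \<otimes>\<^bsub>grp (S W) n\<^esub> vm W n a))" if "z \<in> cocycles Sg n" for z
    by (rule L.vertex_map_surjective[OF V that])
qed

text \<open>Smooth cocycles are treated by reduction to arbitrary ones. If the vertex cochain of \<open>a\<close> is a coboundary,
  so is \<open>a\<close> itself after shrinking, and by \<open>smooth_coboundary\<close> even of a smooth cochain. A singular class comes from an
  arbitrary cocycle, which smoothing replaces by a cohomologous smooth one.\<close>

sublocale cAs: comparison_family G "mtop M" V "As" n \<U>1 for n
proof (intro comparison_family.intro comparison_family_axioms.intro cover_cochains_axioms)
  show "open_identity_nhd_filterbase G (mtop M) \<U>1" by (rule base)
  show "cochain_cx (As U)" if "nbhd U" for U by (rule cochain_cx_As[OF G_lie]) (use that in blast)
  show "cocycle_map (As U) (A U) n (\<lambda>f. f)" for U by (rule incl_As)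
  show "cocycle_map (As U) (As W) n (\<lambda>f. restrict f (tup W n))" if "nbhd U" "nbhd W" "W \<subseteq> U" for U W
    by (rule restrict_As[OF that])
  show "\<exists>W0. nbhd W0 \<and> (\<forall>W. nbhd W \<and> W \<subseteq> W0 \<longrightarrow> restrict a (tup W n) \<in> coboundaries (As W) n)"
    if U: "nbhd U" and a: "a \<in> cocycles (As U) n" and va: "vm U n a \<in> coboundaries (S U) n" for U a
  proof -
    have aA: "a \<in> cocycles (A U) n" and as: "smooth_map_on (tup U n) (power_manifold n M) N a"
      using a by (auto simp: cocycles_As)
    obtain W1 where W1: "nbhd W1" "\<And>W. nbhd W \<and> W \<subseteq> W1 \<Longrightarrow> restrict a (tup W n) \<in> coboundaries (A W) n"
      using cA.locally_inj[OF U aA va] by blast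
    let ?U = "U \<inter> W1"
    have U': "nbhd ?U" using U W1(1) by (auto intro: openin_Int)
    let ?a = "restrict a (tup ?U n)"
    have a1: "?a \<in> coboundaries (A ?U) n" using W1(2)[of ?U] U' by blast
    have a2: "smooth_map_on (tup ?U n) (power_manifold n M) N ?a"
      using cocycle_map_in[OF restrict_As[OF U U' Int_lower1] a] by (simp add: cocycles_As)
    obtain W0 \<Phi> and I :: "(nat \<Rightarrow> 'g) set set" and r \<rho> c where
      sa: "smooth_averaging V \<Phi> G I r \<rho> c M N W0" and W0: "nbhd W0"
      "\<And>x y. x \<in> W0 \<Longrightarrow> y \<in> W0 \<Longrightarrow> x \<otimes>\<^bsub>G\<^esub> inv\<^bsub>G\<^esub> y \<in> ?U"
      by (rule smooth_averaging_nbhd[OF U']) (rule that)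
    have "restrict a (tup W n) \<in> coboundaries (As W) n" if W: "nbhd W" "W \<subseteq> W0" for W
    proof -
      have "restrict ?a (tup W n) \<in> coboundaries (As W) n"
        by (rule smooth_averaging.smooth_coboundary[OF sa W0(1) U' W0(2) W a1 a2])
      moreover have "W \<subseteq> ?U" using smooth_averaging.W0_U[OF sa W0(1) U' W0(2) W] W(2) by blast
      then have "restrict ?a (tup W n) = restrict a (tup W n)"
        using small_tuples_mono[of W ?U n] by (auto simp: fun_eq_iff)
      ultimately show ?thesis by simp
    qed
    then show ?thesis using W0(1) by blast
  qed
  show "\<exists>W0. nbhd W0 \<and> (\<forall>W. nbhd W \<and> W \<subseteq> W0 \<longrightarrow> (\<exists>s\<in>cocycles (As W) n. \<exists>b\<in>coboundaries (S W) n.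
      restrict z (sim W n) = b \<otimes>\<^bsub>grp (S W) n\<^esub> vm W n s))" if z: "z \<in> cocycles Sg n" for z
  proof -
    obtain U where U: "nbhd U" and zU: "\<And>W. nbhd W \<and> W \<subseteq> U \<Longrightarrow> \<exists>a\<in>cocycles (A W) n. \<exists>b\<in>coboundaries (S W) n.
      restrict z (sim W n) = b \<otimes>\<^bsub>grp (S W) n\<^esub> vm W n a"
      using cA.locally_surj[OF z] by blast
    obtain a b where a: "a \<in> cocycles (A U) n" and b: "b \<in> coboundaries (S U) n"
      and zb: "restrict z (sim U n) = b \<otimes>\<^bsub>grp (S U) n\<^esub> vm U n a" using zU[of U] U by blast
    obtain W0 \<Phi> and I :: "(nat \<Rightarrow> 'g) set set" and r \<rho> c where
      sa: "smooth_averaging V \<Phi> G I r \<rho> c M N W0" and W0: "nbhd W0"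
      "\<And>x y. x \<in> W0 \<Longrightarrow> y \<in> W0 \<Longrightarrow> x \<otimes>\<^bsub>G\<^esub> inv\<^bsub>G\<^esub> y \<in> U"
      by (rule smooth_averaging_nbhd[OF U]) (rule that)
    have "\<exists>s\<in>cocycles (As W) n. \<exists>b\<in>coboundaries (S W) n. restrict z (sim W n) = b \<otimes>\<^bsub>grp (S W) n\<^esub> vm W n s"
      if W: "nbhd W" "W \<subseteq> W0" for W
    proof -
      interpret SU: cochain_cx "S U" by (rule cochain_cx_S)
      interpret SW: cochain_cx "S W" by (rule cochain_cx_S)
      interpret AW: cochain_cx "A W" by (rule cochain_cx_A)
      interpret gS: group "grp (S W) n" by (rule SW.grp_group)
      have WU: "W \<subseteq> U" using smooth_averaging.W0_U[OF sa W0(1) U W0(2) W] W(2) by blast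
      obtain s where s: "s \<in> cocycles (As W) n"
        and "\<exists>e\<in>coboundaries (A W) n. restrict a (tup W n) = e \<otimes>\<^bsub>grp (A W) n\<^esub> s"
        using smooth_averaging.smoothing_cocycle[OF sa W0(1) U W0(2) W a]
          smooth_averaging.smoothing_cohomologous[OF sa W0(1) U W0(2) W a] by blast
      then obtain e where e: "e \<in> coboundaries (A W) n" "restrict a (tup W n) = e \<otimes>\<^bsub>grp (A W) n\<^esub> s" by blast
      have ez: "e \<in> cocycles (A W) n" using e(1) AW.coboundaries_cocycles by blast
      have sA: "s \<in> cocycles (A W) n" using s by (simp add: cocycles_As)
      have bz: "b \<in> cocycles (S U) n" using b SU.coboundaries_cocycles by blast
      let ?b = "restrict b (sim W n)"
      have bW: "?b \<in> coboundaries (S W) n" by (rule cocycle_map_coboundary[OF restrict_S[OF WU] b])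
      have eW: "vm W n e \<in> coboundaries (S W) n" by (rule cocycle_map_coboundary[OF vertex_map_cocycle_map[OF V] e(1)])
      have sW: "vm W n s \<in> cocycles (S W) n" by (rule cocycle_map_in[OF vertex_map_cocycle_map[OF V] sA])
      have "restrict z (sim W n) = restrict (restrict z (sim U n)) (sim W n)"
        using small_simplices_mono[OF WU, of n] by (auto simp: fun_eq_iff)
      also have "\<dots> = ?b \<otimes>\<^bsub>grp (S W) n\<^esub> restrict (vm U n a) (sim W n)"
        unfolding zb by (rule cocycle_map_mult[OF restrict_S[OF WU] bz cocycle_map_in[OF vertex_map_cocycle_map[OF V] a]])
      also have "restrict (vm U n a) (sim W n) = vm W n e \<otimes>\<^bsub>grp (S W) n\<^esub> vm W n s"
        unfolding restrict_vertex_map[OF WU] e(2) by (rule cocycle_map_mult[OF vertex_map_cocycle_map[OF V] ez sA])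
      also have "?b \<otimes>\<^bsub>grp (S W) n\<^esub> (vm W n e \<otimes>\<^bsub>grp (S W) n\<^esub> vm W n s) = (?b \<otimes>\<^bsub>grp (S W) n\<^esub> vm W n e) \<otimes>\<^bsub>grp (S W) n\<^esub> vm W n s"
        using subgroup.mem_carrier[OF SW.subgroup_coboundaries] bW eW subgroup.mem_carrier[OF SW.subgroup_cocycles sW]
        by (simp add: gS.m_assoc)
      finally show ?thesis using s subgroup.m_closed[OF SW.subgroup_coboundaries bW eW] by blast
    qed
    then show ?thesis using W0(1) by blast
  qed
qed

lemma colim_to_sing_iso:
  "colim_to_sing G (mtop M) V n \<in> iso (colim_H G V \<U>1 n) (H_sing (mtop M) V n)"
  "colim_to_sing G (mtop M) V n \<in> iso (colim_Hs G M V N \<U>1 n) (H_sing (mtop M) V n)"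
  using cA.comparison_iso cAs.comparison_iso
  by (simp_all add: colim_to_sing_def colim_H_def colim_Hs_def H_U_def[abs_def] H_U_restrict_def[abs_def]
      Hs_U_def[abs_def] Hs_U_restrict_def[abs_def])

text \<open>The comparison map only depends on the underlying cochain, so it is compatible with the inclusion.\<close>

lemma colim_inclusion_iso: "colim_inclusion G V \<U>1 n \<in> iso (colim_Hs G M V N \<U>1 n) (colim_H G V \<U>1 n)"
proof -
  interpret P: directed_system_pair \<U>1 reverse_incl "cAs.H n" "cAs.res n" "cA.H n" "cA.res n" ..
  let ?g = "\<lambda>U. cohomology_map (A U) n (\<lambda>f. f)"
  have pair: "cochain_cx_pair (As U) (A U)" if "nbhd U" for U
    using cAs.cochain_cx[OF that] cochain_cx_A by (simp add: cochain_cx_pair_def)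
  have g: "?g U (cAs.cl n U a) = cA.cl n U a" if "nbhd U" "a \<in> cocycles (As U) n" for U a
    using cochain_cx_pair.cohomology_map_cls[OF pair[OF that(1)] incl_As that(2)] .
  have aA: "a \<in> cocycles (A U) n" if "a \<in> cocycles (As U) n" for U a using that by (simp add: cocycles_As)
  have "colim_map (colim_rel \<U>1 reverse_incl (cA.H n) (cA.res n)) ?g \<in> iso (colim \<U>1 reverse_incl (cAs.H n) (cAs.res n)) (colim \<U>1 reverse_incl (cA.H n) (cA.res n))"
  proof (rule P.colim_map_iso[OF _ _ cAs.vs_res cA.vs_res _ cAs.comparison_iso cA.comparison_iso])
    show "?g j (cAs.res n i j x) = cA.res n i j (?g i x)"
      if ij: "i \<in> \<U>1" "j \<in> \<U>1" "j \<subseteq> i" and x: "x \<in> carrier (cAs.H n i)" for i j x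
    proof -
      have nb: "nbhd i" "nbhd j" using cA.base_nbhd ij by blast+
      obtain a where a: "a \<in> cocycles (As i) n" "x = cAs.cl n i a" using x cAs.carrier_H[OF nb(1)] by blast
      have "restrict a (tup j n) \<in> cocycles (As j) n" by (rule cocycle_map_in[OF restrict_As[OF nb ij(3)] a(1)])
      then show ?thesis
        unfolding a(2) cAs.res_cl[OF nb ij(3) a(1)] g[OF nb(1) a(1)] cA.res_cl[OF nb ij(3) aA[OF a(1)]]
        by (rule g[OF nb(2)])
    qed
    show "?g i \<in> hom (cAs.H n i) (cA.H n i)" if "i \<in> \<U>1" for i
      by (rule cochain_cx_pair.cohomology_map_hom[OF pair[OF cA.base_nbhd[OF that]] incl_As])
    show "cA.vs n i (?g i x) = cAs.vs n i x" if i: "i \<in> \<U>1" and x: "x \<in> carrier (cAs.H n i)" for i x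
    proof -
      have nb: "nbhd i" by (rule cA.base_nbhd[OF i])
      obtain a where a: "a \<in> cocycles (As i) n" "x = cAs.cl n i a" using x cAs.carrier_H[OF nb] by blast
      have "cohomology_map (S i) n (vm i n) (cA.cl n i a) = cochain_cx.cls (S i) n (vm i n a)"
        by (rule cochain_cx_pair.cohomology_map_cls[OF _ vertex_map_cocycle_map[OF V] aA[OF a(1)]])
          (simp add: cochain_cx_pair_def cochain_cx_A cochain_cx_S)
      moreover have "cohomology_map (S i) n (vm i n) (cAs.cl n i a) = cochain_cx.cls (S i) n (vm i n a)"
        by (rule cochain_cx_pair.cohomology_map_cls[OF _ cAs.vertex_C[OF nb] a(1)])
          (simp add: cochain_cx_pair_def cAs.cochain_cx[OF nb] cochain_cx_S)
      ultimately show ?thesis unfolding a(2) g[OF nb a(1)] vertex_map_sing_def by simp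
    qed
  qed
  then show ?thesis
    by (simp add: colim_inclusion_def colim_H_def colim_Hs_def H_U_def[abs_def] H_U_restrict_def[abs_def]
      Hs_U_def[abs_def] Hs_U_restrict_def[abs_def])
qed

end

theorem theorem7p16:
  fixes G :: "'g monoid" and M :: "('g, 'e::real_tvs) manifold"
    and V :: "'v monoid" and N :: "('v, 'f::real_tvs) manifold"
    and \<U>1 :: "'g set set"
  assumes "lie_group G M"
    and "\<forall>p. smoothly_paracompact (power_manifold p M)"
    and "open_identity_nhd_filterbase G (mtop M) \<U>1"
    and "lie_group V N" and "comm_group V"
    and "smoothly_loop_contractible V N"
  shows
    "(\<forall>U\<in>\<U>1. \<forall>n. H_sing_restrict (mtop M) (translate_cover G U) V n
        \<in> iso (H_sing (mtop M) V n) (cohomology (S_complex (mtop M) (translate_cover G U) V) n)) \<and>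
     (\<forall>n. colim_inclusion G V \<U>1 n \<in> iso (colim_Hs G M V N \<U>1 n) (colim_H G V \<U>1 n)) \<and>
     (\<forall>n. colim_to_sing G (mtop M) V n \<in> iso (colim_Hs G M V N \<U>1 n) (H_sing (mtop M) V n)) \<and>
     (\<forall>n. colim_to_sing G (mtop M) V n \<in> iso (colim_H G V \<U>1 n) (H_sing (mtop M) V n))"
proof -
  interpret lie_comparison V N G M \<U>1
    using assms by (simp add: lie_comparison_def lie_comm_group_def lie_comparison_axioms_def)
  show ?thesis
    using H_sing_restrict_translates cA.base_nbhd colim_inclusion_iso colim_to_sing_iso by blast
qed

end
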